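(* Let $n\geq 1$ be an integer. Let $A$ be the $(4n-2)\times(4n-2)$ integral orthogonal matrix of order $2(4n-2)$ given on the standard basis by $Ae_i=e_{i+1}$ for $1\leq i\leq 4n-3$ and $Ae_{4n-2}=-e_1$, and let $A'=\begin{bmatrix}A&0\\0&1\end{bmatrix}\in SO(4n-1)$. Let $\Gamma\subset SO(4n-1)\ltimes\mathbb{R}^{4n-1}$ be the group generated by the translations by $\mathbb{Z}^{4n-1}$ and the element $\left(A',(0,\dots,0,\tfrac{1}{2(4n-2)})\right)$; it is the fundamental group of the flat manifold $M^{4n-1}=\mathbb{R}^{4n-1}/\Gamma$ with holonomy group $\mathbb{Z}_{2(4n-2)}$. Then $$\eta(M^{4n-1})=\frac{(-1)^n}{8n-4}\sum_{r=0}^{4n-3}2^{l_r}(-1)^r\cot\left(\frac{(2r+1)\pi}{2(4n-2)}\right),$$ where $l_r$ is the number of distinct cycles of $A^{2r+1}$.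
   Context: An element $(C,c)\in SO(m)\ltimes\mathbb{R}^m$ acts on $\mathbb{R}^m$ by $x\mapsto Cx+c$. Cycles of a matrix $C\in SO(4n-2,\mathbb{Z})$: $C$ satisfies $C(e_i)=\pm e_{j(C,i)}$ for each $i$; let $\sigma(C)$ be the permutation $i\mapsto j(C,i)$ of $\{1,\dots,4n-2\}$. The number of distinct cycles of $C$ is the number of cycles in the decomposition of $\sigma(C)$ into disjoint cycles. The $\eta$ invariant of the signature operator. Let $Y$ be a closed oriented Riemannian manifold of dimension $4n-1$, $\ast$ the Hodge duality operator on $Y$ and $d$ the exterior derivative. Define the first order self-adjoint elliptic operator $B$ on differential forms by $B\phi=(-1)^{n+p+1}(\epsilon\ast d-d\ast)\phi$, where $\epsilon=1$ if $\phi$ is a $2p$-form and $\epsilon=-1$ if $\phi$ is a $(2p-1)$-form. $B$ preserves the parity of forms; $B^{ev}$ denotes its restriction to even forms. It has pure point spectrum. The function $\eta(s,Y)=\sum_{\lambda\neq 0}\operatorname{sign}(\lambda)\,\dim(\lambda)\,|\lambda|^{-s}$, where the sum is over nonzero eigenvalues $\lambda$ of $B^{ev}$ with multiplicity $\dim(\lambda)$, converges for $\operatorname{Re}(s)$ large, and has a meromorphic continuation to $\mathbb{C}$ which is finite at $s=0$. Put $\eta(Y)=\eta(0,Y)$. Orientation convention: changing the orientation of $Y$ changes the sign of $\eta(Y)$. Write $\mathbb{R}^{4n-1}=\mathbb{R}\times\mathbb{R}^{4n-2}$ with the last coordinate (the direction fixed by $A'$) as the positively oriented first factor; $\mathbb{R}^{4n-2}$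 is oriented so that in a suitable positively oriented orthonormal basis $A$ is block diagonal with $2\times 2$ rotation blocks of rotation angles $\gamma_l=\frac{(2l-1)\pi}{4n-2}$, $1\leq l\leq 2n-1$. $M^{4n-1}$ carries the induced orientation, under the sign conventions in which an isometry $g(x,\bar x)=(x+a,C\bar x+\bar a)$ of $S^1\times T^{4n-2}$ with $a\ne0$ and $C\in SO(4n-2,\mathbb{Z})$ having no eigenvalue $1$ and rotation angles $\gamma_i$ has equivariant invariant $\eta_g(0,S^1\times T^{4n-2})=\nu(g)(-1)^n\cot(\pi a)\prod_{i=1}^{2n-1}\cot(\gamma_i/2)$, $\nu(g)$ being the number of fixed points of $C\bar x+\bar a$ on $T^{4n-2}$. Here $\eta_g(0,Y)$ is the value at $s=0$ of $\eta_g(s,Y)=\sum_{\lambda\neq0}\operatorname{sign}(\lambda)\operatorname{Tr}(g^*_\lambda)|\lambda|^{-s}$, where $g^*_\lambda$ is the map induced by $g$ on the $\lambda$-eigenspace of $B^{ev}$. *)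

theory Defs
  imports
    "HOL-Complex_Analysis.Complex_Analysis"
    "HOL-Library.Function_Algebras"
    "HOL-Combinatorics.Orbits"
    "HOL-Algebra.Generated_Groups"
    "HOL-Algebra.Elementary_Groups"
begin

section \<open>Differential forms on Euclidean space\<close>

text \<open>
  An inhomogeneous complex-valued differential form on \<open>'a\<close> is a function taking a point and a list
  of tangent vectors; its component of degree \<open>q\<close> is its restriction to lists of length \<open>q\<close>.
\<close>

type_synonym 'a form = "'a \<Rightarrow> 'a list \<Rightarrow> complex"

definition form_scale :: "complex \<Rightarrow> 'a form \<Rightarrow> 'a form" where
  "form_scale c \<phi> = (\<lambda>x vs. c * \<phi> x vs)"

lemma vector_space_form: "vector_space (form_scale :: complex \<Rightarrow> 'a form \<Rightarrow> 'a form)"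
  by unfold_locales (auto simp: form_scale_def fun_eq_iff algebra_simps)

definition dir_deriv :: "'a::euclidean_space \<Rightarrow> ('a \<Rightarrow> complex) \<Rightarrow> 'a \<Rightarrow> complex" where
  "dir_deriv v f x = frechet_derivative f (at x) v"

text \<open>\<open>C\<^sup>\<infinity>\<close>: every iterated directional derivative is again Frechet differentiable.\<close>

definition smooth :: "('a::euclidean_space \<Rightarrow> complex) \<Rightarrow> bool" where
  "smooth f \<longleftrightarrow> (\<forall>vs. foldr dir_deriv vs f differentiable_on UNIV)"

definition diff_form :: "'a::euclidean_space form \<Rightarrow> bool" where
  "diff_form \<phi> \<longleftrightarrow>
     (\<forall>vs. smooth (\<lambda>x. \<phi> x vs)) \<and>
     (\<forall>x us ws. linear (\<lambda>v. \<phi> x (us @ v # ws))) \<and>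
     (\<forall>x vs. \<not> distinct vs \<longrightarrow> \<phi> x vs = 0)"

definition even_form :: "'a form \<Rightarrow> bool" where
  "even_form \<phi> \<longleftrightarrow> (\<forall>x vs. odd (length vs) \<longrightarrow> \<phi> x vs = 0)"

definition degree_part :: "nat \<Rightarrow> 'a form \<Rightarrow> 'a form" where
  "degree_part q \<phi> = (\<lambda>x vs. if length vs = q then \<phi> x vs else 0)"

definition ext_deriv :: "'a::euclidean_space form \<Rightarrow> 'a form" where
  "ext_deriv \<phi> = (\<lambda>x vs. \<Sum>i<length vs.
     (-1) ^ i * dir_deriv (vs ! i) (\<lambda>y. \<phi> y (take i vs @ drop (Suc i) vs)) x)"

text \<open>
  An orientation is given by a positively oriented orthonormal basis \<open>b 0, b 1, \<dots>\<close>.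
\<close>

definition orthonormal_frame :: "(nat \<Rightarrow> 'a::euclidean_space) \<Rightarrow> bool" where
  "orthonormal_frame b \<longleftrightarrow> (\<forall>i<DIM('a). \<forall>j<DIM('a). b i \<bullet> b j = (if i = j then 1 else 0))"

definition vol_form :: "(nat \<Rightarrow> 'a::euclidean_space) \<Rightarrow> 'a list \<Rightarrow> real" where
  "vol_form b vs = (\<Sum>\<pi> | \<pi> permutes {..<DIM('a)}.
     of_int (sign \<pi>) * (\<Prod>i<DIM('a). (vs ! i) \<bullet> b (\<pi> i)))"

text \<open>
  The complex-linear Hodge star, normalised by \<open>\<alpha> \<and> \<ast>\<alpha> = |\<alpha>|\<^sup>2 vol\<close> for real \<open>\<alpha>\<close>; thus
  \<open>\<ast>(b\<^sup>0 \<and> \<dots> \<and> b\<^sup>q) = b\<^sup>q\<^sup>+\<^sup>1 \<and> \<dots>\<close> for the dual basis.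
\<close>

definition hodge_star :: "(nat \<Rightarrow> 'a::euclidean_space) \<Rightarrow> 'a form \<Rightarrow> 'a form" where
  "hodge_star b \<phi> = (\<lambda>x ws. \<Sum>I | I \<subseteq> {..<DIM('a)} \<and> card I + length ws = DIM('a).
     let us = map b (sorted_list_of_set I)
     in \<phi> x us * of_real (vol_form b (us @ ws)))"

text \<open>
  The operator \<open>B\<close> in dimension \<open>4n-1\<close>. For \<open>q = 2p\<close> and for \<open>q = 2p - 1\<close>
  one has \<open>(q + 1) div 2 = p\<close>.
\<close>

definition B_op :: "nat \<Rightarrow> (nat \<Rightarrow> 'a::euclidean_space) \<Rightarrow> 'a form \<Rightarrow> 'a form" where
  "B_op n b \<phi> = (\<lambda>x vs. \<Sum>q\<le>DIM('a).
     let \<psi> = degree_part q \<phi>; p = (q + 1) div 2; \<epsilon> = (if even q then 1 else -1)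
     in (-1) ^ (n + p + 1) *
        (\<epsilon> * hodge_star b (ext_deriv \<psi>) x vs - ext_deriv (hodge_star b \<psi>) x vs))"


section \<open>Rigid motions and flat manifolds\<close>

type_synonym 'm motion = "(real^'m^'m) \<times> (real^'m)"

text \<open>The group \<open>SO(m) \<ltimes> \<real>\<^sup>m\<close>.\<close>

definition motions :: "'m::finite motion monoid" where
  "motions = \<lparr>carrier = {(C, c). orthogonal_matrix C \<and> det C = 1},
              mult = (\<lambda>(C, c) (D, d). (C ** D, C *v d + c)),
              one = (mat 1, 0)\<rparr>"

definition act :: "'m::finite motion \<Rightarrow> real^'m \<Rightarrow> real^'m" where
  "act g x = fst g *v x + snd g"

definition integer_translations :: "'m::finite motion set" where
  "integer_translations = {(mat 1, v) | v. \<forall>i. v $ i \<in> \<int>}"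

text \<open>
  \<open>\<Gamma>\<close> acts freely, properly discontinuously and cocompactly, so that \<open>\<real>\<^sup>m/\<Gamma>\<close> is a closed oriented
  flat manifold with universal covering \<open>\<real>\<^sup>m\<close> and fundamental group (group of deck transformations) \<open>\<Gamma>\<close>.
\<close>

definition flat_manifold_group :: "'m::finite motion set \<Rightarrow> bool" where
  "flat_manifold_group \<Gamma> \<longleftrightarrow>
     subgroup \<Gamma> motions \<and>
     (\<forall>g\<in>\<Gamma>. (\<exists>x. act g x = x) \<longrightarrow> g = \<one>\<^bsub>motions\<^esub>) \<and>
     (\<forall>K. compact K \<longrightarrow> finite {g \<in> \<Gamma>. act g ` K \<inter> K \<noteq> {}}) \<and>
     (\<exists>K. compact K \<and> (\<Union>g\<in>\<Gamma>. act g ` K) = UNIV)"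

definition holonomy_group :: "'m::finite motion set \<Rightarrow> (real^'m^'m) monoid" where
  "holonomy_group \<Gamma> = \<lparr>carrier = fst ` \<Gamma>, mult = (**), one = mat 1\<rparr>"


section \<open>The eta invariant of \<open>\<real>\<^sup>m/\<Gamma>\<close>\<close>

definition pullback :: "'m::finite motion \<Rightarrow> (real^'m) form \<Rightarrow> (real^'m) form" where
  "pullback g \<phi> = (\<lambda>x vs. \<phi> (act g x) (map ((*v) (fst g)) vs))"

text \<open>
  Smooth forms on \<open>\<real>\<^sup>m/\<Gamma>\<close> are, by pulling back to the universal covering, the \<open>\<Gamma>\<close>-invariant smooth
  forms on \<open>\<real>\<^sup>m\<close>. As the covering is a local orientation-preserving isometry, \<open>d\<close>, \<open>\<ast>\<close> and \<open>B\<close> on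
  the quotient are those of \<open>\<real>\<^sup>m\<close>.
\<close>

definition forms_on_quotient :: "'m::finite motion set \<Rightarrow> (real^'m) form set" where
  "forms_on_quotient \<Gamma> = {\<phi>. diff_form \<phi> \<and> (\<forall>g\<in>\<Gamma>. pullback g \<phi> = \<phi>)}"

text \<open>Here \<open>B\<close> is restricted to even forms.\<close>

definition B_eigenspace ::
    "nat \<Rightarrow> 'm::finite motion set \<Rightarrow> (nat \<Rightarrow> real^'m) \<Rightarrow> real \<Rightarrow> (real^'m) form set" where
  "B_eigenspace n \<Gamma> b \<mu> =
     {\<phi> \<in> forms_on_quotient \<Gamma>. even_form \<phi> \<and> B_op n b \<phi> = form_scale (of_real \<mu>) \<phi>}"

definition B_spectrum :: "nat \<Rightarrow> 'm::finite motion set \<Rightarrow> (nat \<Rightarrow> real^'m) \<Rightarrow> real set" where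
  "B_spectrum n \<Gamma> b = {\<mu>. \<exists>\<phi>\<in>B_eigenspace n \<Gamma> b \<mu>. \<phi> \<noteq> 0}"

definition multiplicity_of ::
    "nat \<Rightarrow> 'm::finite motion set \<Rightarrow> (nat \<Rightarrow> real^'m) \<Rightarrow> real \<Rightarrow> nat" where
  "multiplicity_of n \<Gamma> b \<mu> = vector_space.dim form_scale (B_eigenspace n \<Gamma> b \<mu>)"

text \<open>\<open>F\<close> is a meromorphic continuation of \<open>s \<mapsto> \<eta>(s, \<real>\<^sup>m/\<Gamma>)\<close> that is finite at \<open>0\<close>.\<close>

definition eta_continuation ::
    "nat \<Rightarrow> 'm::finite motion set \<Rightarrow> (nat \<Rightarrow> real^'m) \<Rightarrow> (complex \<Rightarrow> complex) \<Rightarrow> bool" where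
  "eta_continuation n \<Gamma> b F \<longleftrightarrow>
     F meromorphic_on UNIV \<and> F analytic_on {0} \<and>
     (\<exists>\<sigma>. \<forall>s. Re s > \<sigma> \<longrightarrow>
        ((\<lambda>\<mu>. of_real (sgn \<mu>) * of_nat (multiplicity_of n \<Gamma> b \<mu>) * of_real \<bar>\<mu>\<bar> powr (- s))
           has_sum F s) (B_spectrum n \<Gamma> b - {0}))"

definition eta_invariant :: "nat \<Rightarrow> 'm::finite motion set \<Rightarrow> (nat \<Rightarrow> real^'m) \<Rightarrow> complex" where
  "eta_invariant n \<Gamma> b = (THE v. \<exists>F. eta_continuation n \<Gamma> b F \<and> F 0 = v)"


section \<open>Block matrices and signed permutation matrices\<close>

text \<open>
  If \<open>'k\<close> indexes the coordinates of \<open>\<real>\<^sup>m\<close>, then \<open>'k option\<close> indexes those of \<open>\<real>\<^sup>m\<^sup>+\<^sup>1\<close>, with \<open>None\<close>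
  the last coordinate.
\<close>

definition block_one :: "real^'k^'k \<Rightarrow> real^('k::finite option)^('k option)" where
  "block_one A = (\<chi> i j. case (i, j) of (Some a, Some b) \<Rightarrow> A $ a $ b
                                     | (None, None) \<Rightarrow> 1
                                     | _ \<Rightarrow> 0)"

text \<open>The inclusion of \<open>\<real>\<^sup>m\<close> as \<open>\<real>\<^sup>m \<times> 0\<close>.\<close>

definition embed_first :: "real^'k \<Rightarrow> real^('k::finite option)" where
  "embed_first v = (\<chi> i. case i of Some a \<Rightarrow> v $ a | None \<Rightarrow> 0)"

definition matrix_pow :: "real^'k^'k \<Rightarrow> nat \<Rightarrow> real^'k^('k::finite)" where
  "matrix_pow C r = (((**) C) ^^ r) (mat 1)"

definition perm_of :: "real^'k^'k \<Rightarrow> ('k::finite) \<Rightarrow> 'k" where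
  "perm_of C i = (THE j. C *v axis i 1 = axis j 1 \<or> C *v axis i 1 = - axis j 1)"

text \<open>Fixed points of the permutation count as cycles.\<close>

definition num_cycles :: "real^'k^('k::finite) \<Rightarrow> nat" where
  "num_cycles C = card (range (orbit (perm_of C)))"

end

theory Submission
  imports
    Defs
    "HOL-Number_Theory.Cong"
begin

text \<open>
  On the torus cover an eigenform of \<open>B\<close> for \<open>\<mu>\<close> is a finite Fourier series over the integer vectors \<open>\<xi>\<close> with
  \<open>4 \<pi>\<^sup>2 \<bar>\<xi>\<bar>\<^sup>2 = \<mu>\<^sup>2\<close>, whose coefficients are equivariant under \<open>A'\<close> and eigenvectors of the symbol of \<open>B\<close>.
  Off the axis of \<open>A'\<close>, reflecting the coefficient at \<open>\<xi>\<close> in a vector orthogonal to \<open>\<xi>\<close> exchanges \<open>\<mu>\<close> and \<open>-\<mu>\<close>.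
  On the axis an operator commuting with \<open>A'\<close> does so except on its kernel, which is spanned by the products of
  \<open>dt\<close> and one form \<open>dx\<^sub>l \<plusminus> \<i> dy\<^sub>l\<close> for each rotation plane, and \<open>A'\<close> acts on these by scalars.

  Counting the sign patterns that are invariant, with a filter over \<open>2N\<close>-th roots of unity (\<open>N = 4n - 2\<close>), expresses
  the difference of the multiplicities of \<open>2 \<pi> j\<close> and \<open>-2 \<pi> j\<close> as \<open>\<Sum>\<^sub>k c\<^sub>k (w\<^sub>k\<^sup>j - w\<^sub>k\<^sup>-\<^sup>j)\<close> with
  \<open>w\<^sub>k = exp (\<pi> \<i> k / N)\<close>, where \<open>c\<^sub>k\<close> is a product of the sines of \<open>k \<gamma>\<^sub>l\<close>. Hence the eta function is a combination of
  the series \<open>\<Sum>\<^sub>j w\<^sup>j j\<^sup>-\<^sup>s\<close>, which are entire in \<open>s\<close> with value \<open>w / (1 - w)\<close> at \<open>0\<close> by Abel summation. The sine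
  products vanish for even \<open>k\<close> and are \<open>-\<i> (-1)\<^bsup>n+r\<^esup> 2\<^bsup>gcd(k, N)\<^esup>\<close> for \<open>k = 2r + 1\<close>, and \<open>A\<^bsup>k\<^esup>\<close> has \<open>gcd(k, N)\<close> cycles.
\<close>

section \<open>Exterior algebra on alternating functions of lists\<close>

text \<open>The multiplicities of \<open>B\<close> are never computed: they involve counts of
  lattice points on spheres, and only the difference at \<open>\<mu>\<close> and
  \<open>-\<mu>\<close> enters eta. A linear map \<open>T\<close> exchanging two finite-dimensional
  spaces, with \<open>T (T x) = 0\<close> implying \<open>T x = 0\<close>, makes the difference of
  their dimensions equal to that of the kernels. Reflections supply \<open>T\<close> off the axis.
  On the axis no single reflection commutes with \<open>A'\<close>, since \<open>A'\<close>
  preserves no line orthogonal to the axis; a weighted sum of reflections takes its place, and its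
  kernel is the whole source of asymmetry. Orientation enters through one eigenvalue, that of the
  symbol on a product of isotropic covectors with the axis covector: the product of the chosen signs
  times the axial frequency. The algebra before it is bookkeeping of degrees in odd dimension, where
  the star is an involution that exchanges wedge and contraction up to sign. Before the symmetric
  part may be cancelled, the series over the whole spectrum has to converge absolutely; a crude
  count of integer vectors in a box suffices for this.\<close>

definition alternating :: "('a::real_vector list \<Rightarrow> complex) \<Rightarrow> bool" where
  "alternating \<alpha> \<longleftrightarrow> (\<forall>us ws. linear (\<lambda>v. \<alpha> (us @ v # ws))) \<and> (\<forall>vs. \<not> distinct vs \<longrightarrow> \<alpha> vs = 0)"

lemma alternating_linear: "alternating \<alpha> \<Longrightarrow> linear (\<lambda>v. \<alpha> (us @ v # ws))"
  by (simp add: alternating_def)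

lemma alternating_linear_Cons: "alternating \<alpha> \<Longrightarrow> linear (\<lambda>v. \<alpha> (v # ws))"
  using alternating_linear[of \<alpha> "[]" ws] by simp

lemma alternating_add: "alternating \<alpha> \<Longrightarrow> \<alpha> (us @ (x + y) # ws) = \<alpha> (us @ x # ws) + \<alpha> (us @ y # ws)"
  by (rule linear_add[OF alternating_linear])

lemma alternating_scale: "alternating \<alpha> \<Longrightarrow> \<alpha> (us @ (r *\<^sub>R x) # ws) = of_real r * \<alpha> (us @ x # ws)"
  using linear_scale[OF alternating_linear, of \<alpha> us r x ws] by (simp add: scaleR_conv_of_real)

lemma alternating_add_Cons: "alternating \<alpha> \<Longrightarrow> \<alpha> ((x + y) # ws) = \<alpha> (x # ws) + \<alpha> (y # ws)"
  using alternating_add[of \<alpha> "[]"] by simp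

lemma alternating_scale_Cons: "alternating \<alpha> \<Longrightarrow> \<alpha> ((r *\<^sub>R x) # ws) = of_real r * \<alpha> (x # ws)"
  using alternating_scale[of \<alpha> "[]"] by simp

lemma alternating_zero_Cons: "alternating \<alpha> \<Longrightarrow> \<alpha> (0 # ws) = 0"
  using alternating_scale_Cons[of \<alpha> 0 0 ws] by simp

lemma alternating_eq0: "alternating \<alpha> \<Longrightarrow> \<not> distinct vs \<Longrightarrow> \<alpha> vs = 0"
  by (simp add: alternating_def)

lemma alternating_Cons: "alternating \<alpha> \<Longrightarrow> alternating (\<lambda>vs. \<alpha> (u # vs))"
  unfolding alternating_def
proof (intro conjI allI impI)
  fix us ws
  assume a: "(\<forall>us ws. linear (\<lambda>v. \<alpha> (us @ v # ws))) \<and> (\<forall>vs. \<not> distinct vs \<longrightarrow> \<alpha> vs = 0)"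
  from a have "linear (\<lambda>v. \<alpha> ((u # us) @ v # ws))" by blast
  then show "linear (\<lambda>v. \<alpha> (u # us @ v # ws))" by simp
qed simp

lemma alternating_swap:
  assumes "alternating \<alpha>" shows "\<alpha> (us @ x # y # ws) = - \<alpha> (us @ y # x # ws)"
proof -
  have z: "\<alpha> (us @ u # u # ws) = 0" for u by (rule alternating_eq0[OF assms]) simp
  have "0 = \<alpha> (us @ (x + y) # (x + y) # ws)" using z by simp
  also have "\<dots> = \<alpha> (us @ x # (x + y) # ws) + \<alpha> (us @ y # (x + y) # ws)"
    by (rule alternating_add[OF assms])
  also have "\<alpha> (us @ x # (x + y) # ws) = \<alpha> (us @ x # x # ws) + \<alpha> (us @ x # y # ws)"
    using alternating_add[OF assms, of "us @ [x]"] by simp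
  also have "\<alpha> (us @ y # (x + y) # ws) = \<alpha> (us @ y # x # ws) + \<alpha> (us @ y # y # ws)"
    using alternating_add[OF assms, of "us @ [y]"] by simp
  finally show ?thesis using z by (simp add: eq_neg_iff_add_eq_0)
qed

lemma alternating_swap_Cons: "alternating \<alpha> \<Longrightarrow> \<alpha> (x # y # ws) = - \<alpha> (y # x # ws)"
  using alternating_swap[of \<alpha> "[]" x y ws] by (simp only: append_Nil)

text \<open>Adjacent repetitions are enough: inserting \<open>x + y\<close> twice gives the sign
  under adjacent swaps, and swaps carry any two equal entries next to each other.\<close>

lemma alternatingI:
  assumes lin: "\<And>us ws. linear (\<lambda>v. \<alpha> (us @ v # ws))" and adj: "\<And>us x ws. \<alpha> (us @ x # x # ws) = 0"
  shows "alternating \<alpha>"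
proof -
  have sw: "\<alpha> (us @ x # y # ws) = - \<alpha> (us @ y # x # ws)" for us x y ws
  proof -
    have "0 = \<alpha> (us @ (x + y) # (x + y) # ws)" using adj by simp
    also have "\<dots> = \<alpha> (us @ x # (x + y) # ws) + \<alpha> (us @ y # (x + y) # ws)"
      by (rule linear_add[OF lin])
    also have "\<alpha> (us @ x # (x + y) # ws) = \<alpha> (us @ x # x # ws) + \<alpha> (us @ x # y # ws)"
      using linear_add[OF lin, of "us @ [x]"] by simp
    also have "\<alpha> (us @ y # (x + y) # ws) = \<alpha> (us @ y # x # ws) + \<alpha> (us @ y # y # ws)"
      using linear_add[OF lin, of "us @ [y]"] by simp
    finally show ?thesis using adj by (simp add: eq_neg_iff_add_eq_0)
  qed
  have rep: "\<alpha> (us @ x # ws @ x # zs) = 0" for us x ws zs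
  proof (induction ws arbitrary: us)
    case Nil then show ?case using adj by simp
  next
    case (Cons w ws)
    have "\<alpha> (us @ x # (w # ws) @ x # zs) = - \<alpha> ((us @ [w]) @ x # ws @ x # zs)"
      using sw[of us x w] by simp
    then show ?case using Cons[of "us @ [w]"] by simp
  qed
  have "\<alpha> vs = 0" if nd: "\<not> distinct vs" for vs
  proof -
    from not_distinct_decomp[OF nd] obtain us ws zs x where "vs = us @ [x] @ ws @ [x] @ zs" by blast
    then show ?thesis using rep[of us x ws zs] by simp
  qed
  then show ?thesis using lin unfolding alternating_def by blast
qed

lemma alternating_lin2:
  assumes "alternating \<alpha>" "alternating \<beta>"
  shows "alternating (\<lambda>vs. c * \<alpha> vs + d * \<beta> vs)"
  unfolding alternating_def
proof (intro conjI allI impI)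
  fix us ws
  show "linear (\<lambda>v. c * \<alpha> (us @ v # ws) + d * \<beta> (us @ v # ws))"
    by (rule linearI) (simp_all add: alternating_add[OF assms(1)] alternating_add[OF assms(2)]
      alternating_scale[OF assms(1)] alternating_scale[OF assms(2)] algebra_simps scaleR_conv_of_real)
next
  fix vs :: "'a list" assume "\<not> distinct vs"
  then show "c * \<alpha> vs + d * \<beta> vs = 0"
    by (simp add: alternating_eq0[OF assms(1)] alternating_eq0[OF assms(2)])
qed

lemma alternating_zero: "alternating (\<lambda>_. 0)"
  unfolding alternating_def by (auto intro: linear_zero)

lemma alternating_mult: "alternating \<alpha> \<Longrightarrow> alternating (\<lambda>vs. c * \<alpha> vs)"
  using alternating_lin2[of \<alpha> \<alpha> c 0] by simp

lemma alternating_sum: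
  "(\<And>i. i \<in> S \<Longrightarrow> alternating (\<alpha> i)) \<Longrightarrow> alternating (\<lambda>vs. \<Sum>i\<in>S. \<alpha> i vs)"
proof (induction S rule: infinite_finite_induct)
  case (insert x S)
  have "alternating (\<lambda>vs. 1 * \<alpha> x vs + 1 * (\<Sum>i\<in>S. \<alpha> i vs))"
    by (rule alternating_lin2) (use insert in auto)
  then show ?case using insert by simp
qed (simp_all add: alternating_zero)

text \<open>Exterior multiplication by the covector dual to \<open>v\<close>, defined through its
  contraction rule: contracting \<open>v \<and> \<alpha>\<close> with \<open>u\<close> gives
  \<open>v \<bullet> u\<close> times \<open>\<alpha>\<close>, minus \<open>v\<close> wedge the
  contraction of \<open>\<alpha>\<close>. No factorials or shuffles occur, and proofs go by
  induction on the list of arguments.\<close>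

fun wedge :: "'a::real_inner \<Rightarrow> ('a list \<Rightarrow> complex) \<Rightarrow> 'a list \<Rightarrow> complex" where
  "wedge v \<alpha> [] = 0"
| "wedge v \<alpha> (u # us) = of_real (v \<bullet> u) * \<alpha> us - wedge v (\<lambda>ws. \<alpha> (u # ws)) us"

lemma wedge_lin2: "wedge v (\<lambda>ws. c * \<alpha> ws + d * \<beta> ws) us = c * wedge v \<alpha> us + d * wedge v \<beta> us"
  by (induction us arbitrary: \<alpha> \<beta>) (simp_all add: algebra_simps)

lemma wedge_zero: "wedge v (\<lambda>ws. 0) us = 0"
  using wedge_lin2[of v 0 "\<lambda>_. 0" 0 "\<lambda>_. 0" us] by simp

lemma wedge_mult: "wedge v (\<lambda>ws. c * \<alpha> ws) us = c * wedge v \<alpha> us"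
  using wedge_lin2[of v c \<alpha> 0 \<alpha> us] by simp

lemma wedge_add: "wedge v (\<lambda>ws. \<alpha> ws + \<beta> ws) us = wedge v \<alpha> us + wedge v \<beta> us"
  using wedge_lin2[of v 1 \<alpha> 1 \<beta> us] by simp

lemma wedge_diff: "wedge v (\<lambda>ws. \<alpha> ws - \<beta> ws) us = wedge v \<alpha> us - wedge v \<beta> us"
  using wedge_lin2[of v 1 \<alpha> "-1" \<beta> us] by simp

lemma wedge_uminus: "wedge v (\<lambda>ws. - \<alpha> ws) us = - wedge v \<alpha> us"
  using wedge_mult[of v "-1" \<alpha> us] by simp

lemma wedge_sum: "wedge v (\<lambda>ws. \<Sum>i\<in>S. \<alpha> i ws) us = (\<Sum>i\<in>S. wedge v (\<alpha> i) us)"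
  by (induction S rule: infinite_finite_induct) (simp_all add: wedge_zero wedge_add)

lemma wedge_vec_add: "wedge (v + w) \<alpha> us = wedge v \<alpha> us + wedge w \<alpha> us"
  by (induction us arbitrary: \<alpha>) (simp_all add: inner_add_left algebra_simps)

lemma wedge_vec_scale: "wedge (r *\<^sub>R v) \<alpha> us = of_real r * wedge v \<alpha> us"
  by (induction us arbitrary: \<alpha>) (simp_all add: algebra_simps)

text \<open>The signed Leibniz rule for a list cut in two: the covector is spent on an entry of
  either half, and passing the first half costs one sign per entry.\<close>

lemma wedge_append:
  "wedge v \<alpha> (us @ ws) =
     wedge v (\<lambda>us. \<alpha> (us @ ws)) us + (-1) ^ length us * wedge v (\<lambda>ws. \<alpha> (us @ ws)) ws"
  by (induction us arbitrary: \<alpha>) (simp_all add: algebra_simps)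

lemma alternating_wedge:
  assumes "alternating \<alpha>" shows "alternating (wedge v \<alpha>)"
proof (rule alternatingI)
  fix us ws
  have lw: "linear (\<lambda>x. wedge v (\<lambda>vs. g x vs) zs)"
    if g: "\<And>vs. linear (\<lambda>x. g x vs)" for g :: "'a \<Rightarrow> 'a list \<Rightarrow> complex" and zs
  proof (rule linearI)
    fix x y
    have "(\<lambda>vs. g (x + y) vs) = (\<lambda>vs. g x vs + g y vs)" using linear_add[OF g] by auto
    then show "wedge v (\<lambda>vs. g (x + y) vs) zs = wedge v (\<lambda>vs. g x vs) zs + wedge v (\<lambda>vs. g y vs) zs"
      by (simp add: wedge_add)
  next
    fix r x
    have "(\<lambda>vs. g (r *\<^sub>R x) vs) = (\<lambda>vs. of_real r * g x vs)"
      using linear_scale[OF g] by (auto simp: scaleR_conv_of_real)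
    then show "wedge v (\<lambda>vs. g (r *\<^sub>R x) vs) zs = r *\<^sub>R wedge v (\<lambda>vs. g x vs) zs"
      by (simp add: wedge_mult scaleR_conv_of_real)
  qed
  have eq: "(\<lambda>x. wedge v \<alpha> (us @ x # ws)) = (\<lambda>x. wedge v (\<lambda>zs. \<alpha> (zs @ x # ws)) us
      + ((-1) ^ length us * (of_real (v \<bullet> x) * \<alpha> (us @ ws))
         + - ((-1) ^ length us * wedge v (\<lambda>zs. \<alpha> (us @ x # zs)) ws)))"
    by (simp add: wedge_append algebra_simps)
  have l1: "linear (\<lambda>x. wedge v (\<lambda>zs. \<alpha> (zs @ x # ws)) us)"
    by (rule lw, rule alternating_linear[OF assms])
  have l2: "linear (\<lambda>x. wedge v (\<lambda>zs. \<alpha> (us @ x # zs)) ws)"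
    by (rule lw, rule alternating_linear[OF assms])
  have l3: "linear (\<lambda>x. (-1) ^ length us * (of_real (v \<bullet> x) * \<alpha> (us @ ws)))"
    by (rule linearI) (simp_all add: inner_add_right algebra_simps scaleR_conv_of_real)
  have l4: "linear (\<lambda>x. - ((-1) ^ length us * wedge v (\<lambda>zs. \<alpha> (us @ x # zs)) ws))"
    by (rule linearI) (simp_all add: linear_add[OF l2] linear_scale[OF l2] algebra_simps scaleR_conv_of_real)
  show "linear (\<lambda>x. wedge v \<alpha> (us @ x # ws))"
    unfolding eq by (intro linear_compose_add l1 l3 l4)
next
  fix us x ws
  have z: "\<alpha> (as @ x # x # bs) = 0" for as bs by (rule alternating_eq0[OF assms]) simp
  \<comment> \<open>The two terms that pair \<open>v\<close> with one copy of \<open>x\<close>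
    cancel; all others still contain both copies.\<close>
  show "wedge v \<alpha> (us @ x # x # ws) = 0"
    by (simp add: wedge_append z wedge_zero)
qed

lemma wedge_anticomm:
  "wedge v (wedge w \<alpha>) us = - wedge w (wedge v \<alpha>) us"
proof (induction us arbitrary: \<alpha>)
  case (Cons u us)
  have "(\<lambda>ws. wedge w \<alpha> (u # ws)) = (\<lambda>ws. of_real (w \<bullet> u) * \<alpha> ws - wedge w (\<lambda>zs. \<alpha> (u # zs)) ws)" for w by auto
  then show ?case using Cons[of "\<lambda>zs. \<alpha> (u # zs)"]
    by (simp add: wedge_diff wedge_mult)
qed simp

lemma wedge_twice: "wedge v (wedge v \<alpha>) us = 0"
  using wedge_anticomm[of v v \<alpha> us] by simp

text \<open>\<open>sublist_sum L \<alpha> \<beta>\<close> pairs the values of \<open>\<alpha>\<close> and \<open>\<beta>\<close> on all sublists of \<open>L\<close>.\<close>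

fun sublist_sum :: "'a list \<Rightarrow> ('a list \<Rightarrow> complex) \<Rightarrow> ('a list \<Rightarrow> complex) \<Rightarrow> complex" where
  "sublist_sum [] \<alpha> \<beta> = \<alpha> [] * \<beta> []"
| "sublist_sum (c # L) \<alpha> \<beta> =
     sublist_sum L (\<lambda>ws. \<alpha> (c # ws)) (\<lambda>ws. \<beta> (c # ws)) + sublist_sum L \<alpha> \<beta>"

lemma sublist_sum_comm: "sublist_sum L \<alpha> \<beta> = sublist_sum L \<beta> \<alpha>"
  by (induction L arbitrary: \<alpha> \<beta>) simp_all

lemma sublist_sum_lin2:
  "sublist_sum L (\<lambda>ws. c * \<alpha> ws + d * \<alpha>' ws) \<beta> = c * sublist_sum L \<alpha> \<beta> + d * sublist_sum L \<alpha>' \<beta>"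
  by (induction L arbitrary: \<alpha> \<alpha>' \<beta>) (simp_all add: algebra_simps)

lemma sublist_sum_lin2_right:
  "sublist_sum L \<beta> (\<lambda>ws. c * \<alpha> ws + d * \<alpha>' ws) = c * sublist_sum L \<beta> \<alpha> + d * sublist_sum L \<beta> \<alpha>'"
  using sublist_sum_lin2 by (simp add: sublist_sum_comm[of L \<beta>])

lemma sublist_sum_zero: "sublist_sum L (\<lambda>_. 0) \<beta> = 0"
  using sublist_sum_lin2[of L 0 "\<lambda>_. 0" 0 "\<lambda>_. 0"] by simp

text \<open>Exterior multiplication is adjoint to contraction. For a general list the contraction is
  with the sum of the \<open>(v \<bullet> c) *\<^sub>R c\<close>, which is \<open>v\<close> itself
  for an orthonormal frame. In the induction the \<open>c\<close> part of that vector is lost on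
  sublists starting with \<open>c\<close>, because \<open>\<beta>\<close> alternates.\<close>

lemma sublist_sum_adjoint:
  fixes L :: "'a::real_inner list"
  assumes "alternating \<beta>"
  shows "sublist_sum L (wedge v \<alpha>) \<beta> = sublist_sum L \<alpha> (\<lambda>ws. \<beta> ((\<Sum>c\<leftarrow>L. (v \<bullet> c) *\<^sub>R c) # ws))"
  using assms
proof (induction L arbitrary: \<alpha> \<beta>)
  case Nil
  then show ?case by (simp add: alternating_zero_Cons)
next
  case (Cons c L)
  let ?P = "\<lambda>L. (\<Sum>c\<leftarrow>L. (v \<bullet> c) *\<^sub>R c)"
  define q where "q = ?P L"
  have ac: "alternating (\<lambda>ws. \<beta> (c # ws))" by (rule alternating_Cons[OF Cons.prems])
  have e1: "(\<lambda>ws. wedge v \<alpha> (c # ws)) = (\<lambda>ws. of_real (v \<bullet> c) * \<alpha> ws + (-1) * wedge v (\<lambda>zs. \<alpha> (c # zs)) ws)"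
    by auto
  have "sublist_sum (c # L) (wedge v \<alpha>) \<beta> =
     of_real (v \<bullet> c) * sublist_sum L \<alpha> (\<lambda>ws. \<beta> (c # ws))
     - sublist_sum L (\<lambda>zs. \<alpha> (c # zs)) (\<lambda>ws. \<beta> (c # q # ws))
     + sublist_sum L \<alpha> (\<lambda>ws. \<beta> (q # ws))"
    unfolding sublist_sum.simps e1 sublist_sum_lin2 Cons.IH[OF ac] Cons.IH[OF Cons.prems] q_def by simp
  moreover have "sublist_sum (c # L) \<alpha> (\<lambda>ws. \<beta> (?P (c # L) # ws)) =
     sublist_sum L (\<lambda>ws. \<alpha> (c # ws)) (\<lambda>ws. (-1) * \<beta> (c # q # ws) + 0 * \<beta> ws)
     + sublist_sum L \<alpha> (\<lambda>ws. of_real (v \<bullet> c) * \<beta> (c # ws) + 1 * \<beta> (q # ws))"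
  proof -
    have r1: "(\<lambda>ws. \<beta> (?P (c # L) # c # ws)) = (\<lambda>ws. (-1) * \<beta> (c # q # ws) + 0 * \<beta> ws)"
    proof
      fix ws
      show "\<beta> (?P (c # L) # c # ws) = (-1) * \<beta> (c # q # ws) + 0 * \<beta> ws"
        using alternating_swap_Cons[OF Cons.prems, of q c ws] alternating_eq0[OF Cons.prems, of "c # c # ws"]
        by (simp add: alternating_add_Cons[OF Cons.prems] alternating_scale_Cons[OF Cons.prems] q_def)
    qed
    have r2: "(\<lambda>ws. \<beta> (?P (c # L) # ws)) = (\<lambda>ws. of_real (v \<bullet> c) * \<beta> (c # ws) + 1 * \<beta> (q # ws))"
      by (rule ext) (simp add: alternating_add_Cons[OF Cons.prems] alternating_scale_Cons[OF Cons.prems] q_def)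
    show ?thesis unfolding sublist_sum.simps by (subst r1, subst r2, rule refl)
  qed
  ultimately show ?case unfolding sublist_sum_lin2_right by simp
qed

section \<open>Products of covectors\<close>

definition unit_form :: "'a list \<Rightarrow> complex" where
  "unit_form vs = (if vs = [] then 1 else 0)"

lemma alternating_unit_form: "alternating unit_form"
  by (rule alternatingI) (auto simp: unit_form_def intro: linear_zero)

definition monomial :: "'a::real_inner list \<Rightarrow> 'a list \<Rightarrow> complex" where
  "monomial ws = foldr wedge ws unit_form"

lemma monomial_simps [simp]: "monomial [] = unit_form" "monomial (w # ws) = wedge w (monomial ws)"
  by (simp_all add: monomial_def)

lemma wedge_degree: "(\<And>vs. length vs \<noteq> q \<Longrightarrow> \<alpha> vs = 0) \<Longrightarrow> length vs \<noteq> Suc q \<Longrightarrow> wedge v \<alpha> vs = 0"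
proof (induction vs arbitrary: \<alpha> q)
  case (Cons u us)
  have "wedge v (\<lambda>ws. \<alpha> (u # ws)) us = 0"
  proof (cases q)
    case 0
    then have "(\<lambda>ws. \<alpha> (u # ws)) = (\<lambda>_. 0)" using Cons.prems(1) by auto
    then show ?thesis by (simp add: wedge_zero)
  next
    case (Suc q')
    show ?thesis by (rule Cons.IH[of q']) (use Cons.prems Suc in auto)
  qed
  then show ?case using Cons.prems by simp
qed simp

lemma monomial_degree: "length vs \<noteq> length ws \<Longrightarrow> monomial ws vs = 0"
proof (induction ws arbitrary: vs)
  case (Cons w ws)
  then show ?case by (simp add: wedge_degree[of "length ws" "monomial ws"])
qed (simp add: unit_form_def)

lemma alternating_monomial: "alternating (monomial ws)"
  by (induction ws) (auto simp: alternating_unit_form intro: alternating_wedge)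

section \<open>The Hodge star\<close>

lemma orthonormal_frame_inner:
  fixes b :: "nat \<Rightarrow> 'a::euclidean_space"
  assumes "orthonormal_frame b" "i < DIM('a)" "j < DIM('a)"
  shows "b i \<bullet> b j = (if i = j then 1 else 0)"
  using assms by (simp add: orthonormal_frame_def)

text \<open>Only the values of \<open>b\<close> below the dimension are constrained. They are
  independent and as many as the dimension, hence span, and the remainder of the expansion is
  orthogonal to all of them.\<close>

lemma orthonormal_frame_expansion:
  fixes b :: "nat \<Rightarrow> 'a::euclidean_space"
  assumes "orthonormal_frame b"
  shows "(\<Sum>i<DIM('a). (v \<bullet> b i) *\<^sub>R b i) = v"
proof -
  note ip = orthonormal_frame_inner[OF assms]
  let ?B = "b ` {..<DIM('a)}"
  have inj: "inj_on b {..<DIM('a)}"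
    by (rule inj_onI) (metis ip lessThan_iff zero_neq_one)
  have "pairwise orthogonal ?B"
    using ip by (auto simp: pairwise_def orthogonal_def)
  moreover have "0 \<notin> ?B"
  proof
    assume "0 \<in> ?B"
    then obtain i where "i < DIM('a)" "b i = 0" by auto
    then show False using ip[of i i] by simp
  qed
  ultimately have "independent ?B" by (rule pairwise_orthogonal_independent)
  moreover have "card ?B = DIM('a)" using inj by (simp add: card_image)
  ultimately have sp: "span ?B = UNIV"
    using card_eq_dim[of ?B UNIV] by auto
  define w where "w = v - (\<Sum>i<DIM('a). (v \<bullet> b i) *\<^sub>R b i)"
  have "orthogonal w x" if "x \<in> ?B" for x
  proof -
    from that obtain j where j: "j < DIM('a)" "x = b j" by auto
    have "(\<Sum>i<DIM('a). (v \<bullet> b i) * (b i \<bullet> b j)) = (\<Sum>i<DIM('a). if i = j then v \<bullet> b j else 0)"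
      by (rule sum.cong) (use j ip in auto)
    then show ?thesis using j
      by (simp add: orthogonal_def w_def inner_diff_left inner_sum_left)
  qed
  then have "orthogonal w w" using orthogonal_to_span[of w ?B w] sp by auto
  then show ?thesis by (simp add: w_def orthogonal_def)
qed

text \<open>The slot must lie below the dimension, since \<open>vol_form\<close> reads exactly the
  first \<open>DIM('a)\<close> entries. In each term of the determinant the slot occurs in one
  factor; \<open>R\<close> collects the others.\<close>

lemma vol_form_slot_linear:
  fixes b :: "nat \<Rightarrow> 'a::euclidean_space"
  assumes "length us < DIM('a)"
  shows "linear (\<lambda>v. vol_form b (us @ v # ws))"
proof -
  let ?k = "length us"
  define R where "R \<pi> = (\<Prod>i\<in>{..<DIM('a)} - {?k}. ((us @ 0 # ws) ! i) \<bullet> b (\<pi> i))" for \<pi> :: "nat \<Rightarrow> nat"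
  have "(\<Prod>i<DIM('a). ((us @ v # ws) ! i) \<bullet> b (\<pi> i)) = (v \<bullet> b (\<pi> ?k)) * R \<pi>" for v \<pi>
  proof -
    have "(\<Prod>i<DIM('a). ((us @ v # ws) ! i) \<bullet> b (\<pi> i)) = ((us @ v # ws) ! ?k \<bullet> b (\<pi> ?k)) *
      (\<Prod>i\<in>{..<DIM('a)} - {?k}. ((us @ v # ws) ! i) \<bullet> b (\<pi> i))"
      using assms by (intro prod.remove) auto
    moreover have "(\<Prod>i\<in>{..<DIM('a)} - {?k}. ((us @ v # ws) ! i) \<bullet> b (\<pi> i)) = R \<pi>"
      unfolding R_def by (rule prod.cong) (auto simp: nth_append nth_Cons split: nat.split)
    ultimately show ?thesis by simp
  qed
  then have e: "(\<lambda>v. vol_form b (us @ v # ws)) =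
     (\<lambda>v. \<Sum>\<pi> | \<pi> permutes {..<DIM('a)}. of_int (sign \<pi>) * ((v \<bullet> b (\<pi> ?k)) * R \<pi>))"
    by (auto simp: vol_form_def)
  show ?thesis unfolding e
    by (rule linear_compose_sum, clarify, rule linearI) (simp_all add: inner_add_left algebra_simps)
qed

text \<open>Composing every permutation with the transposition of the two equal slots changes the
  sign of each term and only reorders the sum, so the sum equals its own negative.\<close>

lemma vol_form_repeated:
  fixes b :: "nat \<Rightarrow> 'a::euclidean_space"
  assumes "i < DIM('a)" "j < DIM('a)" "i \<noteq> j" "vs ! i = vs ! j"
  shows "vol_form b vs = 0"
proof -
  let ?P = "{\<pi>. \<pi> permutes {..<DIM('a)}}"
  let ?t = "Transposition.transpose i j"
  define F where "F \<pi> = of_int (sign \<pi>) * (\<Prod>i<DIM('a). (vs ! i) \<bullet> b (\<pi> i))" for \<pi>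
  have t: "?t permutes {..<DIM('a)}" using assms by (simp add: permutes_swap_id)
  have neg: "F (\<pi> \<circ> ?t) = - F \<pi>" if p: "\<pi> permutes {..<DIM('a)}" for \<pi>
  proof -
    have "permutation \<pi>" "permutation ?t"
      using p t permutation_permutes finite_lessThan by blast+
    then have s: "sign (\<pi> \<circ> ?t) = - sign \<pi>"
      using assms by (simp add: sign_compose sign_swap_id)
    have "(\<Prod>k<DIM('a). (vs ! k) \<bullet> b ((\<pi> \<circ> ?t) k)) = (\<Prod>k<DIM('a). (vs ! ?t k) \<bullet> b ((\<pi> \<circ> ?t) k))"
      by (rule prod.cong) (use assms in \<open>auto simp: Transposition.transpose_def\<close>)
    also have "\<dots> = (\<Prod>k<DIM('a). (vs ! k) \<bullet> b (\<pi> k))"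
      using prod.permute[OF t, of "\<lambda>k. (vs ! k) \<bullet> b (\<pi> k)"] by (simp add: o_def)
    finally show ?thesis by (simp add: F_def s)
  qed
  have "sum F ?P = sum (\<lambda>\<pi>. F (\<pi> \<circ> ?t)) ?P"
    by (rule sum_permutations_compose_right[OF t])
  also have "\<dots> = (\<Sum>\<pi>\<in>?P. - F \<pi>)" by (rule sum.cong) (auto simp: neg)
  also have "\<dots> = - sum F ?P" by (simp add: sum_negf)
  finally show ?thesis by (simp add: vol_form_def F_def)
qed

lemma vol_form_frame:
  fixes b :: "nat \<Rightarrow> 'a::euclidean_space"
  assumes "orthonormal_frame b"
  shows "vol_form b (map b [0..<DIM('a)]) = 1"
proof -
  have "of_int (sign \<pi>) * (\<Prod>i<DIM('a). (map b [0..<DIM('a)] ! i) \<bullet> b (\<pi> i)) = (if \<pi> = id then 1 else (0::real))"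
    if p: "\<pi> permutes {..<DIM('a)}" for \<pi>
  proof (cases "\<pi> = id")
    case True
    then show ?thesis
      using orthonormal_frame_inner[OF assms] by (simp add: sign_id)
  next
    case False
    then obtain i where i: "\<pi> i \<noteq> i" by (auto simp: fun_eq_iff)
    then have "i < DIM('a)" using p by (meson lessThan_iff permutes_not_in)
    moreover from this have "\<pi> i < DIM('a)" using p by (meson lessThan_iff permutes_in_image)
    ultimately have "(map b [0..<DIM('a)] ! i) \<bullet> b (\<pi> i) = 0"
      using orthonormal_frame_inner[OF assms, of i "\<pi> i"] i by simp
    then have "(\<Prod>i<DIM('a). (map b [0..<DIM('a)] ! i) \<bullet> b (\<pi> i)) = 0"
      using \<open>i < DIM('a)\<close> by (intro prod_zero) auto
    then show ?thesis using False by simp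
  qed
  then have "vol_form b (map b [0..<DIM('a)]) = (\<Sum>\<pi> | \<pi> permutes {..<DIM('a)}. if \<pi> = id then 1 else 0)"
    unfolding vol_form_def by (intro sum.cong) auto
  then show ?thesis using permutes_id[of "{..<DIM('a)}"] by (simp add: finite_permutations)
qed

text \<open>\<^const>\<open>vol_form\<close> reads junk entries on lists of the wrong length.\<close>

definition volume :: "(nat \<Rightarrow> 'a::euclidean_space) \<Rightarrow> 'a list \<Rightarrow> complex" where
  "volume b vs = (if length vs = DIM('a) then of_real (vol_form b vs) else 0)"

lemma alternating_volume: "alternating (volume (b :: nat \<Rightarrow> 'a::euclidean_space))"
  unfolding alternating_def
proof (intro conjI allI impI)
  fix us ws :: "'a list"
  show "linear (\<lambda>v. volume b (us @ v # ws))"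
  proof (cases "length us + Suc (length ws) = DIM('a)")
    case True
    then have l: "linear (\<lambda>v. vol_form b (us @ v # ws))" by (intro vol_form_slot_linear) simp
    show ?thesis using True
      by (intro linearI) (simp_all add: volume_def linear_add[OF l] linear_scale[OF l] scaleR_conv_of_real)
  next
    case False
    then show ?thesis by (simp add: volume_def linear_zero)
  qed
next
  fix vs :: "'a list" assume "\<not> distinct vs"
  then obtain i j where "i < length vs" "j < length vs" "i \<noteq> j" "vs ! i = vs ! j"
    by (auto simp: distinct_conv_nth)
  then show "volume b vs = 0" using vol_form_repeated[of i j vs b] by (auto simp: volume_def)
qed

section \<open>The star on single cochains, as a pairing with the volume form\<close>

definition star :: "(nat \<Rightarrow> 'a::euclidean_space) \<Rightarrow> ('a list \<Rightarrow> complex) \<Rightarrow> 'a list \<Rightarrow> complex" where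
  "star b \<alpha> ws = (\<Sum>I | I \<subseteq> {..<DIM('a)} \<and> card I + length ws = DIM('a).
     \<alpha> (map b (sorted_list_of_set I)) * of_real (vol_form b (map b (sorted_list_of_set I) @ ws)))"

lemma hodge_star_eq: "hodge_star b \<phi> = (\<lambda>x. star b (\<phi> x))"
  by (intro ext) (simp add: hodge_star_def star_def Let_def)

lemma sorted_list_of_set_insert_min:
  assumes "finite I" "\<And>i. i \<in> I \<Longrightarrow> (k::nat) < i"
  shows "sorted_list_of_set (insert k I) = k # sorted_list_of_set I"
proof -
  have "k \<notin> I" using assms(2) by blast
  then show ?thesis using assms
    by (simp add: insort_is_Cons less_imp_le)
qed

text \<open>Peeling off the least index matches the recursion over the list with the split of the
  power set by membership of \<open>k\<close>.\<close>

lemma sublist_sum_subsets: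
  "sublist_sum (map b [k..<m]) \<alpha> \<beta> =
     (\<Sum>I\<in>Pow {k..<m}. \<alpha> (map b (sorted_list_of_set I)) * \<beta> (map b (sorted_list_of_set I)))"
proof (induction "m - k" arbitrary: k \<alpha> \<beta>)
  case 0
  then show ?case by simp
next
  case (Suc d)
  then have km: "k < m" "d = m - Suc k" by simp_all
  have iv: "{k..<m} = insert k {Suc k..<m}" using km by auto
  have up: "[k..<m] = k # [Suc k..<m]" using km by (simp add: upt_conv_Cons)
  have s: "sorted_list_of_set (insert k I) = k # sorted_list_of_set I" if "I \<in> Pow {Suc k..<m}" for I
    using that by (intro sorted_list_of_set_insert_min) (auto intro: finite_subset)
  have inj: "inj_on (insert k) (Pow {Suc k..<m})"
    by (rule inj_onI) (metis PowD Suc_n_not_le_n atLeastLessThan_iff insert_ident subsetD)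
  have "(\<Sum>I\<in>Pow {k..<m}. \<alpha> (map b (sorted_list_of_set I)) * \<beta> (map b (sorted_list_of_set I))) =
    (\<Sum>I\<in>Pow {Suc k..<m}. \<alpha> (map b (sorted_list_of_set I)) * \<beta> (map b (sorted_list_of_set I))) +
    (\<Sum>I\<in>insert k ` Pow {Suc k..<m}. \<alpha> (map b (sorted_list_of_set I)) * \<beta> (map b (sorted_list_of_set I)))"
    unfolding iv Pow_insert by (rule sum.union_disjoint) auto
  also have "(\<Sum>I\<in>insert k ` Pow {Suc k..<m}. \<alpha> (map b (sorted_list_of_set I)) * \<beta> (map b (sorted_list_of_set I))) =
    (\<Sum>I\<in>Pow {Suc k..<m}. \<alpha> (b k # map b (sorted_list_of_set I)) * \<beta> (b k # map b (sorted_list_of_set I)))"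
    by (subst sum.reindex[OF inj], rule sum.cong) (simp_all add: s)
  finally show ?case
    unfolding up using Suc.hyps(1)[OF km(2)] by simp
qed

definition frame_list :: "(nat \<Rightarrow> 'a::euclidean_space) \<Rightarrow> 'a list" where
  "frame_list b = map b [0..<DIM('a)]"

lemma frame_list_expansion:
  assumes "orthonormal_frame b"
  shows "(\<Sum>c\<leftarrow>frame_list b. (v \<bullet> c) *\<^sub>R c) = v"
  using orthonormal_frame_expansion[OF assms, of v]
  by (simp add: frame_list_def interv_sum_list_conv_sum_set_nat atLeast0LessThan o_def)

text \<open>In this form adjointness of wedge and contraction applies to the star. The degree
  restriction in \<open>star\<close> is carried by \<open>volume\<close>, which vanishes off the top
  degree.\<close>

lemma star_eq_sublist_sum:
  "star b \<alpha> ws = sublist_sum (frame_list b) \<alpha> (\<lambda>us. volume b (us @ ws))"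
proof -
  have f: "finite I" if "I \<subseteq> {..<DIM('a)}" for I using that finite_subset by blast
  have "sublist_sum (frame_list b) \<alpha> (\<lambda>us. volume b (us @ ws)) =
    (\<Sum>I\<in>Pow {..<DIM('a)}. if card I + length ws = DIM('a) then
     \<alpha> (map b (sorted_list_of_set I)) * of_real (vol_form b (map b (sorted_list_of_set I) @ ws)) else 0)"
    unfolding frame_list_def sublist_sum_subsets atLeast0LessThan volume_def
    by (rule sum.cong) (auto simp: f)
  also have "\<dots> = star b \<alpha> ws"
    unfolding star_def by (subst sum.inter_filter[symmetric]) (auto intro: sum.cong)
  finally show ?thesis by simp
qed

lemma star_cong_degree:
  fixes b :: "nat \<Rightarrow> 'a::euclidean_space"
  assumes "\<And>us. length us + length ws = DIM('a) \<Longrightarrow> \<alpha> us = \<beta> us"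
  shows "star b \<alpha> ws = star b \<beta> ws"
proof -
  have f: "finite I" if "I \<subseteq> {..<DIM('a)}" for I using that finite_subset by blast
  show ?thesis unfolding star_def by (rule sum.cong) (auto simp: f assms)
qed

lemma star_lin2: "star b (\<lambda>vs. c * \<alpha> vs + d * \<beta> vs) ws = c * star b \<alpha> ws + d * star b \<beta> ws"
  unfolding star_eq_sublist_sum by (rule sublist_sum_lin2)

lemma star_mult: "star b (\<lambda>vs. c * \<alpha> vs) ws = c * star b \<alpha> ws"
  using star_lin2[of b c \<alpha> 0 \<alpha> ws] by simp

lemma star_add: "star b (\<lambda>vs. \<alpha> vs + \<beta> vs) ws = star b \<alpha> ws + star b \<beta> ws"
  using star_lin2[of b 1 \<alpha> 1 \<beta> ws] by simp

lemma star_zero: "star b (\<lambda>vs. 0) ws = 0"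
  using star_mult[of b 0 "\<lambda>_. 0" ws] by simp

lemma star_sum: "star b (\<lambda>ws. \<Sum>i\<in>S. \<alpha> i ws) us = (\<Sum>i\<in>S. star b (\<alpha> i) us)"
  by (induction S rule: infinite_finite_induct) (simp_all add: star_zero star_add)

lemma alternating_append: "alternating \<alpha> \<Longrightarrow> alternating (\<lambda>ws. \<alpha> (us @ ws))"
  by (induction us arbitrary: \<alpha>) (auto dest: alternating_Cons)

lemma alternating_append_right: "alternating \<alpha> \<Longrightarrow> alternating (\<lambda>us. \<alpha> (us @ ws))"
  unfolding alternating_def by auto

lemma alternating_star: "alternating (star b \<alpha>)"
  unfolding star_eq_sublist_sum frame_list_def sublist_sum_subsets
  by (intro alternating_sum alternating_mult alternating_append alternating_volume)

lemma sublist_sum_cong: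
  assumes "\<And>us. length us \<le> length L \<Longrightarrow> set us \<subseteq> set L \<Longrightarrow> \<alpha> us * \<beta> us = \<alpha>' us * \<beta>' us"
  shows "sublist_sum L \<alpha> \<beta> = sublist_sum L \<alpha>' \<beta>'"
  using assms
proof (induction L arbitrary: \<alpha> \<beta> \<alpha>' \<beta>')
  case (Cons c L)
  have "sublist_sum L (\<lambda>ws. \<alpha> (c # ws)) (\<lambda>ws. \<beta> (c # ws)) = sublist_sum L (\<lambda>ws. \<alpha>' (c # ws)) (\<lambda>ws. \<beta>' (c # ws))"
    by (rule Cons.IH) (rule Cons.prems; auto)
  moreover have "sublist_sum L \<alpha> \<beta> = sublist_sum L \<alpha>' \<beta>'"
    by (rule Cons.IH) (rule Cons.prems; auto)
  ultimately show ?case by simp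
qed simp

lemma sublist_sum_top:
  assumes "\<And>us. length us < length L \<Longrightarrow> \<alpha> us * \<beta> us = 0"
  shows "sublist_sum L \<alpha> \<beta> = \<alpha> L * \<beta> L"
  using assms
proof (induction L arbitrary: \<alpha> \<beta>)
  case (Cons c L)
  have "sublist_sum L \<alpha> \<beta> = sublist_sum L (\<lambda>_. 0) (\<lambda>_. 0)"
    by (rule sublist_sum_cong) (use Cons.prems in auto)
  moreover have "sublist_sum L (\<lambda>ws. \<alpha> (c # ws)) (\<lambda>ws. \<beta> (c # ws)) = \<alpha> (c # L) * \<beta> (c # L)"
    by (rule Cons.IH) (use Cons.prems in auto)
  ultimately show ?case by (simp add: sublist_sum_zero)
qed simp

lemma sublist_sum_unit_form: "sublist_sum L unit_form \<beta> = \<beta> []"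
proof (induction L)
  case (Cons c L)
  have "(\<lambda>ws. unit_form (c # ws)) = (\<lambda>_. 0)" by (simp add: unit_form_def)
  then show ?case using Cons by (simp add: sublist_sum_zero)
qed (simp add: unit_form_def)

lemma wedge_sublist_sum:
  "wedge v (\<lambda>ws. sublist_sum L \<alpha> (\<lambda>us. g us ws)) zs = sublist_sum L \<alpha> (\<lambda>us. wedge v (g us) zs)"
  by (induction L arbitrary: \<alpha> g) (simp_all add: wedge_mult wedge_add)

lemma wedge_cong_length:
  assumes "\<And>ws. Suc (length ws) = length vs \<Longrightarrow> \<alpha> ws = \<beta> ws"
  shows "wedge v \<alpha> vs = wedge v \<beta> vs"
  using assms
proof (induction vs arbitrary: \<alpha> \<beta>)
  case (Cons u vs)
  have "wedge v (\<lambda>ws. \<alpha> (u # ws)) vs = wedge v (\<lambda>ws. \<beta> (u # ws)) vs"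
    by (rule Cons.IH) (use Cons.prems in auto)
  then show ?case using Cons.prems by simp
qed simp

text \<open>Adjointness turns the factors of the monomial one by one into contractions with the
  entries of \<open>ws\<close>, leaving the pairing with the constant \<open>1\<close>. Monomials
  thus represent evaluation functionals.\<close>

lemma alternating_reproducing:
  assumes "orthonormal_frame b" "alternating \<alpha>"
  shows "sublist_sum (frame_list b) (monomial ws) \<alpha> = \<alpha> ws"
  using assms(2)
proof (induction ws arbitrary: \<alpha>)
  case (Cons w ws)
  then show ?case
    using Cons.IH[OF alternating_Cons[OF Cons.prems, of w]]
    by (simp add: sublist_sum_adjoint frame_list_expansion[OF assms(1)])
qed (simp add: sublist_sum_unit_form)

text \<open>By the reproducing property the value at \<open>ws\<close> is a combination of values on
  increasing frame lists of the same length.\<close>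

lemma alternating_eqI:
  fixes b :: "nat \<Rightarrow> 'a::euclidean_space"
  assumes "orthonormal_frame b" "alternating \<alpha>" "alternating \<beta>"
    and "\<And>I. I \<subseteq> {..<DIM('a)} \<Longrightarrow> card I = length ws \<Longrightarrow>
      \<alpha> (map b (sorted_list_of_set I)) = \<beta> (map b (sorted_list_of_set I))"
  shows "\<alpha> ws = \<beta> ws"
proof -
  have "sublist_sum (frame_list b) (monomial ws) \<alpha> = sublist_sum (frame_list b) (monomial ws) \<beta>"
    unfolding frame_list_def sublist_sum_subsets atLeast0LessThan
  proof (rule sum.cong[OF refl])
    fix I assume "I \<in> Pow {..<DIM('a)}"
    then have I: "I \<subseteq> {..<DIM('a)}" "finite I" using finite_subset by auto
    show "monomial ws (map b (sorted_list_of_set I)) * \<alpha> (map b (sorted_list_of_set I)) =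
      monomial ws (map b (sorted_list_of_set I)) * \<beta> (map b (sorted_list_of_set I))"
      using assms(4)[OF I(1)] monomial_degree[of "map b (sorted_list_of_set I)" ws] I(2)
      by (cases "card I = length ws") auto
  qed
  then show ?thesis using alternating_reproducing assms by metis
qed

lemma alternating_high_degree:
  fixes \<alpha> :: "'a::euclidean_space list \<Rightarrow> complex"
  assumes "orthonormal_frame (b :: nat \<Rightarrow> 'a)" "alternating \<alpha>" "length ws > DIM('a)"
  shows "\<alpha> ws = 0"
proof (rule alternating_eqI[OF assms(1,2) alternating_zero])
  fix I assume "I \<subseteq> {..<DIM('a)}" "card I = length ws"
  then have False using assms(3) card_mono[of "{..<DIM('a)}" I] by simp
  then show "\<alpha> (map b (sorted_list_of_set I)) = 0" ..
qed

lemma alternating_move_front: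
  assumes "alternating \<alpha>" shows "\<alpha> (v # us @ ws) = (-1) ^ length us * \<alpha> (us @ v # ws)"
  using assms
proof (induction us arbitrary: \<alpha>)
  case (Cons u us)
  have "\<alpha> (v # (u # us) @ ws) = - \<alpha> (u # v # us @ ws)"
    using alternating_swap_Cons[OF Cons.prems, of v u "us @ ws"] by simp
  then show ?case using Cons.IH[OF alternating_Cons[OF Cons.prems, of u]] by simp
qed simp

section \<open>Star, wedge and contraction in odd dimension\<close>

locale odd_frame =
  fixes b :: "nat \<Rightarrow> 'a::euclidean_space"
  assumes frame: "orthonormal_frame b" and odd_dim: "odd DIM('a)"
begin

text \<open>Adjointness places \<open>v\<close> in front of the arguments of the volume form, and
  moving it past \<open>us\<close> costs \<open>(-1) ^ length us\<close>. As the dimension is odd,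
  \<open>us\<close> and \<open>ws\<close> have lengths of equal parity wherever the volume form does
  not vanish, so the sign can be read off \<open>ws\<close>.\<close>

lemma star_wedge: "star b (wedge v \<alpha>) ws = (-1) ^ length ws * star b \<alpha> (v # ws)"
proof -
  have "star b (wedge v \<alpha>) ws = sublist_sum (frame_list b) \<alpha> (\<lambda>us. volume b (v # us @ ws))"
    unfolding star_eq_sublist_sum
    using sublist_sum_adjoint[OF alternating_append_right[OF alternating_volume[of b]], of "frame_list b" v \<alpha>]
    by (simp add: frame_list_expansion[OF frame])
  also have "(\<lambda>us. volume b (v # us @ ws)) = (\<lambda>us. (-1) ^ length ws * volume b (us @ v # ws) + 0 * unit_form us)"
  proof
    fix us :: "'a list"
    have "(-1::complex) ^ length us = (-1) ^ length ws" if "length us + Suc (length ws) = DIM('a)"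
    proof -
      have "even (length us + length ws)" using that odd_dim by presburger
      then show ?thesis by (auto simp: uminus_power_if)
    qed
    then show "volume b (v # us @ ws) = (-1) ^ length ws * volume b (us @ v # ws) + 0 * unit_form us"
      using alternating_move_front[OF alternating_volume[of b], of v us ws] by (auto simp: volume_def)
  qed
  finally show ?thesis by (simp only: sublist_sum_lin2_right) (simp add: star_eq_sublist_sum)
qed

lemma wedge_volume: "wedge v (volume b) ws = 0"
proof (cases "length ws = Suc DIM('a)")
  case True
  then show ?thesis
    by (intro alternating_high_degree[OF frame] alternating_wedge alternating_volume) simp
qed (simp add: wedge_degree[of "DIM('a)"] volume_def)

text \<open>Since \<open>v\<close> wedge the volume form vanishes, the Leibniz rule over
  \<open>us @ ws\<close> exchanges a wedge on the \<open>us\<close> part for one on the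
  \<open>ws\<close> part.\<close>

lemma star_interior:
  assumes "alternating \<alpha>"
  shows "star b (\<lambda>vs. \<alpha> (v # vs)) ws = (-1) ^ Suc (length ws) * wedge v (star b \<alpha>) ws"
proof -
  let ?F = "frame_list b"
  have "star b (\<lambda>vs. \<alpha> (v # vs)) ws = sublist_sum ?F (wedge v (\<lambda>us. volume b (us @ ws))) \<alpha>"
    unfolding star_eq_sublist_sum sublist_sum_adjoint[OF assms] frame_list_expansion[OF frame]
    by (rule sublist_sum_comm)
  also have "\<dots> = sublist_sum ?F \<alpha> (\<lambda>us. (-1) ^ Suc (length ws) * wedge v (\<lambda>ws. volume b (us @ ws)) ws)"
  proof (subst sublist_sum_comm, rule sublist_sum_cong)
    fix us :: "'a list"
    have e: "wedge v (\<lambda>us. volume b (us @ ws)) us = - ((-1) ^ length us * wedge v (\<lambda>ws. volume b (us @ ws)) ws)"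
      using wedge_append[of v "volume b" us ws] by (simp add: wedge_volume eq_neg_iff_add_eq_0)
    have "wedge v (\<lambda>us. volume b (us @ ws)) us = (-1) ^ Suc (length ws) * wedge v (\<lambda>ws. volume b (us @ ws)) ws"
    proof (cases "length us + length ws = Suc DIM('a)")
      case True
      then have "even (length us + length ws)" using odd_dim by simp
      then have "(-1::complex) ^ length us = (-1) ^ length ws" by (auto simp: uminus_power_if)
      then show ?thesis using e by simp
    next
      case False
      have "wedge v (\<lambda>us. volume b (us @ ws)) us = wedge v (\<lambda>_. 0) us"
        by (rule wedge_cong_length) (use False in \<open>auto simp: volume_def\<close>)
      moreover have "wedge v (\<lambda>ws. volume b (us @ ws)) ws = wedge v (\<lambda>_. 0) ws"
        by (rule wedge_cong_length) (use False in \<open>auto simp: volume_def\<close>)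
      ultimately show ?thesis by (simp add: wedge_zero)
    qed
    then show "\<alpha> us * wedge v (\<lambda>us. volume b (us @ ws)) us =
      \<alpha> us * ((-1) ^ Suc (length ws) * wedge v (\<lambda>ws. volume b (us @ ws)) ws)" by simp
  qed
  also have "\<dots> = (-1) ^ Suc (length ws) * wedge v (star b \<alpha>) ws"
    unfolding star_eq_sublist_sum wedge_sublist_sum
    using sublist_sum_lin2_right[of ?F \<alpha> "(-1) ^ Suc (length ws)" "\<lambda>us. wedge v (\<lambda>ws. volume b (us @ ws)) ws" 0 "\<lambda>_. 0"]
    by simp
  finally show ?thesis .
qed

text \<open>The first star turns the wedge into a contraction, the second turns it back; in odd
  dimension the two signs agree and cancel.\<close>

lemma star_star_wedge:
  "star b (star b (wedge v \<alpha>)) zs = wedge v (star b (star b \<alpha>)) zs"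
proof -
  have "star b (star b (wedge v \<alpha>)) zs = star b (\<lambda>ws. (-1) ^ Suc (length zs) * star b \<alpha> (v # ws)) zs"
  proof (rule star_cong_degree)
    fix us :: "'a list" assume "length us + length zs = DIM('a)"
    then have "odd (length us + length zs)" using odd_dim by simp
    then have "(-1::complex) ^ length us = (-1) ^ Suc (length zs)" by (auto simp: uminus_power_if)
    then show "star b (wedge v \<alpha>) us = (-1) ^ Suc (length zs) * star b \<alpha> (v # us)" by (simp add: star_wedge)
  qed
  also have "\<dots> = (-1) ^ Suc (length zs) * ((-1) ^ Suc (length zs) * wedge v (star b (star b \<alpha>)) zs)"
    by (simp only: star_mult star_interior[OF alternating_star])
  finally show ?thesis by (simp add: power_add[symmetric] mult.assoc[symmetric])
qed

text \<open>Euler's identity: contracting and multiplying back along a frame counts the degree.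
  Expanding the first argument in the frame yields one, the remaining arguments yield the rest by
  induction.\<close>

lemma euler_sum:
  assumes "alternating \<alpha>"
  shows "(\<Sum>i<DIM('a). wedge (b i) (\<lambda>ws. \<alpha> (b i # ws)) vs) = of_nat (length vs) * \<alpha> vs"
  using assms
proof (induction vs arbitrary: \<alpha>)
  case (Cons u us)
  have ex: "(\<Sum>i<DIM('a). of_real (b i \<bullet> u) * \<alpha> (b i # us)) = \<alpha> (u # us)"
  proof -
    have l: "linear (\<lambda>v. \<alpha> (v # us))" by (rule alternating_linear_Cons[OF Cons.prems])
    have "\<alpha> (u # us) = \<alpha> ((\<Sum>i<DIM('a). (u \<bullet> b i) *\<^sub>R b i) # us)"
      by (simp add: orthonormal_frame_expansion[OF frame])
    also have "\<dots> = (\<Sum>i<DIM('a). of_real (b i \<bullet> u) * \<alpha> (b i # us))"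
      by (simp add: linear_sum[OF l] linear_scale[OF l] scaleR_conv_of_real inner_commute)
    finally show ?thesis by simp
  qed
  have "(\<Sum>i<DIM('a). wedge (b i) (\<lambda>ws. \<alpha> (b i # ws)) (u # us)) =
    (\<Sum>i<DIM('a). of_real (b i \<bullet> u) * \<alpha> (b i # us)) + (\<Sum>i<DIM('a). wedge (b i) (\<lambda>ws. \<alpha> (u # b i # ws)) us)"
  proof -
    have "(\<lambda>ws. \<alpha> (b i # u # ws)) = (\<lambda>ws. - \<alpha> (u # b i # ws))" for i
      by (rule ext) (rule alternating_swap_Cons[OF Cons.prems])
    then show ?thesis by (simp add: wedge_uminus sum.distrib)
  qed
  then show ?case using ex Cons.IH[OF alternating_Cons[OF Cons.prems, of u]] by (simp add: algebra_simps)
qed simp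

text \<open>By induction on the degree: Euler's identity writes a form of positive degree as a
  combination of \<open>wedge (b i)\<close> applied to forms of lower degree, and the double star
  commutes with each \<open>wedge (b i)\<close>. The base case exchanges the constant
  \<open>1\<close> and the volume form.\<close>

lemma star_star:
  assumes "alternating \<alpha>" shows "star b (star b \<alpha>) = \<alpha>"
proof -
  have hom: "star b (star b \<alpha>) = \<alpha>" if "alternating \<alpha>" "\<And>vs. length vs \<noteq> q \<Longrightarrow> \<alpha> vs = 0" for q \<alpha>
    using that
  proof (induction q arbitrary: \<alpha>)
    case 0
    have a: "\<alpha> = (\<lambda>vs. \<alpha> [] * unit_form vs)" using 0 by (auto simp: unit_form_def fun_eq_iff)
    have s1: "star b unit_form = volume b"
      by (rule ext) (simp add: star_eq_sublist_sum sublist_sum_unit_form)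
    have s2: "star b (volume b) ws = unit_form ws" for ws
    proof (cases "ws = []")
      case True
      have "star b (volume b) ws = volume b (frame_list b) * volume b (frame_list b @ ws)"
        unfolding star_eq_sublist_sum by (rule sublist_sum_top) (auto simp: volume_def frame_list_def)
      then show ?thesis using True vol_form_frame[OF frame]
        by (simp add: volume_def frame_list_def unit_form_def)
    next
      case False
      have "star b (volume b) ws = star b (\<lambda>_. 0) ws"
        by (rule star_cong_degree) (use False in \<open>auto simp: volume_def\<close>)
      then show ?thesis using False by (simp add: star_zero unit_form_def)
    qed
    have s3: "star b (\<lambda>vs. \<alpha> [] * unit_form vs) = (\<lambda>ws. \<alpha> [] * volume b ws)"
      by (rule ext) (simp add: star_mult s1)
    have "star b (star b \<alpha>) ws = \<alpha> ws" for ws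
      by (subst (1 2) a) (simp add: star_mult s2 s3)
    then show ?case by blast
  next
    case (Suc q)
    define \<beta> where "\<beta> i ws = \<alpha> (b i # ws)" for i ws
    have IH: "star b (star b (\<beta> i)) = \<beta> i" for i
      by (rule Suc.IH) (use Suc.prems in \<open>auto simp: \<beta>_def intro: alternating_Cons\<close>)
    have e: "\<alpha> = (\<lambda>vs. inverse (of_nat (Suc q)) * (\<Sum>i<DIM('a). wedge (b i) (\<beta> i) vs))"
    proof
      fix vs
      show "\<alpha> vs = inverse (of_nat (Suc q)) * (\<Sum>i<DIM('a). wedge (b i) (\<beta> i) vs)"
        unfolding \<beta>_def euler_sum[OF Suc.prems(1)]
        using Suc.prems(2)[of vs] by (cases "length vs = Suc q") (simp_all del: of_nat_Suc)
    qed
    have "star b (star b \<alpha>) ws = \<alpha> ws" for ws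
    proof -
      have "star b \<alpha> = (\<lambda>ws. inverse (of_nat (Suc q)) * (\<Sum>i<DIM('a). star b (wedge (b i) (\<beta> i)) ws))"
        by (subst e) (simp add: star_mult star_sum fun_eq_iff)
      then have "star b (star b \<alpha>) ws =
        inverse (of_nat (Suc q)) * (\<Sum>i<DIM('a). star b (star b (wedge (b i) (\<beta> i))) ws)"
        by (simp add: star_mult star_sum)
      also have "\<dots> = \<alpha> ws" unfolding star_star_wedge IH by (rule fun_cong[OF e, symmetric])
      finally show ?thesis .
    qed
    then show ?case by blast
  qed
  show ?thesis
  proof
    fix zs :: "'a list"
    \<comment> \<open>The cochain is cut down to the degree at which the identity is tested; the
      double star at \<open>zs\<close> reads no other degree.\<close>
    define \<beta> where "\<beta> vs = (if length vs = length zs then \<alpha> vs else 0)" for vs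
    have "alternating \<beta>"
      unfolding alternating_def
    proof (intro conjI allI impI)
      fix us ws
      show "linear (\<lambda>v. \<beta> (us @ v # ws))"
        using alternating_linear[OF assms, of us ws]
        by (cases "Suc (length us + length ws) = length zs") (simp_all add: \<beta>_def linear_zero)
    qed (simp add: \<beta>_def alternating_eq0[OF assms])
    then have "star b (star b \<beta>) zs = \<beta> zs" using hom[of \<beta> "length zs"] by (simp add: \<beta>_def)
    moreover have "star b (star b \<beta>) zs = star b (star b \<alpha>) zs"
    proof (rule star_cong_degree)
      fix us :: "'a list" assume "length us + length zs = DIM('a)"
      then show "star b \<beta> us = star b \<alpha> us"
        by (intro star_cong_degree) (auto simp: \<beta>_def)
    qed
    ultimately show "star b (star b \<alpha>) zs = \<alpha> zs" by (simp add: \<beta>_def)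
  qed
qed

end

section \<open>Reflections and the symbol of \<open>B\<close>\<close>

definition reflect :: "'a::real_inner \<Rightarrow> 'a \<Rightarrow> 'a" where
  "reflect v x = x - (2 * (v \<bullet> x) / (v \<bullet> v)) *\<^sub>R v"

lemma reflect_lin2: "reflect v (r *\<^sub>R x + s *\<^sub>R y) = r *\<^sub>R reflect v x + s *\<^sub>R reflect v y"
  by (simp add: reflect_def inner_add_right algebra_simps add_divide_distrib)

lemma linear_reflect: "linear (reflect v)"
  using reflect_lin2[of v 1 _ 1] reflect_lin2[of v _ _ 0] by (intro linearI) simp_all

lemma reflect_inner: "v \<noteq> 0 \<Longrightarrow> reflect v x \<bullet> reflect v y = x \<bullet> y"
  by (simp add: reflect_def inner_diff_left inner_diff_right inner_commute)

lemma reflect_reflect: "v \<noteq> 0 \<Longrightarrow> reflect v (reflect v x) = x"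
  by (simp add: reflect_def inner_diff_right)

lemma reflect_orthogonal: "v \<bullet> x = 0 \<Longrightarrow> reflect v x = x"
  by (simp add: reflect_def)

lemma alternating_compose_map:
  assumes "alternating \<alpha>" "linear R" shows "alternating (\<lambda>vs. \<alpha> (map R vs))"
  unfolding alternating_def
proof (intro conjI allI impI)
  fix us ws
  have "linear ((\<lambda>v. \<alpha> (map R us @ v # map R ws)) \<circ> R)"
    by (rule linear_compose[OF assms(2) alternating_linear[OF assms(1)]])
  then show "linear (\<lambda>v. \<alpha> (map R (us @ v # ws)))" by (simp add: o_def)
next
  fix vs :: "'b list" assume "\<not> distinct vs"
  then have "\<not> distinct (map R vs)" by (auto simp: distinct_map)
  then show "\<alpha> (map R vs) = 0" by (rule alternating_eq0[OF assms(1)])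
qed

lemma wedge_compose_map:
  assumes "\<And>x y. R x \<bullet> R y = x \<bullet> y"
  shows "wedge (R v) \<alpha> (map R vs) = wedge v (\<lambda>vs. \<alpha> (map R vs)) vs"
  by (induction vs arbitrary: \<alpha>) (simp_all add: assms)

text \<open>For nonzero \<open>v\<close> a reflection acts on forms as \<open>1 - 2 P\<close>, where
  \<open>P\<close> projects onto the multiples of the covector of \<open>v\<close>: correcting two
  arguments at once would contract twice with \<open>v\<close>, which gives zero.\<close>

lemma alternating_reflect:
  assumes "alternating \<alpha>"
  shows "\<alpha> (map (reflect v) vs) = \<alpha> vs - of_real (2 / (v \<bullet> v)) * wedge v (\<lambda>ws. \<alpha> (v # ws)) vs"
  using assms
proof (induction vs arbitrary: \<alpha>)
  case (Cons x xs)
  define k where "k = 2 / (v \<bullet> v)"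
  have r: "reflect v x = x + (- (k * (v \<bullet> x))) *\<^sub>R v" by (simp add: reflect_def k_def)
  have c: "\<alpha> (reflect v x # ws) = \<alpha> (x # ws) - of_real (k * (v \<bullet> x)) * \<alpha> (v # ws)" for ws
    unfolding r alternating_add_Cons[OF Cons.prems] alternating_scale_Cons[OF Cons.prems] by simp
  have "\<alpha> (map (reflect v) (x # xs)) =
    \<alpha> (reflect v x # xs) - of_real k * wedge v (\<lambda>ws. \<alpha> (reflect v x # v # ws)) xs"
    using Cons.IH[OF alternating_Cons[OF Cons.prems, of "reflect v x"]] by (simp add: k_def)
  also have "(\<lambda>ws. \<alpha> (reflect v x # v # ws)) = (\<lambda>ws. - \<alpha> (v # x # ws))"
  proof
    fix ws
    have "\<alpha> (v # v # ws) = 0" by (rule alternating_eq0[OF Cons.prems]) simp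
    then show "\<alpha> (reflect v x # v # ws) = - \<alpha> (v # x # ws)"
      using alternating_swap_Cons[OF Cons.prems, of x v ws] by (simp add: c)
  qed
  finally show ?case by (simp add: wedge_uminus c k_def[symmetric] algebra_simps)
qed simp

context odd_frame
begin

text \<open>Reflections reverse the orientation. The proof avoids determinants and uses the form
  \<open>1 - k P\<close> of a reflection: the star turns contraction followed by wedge into wedge
  followed by contraction, and these two compositions add up to
  \<open>v \<bullet> v\<close>.\<close>

lemma star_reflect:
  assumes "alternating \<alpha>" "v \<noteq> 0"
  shows "star b (\<lambda>vs. \<alpha> (map (reflect v) vs)) ws = - star b \<alpha> (map (reflect v) ws)"
proof -
  define k where "k = (of_real (2 / (v \<bullet> v)) :: complex)"
  have kv: "k * of_real (v \<bullet> v) = 2" using assms(2) by (simp add: k_def flip: of_real_mult)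
  have e: "(\<lambda>vs. \<alpha> (map (reflect v) vs)) = (\<lambda>vs. 1 * \<alpha> vs + (- k) * wedge v (\<lambda>ws. \<alpha> (v # ws)) vs)"
    by (rule ext) (simp add: alternating_reflect[OF assms(1)] k_def)
  have "star b (wedge v (\<lambda>ws. \<alpha> (v # ws))) ws = wedge v (star b \<alpha>) (v # ws)"
    unfolding star_wedge star_interior[OF assms(1)] by (simp add: power_add[symmetric] mult.assoc[symmetric])
  also have "\<dots> = of_real (v \<bullet> v) * star b \<alpha> ws - wedge v (\<lambda>ws. star b \<alpha> (v # ws)) ws" by simp
  finally have "star b (\<lambda>vs. \<alpha> (map (reflect v) vs)) ws =
    star b \<alpha> ws - (k * of_real (v \<bullet> v)) * star b \<alpha> ws + k * wedge v (\<lambda>ws. star b \<alpha> (v # ws)) ws"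
    unfolding e star_lin2 by (simp only:) (simp add: algebra_simps)
  then show ?thesis unfolding kv alternating_reflect[OF alternating_star] by (simp add: k_def)
qed

end

section \<open>The symbol of the signature operator\<close>

definition even_cochain :: "('a list \<Rightarrow> complex) \<Rightarrow> bool" where
  "even_cochain \<alpha> \<longleftrightarrow> (\<forall>vs. odd (length vs) \<longrightarrow> \<alpha> vs = 0)"

text \<open>On even forms with constant coefficients times \<open>exp (2 \<pi> \<i> \<xi> \<cdot> x)\<close> the operator \<open>B\<close> is
  \<open>2 \<pi> \<i>\<close> times \<open>symbol\<close>: the sign \<open>(-1)\<^bsup>n+p+1\<^esup>\<close> is rewritten in terms of the degree of the result.\<close>

definition symbol :: "nat \<Rightarrow> (nat \<Rightarrow> 'a::euclidean_space) \<Rightarrow> 'a \<Rightarrow> ('a list \<Rightarrow> complex) \<Rightarrow> 'a list \<Rightarrow> complex" where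
  "symbol n b \<xi> \<alpha> vs =
     (-1) ^ (n + length vs div 2) * (star b \<alpha> (\<xi> # vs) + wedge \<xi> (star b \<alpha>) vs)"

lemma symbol_lin2:
  "symbol n b \<xi> (\<lambda>vs. c * \<alpha> vs + d * \<beta> vs) vs = c * symbol n b \<xi> \<alpha> vs + d * symbol n b \<xi> \<beta> vs"
proof -
  have "star b (\<lambda>vs. c * \<alpha> vs + d * \<beta> vs) = (\<lambda>vs. c * star b \<alpha> vs + d * star b \<beta> vs)"
    by (rule ext) (rule star_lin2)
  then show ?thesis by (simp add: symbol_def wedge_lin2 algebra_simps)
qed

lemma symbol_mult: "symbol n b \<xi> (\<lambda>vs. c * \<alpha> vs) vs = c * symbol n b \<xi> \<alpha> vs"
  using symbol_lin2[of n b \<xi> c \<alpha> 0 \<alpha> vs] by simp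

lemma symbol_zero: "symbol n b \<xi> (\<lambda>vs. 0) vs = 0"
  using symbol_mult[of n b \<xi> 0 "\<lambda>_. 0" vs] by simp

lemma symbol_sum: "symbol n b \<xi> (\<lambda>vs. \<Sum>i\<in>S. \<alpha> i vs) vs = (\<Sum>i\<in>S. symbol n b \<xi> (\<alpha> i) vs)"
proof (induction S rule: infinite_finite_induct)
  case (insert x F)
  then show ?case using symbol_lin2[of n b \<xi> 1 "\<alpha> x" 1 "\<lambda>vs. \<Sum>i\<in>F. \<alpha> i vs" vs] by simp
qed (simp_all add: symbol_zero)

lemma symbol_scale:
  "symbol n b (r *\<^sub>R \<xi>) \<alpha> vs = of_real r * symbol n b \<xi> \<alpha> vs"
  by (simp add: symbol_def wedge_vec_scale alternating_scale_Cons[OF alternating_star] algebra_simps)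

context odd_frame
begin

text \<open>A reflection fixing \<open>\<xi>\<close> commutes with wedge and contraction by
  \<open>\<xi>\<close> and anticommutes with the star, which occurs once in each term of the
  symbol.\<close>

lemma symbol_reflect:
  assumes "alternating \<alpha>" "v \<noteq> 0" "v \<bullet> \<xi> = 0"
  shows "symbol n b \<xi> (\<lambda>vs. \<alpha> (map (reflect v) vs)) vs = - symbol n b \<xi> \<alpha> (map (reflect v) vs)"
proof -
  have "star b (\<lambda>vs. \<alpha> (map (reflect v) vs)) = (\<lambda>ws. - star b \<alpha> (map (reflect v) ws))"
    by (rule ext) (rule star_reflect[OF assms(1,2)])
  moreover have "wedge \<xi> (\<lambda>ws. star b \<alpha> (map (reflect v) ws)) vs = wedge \<xi> (star b \<alpha>) (map (reflect v) vs)"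
    using wedge_compose_map[of "reflect v" \<xi> "star b \<alpha>" vs] reflect_inner[OF assms(2)]
    by (simp add: reflect_orthogonal[OF assms(3)])
  ultimately show ?thesis
    by (simp add: symbol_def wedge_uminus reflect_orthogonal[OF assms(3)] algebra_simps)
qed

lemma star_even_odd:
  assumes "even_cochain \<alpha>" "even (length ws)" shows "star b \<alpha> ws = 0"
proof -
  have "star b \<alpha> ws = star b (\<lambda>_. 0) ws"
  proof (rule star_cong_degree)
    fix us :: "'a list" assume "length us + length ws = DIM('a)"
    then have "odd (length us)" using odd_dim assms(2) by presburger
    then show "\<alpha> us = 0" using assms(1) by (simp add: even_cochain_def)
  qed
  then show ?thesis by (simp add: star_zero)
qed

text \<open>The sign in the symbol refers to the length of \<open>us\<close>, which the star ties to
  that of \<open>ws\<close> by \<open>2 * (2 * n - t - 1) + (2 * t + 1) = 4 * n - 1\<close>. The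
  double stars that remain are the identity.\<close>

lemma star_symbol:
  assumes dim: "DIM('a) = 4 * n - 1" "n \<ge> 1" and a: "alternating \<alpha>" and ws: "length ws = 2 * t + 1"
  shows "star b (symbol n b \<xi> \<alpha>) ws = (-1) ^ (n + 1 + t) * (wedge \<xi> \<alpha> ws - \<alpha> (\<xi> # ws))"
proof -
  have "star b (symbol n b \<xi> \<alpha>) ws =
    star b (\<lambda>us. (-1) ^ (n + 1 + t) * (star b \<alpha> (\<xi> # us) + wedge \<xi> (star b \<alpha>) us)) ws"
  proof (rule star_cong_degree)
    fix us :: "'a list" assume "length us + length ws = DIM('a)"
    then have "length us = 2 * (2 * n - t - 1)" "t + 1 \<le> 2 * n" using dim ws by linarith+
    then have "length us div 2 + t + 1 = 2 * n" "even (length us)" by simp_all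
    then have "even ((n + length us div 2) + (n + 1 + t))" by presburger
    then have "(-1::complex) ^ (n + length us div 2) = (-1) ^ (n + 1 + t)" by (auto simp: uminus_power_if)
    then show "symbol n b \<xi> \<alpha> us = (-1) ^ (n + 1 + t) * (star b \<alpha> (\<xi> # us) + wedge \<xi> (star b \<alpha>) us)"
      by (simp add: symbol_def)
  qed
  also have "\<dots> = (-1) ^ (n + 1 + t) * (wedge \<xi> \<alpha> ws - \<alpha> (\<xi> # ws))"
    unfolding star_mult star_add star_wedge star_interior[OF alternating_star] star_star[OF a]
    by (simp add: ws)
  finally show ?thesis .
qed

text \<open>The Clifford relation: terms that use \<open>\<xi>\<close> twice in the same way vanish,
  and the two mixed compositions of wedge and contraction add up to
  \<open>\<xi> \<bullet> \<xi>\<close>. With the factor \<open>2 \<pi> \<i>\<close> squared this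
  says that \<open>B\<close> squares to the Laplacian.\<close>

lemma symbol_symbol:
  assumes dim: "DIM('a) = 4 * n - 1" "n \<ge> 1" and a: "alternating \<alpha>" and vs: "even (length vs)"
  shows "symbol n b \<xi> (symbol n b \<xi> \<alpha>) vs = - of_real (\<xi> \<bullet> \<xi>) * \<alpha> vs"
proof -
  from vs obtain r where r: "length vs = 2 * r" by blast
  have z: "\<alpha> (\<xi> # \<xi> # ws) = 0" for ws by (rule alternating_eq0[OF a]) simp
  have e1: "star b (symbol n b \<xi> \<alpha>) (\<xi> # vs) = (-1) ^ (n + 1 + r) * wedge \<xi> \<alpha> (\<xi> # vs)"
    using star_symbol[OF dim a, of "\<xi> # vs" r \<xi>] by (simp add: r z)
  have e2: "wedge \<xi> (star b (symbol n b \<xi> \<alpha>)) vs = - ((-1) ^ (n + r) * wedge \<xi> (\<lambda>ws. \<alpha> (\<xi> # ws)) vs)"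
  proof -
    have "wedge \<xi> (star b (symbol n b \<xi> \<alpha>)) vs =
       wedge \<xi> (\<lambda>ws. (-1) ^ (n + r) * (wedge \<xi> \<alpha> ws - \<alpha> (\<xi> # ws))) vs"
    proof (rule wedge_cong_length)
      fix ws :: "'a list" assume l: "Suc (length ws) = length vs"
      then have "r \<ge> 1" using r by (cases r) auto
      then have "length ws = 2 * (r - 1) + 1" using l r by simp
      from star_symbol[OF dim a this, of \<xi>] \<open>r \<ge> 1\<close>
      show "star b (symbol n b \<xi> \<alpha>) ws = (-1) ^ (n + r) * (wedge \<xi> \<alpha> ws - \<alpha> (\<xi> # ws))" by simp
    qed
    then show ?thesis by (simp add: wedge_mult wedge_diff wedge_twice)
  qed
  show ?thesis
  proof -
    define s where "s = (-1 :: complex) ^ (n + r)"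
    have ss: "s * (s * x) = x" for x by (simp add: s_def mult.assoc[symmetric] power_add[symmetric])
    have "symbol n b \<xi> (symbol n b \<xi> \<alpha>) vs =
      s * (- s * wedge \<xi> \<alpha> (\<xi> # vs) - s * wedge \<xi> (\<lambda>ws. \<alpha> (\<xi> # ws)) vs)"
      unfolding symbol_def[of n b \<xi> "symbol n b \<xi> \<alpha>"] e1 e2 by (simp add: r s_def)
    then show ?thesis by (simp add: algebra_simps ss)
  qed
qed

end

section \<open>Forms on the axis of rotation\<close>

lemma interior_monomial_orthogonal:
  "(\<And>w. w \<in> set ws \<Longrightarrow> w \<bullet> u = 0) \<Longrightarrow> monomial ws (u # vs) = 0"
proof (induction ws arbitrary: vs)
  case (Cons w ws)
  then have "(\<lambda>zs. monomial ws (u # zs)) = (\<lambda>_. 0)" by auto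
  then show ?case using Cons.prems by (simp add: wedge_zero)
qed (simp add: unit_form_def)

text \<open>For a unit vector this is the projection onto the forms divisible by the covector of
  \<open>v\<close>. On lists taken from an orthonormal frame it acts by 0 or 1, so all operators
  built from it can be compared there.\<close>

definition number_op :: "'a::real_inner \<Rightarrow> ('a list \<Rightarrow> complex) \<Rightarrow> 'a list \<Rightarrow> complex" where
  "number_op v \<alpha> vs = wedge v (\<lambda>ws. \<alpha> (v # ws)) vs"

lemma number_op_lin2:
  "number_op v (\<lambda>vs. c * \<alpha> vs + d * \<beta> vs) vs = c * number_op v \<alpha> vs + d * number_op v \<beta> vs"
  unfolding number_op_def by (rule wedge_lin2)

lemma alternating_number_op: "alternating \<alpha> \<Longrightarrow> alternating (number_op v \<alpha>)"
  unfolding number_op_def by (intro alternating_wedge alternating_Cons)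

lemma number_op_interior_orthogonal:
  assumes "alternating \<alpha>" "v \<bullet> u = 0"
  shows "number_op v (\<lambda>ws. \<alpha> (u # ws)) vs = number_op v \<alpha> (u # vs)"
proof -
  have "(\<lambda>ws. \<alpha> (v # u # ws)) = (\<lambda>ws. - \<alpha> (u # v # ws))"
    by (rule ext) (rule alternating_swap_Cons[OF assms(1)])
  then show ?thesis using assms(2) by (simp add: number_op_def wedge_uminus)
qed

lemma number_op_interior_self:
  assumes "alternating \<alpha>"
  shows "number_op v (\<lambda>ws. \<alpha> (v # ws)) vs = 0"
proof -
  have "(\<lambda>ws. \<alpha> (v # v # ws)) = (\<lambda>_. 0)"
    by (rule ext) (rule alternating_eq0[OF assms], simp)
  then show ?thesis by (simp add: number_op_def wedge_zero)
qed

lemma number_op_Cons_self: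
  assumes "alternating \<alpha>" "v \<bullet> v = 1"
  shows "number_op v \<alpha> (v # vs) = \<alpha> (v # vs)"
proof -
  have "(\<lambda>ws. \<alpha> (v # v # ws)) = (\<lambda>_. 0)"
    by (rule ext) (rule alternating_eq0[OF assms(1)], simp)
  then show ?thesis using assms(2) by (simp add: number_op_def wedge_zero)
qed

lemma number_op_diagonal:
  assumes "alternating \<alpha>" "v \<bullet> v = 1" "\<And>u. u \<in> set vs \<Longrightarrow> u = v \<or> v \<bullet> u = 0"
  shows "number_op v \<alpha> vs = (if v \<in> set vs then \<alpha> vs else 0)"
  using assms(1,3)
proof (induction vs arbitrary: \<alpha>)
  case (Cons u us)
  show ?case
  proof (cases "u = v")
    case True
    then show ?thesis using number_op_Cons_self[OF Cons.prems(1) assms(2)] by simp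
  next
    case False
    then have o: "v \<bullet> u = 0" using Cons.prems(2) by auto
    have "number_op v \<alpha> (u # us) = number_op v (\<lambda>ws. \<alpha> (u # ws)) us"
      using number_op_interior_orthogonal[OF Cons.prems(1) o] by simp
    also have "\<dots> = (if v \<in> set us then \<alpha> (u # us) else 0)"
      by (rule Cons.IH[OF alternating_Cons[OF Cons.prems(1)]]) (use Cons.prems(2) in auto)
    finally show ?thesis using False by auto
  qed
qed (simp add: number_op_def)

text \<open>Uniqueness of the balanced ternary representation of zero: the lower digits sum to less
  than half of \<open>3 * 3 ^ K\<close> in absolute value and cannot compensate a nonzero top
  digit.\<close>

lemma balanced_ternary:
  assumes "(\<Sum>l\<in>{1..K}. 3 ^ l * e l) = (0::int)" "\<And>l. l \<in> {1..K} \<Longrightarrow> \<bar>e l\<bar> \<le> 1" "l \<in> {1..K}"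
  shows "e l = 0"
  using assms
proof (induction K arbitrary: l)
  case (Suc K)
  note le = Suc.prems(2)
  have bound: "\<bar>\<Sum>l\<in>{1..k}. 3 ^ l * e l\<bar> * 2 < 3 * 3 ^ k" if "k \<le> Suc K" for k
    using that
  proof (induction k)
    case (Suc k)
    have "\<bar>e (Suc k)\<bar> \<le> 1" using Suc.prems le by auto
    then have t: "\<bar>3 ^ Suc k * e (Suc k)\<bar> \<le> 3 ^ Suc k" by (simp add: abs_mult mult_left_le)
    have "(\<Sum>l\<in>{1..Suc k}. 3 ^ l * e l) = (\<Sum>l\<in>{1..k}. 3 ^ l * e l) + 3 ^ Suc k * e (Suc k)" by simp
    then have "\<bar>\<Sum>l\<in>{1..Suc k}. 3 ^ l * e l\<bar> \<le> \<bar>\<Sum>l\<in>{1..k}. 3 ^ l * e l\<bar> + 3 ^ Suc k"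
      using t abs_triangle_ineq[of "\<Sum>l\<in>{1..k}. 3 ^ l * e l" "3 ^ Suc k * e (Suc k)"] by linarith
    moreover have "\<bar>\<Sum>l\<in>{1..k}. 3 ^ l * e l\<bar> * 2 < 3 * 3 ^ k" using Suc by simp
    moreover have "(3::int) ^ Suc k = 3 * 3 ^ k" by simp
    ultimately show ?case by linarith
  qed simp
  have "e (Suc K) = 0"
  proof (rule ccontr)
    assume "e (Suc K) \<noteq> 0"
    then have "\<bar>3 ^ Suc K * e (Suc K)\<bar> \<ge> 3 ^ Suc K" by (simp add: abs_mult)
    moreover have "3 ^ Suc K * e (Suc K) = - (\<Sum>l\<in>{1..K}. 3 ^ l * e l)" using Suc.prems(1) by simp
    ultimately show False using bound[of K] by simp
  qed
  then show ?case using Suc.IH Suc.prems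
    by (cases "l = Suc K") auto
qed simp

section \<open>Frames adapted to an axis and rotation planes\<close>

locale plane_frame = odd_frame b for b :: "nat \<Rightarrow> 'a::euclidean_space" +
  fixes K :: nat
  assumes dim_planes: "DIM('a) = 2 * K + 1"
begin

text \<open>\<open>b 0\<close> spans the axis; \<open>b (2 * l - 1)\<close> and
  \<open>b (2 * l)\<close> span the \<open>l\<close>-th rotation plane, the planes being numbered
  from 1.\<close>

definition pv :: "nat \<Rightarrow> 'a" where "pv l = b (2 * l - 1)"
definition qv :: "nat \<Rightarrow> 'a" where "qv l = b (2 * l)"

lemma inner_b: "i \<le> 2 * K \<Longrightarrow> j \<le> 2 * K \<Longrightarrow> b i \<bullet> b j = (if i = j then 1 else 0)"
  using orthonormal_frame_inner[OF frame, of i j] dim_planes by simp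

lemma inner_planes:
  assumes "l \<in> {1..K}"
  shows "b 0 \<bullet> b 0 = 1" "b 0 \<bullet> pv l = 0" "b 0 \<bullet> qv l = 0" "pv l \<bullet> b 0 = 0" "qv l \<bullet> b 0 = 0"
    "pv l \<bullet> pv l = 1" "qv l \<bullet> qv l = 1" "pv l \<bullet> qv l = 0" "qv l \<bullet> pv l = 0"
  using assms by (auto simp: pv_def qv_def inner_b)

lemma inner_distinct_planes:
  assumes "l \<in> {1..K}" "j \<in> {1..K}" "l \<noteq> j"
  shows "pv l \<bullet> pv j = 0" "pv l \<bullet> qv j = 0" "qv l \<bullet> pv j = 0" "qv l \<bullet> qv j = 0"
  using assms by (auto simp: pv_def qv_def inner_b)

text \<open>Counts how many of the two covectors of the plane occur: the eigenvalues are 0, 1 and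
  2.\<close>

definition plane_op :: "nat \<Rightarrow> ('a list \<Rightarrow> complex) \<Rightarrow> 'a list \<Rightarrow> complex" where
  "plane_op l \<alpha> vs = number_op (pv l) \<alpha> vs + number_op (qv l) \<alpha> vs"

lemma alternating_plane_op: "alternating \<alpha> \<Longrightarrow> alternating (plane_op l \<alpha>)"
  unfolding plane_op_def
  using alternating_lin2[OF alternating_number_op alternating_number_op, of \<alpha> \<alpha> 1 "pv l" 1 "qv l"] by simp

lemma plane_op_lin2:
  "plane_op l (\<lambda>vs. c * \<alpha> vs + d * \<beta> vs) vs = c * plane_op l \<alpha> vs + d * plane_op l \<beta> vs"
  unfolding plane_op_def number_op_lin2 by (simp add: algebra_simps)

text \<open>The summands commute and have eigenvalues \<open>-1, 0, 1\<close>, so the weights \<open>3\<^sup>l\<close> make \<open>axis_op \<alpha>\<close> vanish only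
  where every summand does.\<close>

definition axis_op :: "('a list \<Rightarrow> complex) \<Rightarrow> 'a list \<Rightarrow> complex" where
  "axis_op \<alpha> vs = (\<Sum>l\<in>{1..K}. 3 ^ l * (\<alpha> vs - plane_op l \<alpha> vs))"

lemma axis_op_lin2:
  "axis_op (\<lambda>vs. c * \<alpha> vs + d * \<beta> vs) vs = c * axis_op \<alpha> vs + d * axis_op \<beta> vs"
  unfolding axis_op_def plane_op_lin2 by (simp add: sum_distrib_left sum.distrib[symmetric] algebra_simps)

text \<open>The two reflections of a plane add up to \<open>2 - 2 * plane_op\<close>. So
  \<open>axis_op\<close> is a combination of reflections fixing the axis, and each of these
  anticommutes with the symbol.\<close>

lemma axis_op_reflect:
  assumes "alternating \<alpha>"
  shows "axis_op \<alpha> vs =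
    (\<Sum>l\<in>{1..K}. 3 ^ l / 2 * (\<alpha> (map (reflect (pv l)) vs) + \<alpha> (map (reflect (qv l)) vs)))"
  unfolding axis_op_def
proof (rule sum.cong[OF refl])
  fix l assume "l \<in> {1..K}"
  then show "3 ^ l * (\<alpha> vs - plane_op l \<alpha> vs) =
    3 ^ l / 2 * (\<alpha> (map (reflect (pv l)) vs) + \<alpha> (map (reflect (qv l)) vs))"
    by (simp add: inner_planes alternating_reflect[OF assms] plane_op_def number_op_def field_simps)
qed

lemma alternating_axis_op:
  assumes "alternating \<alpha>" shows "alternating (axis_op \<alpha>)"
proof -
  have "alternating (\<lambda>vs. 3 ^ l * (1 * \<alpha> vs + (-1) * plane_op l \<alpha> vs))" for l
    by (intro alternating_mult alternating_lin2 alternating_plane_op assms)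
  then have "alternating (\<lambda>vs. \<Sum>l\<in>{1..K}. 3 ^ l * (1 * \<alpha> vs + (-1) * plane_op l \<alpha> vs))"
    by (intro alternating_sum)
  then show ?thesis by (simp add: axis_op_def[abs_def])
qed

lemma even_cochain_axis_op:
  assumes "even_cochain \<alpha>" "alternating \<alpha>" shows "even_cochain (axis_op \<alpha>)"
  using assms(1) unfolding even_cochain_def axis_op_reflect[OF assms(2)] by simp

lemma symbol_axis_op:
  assumes "alternating \<alpha>"
  shows "symbol n b (r *\<^sub>R b 0) (axis_op \<alpha>) vs = - axis_op (symbol n b (r *\<^sub>R b 0) \<alpha>) vs"
proof -
  have z: "symbol n b (r *\<^sub>R b 0) (\<lambda>vs. \<alpha> (map (reflect v) vs)) vs =
      - symbol n b (r *\<^sub>R b 0) \<alpha> (map (reflect v) vs)" if "l \<in> {1..K}" "v = pv l \<or> v = qv l" for l v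
    by (rule symbol_reflect[OF assms]) (use inner_planes[OF that(1)] that(2) in auto)
  have a: "alternating (symbol n b (r *\<^sub>R b 0) \<alpha>)"
  proof -
    let ?\<xi> = "r *\<^sub>R b 0"
    have "alternating (\<lambda>vs. 1 * star b \<alpha> (?\<xi> # vs) + 1 * wedge ?\<xi> (star b \<alpha>) vs)"
      by (intro alternating_lin2 alternating_Cons alternating_wedge alternating_star)
    then have s: "alternating (\<lambda>vs. star b \<alpha> (?\<xi> # vs) + wedge ?\<xi> (star b \<alpha>) vs)" by simp
    show ?thesis unfolding alternating_def
    proof (intro conjI allI impI)
      fix us ws
      show "linear (\<lambda>v. symbol n b ?\<xi> \<alpha> (us @ v # ws))"
        by (rule linearI) (simp_all only: symbol_def alternating_add[OF s] alternating_scale[OF s]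
          length_append list.size distrib_left scaleR_conv_of_real mult.left_commute)
    qed (simp add: symbol_def alternating_eq0[OF s])
  qed
  have "axis_op \<alpha> = (\<lambda>vs. \<Sum>l\<in>{1..K}. 3 ^ l / 2 * \<alpha> (map (reflect (pv l)) vs) + 3 ^ l / 2 * \<alpha> (map (reflect (qv l)) vs))"
    by (rule ext) (simp add: axis_op_reflect[OF assms] distrib_left)
  then have "symbol n b (r *\<^sub>R b 0) (axis_op \<alpha>) vs =
    (\<Sum>l\<in>{1..K}. 3 ^ l / 2 * symbol n b (r *\<^sub>R b 0) (\<lambda>vs. \<alpha> (map (reflect (pv l)) vs)) vs +
      3 ^ l / 2 * symbol n b (r *\<^sub>R b 0) (\<lambda>vs. \<alpha> (map (reflect (qv l)) vs)) vs)"
    by (simp only: symbol_sum symbol_lin2)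
  also have "\<dots> = (\<Sum>l\<in>{1..K}. - (3 ^ l / 2 * (symbol n b (r *\<^sub>R b 0) \<alpha> (map (reflect (pv l)) vs) +
      symbol n b (r *\<^sub>R b 0) \<alpha> (map (reflect (qv l)) vs))))"
  proof (rule sum.cong[OF refl])
    fix l assume "l \<in> {1..K}"
    then show "3 ^ l / 2 * symbol n b (r *\<^sub>R b 0) (\<lambda>vs. \<alpha> (map (reflect (pv l)) vs)) vs +
      3 ^ l / 2 * symbol n b (r *\<^sub>R b 0) (\<lambda>vs. \<alpha> (map (reflect (qv l)) vs)) vs =
      - (3 ^ l / 2 * (symbol n b (r *\<^sub>R b 0) \<alpha> (map (reflect (pv l)) vs) +
      symbol n b (r *\<^sub>R b 0) \<alpha> (map (reflect (qv l)) vs)))"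
      using z[of l "pv l"] z[of l "qv l"] by (simp only: simp_thms) (simp only: mult_minus_right distrib_left minus_add_distrib)
  qed
  finally show ?thesis by (simp only: axis_op_reflect[OF a] sum_negf)
qed

abbreviation "basis_list I \<equiv> map b (sorted_list_of_set I)"

lemma number_op_basis:
  assumes "alternating \<alpha>" "I \<subseteq> {..<DIM('a)}" "i \<le> 2 * K"
  shows "number_op (b i) \<alpha> (basis_list I) = (if i \<in> I then \<alpha> (basis_list I) else 0)"
proof -
  have f: "finite I" using assms(2) finite_subset by blast
  have I: "j \<le> 2 * K" if "j \<in> I" for j using that assms(2) dim_planes by fastforce
  have "b i \<in> b ` I \<longleftrightarrow> i \<in> I"
    using inner_b[OF assms(3)] I assms(3) by (metis imageE image_eqI zero_neq_one)
  then show ?thesis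
    by (subst number_op_diagonal) (use assms f I inner_b in \<open>auto split: if_splits\<close>)
qed

lemma plane_op_basis:
  assumes "alternating \<alpha>" "I \<subseteq> {..<DIM('a)}" "l \<in> {1..K}"
  shows "plane_op l \<alpha> (basis_list I) = of_nat (card (I \<inter> {2 * l - 1, 2 * l})) * \<alpha> (basis_list I)"
proof -
  have "card (I \<inter> {2 * l - 1, 2 * l}) = (if 2 * l - 1 \<in> I then 1 else 0) + (if 2 * l \<in> I then 1 else 0)"
    using assms(3) by (auto simp: Int_insert_right)
  moreover have "2 * l - 1 \<le> 2 * K" "2 * l \<le> 2 * K" using assms(3) by auto
  ultimately show ?thesis unfolding plane_op_def pv_def qv_def
    by (simp only: number_op_basis[OF assms(1,2)]) simp
qed

lemma axis_op_basis:
  assumes "alternating \<alpha>" "I \<subseteq> {..<DIM('a)}"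
  shows "axis_op \<alpha> (basis_list I) =
    of_int (\<Sum>l\<in>{1..K}. 3 ^ l * (1 - int (card (I \<inter> {2 * l - 1, 2 * l})))) * \<alpha> (basis_list I)"
  unfolding axis_op_def of_int_sum sum_distrib_right
  by (rule sum.cong[OF refl]) (simp add: plane_op_basis[OF assms] algebra_simps)

text \<open>\<open>axis_op\<close> is diagonal on frame lists, so its square has no larger kernel.
  This is the semisimplicity that the comparison of dimensions asks for.\<close>

lemma axis_op_twice:
  assumes "alternating \<alpha>" "axis_op (axis_op \<alpha>) = (\<lambda>_. 0)"
  shows "axis_op \<alpha> ws = 0"
proof (rule alternating_eqI[OF frame alternating_axis_op[OF assms(1)] alternating_zero])
  fix I :: "nat set" assume I: "I \<subseteq> {..<DIM('a)}"
  have "axis_op (axis_op \<alpha>) (basis_list I) = 0" using assms(2) by simp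
  then show "axis_op \<alpha> (basis_list I) = 0"
    by (simp add: axis_op_basis[OF alternating_axis_op[OF assms(1)] I] axis_op_basis[OF assms(1) I])
qed

text \<open>On a frame list where \<open>\<alpha>\<close> does not vanish the eigenvalue of
  \<open>axis_op\<close> is zero, and by balanced ternary every plane then meets the list in exactly
  one index.\<close>

lemma axis_op_kernel_plane:
  assumes "alternating \<alpha>" "axis_op \<alpha> = (\<lambda>_. 0)" "l \<in> {1..K}"
  shows "plane_op l \<alpha> = \<alpha>"
proof
  fix ws
  show "plane_op l \<alpha> ws = \<alpha> ws"
  proof (rule alternating_eqI[OF frame alternating_plane_op[OF assms(1)] assms(1)])
    fix I :: "nat set" assume I: "I \<subseteq> {..<DIM('a)}"
    show "plane_op l \<alpha> (basis_list I) = \<alpha> (basis_list I)"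
    proof (cases "\<alpha> (basis_list I) = 0")
      case True
      then show ?thesis by (simp add: plane_op_basis[OF assms(1) I assms(3)])
    next
      case False
      have "axis_op \<alpha> (basis_list I) = 0" using assms(2) by simp
      then have "of_int (\<Sum>l\<in>{1..K}. 3 ^ l * (1 - int (card (I \<inter> {2 * l - 1, 2 * l})))) = (0::complex)"
        unfolding axis_op_basis[OF assms(1) I] mult_eq_0_iff using False by blast
      then have "(\<Sum>l\<in>{1..K}. 3 ^ l * (1 - int (card (I \<inter> {2 * l - 1, 2 * l})))) = 0"
        by (simp only: of_int_eq_0_iff)
      moreover have "\<bar>1 - int (card (I \<inter> {2 * l - 1, 2 * l}))\<bar> \<le> 1" for l
      proof -
        have "card (I \<inter> {2 * l - 1, 2 * l}) \<le> card {2 * l - 1, 2 * l}" by (rule card_mono) auto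
        also have "\<dots> \<le> 2" by (simp add: card_insert_if)
        finally show ?thesis by linarith
      qed
      ultimately have "1 - int (card (I \<inter> {2 * l - 1, 2 * l})) = 0"
        using balanced_ternary[of "\<lambda>l. 1 - int (card (I \<inter> {2 * l - 1, 2 * l}))" K l] assms(3) by blast
      then have "card (I \<inter> {2 * l - 1, 2 * l}) = 1" by linarith
      then show ?thesis by (simp add: plane_op_basis[OF assms(1) I assms(3)])
    qed
  qed
qed

lemma euler_planes:
  assumes "alternating \<alpha>"
  shows "number_op (b 0) \<alpha> vs + (\<Sum>l\<in>{1..K}. plane_op l \<alpha> vs) = of_nat (length vs) * \<alpha> vs"
proof -
  have pairs: "(\<Sum>i<2 * k + 1. f i) = f 0 + (\<Sum>l\<in>{1..k}. f (2 * l - 1) + f (2 * l))" for f :: "nat \<Rightarrow> complex" and k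
    by (induction k) (simp_all add: algebra_simps)
  have "(\<Sum>i<2 * K + 1. number_op (b i) \<alpha> vs) = of_nat (length vs) * \<alpha> vs"
    using euler_sum[OF assms, of vs] by (simp add: dim_planes number_op_def)
  then show ?thesis unfolding pairs plane_op_def pv_def qv_def .
qed

text \<open>One covector from each plane gives the odd degree \<open>K\<close>; a form of even
  degree must therefore contain the axis covector as well.\<close>

lemma axis_number_op:
  assumes "alternating \<alpha>" "even_cochain \<alpha>" "odd K" "\<And>l. l \<in> {1..K} \<Longrightarrow> plane_op l \<alpha> = \<alpha>"
  shows "number_op (b 0) \<alpha> = \<alpha>"
proof
  fix ws
  show "number_op (b 0) \<alpha> ws = \<alpha> ws"
  proof (rule alternating_eqI[OF frame alternating_number_op[OF assms(1)] assms(1)])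
    fix I :: "nat set" assume I: "I \<subseteq> {..<DIM('a)}"
    have f: "finite I" using I finite_subset by blast
    show "number_op (b 0) \<alpha> (basis_list I) = \<alpha> (basis_list I)"
    proof (cases "\<alpha> (basis_list I) = 0")
      case True
      then show ?thesis by (simp add: number_op_basis[OF assms(1) I])
    next
      case False
      then have "even (length (basis_list I))" using assms(2) unfolding even_cochain_def by blast
      then have "even (card I)" using f by simp
      then have ck: "card I \<noteq> K" using assms(3) by auto
      have "number_op (b 0) \<alpha> (basis_list I) + of_nat K * \<alpha> (basis_list I) = of_nat (card I) * \<alpha> (basis_list I)"
        using euler_planes[OF assms(1), of "basis_list I"] f assms(4) by simp
      then have "0 \<in> I" using False ck
        by (cases "0 \<in> I") (simp_all add: number_op_basis[OF assms(1) I])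
      then show ?thesis by (simp add: number_op_basis[OF assms(1) I])
    qed
  qed
qed

section \<open>Isotropic covectors \<open>dx\<^sub>l + \<i> s dy\<^sub>l\<close> of the rotation
  planes and their products\<close>

definition rot_wedge :: "complex \<Rightarrow> nat \<Rightarrow> ('a list \<Rightarrow> complex) \<Rightarrow> 'a list \<Rightarrow> complex" where
  "rot_wedge s l \<alpha> vs = wedge (pv l) \<alpha> vs + \<i> * s * wedge (qv l) \<alpha> vs"

definition rot_interior :: "complex \<Rightarrow> nat \<Rightarrow> ('a list \<Rightarrow> complex) \<Rightarrow> 'a list \<Rightarrow> complex" where
  "rot_interior s l \<alpha> vs = \<alpha> (pv l # vs) + \<i> * s * \<alpha> (qv l # vs)"

text \<open>Planes \<open>1\<close> to \<open>k\<close> are multiplied in from the left, plane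
  \<open>k\<close> outermost; for values \<open>1\<close> and \<open>-1\<close> the signs
  \<open>\<sigma>\<close> choose one of the two isotropic covectors of each plane.\<close>

fun chain :: "nat \<Rightarrow> (nat \<Rightarrow> complex) \<Rightarrow> ('a list \<Rightarrow> complex) \<Rightarrow> 'a list \<Rightarrow> complex" where
  "chain 0 \<sigma> \<alpha> = \<alpha>"
| "chain (Suc k) \<sigma> \<alpha> = rot_wedge (\<sigma> (Suc k)) (Suc k) (chain k \<sigma> \<alpha>)"

lemma rot_wedge_lin2:
  "rot_wedge s l (\<lambda>vs. c * \<alpha> vs + d * \<beta> vs) vs = c * rot_wedge s l \<alpha> vs + d * rot_wedge s l \<beta> vs"
  by (simp add: rot_wedge_def wedge_lin2 algebra_simps)

lemma rot_wedge_mult: "rot_wedge s l (\<lambda>vs. c * \<alpha> vs) vs = c * rot_wedge s l \<alpha> vs"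
  using rot_wedge_lin2[of s l c \<alpha> 0 \<alpha> vs] by simp

lemma rot_wedge_sum: "rot_wedge s l (\<lambda>vs. \<Sum>i\<in>S. \<alpha> i vs) vs = (\<Sum>i\<in>S. rot_wedge s l (\<alpha> i) vs)"
  by (simp add: rot_wedge_def wedge_sum sum.distrib sum_distrib_left)

lemma chain_mult: "chain k \<sigma> (\<lambda>vs. c * \<alpha> vs) = (\<lambda>vs. c * chain k \<sigma> \<alpha> vs)"
proof (induction k)
  case (Suc k)
  show ?case by (rule ext) (simp add: Suc rot_wedge_mult)
qed simp

lemma alternating_rot_wedge: "alternating \<alpha> \<Longrightarrow> alternating (rot_wedge s l \<alpha>)"
  using alternating_lin2[OF alternating_wedge alternating_wedge, of \<alpha> \<alpha> 1 "pv l" "\<i> * s" "qv l"]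
  by (simp add: rot_wedge_def[abs_def])

lemma alternating_chain: "alternating \<alpha> \<Longrightarrow> alternating (chain k \<sigma> \<alpha>)"
  by (induction k) (simp_all add: alternating_rot_wedge)

lemma rot_wedge_anticomm: "rot_wedge s l (rot_wedge t k \<alpha>) vs = - rot_wedge t k (rot_wedge s l \<alpha>) vs"
proof -
  have e: "wedge u (rot_wedge t k \<alpha>) vs = wedge u (wedge (pv k) \<alpha>) vs + \<i> * t * wedge u (wedge (qv k) \<alpha>) vs"
    for u t k using wedge_lin2[of u 1 "wedge (pv k) \<alpha>" "\<i> * t" "wedge (qv k) \<alpha>" vs]
    by (simp add: rot_wedge_def[abs_def])
  show ?thesis unfolding rot_wedge_def[of s l "rot_wedge t k \<alpha>"] rot_wedge_def[of t k "rot_wedge s l \<alpha>"] e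
    by (simp add: wedge_anticomm[of "pv l" "pv k"] wedge_anticomm[of "pv l" "qv k"]
      wedge_anticomm[of "qv l" "pv k"] wedge_anticomm[of "qv l" "qv k"] algebra_simps)
qed

lemma chain_rot_wedge:
  "chain j \<sigma> (rot_wedge s l \<alpha>) = (\<lambda>vs. (-1) ^ j * rot_wedge s l (chain j \<sigma> \<alpha>) vs)"
proof (induction j)
  case (Suc j)
  show ?case
    by (rule ext) (simp add: Suc rot_wedge_mult rot_wedge_anticomm[of "\<sigma> (Suc j)"])
qed simp

lemma rot_interior_rot_wedge:
  assumes "l \<in> {1..K}" "j \<in> {1..K}" "l \<noteq> j"
  shows "rot_interior s l (rot_wedge t j \<alpha>) vs = - rot_wedge t j (rot_interior s l \<alpha>) vs"
proof -
  note o = inner_distinct_planes[OF assms(2,1) assms(3)[symmetric]]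
  have e: "wedge u (rot_interior s l \<alpha>) vs =
    wedge u (\<lambda>ws. \<alpha> (pv l # ws)) vs + \<i> * s * wedge u (\<lambda>ws. \<alpha> (qv l # ws)) vs" for u
    using wedge_lin2[of u 1 "\<lambda>ws. \<alpha> (pv l # ws)" "\<i> * s" "\<lambda>ws. \<alpha> (qv l # ws)" vs]
    by (simp add: rot_interior_def[abs_def])
  show ?thesis unfolding rot_interior_def[of s l "rot_wedge t j \<alpha>"] rot_wedge_def e
    by (simp add: o algebra_simps)
qed

lemma rot_interior_mult: "rot_interior s l (\<lambda>vs. c * \<alpha> vs) vs = c * rot_interior s l \<alpha> vs"
  by (simp add: rot_interior_def algebra_simps)

lemma rot_interior_chain:
  assumes "l \<in> {1..K}" "j < l"
  shows "rot_interior s l (chain j \<sigma> \<alpha>) = (\<lambda>vs. (-1) ^ j * chain j \<sigma> (rot_interior s l \<alpha>) vs)"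
  using assms(2)
proof (induction j)
  case (Suc j)
  then have "j < l" by simp
  show ?case
  proof
    fix vs
    show "rot_interior s l (chain (Suc j) \<sigma> \<alpha>) vs = (-1) ^ Suc j * chain (Suc j) \<sigma> (rot_interior s l \<alpha>) vs"
      using Suc assms(1) by (simp add: rot_interior_rot_wedge rot_wedge_mult)
  qed
qed simp

end

lemma number_op_wedge_orthogonal:
  assumes "u \<bullet> v = 0" shows "number_op v (wedge u \<alpha>) vs = wedge u (number_op v \<alpha>) vs"
proof -
  have "(\<lambda>ws. wedge u \<alpha> (v # ws)) = (\<lambda>ws. - wedge u (\<lambda>ws. \<alpha> (v # ws)) ws)"
    using assms by auto
  then have "number_op v (wedge u \<alpha>) vs = - wedge v (wedge u (\<lambda>ws. \<alpha> (v # ws))) vs"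
    by (simp add: number_op_def wedge_uminus)
  also have "\<dots> = wedge u (wedge v (\<lambda>ws. \<alpha> (v # ws))) vs" by (subst wedge_anticomm) simp
  finally show ?thesis by (simp add: number_op_def[abs_def])
qed

context plane_frame
begin

lemma chain_degree:
  assumes "\<And>vs. length vs \<noteq> q \<Longrightarrow> \<alpha> vs = 0" "length vs \<noteq> q + k"
  shows "chain k \<sigma> \<alpha> vs = 0"
  using assms(2)
proof (induction k arbitrary: vs)
  case (Suc k)
  have "wedge u (chain k \<sigma> \<alpha>) vs = 0" for u
    by (rule wedge_degree[of "q + k"]) (use Suc in auto)
  then show ?case by (simp add: rot_wedge_def)
qed (simp add: assms(1))

lemma rot_wedge_interior:
  assumes "pv l \<bullet> u = 0" "qv l \<bullet> u = 0"
  shows "rot_wedge s l \<alpha> (u # vs) = - rot_wedge s l (\<lambda>ws. \<alpha> (u # ws)) vs"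
  by (simp add: rot_wedge_def assms)

lemma chain_interior:
  assumes "\<And>j. j \<in> {1..k} \<Longrightarrow> pv j \<bullet> u = 0 \<and> qv j \<bullet> u = 0"
  shows "chain k \<sigma> \<alpha> (u # vs) = (-1) ^ k * chain k \<sigma> (\<lambda>ws. \<alpha> (u # ws)) vs"
  using assms
proof (induction k arbitrary: vs)
  case (Suc k)
  have "(\<lambda>vs. chain k \<sigma> \<alpha> (u # vs)) = (\<lambda>vs. (-1) ^ k * chain k \<sigma> (\<lambda>ws. \<alpha> (u # ws)) vs)"
    by (rule ext) (rule Suc.IH, use Suc.prems in auto)
  then show ?case using Suc.prems[of "Suc k"] by (simp add: rot_wedge_interior rot_wedge_mult)
qed simp

lemma chain_zero: "chain k \<sigma> (\<lambda>_. 0) = (\<lambda>_. 0)"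
  using chain_mult[of k \<sigma> 0 "\<lambda>_. 0"] by simp

lemma wedge_chain: "wedge v (chain k \<sigma> \<alpha>) vs = (-1) ^ k * chain k \<sigma> (wedge v \<alpha>) vs"
proof (induction k arbitrary: vs)
  case (Suc k)
  have "(\<lambda>vs. chain k \<sigma> (wedge v \<alpha>) vs) = (\<lambda>vs. (-1) ^ k * wedge v (chain k \<sigma> \<alpha>) vs)"
    by (rule ext) (simp add: Suc mult.assoc[symmetric] power_add[symmetric])
  then have "rot_wedge s l (chain k \<sigma> (wedge v \<alpha>)) vs = (-1) ^ k * rot_wedge s l (wedge v (chain k \<sigma> \<alpha>)) vs" for s l
    by (simp add: rot_wedge_mult)
  moreover have "wedge v (rot_wedge s l \<beta>) vs = - rot_wedge s l (wedge v \<beta>) vs" for s l \<beta>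
    using wedge_lin2[of v 1 "wedge (pv l) \<beta>" "\<i> * s" "wedge (qv l) \<beta>" vs]
    by (simp add: rot_wedge_def[abs_def] wedge_anticomm[of v])
  ultimately show ?case by (simp add: mult.assoc[symmetric] power_add[symmetric])
qed simp

text \<open>One isotropic covector from every plane and the axis covector innermost, a form of
  degree \<open>K + 1\<close>. For odd \<open>K\<close> these products span the even part of the
  kernel of \<open>axis_op\<close>.\<close>

definition single :: "(nat \<Rightarrow> complex) \<Rightarrow> 'a list \<Rightarrow> complex" where
  "single \<sigma> = chain K \<sigma> (wedge (b 0) unit_form)"

lemma wedge_unit_form_degree: "length vs \<noteq> 1 \<Longrightarrow> wedge v unit_form vs = 0"
  using wedge_degree[of 0 unit_form vs v] by (simp add: unit_form_def)

lemma alternating_single: "alternating (single \<sigma>)"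
  unfolding single_def by (intro alternating_chain alternating_wedge alternating_unit_form)

lemma single_degree: "length vs \<noteq> K + 1 \<Longrightarrow> single \<sigma> vs = 0"
  unfolding single_def by (rule chain_degree[of 1]) (auto intro: wedge_unit_form_degree)

text \<open>The frame covectors of all planes beyond \<open>k\<close>: what the star leaves over
  from the axis and the first \<open>k\<close> planes.\<close>

definition upper :: "nat \<Rightarrow> 'a list \<Rightarrow> complex" where
  "upper k = monomial (map b [2 * k + 1..<2 * K + 1])"

lemma upper_Suc:
  assumes "k < K"
  shows "upper k = wedge (pv (Suc k)) (wedge (qv (Suc k)) (upper (Suc k)))"
proof -
  have "[2 * k + 1..<2 * K + 1] = (2 * k + 1) # (2 * k + 2) # [2 * k + 3..<2 * K + 1]"
    using assms by (simp add: upt_conv_Cons eval_nat_numeral del: upt_Suc)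
  then show ?thesis by (simp add: upper_def pv_def qv_def eval_nat_numeral del: upt_Suc)
qed

lemma upper_interior:
  assumes "i \<le> 2 * k" "k \<le> K" shows "upper k (b i # vs) = 0"
  unfolding upper_def
  by (rule interior_monomial_orthogonal) (use assms inner_b in auto)

text \<open>Both sides alternate and live in the top degree, where the full frame list is the only
  increasing one. The value \<open>1\<close> of the monomial there comes from the reproducing
  property applied to the volume form.\<close>

lemma volume_eq_monomial: "volume b = monomial (frame_list b)"
proof
  fix ws :: "'a list"
  have l: "length (frame_list b) = DIM('a)" by (simp add: frame_list_def)
  have v1: "volume b (frame_list b) = 1"
    using vol_form_frame[OF frame] by (simp add: volume_def frame_list_def)
  have "sublist_sum (frame_list b) (monomial (frame_list b)) (volume b) =
    monomial (frame_list b) (frame_list b) * volume b (frame_list b)"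
    by (rule sublist_sum_top) (simp add: monomial_degree)
  then have m1: "monomial (frame_list b) (frame_list b) = 1"
    using alternating_reproducing[OF frame alternating_volume, of "frame_list b"] v1 by simp
  show "volume b ws = monomial (frame_list b) ws"
  proof (rule alternating_eqI[OF frame alternating_volume alternating_monomial])
    fix I assume I: "I \<subseteq> {..<DIM('a)}" "card I = length ws"
    have f: "finite I" using I finite_subset by blast
    show "volume b (basis_list I) = monomial (frame_list b) (basis_list I)"
    proof (cases "card I = DIM('a)")
      case True
      then have "I = {..<DIM('a)}" using I by (intro card_subset_eq) auto
      then have "basis_list I = frame_list b"
        by (simp add: frame_list_def lessThan_atLeast0)
      then show ?thesis using v1 m1 by simp
    next
      case False
      then show ?thesis using f l by (simp add: volume_def monomial_degree)
    qed
  qed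
qed

lemma volume_eq_upper: "volume b = wedge (b 0) (upper 0)"
proof -
  have "[0..<2 * K + 1] = 0 # [1..<2 * K + 1]" by (simp add: upt_conv_Cons)
  then show ?thesis unfolding volume_eq_monomial frame_list_def upper_def dim_planes by simp
qed

lemma rot_interior_rot_wedge_same:
  assumes "l \<in> {1..K}" "\<And>ws. \<alpha> (pv l # ws) = 0" "\<And>ws. \<alpha> (qv l # ws) = 0"
  shows "rot_wedge t l \<alpha> (pv l # vs) = \<alpha> vs" "rot_wedge t l \<alpha> (qv l # vs) = \<i> * t * \<alpha> vs"
  using inner_planes[OF assms(1)] by (simp_all add: rot_wedge_def assms(2,3) wedge_zero)

text \<open>An isotropic line is its own orthogonal complement in the complexified plane:
  contracting \<open>p \<and> q\<close> with \<open>p + \<i> s q\<close> gives a multiple of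
  \<open>p + \<i> s q\<close>. Hence the star of a chain is again a chain with the same
  signs.\<close>

lemma rot_interior_upper:
  assumes "k < K" "s * s = 1"
  shows "rot_interior s (Suc k) (upper k) = (\<lambda>vs. - \<i> * s * rot_wedge s (Suc k) (upper (Suc k)) vs)"
proof
  fix vs
  let ?p = "pv (Suc k)" and ?q = "qv (Suc k)" and ?Y = "upper (Suc k)"
  have l: "Suc k \<in> {1..K}" using assms by auto
  have Y: "?Y (?p # ws) = 0" "?Y (?q # ws) = 0" for ws
    unfolding pv_def qv_def by (rule upper_interior; use assms in simp)+
  have e: "wedge ?p (wedge ?q ?Y) (?p # vs) = wedge ?q ?Y vs" "wedge ?p (wedge ?q ?Y) (?q # vs) = - wedge ?p ?Y vs"
    using inner_planes[OF l] by (simp_all add: Y wedge_zero)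
  have "rot_interior s (Suc k) (upper k) vs = wedge ?q ?Y vs - \<i> * s * wedge ?p ?Y vs"
    unfolding rot_interior_def upper_Suc[OF assms(1)] e by simp
  moreover have "- \<i> * s * (\<i> * s * wedge ?q ?Y vs) = (s * s) * wedge ?q ?Y vs"
    by (simp add: algebra_simps)
  ultimately show "rot_interior s (Suc k) (upper k) vs = - \<i> * s * rot_wedge s (Suc k) ?Y vs"
    by (simp only: rot_wedge_def distrib_left assms(2)) simp
qed

lemma star_rot_wedge: "star b (rot_wedge s l \<alpha>) ws = (-1) ^ length ws * rot_interior s l (star b \<alpha>) ws"
  using star_lin2[of b 1 "wedge (pv l) \<alpha>" "\<i> * s" "wedge (qv l) \<alpha>" ws]
  by (simp add: rot_wedge_def[abs_def] rot_interior_def star_wedge algebra_simps)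

text \<open>The star turns the wedge of a new plane into a contraction, which is carried through the
  earlier planes and meets the first plane of \<open>upper k\<close>; the resulting covector is
  carried back, and the signs of the two passages cancel. What remains is \<open>- \<i> * s\<close>
  times the parity of the degree \<open>2 * K - Suc k\<close>.\<close>

lemma star_chain:
  assumes "k \<le> K" "\<And>j. \<sigma> j * \<sigma> j = 1"
  shows "star b (chain k \<sigma> (wedge (b 0) unit_form)) =
    (\<lambda>ws. (\<Prod>j\<in>{1..k}. (-1) ^ (j - 1) * \<i> * \<sigma> j) * chain k \<sigma> (upper k) ws)"
  using assms(1)
proof (induction k)
  case 0
  have u: "star b unit_form = volume b"
    by (rule ext) (simp add: star_eq_sublist_sum sublist_sum_unit_form)
  have "star b (wedge (b 0) unit_form) ws = upper 0 ws" for ws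
  proof -
    have "star b (wedge (b 0) unit_form) ws = (-1) ^ length ws * upper 0 ws"
      using upper_interior[of 0 0] inner_b[of 0 0]
      by (simp add: star_wedge u volume_eq_upper wedge_zero)
    moreover have "upper 0 ws = 0" if "length ws \<noteq> 2 * K"
      unfolding upper_def by (rule monomial_degree) (use that in \<open>simp del: upt_Suc\<close>)
    ultimately show ?thesis by (cases "length ws = 2 * K") auto
  qed
  then show ?case by auto
next
  case (Suc k)
  then have kK: "k < K" by simp
  define d where "d = (\<Prod>j\<in>{1..k}. (-1) ^ (j - 1) * \<i> * \<sigma> j)"
  define s where "s = \<sigma> (Suc k)"
  define R where "R = chain (Suc k) \<sigma> (upper (Suc k))"
  have IH: "star b (chain k \<sigma> (wedge (b 0) unit_form)) = (\<lambda>ws. d * chain k \<sigma> (upper k) ws)"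
    using Suc by (simp add: d_def)
  have st: "star b (chain (Suc k) \<sigma> (wedge (b 0) unit_form)) ws = (-1) ^ length ws * (- \<i> * s) * d * R ws" for ws
  proof -
    have "star b (chain (Suc k) \<sigma> (wedge (b 0) unit_form)) ws =
      (-1) ^ length ws * d * rot_interior s (Suc k) (chain k \<sigma> (upper k)) ws"
      by (simp add: star_rot_wedge IH rot_interior_mult s_def)
    also have "rot_interior s (Suc k) (chain k \<sigma> (upper k)) ws =
      (-1) ^ k * chain k \<sigma> (\<lambda>vs. - \<i> * s * rot_wedge s (Suc k) (upper (Suc k)) vs) ws"
      using rot_interior_chain[of "Suc k" k s \<sigma> "upper k"] rot_interior_upper[OF kK, of s] kK assms(2)
      by (simp add: s_def)
    also have "\<dots> = (-1) ^ k * ((- \<i> * s) * ((-1) ^ k * R ws))"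
      by (simp only: chain_mult chain_rot_wedge) (simp add: R_def s_def)
    also have "\<dots> = (- \<i> * s) * R ws" by (simp add: mult.left_commute[of "(-1) ^ k"] mult.assoc[symmetric] power_add[symmetric])
    finally show ?thesis by (simp add: algebra_simps)
  qed
  have "R ws = 0" if "length ws \<noteq> 2 * K - Suc k" for ws
    unfolding R_def upper_def
    by (rule chain_degree[of "2 * K - 2 * Suc k"], rule monomial_degree)
      (use that kK in \<open>simp_all del: upt_Suc\<close>)
  moreover have "(-1::complex) ^ (2 * K - Suc k) = (-1) ^ Suc k"
    using kK by (auto simp: uminus_power_if)
  ultimately have "(-1) ^ length ws * R ws = (-1) ^ Suc k * R ws" for ws
    by (cases "length ws = 2 * K - Suc k") auto
  then have "star b (chain (Suc k) \<sigma> (wedge (b 0) unit_form)) ws = (-1) ^ Suc k * (- \<i> * s) * d * R ws" for ws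
    unfolding st by (metis (no_types, lifting) mult.assoc mult.commute)
  then show ?case by (simp add: fun_eq_iff R_def s_def d_def algebra_simps)
qed

text \<open>The factors \<open>\<i>\<close> and \<open>-\<i>\<close> cancel in pairs; as
  \<open>K\<close> is odd, one \<open>\<i>\<close> is left over.\<close>

lemma star_factor:
  assumes "n \<ge> 1" "K = 2 * n - 1"
  shows "(\<Prod>j\<in>{1..K}. (-1) ^ (j - 1) * \<i> * \<sigma> j) = \<i> * (\<Prod>j\<in>{1..K}. \<sigma> j)"
proof -
  have "(\<Prod>j\<in>{1..2 * m + 1}. (-1) ^ (j - 1) * \<i>) = \<i>" for m
    by (induction m) (simp_all add: algebra_simps)
  moreover have "K = 2 * (n - 1) + 1" using assms by simp
  ultimately have "(\<Prod>j\<in>{1..K}. (-1) ^ (j - 1) * \<i>) = \<i>" by (simp only:)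
  then show ?thesis by (simp add: prod.distrib)
qed

text \<open>Here the asymmetry arises: up to the sign of \<open>r\<close>, the product of the chosen
  signs decides the sign of the eigenvalue. Only the wedge term of the symbol contributes, because
  the star of the product no longer contains the axis covector, and in degree
  \<open>K + 1 = 2 n\<close> the sign in front of the symbol is \<open>1\<close>.\<close>

lemma symbol_single:
  assumes "n \<ge> 1" "K = 2 * n - 1" "\<And>j. \<sigma> j * \<sigma> j = 1"
  shows "symbol n b (r *\<^sub>R b 0) (single \<sigma>) vs = - \<i> * of_real r * (\<Prod>j\<in>{1..K}. \<sigma> j) * single \<sigma> vs"
proof -
  have up: "upper K = unit_form" by (simp add: upper_def)
  have st: "star b (single \<sigma>) = (\<lambda>ws. \<i> * (\<Prod>j\<in>{1..K}. \<sigma> j) * chain K \<sigma> unit_form ws)"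
    unfolding single_def star_chain[OF order_refl assms(3)] up star_factor[OF assms(1,2)] ..
  have "chain K \<sigma> unit_form (b 0 # vs) = (-1) ^ K * chain K \<sigma> (\<lambda>ws. unit_form (b 0 # ws)) vs"
    by (rule chain_interior) (simp add: inner_planes)
  then have z: "chain K \<sigma> unit_form (b 0 # vs) = 0" by (simp add: unit_form_def chain_zero)
  have w: "wedge (b 0) (chain K \<sigma> unit_form) vs = - single \<sigma> vs"
  proof -
    have "odd K" using assms(1,2) by simp
    then show ?thesis by (simp add: wedge_chain single_def)
  qed
  have w': "wedge (b 0) (star b (single \<sigma>)) vs = \<i> * (\<Prod>j\<in>{1..K}. \<sigma> j) * - single \<sigma> vs"
    by (simp only: st wedge_mult w)
  have z': "star b (single \<sigma>) (b 0 # vs) = 0" by (simp add: st z)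
  have e: "symbol n b (r *\<^sub>R b 0) (single \<sigma>) vs =
    (-1) ^ (n + length vs div 2) * (- \<i> * of_real r * (\<Prod>j\<in>{1..K}. \<sigma> j) * single \<sigma> vs)"
    unfolding symbol_scale by (simp add: symbol_def z' w' algebra_simps)
  show ?thesis
  proof (cases "length vs = K + 1")
    case True
    then have "length vs div 2 = n" using assms by simp
    then show ?thesis unfolding e by (simp add: power_add[symmetric] flip: mult_2)
  qed (simp add: e single_degree)
qed

lemma plane_op_rot_wedge:
  assumes "l \<in> {1..K}" "j \<in> {1..K}" "l \<noteq> j"
  shows "plane_op l (rot_wedge s j \<alpha>) vs = rot_wedge s j (plane_op l \<alpha>) vs"
proof -
  note o = inner_distinct_planes[OF assms(2,1) assms(3)[symmetric]]
  have e: "number_op v (rot_wedge s j \<alpha>) vs =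
    number_op v (wedge (pv j) \<alpha>) vs + \<i> * s * number_op v (wedge (qv j) \<alpha>) vs" for v
    using number_op_lin2[of v 1 "wedge (pv j) \<alpha>" "\<i> * s" "wedge (qv j) \<alpha>" vs]
    by (simp add: rot_wedge_def[abs_def])
  have f: "wedge v (plane_op l \<alpha>) vs = wedge v (number_op (pv l) \<alpha>) vs + wedge v (number_op (qv l) \<alpha>) vs" for v
    using wedge_add[of v "number_op (pv l) \<alpha>" "number_op (qv l) \<alpha>"] by (simp add: plane_op_def[abs_def])
  show ?thesis unfolding plane_op_def[of l "rot_wedge s j \<alpha>"] e rot_wedge_def f
    by (simp add: number_op_wedge_orthogonal o algebra_simps)
qed

lemma chain_base_interior:
  assumes "\<And>j. j \<in> {1..k} \<Longrightarrow> pv j \<bullet> u = 0 \<and> qv j \<bullet> u = 0" "b 0 \<bullet> u = 0"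
  shows "chain k \<sigma> (wedge (b 0) unit_form) (u # vs) = 0"
proof -
  have "(\<lambda>ws. wedge (b 0) unit_form (u # ws)) = (\<lambda>_. 0)"
  proof
    fix ws
    have "(\<lambda>ws. unit_form (u # ws)) = (\<lambda>_. 0)" by (simp add: unit_form_def)
    then show "wedge (b 0) unit_form (u # ws) = 0" using assms(2) by (simp add: wedge_zero)
  qed
  then show ?thesis using chain_interior[of k u \<sigma> "wedge (b 0) unit_form" vs] assms(1)
    by (simp add: chain_zero)
qed

lemma chain_base_plane_interior:
  assumes "Suc k \<le> K"
  shows "chain k \<sigma> (wedge (b 0) unit_form) (pv (Suc k) # vs) = 0"
    and "chain k \<sigma> (wedge (b 0) unit_form) (qv (Suc k) # vs) = 0"
  using assms by (auto intro!: chain_base_interior simp: inner_distinct_planes inner_planes)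

lemma plane_op_chain:
  assumes "l \<in> {1..k}" "k \<le> K"
  shows "plane_op l (chain k \<sigma> (wedge (b 0) unit_form)) = chain k \<sigma> (wedge (b 0) unit_form)"
  using assms
proof (induction k)
  case (Suc k)
  show ?case
  proof (cases "l = Suc k")
    case False
    then have "plane_op l (chain k \<sigma> (wedge (b 0) unit_form)) = chain k \<sigma> (wedge (b 0) unit_form)"
      using Suc by auto
    then show ?thesis using False Suc.prems by (auto simp: plane_op_rot_wedge)
  next
    case True
    let ?X = "chain k \<sigma> (wedge (b 0) unit_form)"
    have "rot_wedge (\<sigma> (Suc k)) (Suc k) ?X (pv (Suc k) # vs) = ?X vs"
      "rot_wedge (\<sigma> (Suc k)) (Suc k) ?X (qv (Suc k) # vs) = \<i> * \<sigma> (Suc k) * ?X vs" for vs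
      using Suc.prems chain_base_plane_interior[OF Suc.prems(2), of \<sigma>]
      by (auto intro!: rot_interior_rot_wedge_same)
    then show ?thesis
      by (simp add: True fun_eq_iff plane_op_def number_op_def wedge_mult)
        (simp add: rot_wedge_def)
  qed
qed simp

lemma axis_op_single: "axis_op (single \<sigma>) = (\<lambda>_. 0)"
proof -
  have "plane_op l (single \<sigma>) = single \<sigma>" if "l \<in> {1..K}" for l
    unfolding single_def using plane_op_chain[OF that order_refl] .
  then show ?thesis by (simp add: axis_op_def fun_eq_iff)
qed

lemma even_cochain_single: "odd K \<Longrightarrow> even_cochain (single \<sigma>)"
  unfolding even_cochain_def by (intro allI impI single_degree) auto

text \<open>Contracts each plane, outermost first, with the covector of opposite sign. An isotropic
  covector pairs to zero with itself, so a plane contributes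
  \<open>1 + \<sigma>\<^sub>l \<tau>\<^sub>l\<close>, which is 2 for equal signs and 0 otherwise:
  dual functionals to the products, up to a power of two.\<close>

fun coefficient :: "nat \<Rightarrow> (nat \<Rightarrow> complex) \<Rightarrow> ('a list \<Rightarrow> complex) \<Rightarrow> complex" where
  "coefficient 0 \<sigma> \<alpha> = \<alpha> [b 0]"
| "coefficient (Suc k) \<sigma> \<alpha> = coefficient k \<sigma> (rot_interior (- \<sigma> (Suc k)) (Suc k) \<alpha>)"

lemma coefficient_lin2:
  "coefficient k \<sigma> (\<lambda>vs. c * \<alpha> vs + d * \<beta> vs) = c * coefficient k \<sigma> \<alpha> + d * coefficient k \<sigma> \<beta>"
proof (induction k arbitrary: \<alpha> \<beta>)
  case (Suc k)
  have "rot_interior (- \<sigma> (Suc k)) (Suc k) (\<lambda>vs. c * \<alpha> vs + d * \<beta> vs) =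
    (\<lambda>vs. c * rot_interior (- \<sigma> (Suc k)) (Suc k) \<alpha> vs + d * rot_interior (- \<sigma> (Suc k)) (Suc k) \<beta> vs)"
    by (rule ext) (simp add: rot_interior_def algebra_simps)
  then show ?case by (simp add: Suc)
qed simp

lemma coefficient_mult: "coefficient k \<sigma> (\<lambda>vs. c * \<alpha> vs) = c * coefficient k \<sigma> \<alpha>"
  using coefficient_lin2[of k \<sigma> c \<alpha> 0 \<alpha>] by simp

lemma coefficient_zero: "coefficient k \<sigma> (\<lambda>vs. 0) = 0"
  using coefficient_mult[of k \<sigma> 0 "\<lambda>_. 0"] by simp

lemma coefficient_sum: "coefficient k \<sigma> (\<lambda>vs. \<Sum>i\<in>S. \<alpha> i vs) = (\<Sum>i\<in>S. coefficient k \<sigma> (\<alpha> i))"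
proof (induction S rule: infinite_finite_induct)
  case (insert x F)
  then show ?case using coefficient_lin2[of k \<sigma> 1 "\<alpha> x" 1 "\<lambda>vs. \<Sum>i\<in>F. \<alpha> i vs"] by simp
qed (simp_all add: coefficient_zero)

lemma coefficient_chain:
  assumes "k \<le> K"
  shows "coefficient k \<sigma> (chain k \<tau> (wedge (b 0) unit_form)) = (\<Prod>j\<in>{1..k}. 1 + \<sigma> j * \<tau> j)"
  using assms
proof (induction k)
  case 0
  then show ?case using inner_b[of 0 0] by (simp add: unit_form_def)
next
  case (Suc k)
  let ?X = "chain k \<tau> (wedge (b 0) unit_form)"
  have "rot_interior (- \<sigma> (Suc k)) (Suc k) (chain (Suc k) \<tau> (wedge (b 0) unit_form)) =
    (\<lambda>vs. (1 + \<sigma> (Suc k) * \<tau> (Suc k)) * ?X vs)"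
  proof
    fix vs
    have "rot_wedge (\<tau> (Suc k)) (Suc k) ?X (pv (Suc k) # vs) = ?X vs"
      "rot_wedge (\<tau> (Suc k)) (Suc k) ?X (qv (Suc k) # vs) = \<i> * \<tau> (Suc k) * ?X vs"
      using Suc.prems chain_base_plane_interior[OF Suc.prems, of \<tau>]
      by (auto intro!: rot_interior_rot_wedge_same)
    then show "rot_interior (- \<sigma> (Suc k)) (Suc k) (chain (Suc k) \<tau> (wedge (b 0) unit_form)) vs =
      (1 + \<sigma> (Suc k) * \<tau> (Suc k)) * ?X vs"
      by (simp add: rot_interior_def algebra_simps)
  qed
  then have "coefficient (Suc k) \<sigma> (chain (Suc k) \<tau> (wedge (b 0) unit_form)) =
    (1 + \<sigma> (Suc k) * \<tau> (Suc k)) * coefficient k \<sigma> ?X"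
    by (simp only: coefficient.simps coefficient_mult)
  then show ?case using Suc by simp
qed

end

section \<open>The kernel of the axis operator and the action of rotations\<close>

context plane_frame
begin

lemma chain_cong: "(\<And>j. j \<in> {1..k} \<Longrightarrow> \<sigma> j = \<tau> j) \<Longrightarrow> chain k \<sigma> \<alpha> = chain k \<tau> \<alpha>"
  by (induction k) auto

text \<open>\<open>D\<close> is the set of planes that carry the minus sign.\<close>

definition sign_of :: "nat set \<Rightarrow> nat \<Rightarrow> complex" where
  "sign_of D l = (if l \<in> D then -1 else 1)"

lemma sign_of_square: "sign_of D l * sign_of D l = 1"
  by (simp add: sign_of_def)

lemma alternating_rot_interior: "alternating \<alpha> \<Longrightarrow> alternating (rot_interior s l \<alpha>)"
  using alternating_lin2[OF alternating_Cons alternating_Cons, of \<alpha> \<alpha> 1 "pv l" "\<i> * s" "qv l"]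
  by (simp add: rot_interior_def[abs_def])

lemma number_op_rot_interior:
  assumes "alternating \<alpha>" "v \<bullet> pv l = 0" "v \<bullet> qv l = 0"
  shows "number_op v (rot_interior s l \<alpha>) vs = rot_interior s l (number_op v \<alpha>) vs"
  using number_op_lin2[of v 1 "\<lambda>ws. \<alpha> (pv l # ws)" "\<i> * s" "\<lambda>ws. \<alpha> (qv l # ws)" vs]
  by (simp add: rot_interior_def[abs_def] number_op_interior_orthogonal assms)

lemma plane_op_rot_interior:
  assumes "alternating \<alpha>" "l \<in> {1..K}" "j \<in> {1..K}" "l \<noteq> j"
  shows "plane_op j (rot_interior s l \<alpha>) = rot_interior s l (plane_op j \<alpha>)"
proof
  fix vs
  show "plane_op j (rot_interior s l \<alpha>) vs = rot_interior s l (plane_op j \<alpha>) vs"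
    using inner_distinct_planes[OF assms(3,2) assms(4)[symmetric]]
    by (simp only: plane_op_def number_op_rot_interior[OF assms(1)]) (simp add: rot_interior_def plane_op_def algebra_simps)
qed

text \<open>A form with exactly one covector of the plane in every term has none after a
  contraction. Evaluating the hypothesis on lists starting with \<open>pv l\<close> shows that no
  \<open>qv l\<close> is left behind, and symmetrically with the roles exchanged.\<close>

lemma plane_op_rot_interior_same:
  assumes "alternating \<alpha>" "l \<in> {1..K}" "plane_op l \<alpha> = \<alpha>"
  shows "plane_op l (rot_interior s l \<alpha>) = (\<lambda>_. 0)"
proof
  fix vs
  note ip = inner_planes[OF assms(2)]
  have "\<alpha> (pv l # ws) = \<alpha> (pv l # ws) + number_op (qv l) (\<lambda>ws. \<alpha> (pv l # ws)) ws" for ws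
    using fun_cong[OF assms(3), of "pv l # ws"]
    by (simp add: plane_op_def number_op_Cons_self[OF assms(1)] number_op_interior_orthogonal[OF assms(1)] ip)
  then have 1: "number_op (qv l) (\<lambda>ws. \<alpha> (pv l # ws)) ws = 0" for ws by simp
  have "\<alpha> (qv l # ws) = number_op (pv l) (\<lambda>ws. \<alpha> (qv l # ws)) ws + \<alpha> (qv l # ws)" for ws
    using fun_cong[OF assms(3), of "qv l # ws"]
    by (simp add: plane_op_def number_op_Cons_self[OF assms(1)] number_op_interior_orthogonal[OF assms(1)] ip)
  then have 2: "number_op (pv l) (\<lambda>ws. \<alpha> (qv l # ws)) ws = 0" for ws by simp
  have e: "number_op v (rot_interior s l \<alpha>) vs = 0" if "v = pv l \<or> v = qv l" for v
  proof -
    have "number_op v (rot_interior s l \<alpha>) vs =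
      number_op v (\<lambda>ws. \<alpha> (pv l # ws)) vs + \<i> * s * number_op v (\<lambda>ws. \<alpha> (qv l # ws)) vs"
      using number_op_lin2[of v 1 "\<lambda>ws. \<alpha> (pv l # ws)" "\<i> * s" "\<lambda>ws. \<alpha> (qv l # ws)" vs]
      by (simp add: rot_interior_def[abs_def])
    then show ?thesis using that 1 2 number_op_interior_self[OF assms(1)] by auto
  qed
  show "plane_op l (rot_interior s l \<alpha>) vs = 0" by (simp add: plane_op_def e)
qed

text \<open>Polarisation of the sum of the two number operators along the two isotropic covectors;
  the cross terms cancel.\<close>

lemma plane_op_decompose:
  "2 * plane_op l \<alpha> vs = rot_wedge 1 l (rot_interior (-1) l \<alpha>) vs + rot_wedge (-1) l (rot_interior 1 l \<alpha>) vs"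
proof -
  have "wedge v (rot_interior s l \<alpha>) vs =
      wedge v (\<lambda>ws. \<alpha> (pv l # ws)) vs + \<i> * s * wedge v (\<lambda>ws. \<alpha> (qv l # ws)) vs" for v s
    using wedge_lin2[of v 1 "\<lambda>ws. \<alpha> (pv l # ws)" "\<i> * s" "\<lambda>ws. \<alpha> (qv l # ws)" vs]
    by (simp add: rot_interior_def[abs_def])
  then show ?thesis by (simp add: rot_wedge_def plane_op_def number_op_def algebra_simps)
qed

text \<open>Since \<open>plane_op (Suc k) \<alpha> = \<alpha>\<close>, polarisation rebuilds
  \<open>\<alpha>\<close> from its two isotropic contractions, which no longer involve plane
  \<open>Suc k\<close> and fall under the induction hypothesis. When no plane is left, Euler's
  identity forces degree one, and \<open>\<alpha>\<close> is a multiple of the axis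
  covector.\<close>

lemma chain_span:
  assumes "alternating \<alpha>" "k \<le> K" "number_op (b 0) \<alpha> = \<alpha>"
    and "\<And>l. l \<in> {1..k} \<Longrightarrow> plane_op l \<alpha> = \<alpha>"
    and "\<And>l. l \<in> {Suc k..K} \<Longrightarrow> plane_op l \<alpha> = (\<lambda>_. 0)"
  shows "\<exists>c. \<alpha> = (\<lambda>vs. \<Sum>D\<in>Pow {1..k}. c D * chain k (sign_of D) (wedge (b 0) unit_form) vs)"
  using assms
proof (induction k arbitrary: \<alpha>)
  case 0
  have d: "\<alpha> vs = 0" if "length vs \<noteq> 1" for vs
  proof -
    have "\<alpha> vs = of_nat (length vs) * \<alpha> vs"
      using euler_planes[OF 0(1), of vs] 0(3,5) by simp
    then have "of_nat 1 * \<alpha> vs = of_nat (length vs) * \<alpha> vs" by (simp only: of_nat_1 mult_1)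
    then show ?thesis using that unfolding mult_cancel_right of_nat_eq_iff by auto
  qed
  have e: "\<alpha> vs = \<alpha> [b 0] * wedge (b 0) unit_form vs" for vs
  proof -
    have "(\<lambda>ws. \<alpha> (b 0 # ws)) = (\<lambda>ws. \<alpha> [b 0] * unit_form ws)"
      using d by (auto simp: unit_form_def)
    then have "number_op (b 0) \<alpha> vs = \<alpha> [b 0] * wedge (b 0) unit_form vs"
      by (simp add: number_op_def wedge_mult)
    then show ?thesis using 0(3) by simp
  qed
  have "\<alpha> = (\<lambda>vs. \<Sum>D\<in>Pow {1..0::nat}. \<alpha> [b 0] * chain 0 (sign_of D) (wedge (b 0) unit_form) vs)"
  proof
    fix vs
    show "\<alpha> vs = (\<Sum>D\<in>Pow {1..0::nat}. \<alpha> [b 0] * chain 0 (sign_of D) (wedge (b 0) unit_form) vs)"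
      using e[of vs] by simp
  qed
  then show ?case by (rule exI[of _ "\<lambda>_. \<alpha> [b 0]"])
next
  case (Suc k)
  let ?w = "wedge (b 0) unit_form"
  have l: "Suc k \<in> {1..K}" using Suc.prems by auto
  have ex: "\<exists>c. rot_interior s (Suc k) \<alpha> = (\<lambda>vs. \<Sum>D\<in>Pow {1..k}. c D * chain k (sign_of D) ?w vs)" for s
  proof (rule Suc.IH)
    show "alternating (rot_interior s (Suc k) \<alpha>)" by (rule alternating_rot_interior[OF Suc.prems(1)])
    show "number_op (b 0) (rot_interior s (Suc k) \<alpha>) = rot_interior s (Suc k) \<alpha>"
      using number_op_rot_interior[OF Suc.prems(1), of "b 0" "Suc k"] inner_planes[OF l] Suc.prems(3)
      by (simp add: fun_eq_iff)
    show "plane_op j (rot_interior s (Suc k) \<alpha>) = rot_interior s (Suc k) \<alpha>" if "j \<in> {1..k}" for j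
      using plane_op_rot_interior[OF Suc.prems(1) l, of j s] that Suc.prems(2,4) by auto
    show "plane_op j (rot_interior s (Suc k) \<alpha>) = (\<lambda>_. 0)" if "j \<in> {Suc k..K}" for j
    proof (cases "j = Suc k")
      case True
      then show ?thesis using plane_op_rot_interior_same[OF Suc.prems(1) l] Suc.prems(4)[of "Suc k"] by auto
    next
      case False
      then have "plane_op j (rot_interior s (Suc k) \<alpha>) = rot_interior s (Suc k) (plane_op j \<alpha>)"
        using plane_op_rot_interior[OF Suc.prems(1) l, of j s] that by auto
      then show ?thesis using Suc.prems(5)[of j] False that by (auto simp: rot_interior_def)
    qed
  qed (use Suc.prems in auto)
  from ex[of "-1"] obtain c where c: "rot_interior (-1) (Suc k) \<alpha> = (\<lambda>vs. \<Sum>D\<in>Pow {1..k}. c D * chain k (sign_of D) ?w vs)" ..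
  from ex[of 1] obtain d where d: "rot_interior 1 (Suc k) \<alpha> = (\<lambda>vs. \<Sum>D\<in>Pow {1..k}. d D * chain k (sign_of D) ?w vs)" ..
  \<comment> \<open>Sign sets without \<open>Suc k\<close> come from the contraction with sign
    \<open>-1\<close>, those containing it from the contraction with sign \<open>1\<close>; the
    halves undo the factor 2 of the polarisation.\<close>
  define e where "e D = (if Suc k \<in> D then d (D - {Suc k}) / 2 else c D / 2)" for D
  have up: "rot_wedge 1 (Suc k) (chain k (sign_of D) ?w) = chain (Suc k) (sign_of D) ?w" 
    "rot_wedge (-1) (Suc k) (chain k (sign_of D) ?w) = chain (Suc k) (sign_of (insert (Suc k) D)) ?w"
    if "D \<in> Pow {1..k}" for D
  proof -
    have "chain k (sign_of (insert (Suc k) D)) ?w = chain k (sign_of D) ?w"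
      by (rule chain_cong) (auto simp: sign_of_def)
    then show "rot_wedge 1 (Suc k) (chain k (sign_of D) ?w) = chain (Suc k) (sign_of D) ?w"
      "rot_wedge (-1) (Suc k) (chain k (sign_of D) ?w) = chain (Suc k) (sign_of (insert (Suc k) D)) ?w"
      using that by (auto simp: sign_of_def)
  qed
  have iv: "{1..Suc k} = insert (Suc k) {1..k}" by auto
  have inj: "inj_on (insert (Suc k)) (Pow {1..k})"
    by (rule inj_onI) (metis PowD Suc_n_not_le_n atLeastAtMost_iff insert_ident subsetD)
  have "\<alpha> vs = (\<Sum>D\<in>Pow {1..Suc k}. e D * chain (Suc k) (sign_of D) ?w vs)" for vs
  proof -
    have "(\<Sum>D\<in>Pow {1..Suc k}. e D * chain (Suc k) (sign_of D) ?w vs) =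
      (\<Sum>D\<in>Pow {1..k}. e D * chain (Suc k) (sign_of D) ?w vs) +
      (\<Sum>D\<in>insert (Suc k) ` Pow {1..k}. e D * chain (Suc k) (sign_of D) ?w vs)"
      unfolding iv Pow_insert by (rule sum.union_disjoint) auto
    also have "(\<Sum>D\<in>insert (Suc k) ` Pow {1..k}. e D * chain (Suc k) (sign_of D) ?w vs) =
      (\<Sum>D\<in>Pow {1..k}. d D / 2 * rot_wedge (-1) (Suc k) (chain k (sign_of D) ?w) vs)"
    proof (subst sum.reindex[OF inj], rule sum.cong[OF refl])
      fix D assume D: "D \<in> Pow {1..k}"
      then have "Suc k \<notin> D" by auto
      then have "e (insert (Suc k) D) = d D / 2" by (simp add: e_def)
      then show "((\<lambda>D. e D * chain (Suc k) (sign_of D) ?w vs) \<circ> insert (Suc k)) D =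
        d D / 2 * rot_wedge (-1) (Suc k) (chain k (sign_of D) ?w) vs"
        unfolding up(2)[OF D] o_def by (simp only:)
    qed
    also have "(\<Sum>D\<in>Pow {1..k}. e D * chain (Suc k) (sign_of D) ?w vs) =
      (\<Sum>D\<in>Pow {1..k}. c D / 2 * rot_wedge 1 (Suc k) (chain k (sign_of D) ?w) vs)"
    proof (rule sum.cong[OF refl])
      fix D assume D: "D \<in> Pow {1..k}"
      then have "Suc k \<notin> D" by auto
      then have "e D = c D / 2" by (simp add: e_def)
      then show "e D * chain (Suc k) (sign_of D) ?w vs = c D / 2 * rot_wedge 1 (Suc k) (chain k (sign_of D) ?w) vs"
        unfolding up(1)[OF D] by (simp only:)
    qed
    finally have "2 * (\<Sum>D\<in>Pow {1..Suc k}. e D * chain (Suc k) (sign_of D) ?w vs) =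
      rot_wedge 1 (Suc k) (rot_interior (-1) (Suc k) \<alpha>) vs + rot_wedge (-1) (Suc k) (rot_interior 1 (Suc k) \<alpha>) vs"
      unfolding c d rot_wedge_sum rot_wedge_mult by (simp add: sum_distrib_left distrib_left)
    also have "\<dots> = 2 * plane_op (Suc k) \<alpha> vs" by (rule plane_op_decompose[symmetric])
    finally show ?thesis using Suc.prems(4)[of "Suc k"] by simp
  qed
  then show ?case by blast
qed

definition single_coefficient :: "nat set \<Rightarrow> ('a list \<Rightarrow> complex) \<Rightarrow> complex" where
  "single_coefficient D \<alpha> = coefficient K (sign_of D) \<alpha> / 2 ^ K"

lemma single_coefficient_single:
  assumes "D \<subseteq> {1..K}" "E \<subseteq> {1..K}"
  shows "single_coefficient D (single (sign_of E)) = (if D = E then 1 else 0)"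
proof (cases "D = E")
  case True
  then show ?thesis
    by (simp add: single_coefficient_def single_def coefficient_chain sign_of_square)
next
  case False
  then obtain j where "j \<in> {1..K}" "j \<in> D \<longleftrightarrow> j \<notin> E" using assms by blast
  then have "(\<Prod>j\<in>{1..K}. 1 + sign_of D j * sign_of E j) = 0"
    by (intro prod_zero) (auto simp: sign_of_def)
  then show ?thesis using False by (simp add: single_coefficient_def single_def coefficient_chain)
qed

lemma single_coefficient_mult: "single_coefficient D (\<lambda>vs. c * \<alpha> vs) = c * single_coefficient D \<alpha>"
  by (simp add: single_coefficient_def coefficient_mult)

lemma single_coefficient_sum:
  "single_coefficient D (\<lambda>vs. \<Sum>i\<in>S. \<alpha> i vs) = (\<Sum>i\<in>S. single_coefficient D (\<alpha> i))"
  by (simp add: single_coefficient_def coefficient_sum sum_divide_distrib)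

text \<open>The span is already known; the dual functionals identify the coefficients, which makes
  them linear in \<open>\<alpha>\<close> and unique.\<close>

lemma axis_kernel_expansion:
  assumes "odd K" "alternating \<alpha>" "even_cochain \<alpha>" "axis_op \<alpha> = (\<lambda>_. 0)"
  shows "\<alpha> vs = (\<Sum>D\<in>Pow {1..K}. single_coefficient D \<alpha> * single (sign_of D) vs)"
proof -
  have p: "plane_op l \<alpha> = \<alpha>" if "l \<in> {1..K}" for l
    by (rule axis_op_kernel_plane[OF assms(2,4) that])
  have "number_op (b 0) \<alpha> = \<alpha>"
    by (rule axis_number_op[OF assms(2,3,1) p])
  with chain_span[OF assms(2) order_refl] p
  obtain c where c: "\<alpha> = (\<lambda>vs. \<Sum>D\<in>Pow {1..K}. c D * single (sign_of D) vs)"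
    unfolding single_def by fastforce
  have "single_coefficient D \<alpha> = c D" if D: "D \<in> Pow {1..K}" for D
  proof -
    have "single_coefficient D \<alpha> = (\<Sum>E\<in>Pow {1..K}. c E * single_coefficient D (single (sign_of E)))"
      by (subst c) (simp only: single_coefficient_sum single_coefficient_mult)
    also have "\<dots> = (\<Sum>E\<in>Pow {1..K}. if D = E then c D else 0)"
      by (rule sum.cong) (use D in \<open>auto simp: single_coefficient_single\<close>)
    finally show ?thesis using D by simp
  qed
  then have "(\<Sum>D\<in>Pow {1..K}. single_coefficient D \<alpha> * single (sign_of D) vs) =
    (\<Sum>D\<in>Pow {1..K}. c D * single (sign_of D) vs)"
    by (intro sum.cong) auto
  then show ?thesis using fun_cong[OF c, of vs] by simp
qed

definition rotates :: "('a \<Rightarrow> 'a) \<Rightarrow> (nat \<Rightarrow> real) \<Rightarrow> bool" where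
  "rotates C \<gamma> \<longleftrightarrow> linear C \<and> (\<forall>x y. C x \<bullet> C y = x \<bullet> y) \<and> C (b 0) = b 0 \<and>
     (\<forall>l\<in>{1..K}. C (pv l) = cos (\<gamma> l) *\<^sub>R pv l + sin (\<gamma> l) *\<^sub>R qv l \<and>
                 C (qv l) = - sin (\<gamma> l) *\<^sub>R pv l + cos (\<gamma> l) *\<^sub>R qv l)"

lemma rot_wedge_rotate:
  assumes "rotates C \<gamma>" "l \<in> {1..K}" "s = 1 \<or> s = -1"
  shows "rot_wedge s l \<alpha> (map C vs) = exp (\<i> * s * of_real (\<gamma> l)) * rot_wedge s l (\<lambda>vs. \<alpha> (map C vs)) vs"
proof -
  let ?c = "cos (\<gamma> l)" and ?s = "sin (\<gamma> l)"
  have lin: "linear C" and iso: "\<And>x y. C x \<bullet> C y = x \<bullet> y"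
    and Cp: "C (pv l) = ?c *\<^sub>R pv l + ?s *\<^sub>R qv l" and Cq: "C (qv l) = - ?s *\<^sub>R pv l + ?c *\<^sub>R qv l"
    using assms(1,2) by (auto simp: rotates_def)
  have sc: "?s * ?s + ?c * ?c = 1" using sin_cos_squared_add[of "\<gamma> l"] by (simp add: power2_eq_square)
  \<comment> \<open>\<open>wedge_compose_map\<close> expects a covector of the form
    \<open>C v\<close>, so \<open>pv l\<close> and below \<open>qv l\<close> are expressed through
    the inverse rotation.\<close>
  have "C (?c *\<^sub>R pv l + (- ?s) *\<^sub>R qv l) = (?s * ?s + ?c * ?c) *\<^sub>R pv l"
    unfolding linear_add[OF lin] linear_scale[OF lin] Cp Cq
    by (simp add: algebra_simps del: sin_cos_squared_add sin_cos_squared_add2 sin_cos_squared_add3)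
  then have P: "pv l = C (?c *\<^sub>R pv l + (- ?s) *\<^sub>R qv l)" by (simp only: sc scaleR_one)
  have "C (?s *\<^sub>R pv l + ?c *\<^sub>R qv l) = (?s * ?s + ?c * ?c) *\<^sub>R qv l"
    unfolding linear_add[OF lin] linear_scale[OF lin] Cp Cq
    by (simp add: algebra_simps del: sin_cos_squared_add sin_cos_squared_add2 sin_cos_squared_add3)
  then have Q: "qv l = C (?s *\<^sub>R pv l + ?c *\<^sub>R qv l)" by (simp only: sc scaleR_one)
  let ?wp = "wedge (pv l) (\<lambda>vs. \<alpha> (map C vs)) vs" and ?wq = "wedge (qv l) (\<lambda>vs. \<alpha> (map C vs)) vs"
  have wp: "wedge (pv l) \<alpha> (map C vs) = of_real ?c * ?wp - of_real ?s * ?wq"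
    by (subst P, subst wedge_compose_map[OF iso]) (simp only: wedge_vec_add wedge_vec_scale, simp)
  have wq: "wedge (qv l) \<alpha> (map C vs) = of_real ?s * ?wp + of_real ?c * ?wq"
    by (subst Q, subst wedge_compose_map[OF iso]) (simp only: wedge_vec_add wedge_vec_scale)
  have ex: "exp (\<i> * s * of_real (\<gamma> l)) = of_real ?c + \<i> * s * of_real ?s"
    using assms(3)
  proof
    assume "s = 1"
    then show ?thesis by (simp add: cis_conv_exp[symmetric]) (simp add: complex_eq_iff)
  next
    assume s: "s = -1"
    have "exp (\<i> * s * of_real (\<gamma> l)) = cis (- \<gamma> l)" unfolding cis_conv_exp by (simp add: s)
    then show ?thesis by (simp add: s complex_eq_iff)
  qed
  have ss: "s * s = 1" using assms(3) by auto
  have "rot_wedge s l \<alpha> (map C vs) =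
     (of_real ?c + \<i> * s * of_real ?s) * ?wp + \<i> * (s * of_real ?c + \<i> * of_real ?s) * ?wq"
    unfolding rot_wedge_def wp wq by (simp add: algebra_simps)
  also have "\<i> * (s * of_real ?c + \<i> * of_real ?s) = \<i> * (s * of_real ?c + \<i> * (s * s) * of_real ?s)"
    by (simp only: ss) simp
  finally show ?thesis unfolding ex rot_wedge_def by (simp only: distrib_left distrib_right mult.assoc) (simp add: algebra_simps)
qed

lemma chain_rotate:
  assumes "rotates C \<gamma>" "k \<le> K" "\<And>j. \<sigma> j = 1 \<or> \<sigma> j = -1"
  shows "chain k \<sigma> (wedge (b 0) unit_form) (map C vs) =
    exp (\<i> * (\<Sum>j\<in>{1..k}. \<sigma> j * of_real (\<gamma> j))) * chain k \<sigma> (wedge (b 0) unit_form) vs"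
  using assms(2)
proof (induction k arbitrary: vs)
  case 0
  have "C (b 0) = b 0" "\<And>x y. C x \<bullet> C y = x \<bullet> y" using assms(1) by (auto simp: rotates_def)
  then have "wedge (b 0) unit_form (map C vs) = wedge (b 0) (\<lambda>vs. unit_form (map C vs)) vs"
    using wedge_compose_map[of C "b 0" unit_form vs] by simp
  moreover have "(\<lambda>vs. unit_form (map C vs)) = unit_form" by (simp add: unit_form_def fun_eq_iff)
  ultimately show ?case by simp
next
  case (Suc k)
  have "chain (Suc k) \<sigma> (wedge (b 0) unit_form) (map C vs) = exp (\<i> * \<sigma> (Suc k) * of_real (\<gamma> (Suc k))) *
    rot_wedge (\<sigma> (Suc k)) (Suc k) (\<lambda>vs. chain k \<sigma> (wedge (b 0) unit_form) (map C vs)) vs"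
    using rot_wedge_rotate[OF assms(1), of "Suc k" "\<sigma> (Suc k)"] Suc.prems assms(3) by simp
  also have "(\<lambda>vs. chain k \<sigma> (wedge (b 0) unit_form) (map C vs)) =
    (\<lambda>vs. exp (\<i> * (\<Sum>j\<in>{1..k}. \<sigma> j * of_real (\<gamma> j))) * chain k \<sigma> (wedge (b 0) unit_form) vs)"
    using Suc by simp
  finally show ?case by (simp add: rot_wedge_mult distrib_left exp_add mult.assoc[symmetric])
qed

lemma single_rotate:
  assumes "rotates C \<gamma>" "\<And>j. \<sigma> j = 1 \<or> \<sigma> j = -1"
  shows "single \<sigma> (map C vs) = exp (\<i> * (\<Sum>j\<in>{1..K}. \<sigma> j * of_real (\<gamma> j))) * single \<sigma> vs"
  unfolding single_def by (rule chain_rotate[OF assms(1) order_refl assms(2)])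

text \<open>The sum of the two number operators is the same for every orthonormal basis of the
  plane; the squares of cosine and sine collect to \<open>1\<close>.\<close>

lemma plane_op_rotate:
  assumes "rotates C \<gamma>" "l \<in> {1..K}" "alternating \<alpha>"
  shows "plane_op l (\<lambda>vs. \<alpha> (map C vs)) vs = plane_op l \<alpha> (map C vs)"
proof -
  let ?c = "cos (\<gamma> l)" and ?s = "sin (\<gamma> l)"
  have iso: "\<And>x y. C x \<bullet> C y = x \<bullet> y"
    and Cp: "C (pv l) = ?c *\<^sub>R pv l + ?s *\<^sub>R qv l" and Cq: "C (qv l) = (- ?s) *\<^sub>R pv l + ?c *\<^sub>R qv l"
    using assms(1,2) by (auto simp: rotates_def)
  have sc: "of_real ?s * of_real ?s + of_real ?c * of_real ?c = (1::complex)"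
    using sin_cos_squared_add[of "\<gamma> l"] by (simp add: power2_eq_square flip: of_real_mult of_real_add)
  define P where "P = (\<lambda>ws. \<alpha> (pv l # ws))"
  define Q where "Q = (\<lambda>ws. \<alpha> (qv l # ws))"
  have n: "number_op v (\<lambda>vs. \<alpha> (map C vs)) vs = wedge (C v) (\<lambda>ws. \<alpha> (C v # ws)) (map C vs)" for v
    by (simp add: number_op_def wedge_compose_map[OF iso])
  have "(\<lambda>ws. \<alpha> (C (pv l) # ws)) = (\<lambda>ws. of_real ?c * P ws + of_real ?s * Q ws)"
    "(\<lambda>ws. \<alpha> (C (qv l) # ws)) = (\<lambda>ws. (- of_real ?s) * P ws + of_real ?c * Q ws)"
    unfolding Cp Cq P_def Q_def alternating_add_Cons[OF assms(3)] alternating_scale_Cons[OF assms(3)] by simp_all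
  then have "plane_op l (\<lambda>vs. \<alpha> (map C vs)) vs =
    (of_real ?s * of_real ?s + of_real ?c * of_real ?c) * (wedge (pv l) P (map C vs) + wedge (qv l) Q (map C vs))"
    unfolding plane_op_def n
    by (simp only: wedge_lin2) (simp only: Cp Cq wedge_vec_add wedge_vec_scale, simp add: algebra_simps)
  then show ?thesis by (simp add: sc plane_op_def number_op_def P_def Q_def)
qed

lemma axis_op_rotate:
  assumes "rotates C \<gamma>" "alternating \<alpha>"
  shows "axis_op (\<lambda>vs. \<alpha> (map C vs)) vs = axis_op \<alpha> (map C vs)"
  unfolding axis_op_def by (rule sum.cong[OF refl]) (simp add: plane_op_rotate[OF assms(1) _ assms(2)])

end

section \<open>Dirichlet series with oscillating coefficients\<close>

fun cpow_diff :: "nat \<Rightarrow> complex \<Rightarrow> real \<Rightarrow> complex" where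
  "cpow_diff 0 s x = of_real x powr (- s)"
| "cpow_diff (Suc k) s x = cpow_diff k s x - cpow_diff k s (x + 1)"

text \<open>Differences commute with differentiation: the derivative of a \<open>k\<close>-fold
  difference of a power is a \<open>k\<close>-fold difference of the next lower power.\<close>

lemma has_vector_derivative_cpow_diff:
  assumes "x > 0"
  shows "(cpow_diff k s has_vector_derivative - s * cpow_diff k (s + 1) x) (at x within S)"
  using assms
proof (induction k arbitrary: x S)
  case 0
  have "((\<lambda>z. z powr (- s)) has_field_derivative (- s) * of_real x powr (- s - 1)) (at (of_real x))"
    by (rule has_field_derivative_powr) (use 0 in \<open>auto simp: complex_nonpos_Reals_iff\<close>)
  from has_vector_derivative_real_field[OF this, of S]
  moreover have "- (s + 1) = - s - 1" by simp
  ultimately show ?case by (simp only: cpow_diff.simps)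
next
  case (Suc k)
  have "(cpow_diff k s has_vector_derivative - s * cpow_diff k (s + 1) x) (at x within S)"
    by (rule Suc.IH) (use Suc.prems in auto)
  moreover have "((cpow_diff k s \<circ> (\<lambda>x. x + 1)) has_vector_derivative 1 *\<^sub>R (- s * cpow_diff k (s + 1) (x + 1))) (at x within S)"
    by (rule vector_diff_chain_within[OF _ Suc.IH]) (use Suc.prems in \<open>auto intro!: derivative_eq_intros\<close>)
  ultimately have "((\<lambda>x. cpow_diff k s x - (cpow_diff k s \<circ> (\<lambda>x. x + 1)) x) has_vector_derivative
      - s * cpow_diff k (s + 1) x - 1 *\<^sub>R (- s * cpow_diff k (s + 1) (x + 1))) (at x within S)"
    by (rule has_vector_derivative_diff)
  then show ?case by (simp add: o_def algebra_simps)
qed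

text \<open>By the mean value inequality each difference gains one power of decay in
  \<open>x\<close> at the cost of one factor of the rising factorial of \<open>s\<close>. This gain
  moves the abscissa of convergence to the left.\<close>

lemma norm_cpow_diff_le:
  assumes "x > 0" "Re s + k \<ge> 0"
  shows "norm (cpow_diff k s x) \<le> (\<Prod>i<k. norm (s + of_nat i)) * x powr (- (Re s + k))"
  using assms
proof (induction k arbitrary: x s)
  case 0
  then show ?case by (simp add: norm_powr_real_powr)
next
  case (Suc k)
  let ?B = "norm s * ((\<Prod>i<k. norm (s + 1 + of_nat i)) * x powr (- (Re s + Suc k)))"
  have "norm (cpow_diff k s x - cpow_diff k s (x + 1)) \<le> ?B * norm (x - (x + 1))"
  proof (rule differentiable_bound[where S = "{x..x + 1}"])
    fix y assume y: "y \<in> {x..x + 1}"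
    then show "(cpow_diff k s has_derivative (\<lambda>h. h *\<^sub>R (- s * cpow_diff k (s + 1) y))) (at y within {x..x + 1})"
      using has_vector_derivative_cpow_diff[of y k s "{x..x + 1}"] Suc.prems
      by (simp add: has_vector_derivative_def)
    have "norm (cpow_diff k (s + 1) y) \<le> (\<Prod>i<k. norm (s + 1 + of_nat i)) * y powr (- (Re (s + 1) + k))"
      by (rule Suc.IH) (use y Suc.prems in auto)
    also have "\<dots> \<le> (\<Prod>i<k. norm (s + 1 + of_nat i)) * x powr (- (Re s + Suc k))"
    proof (rule mult_left_mono)
      have "y powr (- (Re (s + 1) + k)) = y powr (- (Re s + Suc k))" by (simp add: algebra_simps)
      also have "\<dots> \<le> x powr (- (Re s + Suc k))"
        by (rule powr_mono2') (use y Suc.prems in auto)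
      finally show "y powr (- (Re (s + 1) + k)) \<le> x powr (- (Re s + Suc k))" .
    qed (simp add: prod_nonneg)
    finally have b: "norm (- s * cpow_diff k (s + 1) y) \<le> ?B" by (simp add: norm_mult mult_left_mono)
    show "onorm (\<lambda>h. h *\<^sub>R (- s * cpow_diff k (s + 1) y)) \<le> ?B"
    proof (rule onorm_bound)
      show "0 \<le> ?B" by (simp add: prod_nonneg)
      fix h :: real
      show "norm (h *\<^sub>R (- s * cpow_diff k (s + 1) y)) \<le> ?B * norm h"
        using mult_left_mono[OF b, of "\<bar>h\<bar>"] by (simp add: mult.commute)
    qed
  qed auto
  moreover have "(\<Prod>i<Suc k. norm (s + of_nat i)) = norm s * (\<Prod>i<k. norm (s + 1 + of_nat i))"
    unfolding prod.lessThan_Suc_shift by (simp add: algebra_simps)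
  ultimately show ?case by (simp add: mult.assoc)
qed

lemma cpow_diff_holomorphic: "x > 0 \<Longrightarrow> (\<lambda>s. cpow_diff k s x) holomorphic_on S"
proof (induction k arbitrary: x)
  case (Suc k)
  have "(\<lambda>s. cpow_diff k s x - cpow_diff k s (x + 1)) holomorphic_on S"
    using Suc by (intro holomorphic_on_diff) auto
  then show ?case by simp
qed (auto intro!: holomorphic_intros)

text \<open>The sums \<open>\<Sum>\<^sub>j w\<^sup>j \<Delta>\<^sup>k f (j)\<close> over \<open>j \<ge> 1\<close>, where \<open>f x = x\<^sup>-\<^sup>s\<close> and \<open>\<Delta>\<^sup>k\<close> is a \<open>k\<close>-fold difference,
  converge for \<open>Re s > 1 - k\<close>; Abel summation relates consecutive values of \<open>k\<close>.\<close>

definition osc_sum :: "complex \<Rightarrow> nat \<Rightarrow> complex \<Rightarrow> complex" where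
  "osc_sum w k s = (\<Sum>j. w ^ Suc j * cpow_diff k s (of_nat (Suc j)))"

text \<open>The outcome of \<open>k\<close> Abel summations: the collected boundary terms and the
  series that remains. Where the series converges the value is independent of \<open>k\<close>, so
  the half-planes \<open>Re s > 1 - k\<close> glue to an entire function.\<close>

definition osc_partial :: "complex \<Rightarrow> nat \<Rightarrow> complex \<Rightarrow> complex" where
  "osc_partial w k s =
     (\<Sum>i<k. (w / (1 - w)) * (- w / (1 - w)) ^ i * cpow_diff i s 1) + (- w / (1 - w)) ^ k * osc_sum w k s"

lemma summable_cpow_diff:
  assumes "norm w = 1" "Re s + k > 1"
  shows "summable (\<lambda>j. norm (w ^ Suc j * cpow_diff k s (of_nat (Suc j))))"
proof (rule summable_comparison_test')
  have "summable (\<lambda>j. (of_nat (Suc j) :: real) powr (- (Re s + k)))"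
    using assms(2) by (subst summable_Suc_iff, subst summable_real_powr_iff) simp
  then show "summable (\<lambda>j. (\<Prod>i<k. norm (s + of_nat i)) * real (Suc j) powr (- (Re s + k)))"
    by (rule summable_mult)
  fix j :: nat
  show "norm (norm (w ^ Suc j * cpow_diff k s (of_nat (Suc j)))) \<le> (\<Prod>i<k. norm (s + of_nat i)) * real (Suc j) powr (- (Re s + k))"
    using norm_cpow_diff_le[of "of_nat (Suc j)" s k] assms by (simp add: norm_mult norm_power del: of_nat_Suc)
qed

text \<open>Shifting the index by one in the series \<open>S\<close> and subtracting gives
  \<open>(1 - w) S = w g(0) - w S'\<close>, where \<open>S'\<close> is the series of
  differences.\<close>

lemma osc_sum_Suc:
  assumes "norm w = 1" "w \<noteq> 1" "Re s + k > 1"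
  shows "osc_sum w k s = w / (1 - w) * cpow_diff k s 1 - w / (1 - w) * osc_sum w (Suc k) s"
proof -
  define g where "g j = cpow_diff k s (of_nat (Suc j))" for j
  have s0: "summable (\<lambda>j. w ^ Suc j * g j)"
    using summable_cpow_diff[OF assms(1,3)] unfolding g_def by (rule summable_norm_cancel)
  have "(\<lambda>j. w ^ Suc (Suc j) * g (Suc j)) sums (osc_sum w k s - w * g 0)"
    using summable_sums[OF s0] by (subst sums_Suc_iff) (simp add: osc_sum_def g_def del: of_nat_Suc)
  from sums_mult[OF this, of "1 / w"]
  have "(\<lambda>j. 1 / w * (w ^ Suc (Suc j) * g (Suc j))) sums ((osc_sum w k s - w * g 0) / w)" by simp
  moreover have "1 / w * (w ^ Suc (Suc j) * g (Suc j)) = w ^ Suc j * g (Suc j)" for j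
    using assms(1) by auto
  ultimately have s1: "(\<lambda>j. w ^ Suc j * g (Suc j)) sums ((osc_sum w k s - w * g 0) / w)"
    by (simp only:)
  have "(\<lambda>j. w ^ Suc j * g j - w ^ Suc j * g (Suc j)) sums (osc_sum w k s - (osc_sum w k s - w * g 0) / w)"
    using summable_sums[OF s0] by (intro sums_diff s1) (simp add: osc_sum_def g_def)
  moreover have "w ^ Suc j * g j - w ^ Suc j * g (Suc j) = w ^ Suc j * cpow_diff (Suc k) s (of_nat (Suc j))" for j
    by (simp add: g_def algebra_simps)
  ultimately have "osc_sum w (Suc k) s = osc_sum w k s - (osc_sum w k s - w * g 0) / w"
    unfolding osc_sum_def[of w "Suc k"] by (simp add: sums_iff)
  moreover have "g 0 = cpow_diff k s 1" by (simp add: g_def)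
  ultimately have e: "osc_sum w (Suc k) s = osc_sum w k s - (osc_sum w k s - w * cpow_diff k s 1) / w" by simp
  have w: "w \<noteq> 0" "1 - w \<noteq> 0" using assms by auto
  have "osc_sum w k s * (1 - w) = w * cpow_diff k s 1 - w * osc_sum w (Suc k) s"
    unfolding e using w by (simp add: field_simps)
  then have "osc_sum w k s = (w * cpow_diff k s 1 - w * osc_sum w (Suc k) s) / (1 - w)"
    using w(2) by (simp add: eq_divide_eq)
  then show ?thesis by (simp add: diff_divide_distrib)
qed

lemma osc_partial_Suc:
  assumes "norm w = 1" "w \<noteq> 1" "Re s + k > 1"
  shows "osc_partial w (Suc k) s = osc_partial w k s"
  unfolding osc_partial_def osc_sum_Suc[OF assms] by (simp add: algebra_simps add_divide_distrib diff_divide_distrib)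

lemma osc_partial_eq:
  assumes "norm w = 1" "w \<noteq> 1" "Re s + k > 1" "k \<le> l"
  shows "osc_partial w l s = osc_partial w k s"
  using assms(4)
proof (induction l rule: dec_induct)
  case (step l)
  then show ?case using osc_partial_Suc[OF assms(1,2), of s l] assms(3) by simp
qed simp

lemma osc_partial_holomorphic:
  assumes "norm w = 1" "w \<noteq> 1"
  shows "osc_partial w k holomorphic_on {s. Re s > 1 - real k}"
proof -
  let ?S = "{s. Re s > 1 - real k}"
  have op: "open ?S" by (rule open_halfspace_Re_gt)
  have "(\<lambda>s. \<Sum>j. w ^ Suc j * cpow_diff k s (of_nat (Suc j))) holomorphic_on ?S"
  proof (rule holomorphic_uniform_sequence[OF op])
    show "(\<lambda>s. \<Sum>j<n. w ^ Suc j * cpow_diff k s (of_nat (Suc j))) holomorphic_on ?S" for n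
      by (intro holomorphic_intros cpow_diff_holomorphic) simp
    fix z assume z: "z \<in> ?S"
    \<comment> \<open>The midpoint between 1 and \<open>Re z + k\<close>: on the disc of radius
      \<open>d / 2\<close> the decay exponent stays at least \<open>a > 1\<close>, which gives one
      convergent majorant for the whole disc.\<close>
    define a where "a = (Re z + k + 1) / 2"
    have a: "a > 1" "a < Re z + k" using z by (auto simp: a_def)
    define d where "d = Re z + k - a"
    have d: "d > 0" using a by (simp add: d_def)
    have sub: "cball z (d / 2) \<subseteq> ?S"
    proof
      fix s assume "s \<in> cball z (d / 2)"
      then have "\<bar>Re z - Re s\<bar> \<le> d / 2" using abs_Re_le_cmod[of "z - s"] by (simp add: dist_norm)
      then show "s \<in> ?S" using a d by (simp add: d_def field_simps) (smt (verit))
    qed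
    define C where "C = (\<Prod>i<k. norm z + d / 2 + of_nat i)"
    have "uniform_limit (cball z (d / 2)) (\<lambda>n s. \<Sum>j<n. w ^ Suc j * cpow_diff k s (of_nat (Suc j)))
      (\<lambda>s. \<Sum>j. w ^ Suc j * cpow_diff k s (of_nat (Suc j))) sequentially"
    proof (rule Weierstrass_m_test)
      have "summable (\<lambda>j. (of_nat (Suc j) :: real) powr (- a))"
        using a by (subst summable_Suc_iff, subst summable_real_powr_iff) simp
      then show "summable (\<lambda>j. C * real (Suc j) powr (- a))" by (rule summable_mult)
      fix j s assume s: "s \<in> cball z (d / 2)"
      have "\<bar>Re z - Re s\<bar> \<le> d / 2" using abs_Re_le_cmod[of "z - s"] s by (simp add: dist_norm)
      then have re: "Re s + k \<ge> a" 
      proof -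
        have "Re z - Re s \<le> d / 2" by (rule abs_le_D1) fact
        then have "Re s \<ge> Re z - d / 2" by simp
        moreover have "Re z = d + a - k" by (simp add: d_def)
        ultimately show ?thesis using d by (simp add: field_simps)
      qed
      have ns: "norm s \<le> norm z + d / 2" using s norm_triangle_ineq4[of z "z - s"] by (simp add: dist_norm)
      have "norm (w ^ Suc j * cpow_diff k s (of_nat (Suc j))) \<le> (\<Prod>i<k. norm (s + of_nat i)) * real (Suc j) powr (- (Re s + k))"
        using norm_cpow_diff_le[of "of_nat (Suc j)" s k] assms re a by (simp add: norm_mult norm_power del: of_nat_Suc)
      also have "\<dots> \<le> C * real (Suc j) powr (- a)"
      proof (rule mult_mono)
        show "(\<Prod>i<k. norm (s + of_nat i)) \<le> C" unfolding C_def
        proof (rule prod_mono, safe)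
          fix i
          have "norm (s + of_nat i) \<le> norm s + of_nat i" using norm_triangle_ineq[of s "of_nat i"] by simp
          then show "norm (s + of_nat i) \<le> norm z + d / 2 + of_nat i" using ns by simp
        qed simp
        show "real (Suc j) powr (- (Re s + k)) \<le> real (Suc j) powr (- a)"
          by (rule powr_mono) (use re in auto)
        show "0 \<le> C" unfolding C_def using d by (intro prod_nonneg) auto
      qed auto
      finally show "norm (w ^ Suc j * cpow_diff k s (of_nat (Suc j))) \<le> C * real (Suc j) powr (- a)" .
    qed
    then show "\<exists>d>0. cball z d \<subseteq> ?S \<and> uniform_limit (cball z d)
      (\<lambda>n s. \<Sum>j<n. w ^ Suc j * cpow_diff k s (of_nat (Suc j)))
      (\<lambda>s. \<Sum>j. w ^ Suc j * cpow_diff k s (of_nat (Suc j))) sequentially"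
      using sub d by (intro exI[of _ "d / 2"]) auto
  qed
  then have "osc_sum w k holomorphic_on ?S" unfolding osc_sum_def[abs_def] .
  then show ?thesis unfolding osc_partial_def[abs_def]
    by (intro holomorphic_intros cpow_diff_holomorphic) auto
qed

theorem oscillating_dirichlet_series:
  assumes "norm w = 1" "w \<noteq> 1"
  obtains F where "F holomorphic_on UNIV" "F 0 = w / (1 - w)"
    "\<And>s. Re s > 1 \<Longrightarrow> (\<lambda>j. w ^ Suc j * of_nat (Suc j) powr (- s)) sums F s"
proof -
  \<comment> \<open>The number of summations is chosen so that \<open>Re s + k \<ge> 2\<close>,
    inside the range where the value no longer depends on \<open>k\<close>.\<close>
  define F where "F s = osc_partial w (nat \<lceil>2 - Re s\<rceil>) s" for s
  have F: "F s = osc_partial w k s" if "Re s + k > 1" for k s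
  proof -
    let ?k = "nat \<lceil>2 - Re s\<rceil>"
    have "Re s + ?k > 1" by linarith
    then show ?thesis
      using osc_partial_eq[OF assms, of s k ?k] osc_partial_eq[OF assms, of s ?k k] that
      unfolding F_def by (cases "k \<le> ?k") auto
  qed
  have "F holomorphic_on UNIV"
  proof -
    have "F holomorphic_on (\<Union>k. {s. Re s > 1 - real k})"
    proof (rule holomorphic_on_UN_open)
      fix k
      have "osc_partial w k holomorphic_on {s. Re s > 1 - real k}" by (rule osc_partial_holomorphic[OF assms])
      then show "F holomorphic_on {s. Re s > 1 - real k}"
        by (rule holomorphic_transform) (use F[of _ k] in auto)
      show "open {s. Re s > 1 - real k}" by (rule open_halfspace_Re_gt)
    qed
    moreover have "s \<in> (\<Union>k. {s. Re s > 1 - real k})" for s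
    proof -
      obtain k :: nat where "1 - Re s < k" using reals_Archimedean2 by blast
      then show ?thesis by (auto intro!: exI[of _ k])
    qed
    ultimately show ?thesis by (metis UNIV_eq_I)
  qed
  \<comment> \<open>At \<open>s = 0\<close> the power is the constant \<open>1\<close>, so all
    proper differences vanish and only the first boundary term survives.\<close>
  moreover have "F 0 = w / (1 - w)"
  proof -
    have "F 0 = osc_partial w 2 0" by (rule F) simp
    moreover have z: "cpow_diff 2 0 x = 0" if "x > 0" for x :: real
    proof -
      have "complex_of_real x \<noteq> 0" "complex_of_real (x + 1) \<noteq> 0" "complex_of_real (x + 1 + 1) \<noteq> 0"
        using that unfolding of_real_eq_0_iff by linarith+
      then show ?thesis by (simp add: numeral_2_eq_2 del: of_real_add)
    qed
    moreover have "osc_sum w 2 0 = 0" by (simp add: osc_sum_def z)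
    ultimately show ?thesis by (simp add: osc_partial_def numeral_2_eq_2)
  qed
  moreover have "(\<lambda>j. w ^ Suc j * of_nat (Suc j) powr (- s)) sums F s" if "Re s > 1" for s
  proof -
    have "summable (\<lambda>j. w ^ Suc j * cpow_diff 0 s (of_nat (Suc j)))"
      by (rule summable_norm_cancel, rule summable_cpow_diff[OF assms(1)]) (use that in simp)
    then have "(\<lambda>j. w ^ Suc j * cpow_diff 0 s (of_nat (Suc j))) sums osc_sum w 0 s"
      unfolding osc_sum_def by (rule summable_sums)
    moreover have "F s = osc_sum w 0 s" using F[of s 0] that by (simp add: osc_partial_def)
    ultimately show ?thesis by simp
  qed
  ultimately show ?thesis using that by blast
qed

section \<open>Products of sines and cycles\<close>

text \<open>The solutions are the multiples of \<open>K div gcd k K\<close> below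
  \<open>K\<close>.\<close>

lemma card_multiples_dvd:
  fixes k K :: nat
  assumes "K > 0"
  shows "card {t. t < K \<and> K dvd k * t} = gcd k K"
proof -
  define g where "g = gcd k K"
  obtain k' K' where k: "k = g * k'" "K = g * K'" and cop: "coprime k' K'"
    using gcd_coprime_exists[of k K] assms unfolding g_def by (metis gcd_eq_0_iff less_numeral_extra(3) mult.commute)
  have g: "g > 0" "K' > 0" using assms k by auto
  have "K dvd k * t \<longleftrightarrow> K' dvd t" for t
  proof -
    have "K dvd k * t \<longleftrightarrow> K' dvd k' * t" using g by (simp add: k mult.assoc)
    also have "\<dots> \<longleftrightarrow> K' dvd t" using cop by (metis coprime_commute coprime_dvd_mult_right_iff)
    finally show ?thesis .
  qed
  then have e: "{t. t < K \<and> K dvd k * t} = {t. t < K \<and> K' dvd t}" by simp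
  have "{t. t < K \<and> K' dvd t} = (\<lambda>u. K' * u) ` {..<g}"
  proof (intro equalityI subsetI)
    fix t assume "t \<in> {t. t < K \<and> K' dvd t}"
    then obtain u where u: "t = K' * u" "t < K" by (auto elim: dvdE)
    then have "K' * u < K' * g" by (simp only: k(2) mult.commute)
    then have "u < g" using g(2) by (simp only: mult_less_cancel1)
    then show "t \<in> (\<lambda>u. K' * u) ` {..<g}" using u(1) by blast
  next
    fix t assume "t \<in> (\<lambda>u. K' * u) ` {..<g}"
    then obtain u where u: "t = K' * u" "u < g" by auto
    then have "K' * u < K' * g" using g(2) by (simp only: mult_less_cancel1)
    then have "t < K" using u(1) by (simp only: k(2) mult.commute)
    then show "t \<in> {t. t < K \<and> K' dvd t}" using u(1) by simp
  qed
  moreover have "inj_on (\<lambda>u. K' * u) {..<g}" using g by (auto simp: inj_on_def)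
  ultimately show ?thesis unfolding e by (simp add: card_image g_def)
qed

text \<open>For odd \<open>K\<close> doubling permutes the exponents with
  \<open>\<zeta> ^ t \<noteq> 1\<close>. As \<open>1 - \<zeta>^(2t)\<close> is
  \<open>(1 - \<zeta>^t) (1 + \<zeta>^t)\<close>, the product of \<open>1 + \<zeta>^t\<close> over
  these exponents is 1; each of the others contributes 2.\<close>

lemma prod_one_plus_root_powers:
  fixes \<zeta> :: complex
  assumes "odd K" "\<zeta> ^ K = 1"
  shows "(\<Prod>t<K. 1 + \<zeta> ^ t) = 2 ^ card {t. t < K \<and> \<zeta> ^ t = 1}"
proof -
  define Z where "Z = {t. t < K \<and> \<zeta> ^ t = 1}"
  define W where "W = {t. t < K \<and> \<zeta> ^ t \<noteq> 1}"
  have K: "K > 0" using assms(1) by (cases K) auto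
  have md: "\<zeta> ^ (m mod K) = \<zeta> ^ m" for m
  proof -
    have "\<zeta> ^ m = \<zeta> ^ (K * (m div K) + m mod K)" by simp
    also have "\<dots> = \<zeta> ^ (m mod K)" by (simp only: power_add power_mult assms(2) power_one mult_1)
    finally show ?thesis by simp
  qed
  have half: "\<zeta> ^ t = 1" if "\<zeta> ^ (2 * t) = 1" for t
  proof -
    from assms(1) obtain h where h: "K = 2 * h + 1" by (elim oddE)
    have "1 = (\<zeta> ^ (2 * t)) ^ (h + 1)" using that by simp
    also have "\<dots> = (\<zeta> ^ K) ^ t * \<zeta> ^ t"
      by (simp add: h power_mult[symmetric] power_add[symmetric] algebra_simps)
    finally show ?thesis by (simp add: assms(2))
  qed
  have inj: "inj_on (\<lambda>t. (2 * t) mod K) {..<K}"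
  proof (rule inj_onI)
    fix x y assume xy: "x \<in> {..<K}" "y \<in> {..<K}" "(2 * x) mod K = (2 * y) mod K"
    then have "[2 * x = 2 * y] (mod K)" by (simp add: cong_def)
    then have "[x = y] (mod K)" using assms(1) by (simp add: cong_mult_lcancel_nat coprime_commute)
    then show "x = y" using xy by (simp add: cong_def)
  qed
  have W: "finite W" "W \<subseteq> {..<K}" by (auto simp: W_def)
  have img: "(\<lambda>t. (2 * t) mod K) ` W = W"
  proof (rule card_subset_eq[OF W(1)])
    show "(\<lambda>t. (2 * t) mod K) ` W \<subseteq> W" using half K by (auto simp: W_def md)
    show "card ((\<lambda>t. (2 * t) mod K) ` W) = card W"
      by (rule card_image[OF inj_on_subset[OF inj W(2)]])
  qed
  have "(\<Prod>t\<in>W. 1 - \<zeta> ^ t) = (\<Prod>t\<in>(\<lambda>t. (2 * t) mod K) ` W. 1 - \<zeta> ^ t)" by (simp only: img)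
  also have "\<dots> = (\<Prod>t\<in>W. 1 - \<zeta> ^ (2 * t))"
    by (subst prod.reindex[OF inj_on_subset[OF inj W(2)]]) (simp add: md)
  also have "\<dots> = (\<Prod>t\<in>W. (1 + \<zeta> ^ t) * (1 - \<zeta> ^ t))"
    by (rule prod.cong) (auto simp: power_mult power2_eq_square algebra_simps power_commutes mult.commute[of 2] power_mult)
  finally have "(\<Prod>t\<in>W. 1 + \<zeta> ^ t) * (\<Prod>t\<in>W. 1 - \<zeta> ^ t) = (\<Prod>t\<in>W. 1 - \<zeta> ^ t)"
    by (simp only: prod.distrib)
  moreover have "(\<Prod>t\<in>W. 1 - \<zeta> ^ t) \<noteq> 0" using W(1) by (auto simp: W_def)
  ultimately have w: "(\<Prod>t\<in>W. 1 + \<zeta> ^ t) = 1" by simp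
  have "{..<K} = Z \<union> W" by (auto simp: Z_def W_def)
  then have "(\<Prod>t<K. 1 + \<zeta> ^ t) = (\<Prod>t\<in>Z. 1 + \<zeta> ^ t) * (\<Prod>t\<in>W. 1 + \<zeta> ^ t)"
    using W(1) by (subst prod.union_disjoint[symmetric]) (auto simp: Z_def W_def)
  also have "(\<Prod>t\<in>Z. 1 + \<zeta> ^ t) = (\<Prod>t\<in>Z. 2)" by (rule prod.cong) (auto simp: Z_def)
  finally show ?thesis by (simp add: w Z_def)
qed

lemma sum_odd_numbers: "(\<Sum>l\<in>{1..K}. 2 * real l - 1) = (real K)\<^sup>2"
  by (induction K) (simp_all add: power2_eq_square algebra_simps)

text \<open>Up to unit factors the sines are \<open>1 + \<zeta> ^ t\<close> for a
  \<open>K\<close>-th root of unity \<open>\<zeta>\<close>: as \<open>k\<close> is odd, the sign in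
  \<open>1 - exp (2 \<i> \<theta>)\<close> is \<open>exp (\<i> \<pi> k)\<close>, a formal power
  \<open>\<zeta>^(K/2)\<close>, and with \<open>K = 2 n - 1\<close> it moves the exponent
  \<open>l - 1/2\<close> to the integer \<open>l + n - 1\<close>.\<close>

lemma prod_sines_odd:
  fixes n r :: nat
  assumes n: "n \<ge> 1" and K: "K = 2 * n - 1" and k: "k = 2 * r + 1"
  shows "(\<Prod>l\<in>{1..K}. 2 * \<i> * of_real (sin (real k * ((2 * real l - 1) * pi / (2 * real K))))) =
    - \<i> * (-1) ^ (n + r) * 2 ^ gcd k K"
proof -
  have K0: "K > 0" "odd K" using n K by auto
  define \<theta> where "\<theta> l = real k * ((2 * real l - 1) * pi / (2 * real K))" for l
  define \<zeta> where "\<zeta> = cis (2 * pi * real k / real K)"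
  have zp: "\<zeta> ^ t = cis (2 * pi * real k * real t / real K)" for t
    unfolding \<zeta>_def Complex.DeMoivre by (rule arg_cong[of _ _ cis]) (simp add: field_simps)
  have z1: "\<zeta> ^ t = 1 \<longleftrightarrow> K dvd k * t" for t
  proof -
    have "\<zeta> ^ t = exp (2 * of_real pi * \<i> * of_nat (k * t) / of_nat K)"
      unfolding zp cis_conv_exp by (simp add: algebra_simps)
    then show ?thesis using complex_root_unity_eq_1[of K "k * t"] K0 by simp
  qed
  have zK: "\<zeta> ^ K = 1" by (simp add: z1)
  have md: "\<zeta> ^ (m mod K) = \<zeta> ^ m" for m
  proof -
    have "\<zeta> ^ m = \<zeta> ^ (K * (m div K) + m mod K)" by simp
    also have "\<dots> = \<zeta> ^ (m mod K)" by (simp only: power_add power_mult zK power_one mult_1)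
    finally show ?thesis by simp
  qed
  have f: "2 * \<i> * of_real (sin (\<theta> l)) = - cis (- \<theta> l) * (1 + \<zeta> ^ (l + n - 1))" if "l \<in> {1..K}" for l
  proof -
    have "2 * pi * real k * real (l + n - 1) / real K = 2 * \<theta> l + pi * real k"
    proof -
      have "2 * real (l + n - 1) = (2 * real l - 1) + real K" using that n K by auto
      moreover have "2 * pi * real k * real (l + n - 1) / real K = pi * real k * (2 * real (l + n - 1)) / real K"
        by simp
      ultimately have "2 * pi * real k * real (l + n - 1) / real K = pi * real k * ((2 * real l - 1) + real K) / real K"
        by (simp only:)
      also have "\<dots> = 2 * \<theta> l + pi * real k"
        unfolding \<theta>_def using K0 by (simp add: field_simps)
      finally show ?thesis .
    qed
    then have "\<zeta> ^ (l + n - 1) = cis (2 * \<theta> l) * cis (pi * real k)" unfolding zp cis_mult by simp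
    also have "cis (pi * real k) = cis pi ^ k" by (simp only: Complex.DeMoivre mult.commute)
    also have "\<dots> = -1" by (simp add: k)
    finally have "1 + \<zeta> ^ (l + n - 1) = 1 - cis (2 * \<theta> l)" by simp
    moreover have "- cis (- \<theta> l) * (1 - cis (2 * \<theta> l)) = cis (\<theta> l) - cis (- \<theta> l)"
      by (simp only: right_diff_distrib mult_minus_left cis_mult) simp
    ultimately have "- cis (- \<theta> l) * (1 + \<zeta> ^ (l + n - 1)) = cis (\<theta> l) - cis (- \<theta> l)"
      by (simp only:)
    then show ?thesis by (simp add: complex_eq_iff)
  qed
  have "(\<Prod>l\<in>{1..K}. 2 * \<i> * of_real (sin (\<theta> l))) =
    (\<Prod>l\<in>{1..K}. - cis (- \<theta> l)) * (\<Prod>l\<in>{1..K}. 1 + \<zeta> ^ (l + n - 1))"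
    unfolding prod.distrib[symmetric] by (rule prod.cong[OF refl]) (rule f)
  also have "(\<Prod>l\<in>{1..K}. 1 + \<zeta> ^ (l + n - 1)) = (\<Prod>t<K. 1 + \<zeta> ^ t)"
  proof -
    have inj: "inj_on (\<lambda>l. (l + n - 1) mod K) {1..K}"
    proof (rule inj_onI)
      fix x y assume xy: "x \<in> {1..K}" "y \<in> {1..K}" "(x + n - 1) mod K = (y + n - 1) mod K"
      then have "[x - 1 + n = y - 1 + n] (mod K)" by (simp add: cong_def)
      then have "[x - 1 = y - 1] (mod K)" by (simp add: cong_add_rcancel_nat)
      then show "x = y" using xy by (auto simp: cong_def)
    qed
    have "(\<lambda>l. (l + n - 1) mod K) ` {1..K} = {..<K}"
      by (rule card_subset_eq) (use K0 inj in \<open>auto simp: card_image\<close>)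
    then have "(\<Prod>t<K. 1 + \<zeta> ^ t) = (\<Prod>t\<in>(\<lambda>l. (l + n - 1) mod K) ` {1..K}. 1 + \<zeta> ^ t)" by simp
    also have "\<dots> = (\<Prod>l\<in>{1..K}. 1 + \<zeta> ^ (l + n - 1))"
      by (subst prod.reindex[OF inj]) (simp add: md)
    finally show ?thesis by simp
  qed
  also have "(\<Prod>t<K. 1 + \<zeta> ^ t) = 2 ^ gcd k K"
    unfolding prod_one_plus_root_powers[OF K0(2) zK] z1 card_multiples_dvd[OF K0(1)] ..
  also have "(\<Prod>l\<in>{1..K}. - cis (- \<theta> l)) = - \<i> * (-1) ^ (n + r)"
  proof -
    have pc: "(\<Prod>l\<in>{1..L}. - cis (- \<theta> l)) = (-1) ^ L * cis (- (\<Sum>l\<in>{1..L}. \<theta> l))" for L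
      by (induction L) (simp_all add: cis_mult algebra_simps)
    have "(\<Sum>l\<in>{1..K}. \<theta> l) = (\<Sum>l\<in>{1..K}. 2 * real l - 1) * (real k * pi / (2 * real K))"
      unfolding \<theta>_def sum_distrib_right by (rule sum.cong) (auto simp: field_simps)
    also have "\<dots> = real k * real K * pi / 2"
      unfolding sum_odd_numbers using K0 by (simp add: power2_eq_square field_simps)
    \<comment> \<open>With \<open>k = 2 r + 1\<close> and \<open>K = 2 n - 1\<close> the angle
      \<open>k K \<pi> / 2\<close> splits into full turns, half turns counted by \<open>n\<close>
      and \<open>r\<close>, and a quarter turn.\<close>
    also have "\<dots> = real (r * n) * (2 * pi) + (real n * pi - (real r * pi + pi / 2))"
      using n by (simp add: k K of_nat_diff field_simps)
    finally have "- (\<Sum>l\<in>{1..K}. \<theta> l) = (real r * pi + pi / 2) - real n * pi - real (r * n) * (2 * pi)" by simp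
    moreover have "cis ((real r * pi + pi / 2) - real n * pi - real (r * n) * (2 * pi)) =
      cis (real r * pi) * cis (pi / 2) / (cis (real n * pi) * cis (real (r * n) * (2 * pi)))"
      by (simp only: cis_mult cis_divide diff_diff_eq)
    moreover have "cis (real m * pi) = (-1) ^ m" for m
      using Complex.DeMoivre[of pi m] by (simp add: complex_eq_iff)
    moreover have "cis (real m * (2 * pi)) = 1" for m
      using cis_multiple_2pi[of "real m"] by (simp add: mult.commute)
    ultimately have "cis (- (\<Sum>l\<in>{1..K}. \<theta> l)) = (-1) ^ r * \<i> / (-1) ^ n" by (simp del: of_nat_mult)
    then show ?thesis unfolding pc using K0(2)
      by (cases "even n"; cases "even r") (simp_all add: power_add)
  qed
  finally show ?thesis unfolding \<theta>_def .
qed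

text \<open>The middle index \<open>l = n\<close> has angle \<open>\<pi> / 2\<close>, and an even
  multiple of it has sine zero.\<close>

lemma prod_sines_even:
  fixes n :: nat
  assumes "n \<ge> 1" "K = 2 * n - 1" "even k"
  shows "(\<Prod>l\<in>{1..K}. 2 * \<i> * of_real (sin (real k * ((2 * real l - 1) * pi / (2 * real K))))) = 0"
proof (rule prod_zero)
  from assms(3) obtain j where j: "k = 2 * j" by blast
  have "real k * ((2 * real n - 1) * pi / (2 * real K)) = real j * pi"
    using assms(1,2) by (simp add: j of_nat_diff field_simps)
  then have "sin (real k * ((2 * real n - 1) * pi / (2 * real K))) = 0" by simp
  then show "\<exists>l\<in>{1..K}. 2 * \<i> * of_real (sin (real k * ((2 * real l - 1) * pi / (2 * real K)))) = (0::complex)"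
    using assms(1,2) by (intro bexI[of _ n]) auto
qed simp

lemma shift_orbit:
  fixes k N :: nat
  assumes "N > 0" "i < N"
  shows "{(i + m * k) mod N |m. 0 < m} = {j. j < N \<and> j mod gcd k N = i mod gcd k N}"
proof (intro equalityI subsetI)
  fix j assume "j \<in> {(i + m * k) mod N |m. 0 < m}"
  then obtain m where m: "j = (i + m * k) mod N" by blast
  have "j mod gcd k N = (i + m * k) mod gcd k N" unfolding m by (simp add: mod_mod_cancel)
  also have "\<dots> = i mod gcd k N"
    by (metis dvd_eq_mod_eq_0 dvd_mult gcd_dvd1 mod_add_right_eq add.right_neutral)
  finally show "j \<in> {j. j < N \<and> j mod gcd k N = i mod gcd k N}" using m assms by simp
next
  fix j assume "j \<in> {j. j < N \<and> j mod gcd k N = i mod gcd k N}"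
  then have j: "j < N" "j mod gcd k N = i mod gcd k N" by auto
  \<comment> \<open>Passing from \<open>j\<close> to \<open>j + N * i\<close> keeps the residue and
    makes the subtraction of \<open>i\<close> safe on natural numbers.\<close>
  have "(j + N * i) mod gcd k N = i mod gcd k N"
    using j(2) by (metis dvd_eq_mod_eq_0 dvd_mult2 gcd_dvd2 mod_add_right_eq add.right_neutral)
  moreover have le: "i \<le> j + N * i" using assms(1) by (cases N) auto
  ultimately have "gcd k N dvd (j + N * i) - i" by (metis mod_eq_dvd_iff_nat)
  then obtain d where d: "(j + N * i) - i = gcd k N * d" by blast
  obtain x where x: "[k * x = gcd k N] (mod N)"
    using cong_solve_nat by blast
  \<comment> \<open>The Bezout coefficient gives \<open>x * d\<close> steps; the added
    \<open>N\<close> only ensures that their number is positive.\<close>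
  have "[i + (x * d + N) * k = i + gcd k N * d] (mod N)"
  proof -
    have "[(k * x) * d + N * k = gcd k N * d + 0] (mod N)"
      by (intro cong_add cong_mult x cong_refl) (simp add: cong_0_iff)
    then show ?thesis by (simp add: cong_add_lcancel_nat algebra_simps)
  qed
  moreover have "i + gcd k N * d = j + N * i" using d le by linarith
  ultimately have "(i + (x * d + N) * k) mod N = (j + N * i) mod N" unfolding cong_def by (simp only:)
  also have "\<dots> = j" using j by simp
  finally show "j \<in> {(i + m * k) mod N |m. 0 < m}" using assms(1)
    by (intro CollectI exI[of _ "x * d + N"]) auto
qed

text \<open>\<open>perm_of\<close> forgets the signs, so \<open>C\<close> counts as a shift by
  \<open>k\<close> on \<open>N\<close> positions, whose orbits are the residue classes modulo the
  gcd.\<close>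

lemma num_cycles_shift:
  fixes C :: "real^'k^('k::finite)"
  assumes "N > 0" "bij_betw jx {..<N} (UNIV :: 'k set)"
    and sh: "\<And>i. i < N \<Longrightarrow> C *v axis (jx i) 1 = axis (jx ((i + k) mod N)) 1 \<or>
      C *v axis (jx i) 1 = - axis (jx ((i + k) mod N)) 1"
  shows "num_cycles C = gcd k N"
proof -
  define g where "g = gcd k N"
  have g: "g > 0" "g dvd N" using assms(1) by (auto simp: g_def)
  have axn: "axis a (1::real) \<noteq> - axis c 1" for a c :: 'k
  proof
    assume "axis a (1::real) = - axis c 1"
    then have "axis a (1::real) $ a = (- axis c 1) $ a" by simp
    then show False by (simp add: axis_def split: if_splits)
  qed
  have axe: "axis a (1::real) = axis c 1 \<longleftrightarrow> a = c" for a c :: 'k by (simp add: axis_eq_axis)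
  have p: "perm_of C (jx i) = jx ((i + k) mod N)" if "i < N" for i
    unfolding perm_of_def
  proof (rule the_equality)
    show "C *v axis (jx i) 1 = axis (jx ((i + k) mod N)) 1 \<or> C *v axis (jx i) 1 = - axis (jx ((i + k) mod N)) 1"
      by (rule sh[OF that])
    fix j assume "C *v axis (jx i) 1 = axis j 1 \<or> C *v axis (jx i) 1 = - axis j 1"
    then show "j = jx ((i + k) mod N)" using sh[OF that] axn axe
      by (metis neg_equal_iff_equal)
  qed
  have pm: "(perm_of C ^^ m) (jx i) = jx ((i + m * k) mod N)" if "i < N" for i m
  proof (induction m)
    case (Suc m)
    have "(perm_of C ^^ Suc m) (jx i) = jx (((i + m * k) mod N + k) mod N)"
      using Suc assms(1) by (simp add: p)
    also have "((i + m * k) mod N + k) mod N = (i + Suc m * k) mod N"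
      by (simp only: mod_add_left_eq) (simp add: algebra_simps)
    finally show ?case .
  qed (simp add: that)
  have orb: "orbit (perm_of C) (jx i) = jx ` {j. j < N \<and> j mod g = i mod g}" if "i < N" for i
    unfolding orbit_altdef g_def shift_orbit[OF assms(1) that, symmetric]
    by (auto simp: pm[OF that])
  have inj: "inj_on jx {..<N}" and img: "jx ` {..<N} = UNIV" using assms(2) by (auto simp: bij_betw_def)
  have "range (orbit (perm_of C)) = (\<lambda>c. jx ` {j. j < N \<and> j mod g = c}) ` {..<g}"
  proof (intro equalityI subsetI)
    fix S assume "S \<in> range (orbit (perm_of C))"
    then obtain x where x: "S = orbit (perm_of C) x" by blast
    obtain i where "i < N" "x = jx i" using img by (metis UNIV_I imageE lessThan_iff)
    then show "S \<in> (\<lambda>c. jx ` {j. j < N \<and> j mod g = c}) ` {..<g}"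
      using x orb g by (intro image_eqI[of _ _ "i mod g"]) auto
  next
    fix S assume "S \<in> (\<lambda>c. jx ` {j. j < N \<and> j mod g = c}) ` {..<g}"
    then obtain c where c: "c < g" "S = jx ` {j. j < N \<and> j mod g = c}" by auto
    have "c < N" using c(1) g(2) assms(1) by (meson dvd_imp_le less_le_trans)
    then have "S = orbit (perm_of C) (jx c)" using c orb[of c] by simp
    then show "S \<in> range (orbit (perm_of C))" by (rule range_eqI)
  qed
  moreover have "inj_on (\<lambda>c. jx ` {j. j < N \<and> j mod g = c}) {..<g}"
  proof (rule inj_onI)
    fix c d assume cd: "c \<in> {..<g}" "d \<in> {..<g}"
      "jx ` {j. j < N \<and> j mod g = c} = jx ` {j. j < N \<and> j mod g = d}"
    have "c < N" using cd(1) g(2) assms(1) by (meson dvd_imp_le lessThan_iff less_le_trans)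
    then have "jx c \<in> jx ` {j. j < N \<and> j mod g = c}" using cd(1) by auto
    then have "jx c \<in> jx ` {j. j < N \<and> j mod g = d}" unfolding cd(3) .
    then obtain j where "j < N" "j mod g = d" "jx c = jx j" by auto
    then have "c = j" using inj \<open>c < N\<close> by (auto simp: inj_on_def)
    then show "c = d" using \<open>j mod g = d\<close> cd(1) by simp
  qed
  ultimately show ?thesis unfolding num_cycles_def g_def[symmetric] by (simp add: card_image)
qed

section \<open>The crystallographic group\<close>

lemma matrix_pow_0 [simp]: "matrix_pow C 0 = mat 1"
  by (simp add: matrix_pow_def)

lemma matrix_pow_Suc: "matrix_pow C (Suc k) = C ** matrix_pow C k"
  by (simp add: matrix_pow_def)

lemma matrix_pow_add: "matrix_pow C (k + l) = matrix_pow C k ** matrix_pow C l"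
  by (induction k) (simp_all add: matrix_pow_Suc matrix_mul_assoc matrix_mul_lid)

lemma orthogonal_matrix_pow: "orthogonal_matrix C \<Longrightarrow> orthogonal_matrix (matrix_pow C k)"
  by (induction k) (simp_all add: matrix_pow_Suc orthogonal_matrix_mul orthogonal_matrix_id)

lemma det_matrix_pow: "det C = 1 \<Longrightarrow> det (matrix_pow C k) = 1"
  by (induction k) (simp_all add: matrix_pow_Suc det_mul)

lemma orthogonal_matrix_inner:
  assumes "orthogonal_matrix (C :: real^'n^'n)" shows "(C *v x) \<bullet> (C *v y) = x \<bullet> y"
  using assms orthogonal_transformation_matrix[of "(*v) C"]
  by (simp add: orthogonal_transformation_def)

lemma matrix_eq_axis:
  assumes "\<And>i. C *v axis i 1 = D *v axis i (1::real)" shows "C = (D :: real^'n^'m)"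
proof -
  have "C $ i $ j = D $ i $ j" for i j
    using arg_cong[OF assms[of j], of "\<lambda>v. v $ i"] by (simp add: matrix_vector_mult_basis column_def)
  then show ?thesis by (simp add: vec_eq_iff)
qed

lemma UNIV_option_sum: "(\<Sum>i\<in>UNIV. f i) = f None + (\<Sum>a\<in>UNIV. f (Some a))"
  for f :: "'k::finite option \<Rightarrow> 'b::comm_monoid_add"
  unfolding UNIV_option_conv by (subst sum.insert) (auto simp: sum.reindex)

lemma block_one_mult_Some: "(block_one C *v x) $ Some a = (C *v (\<chi> c. x $ Some c)) $ a"
  by (simp add: matrix_vector_mult_def block_one_def UNIV_option_sum)

lemma block_one_mult_None: "(block_one C *v x) $ None = x $ None"
  by (simp add: matrix_vector_mult_def block_one_def UNIV_option_sum)

lemma block_one_mult: "block_one C ** block_one D = block_one (C ** D)"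
  by (simp add: vec_eq_iff matrix_matrix_mult_def block_one_def UNIV_option_sum split: option.split)

lemma block_one_mat_1: "block_one (mat 1) = mat 1"
  by (simp add: vec_eq_iff block_one_def mat_def split: option.split)

lemma matrix_pow_block_one: "matrix_pow (block_one C) k = block_one (matrix_pow C k)"
  by (induction k) (simp_all add: matrix_pow_Suc block_one_mult block_one_mat_1)

lemma transpose_block_one: "transpose (block_one C) = block_one (transpose C)"
  by (simp add: vec_eq_iff transpose_def block_one_def split: option.split)

lemma block_one_axis_None: "block_one C *v axis None x = axis None x"
proof -
  have e: "(\<chi> c. axis None x $ Some c) = 0" by (simp add: vec_eq_iff axis_def)
  have "(block_one C *v axis None x) $ i = axis None x $ i" for i
    by (cases i) (simp_all only: block_one_mult_Some block_one_mult_None e, simp_all add: axis_def)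
  then show ?thesis by (simp add: vec_eq_iff)
qed

lemma block_one_embed_first: "block_one C *v embed_first v = embed_first (C *v v)"
proof -
  have "(\<chi> c. embed_first v $ Some c) = v" by (simp add: vec_eq_iff embed_first_def)
  then have "(block_one C *v embed_first v) $ i = embed_first (C *v v) $ i" for i
    by (cases i) (simp_all add: block_one_mult_Some block_one_mult_None embed_first_def)
  then show ?thesis by (simp add: vec_eq_iff)
qed

lemma neg_mat_1_mult: "(- mat 1) *v x = - (x :: real^'n::finite)"
  using matrix_vector_mult_diff_rdistrib[of 0 "mat 1" x] by simp

definition integer_vec :: "real^'n \<Rightarrow> bool" where
  "integer_vec v \<longleftrightarrow> (\<forall>i. v $ i \<in> \<int>)"

lemma integer_vec_simps [simp]:
  "integer_vec 0" "integer_vec v \<Longrightarrow> integer_vec w \<Longrightarrow> integer_vec (v + w)"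
  "integer_vec v \<Longrightarrow> integer_vec w \<Longrightarrow> integer_vec (v - w)" "integer_vec v \<Longrightarrow> integer_vec (- v)"
  by (auto simp: integer_vec_def)

lemma integer_vec_axis: "r \<in> \<int> \<Longrightarrow> integer_vec (axis i r)"
  by (auto simp: integer_vec_def axis_def)

lemma card_integer_vec_box:
  fixes B :: nat
  shows "finite {v :: real^'n::finite. integer_vec v \<and> (\<forall>i. \<bar>v $ i\<bar> \<le> B)}" (is "finite ?S")
    and "card {v :: real^'n::finite. integer_vec v \<and> (\<forall>i. \<bar>v $ i\<bar> \<le> B)} \<le> (2 * B + 1) ^ CARD('n)"
proof -
  let ?T = "PiE (UNIV :: 'n set) (\<lambda>_. {- int B..int B})"
  let ?f = "\<lambda>(v :: real^'n) i. \<lfloor>v $ i\<rfloor>"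
  have inj: "inj_on ?f ?S"
  proof (rule inj_onI)
    fix v w assume vw: "v \<in> ?S" "w \<in> ?S" "?f v = ?f w"
    have "v $ i = w $ i" for i
    proof -
      have "v $ i \<in> \<int>" "w $ i \<in> \<int>" using vw(1,2) by (auto simp: integer_vec_def)
      then show ?thesis using fun_cong[OF vw(3), of i] by (metis Ints_cases floor_of_int)
    qed
    then show "v = w" by (simp add: vec_eq_iff)
  qed
  have sub: "?f ` ?S \<subseteq> ?T"
  proof
    fix g assume "g \<in> ?f ` ?S"
    then obtain v where v: "g = ?f v" "v \<in> ?S" by blast
    have "\<lfloor>v $ i\<rfloor> \<in> {- int B..int B}" for i
    proof -
      have "\<bar>v $ i\<bar> \<le> B" using v by simp
      then show ?thesis by (auto simp: le_floor_iff floor_le_iff abs_le_iff)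
    qed
    then show "g \<in> ?T" by (simp add: v(1) PiE_UNIV_domain)
  qed
  have fin: "finite ?T" by (intro finite_PiE) auto
  show "finite ?S" using finite_imageD[OF finite_subset[OF sub fin] inj] .
  have "card ?S = card (?f ` ?S)" by (simp add: card_image[OF inj])
  also have "\<dots> \<le> card ?T" by (rule card_mono[OF fin sub])
  also have "\<dots> = (2 * B + 1) ^ CARD('n)" by (simp add: card_PiE nat_add_distrib nat_mult_distrib)
  finally show "card ?S \<le> (2 * B + 1) ^ CARD('n)" .
qed

lemma group_motions: "group (motions :: 'm::finite motion monoid)"
proof (rule groupI)
  fix x y :: "'m motion"
  assume "x \<in> carrier motions" "y \<in> carrier motions"
  then show "x \<otimes>\<^bsub>motions\<^esub> y \<in> carrier motions"
    by (auto simp: motions_def orthogonal_matrix_mul det_mul)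
next
  show "\<one>\<^bsub>motions\<^esub> \<in> carrier (motions :: 'm motion monoid)"
    by (simp add: motions_def orthogonal_matrix_id)
next
  fix x y z :: "'m motion"
  show "x \<otimes>\<^bsub>motions\<^esub> y \<otimes>\<^bsub>motions\<^esub> z = x \<otimes>\<^bsub>motions\<^esub> (y \<otimes>\<^bsub>motions\<^esub> z)"
    by (simp add: motions_def split_beta matrix_mul_assoc matrix_vector_mul_assoc[symmetric] matrix_vector_right_distrib)
next
  fix x :: "'m motion"
  show "\<one>\<^bsub>motions\<^esub> \<otimes>\<^bsub>motions\<^esub> x = x"
    by (simp add: motions_def split_beta matrix_mul_lid)
  assume "x \<in> carrier motions"
  then obtain C c where x: "x = (C, c)" "orthogonal_matrix C" "det C = 1" by (auto simp: motions_def)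
  show "\<exists>y\<in>carrier motions. y \<otimes>\<^bsub>motions\<^esub> x = \<one>\<^bsub>motions\<^esub>"
  proof (rule bexI)
    show "(transpose C, - (transpose C *v c)) \<otimes>\<^bsub>motions\<^esub> x = \<one>\<^bsub>motions\<^esub>"
      using x by (simp add: motions_def orthogonal_matrix_def)
    show "(transpose C, - (transpose C *v c)) \<in> carrier motions"
      using x by (simp add: motions_def orthogonal_matrix_transpose)
  qed
qed

lemma act_mult: "act (g \<otimes>\<^bsub>motions\<^esub> h) x = act g (act h x)"
  by (simp add: act_def motions_def split_beta matrix_vector_mul_assoc[symmetric] matrix_vector_right_distrib)

section \<open>Powers of the signed cyclic shift\<close>

locale shift_matrix =
  fixes A :: "real^'k^('k::finite)" and jx :: "nat \<Rightarrow> 'k" and N :: nat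
  assumes N_pos: "N > 0" and even_N: "even N" and jx_bij: "bij_betw jx {..<N} UNIV"
    and A_step: "\<And>i. Suc i < N \<Longrightarrow> A *v axis (jx i) 1 = axis (jx (Suc i)) 1"
    and A_wrap: "A *v axis (jx (N - 1)) 1 = - axis (jx 0) 1"
begin

lemma jx_surj: obtains i where "i < N" "a = jx i"
  using jx_bij by (metis bij_betw_def imageE UNIV_I lessThan_iff)

lemma jx_inj: "i < N \<Longrightarrow> j < N \<Longrightarrow> jx i = jx j \<longleftrightarrow> i = j"
  using jx_bij by (auto simp: bij_betw_def inj_on_def)

text \<open>Up to the \<open>N\<close>-th power a basis vector passes the sign change at most once,
  so the sign is explicit here; \<open>matrix_pow_axis_mod\<close> covers all exponents but leaves
  it open.\<close>

lemma matrix_pow_axis: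
  assumes "i < N" "m \<le> N"
  shows "matrix_pow A m *v axis (jx i) 1 =
    (if i + m < N then axis (jx (i + m)) 1 else - axis (jx (i + m - N)) 1)"
  using assms(2)
proof (induction m)
  case (Suc m)
  have neg: "A *v (- x) = - (A *v x)" for x by (simp add: vec.neg)
  have e: "matrix_pow A (Suc m) *v axis (jx i) 1 = A *v (matrix_pow A m *v axis (jx i) 1)"
    by (simp add: matrix_pow_Suc matrix_vector_mul_assoc)
  consider "Suc (i + m) < N" | "Suc (i + m) = N" | "i + m \<ge> N" by linarith
  then show ?case
  proof cases
    case 1
    then show ?thesis using Suc unfolding e by (simp add: A_step)
  next
    case 2
    then have "i + m = N - 1" by simp
    then show ?thesis using Suc 2 A_wrap unfolding e by simp
  next
    case 3
    then have "A *v axis (jx (i + m - N)) 1 = axis (jx (Suc (i + m - N))) 1"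
      using assms(1) Suc.prems by (intro A_step) linarith
    then show ?thesis using Suc 3 unfolding e by (simp add: neg Suc_diff_le)
  qed
qed (use assms(1) in simp)

lemma A_axis:
  assumes "i < N"
  shows "A *v axis (jx i) 1 = axis (jx (Suc i mod N)) 1 \<or> A *v axis (jx i) 1 = - axis (jx (Suc i mod N)) 1"
proof (cases "Suc i < N")
  case False
  then have N: "N = Suc i" using assms by simp
  then show ?thesis using A_wrap by (simp add: N)
qed (use A_step[of i] in auto)

lemma matrix_pow_axis_mod:
  assumes "i < N"
  shows "matrix_pow A k *v axis (jx i) 1 = axis (jx ((i + k) mod N)) 1 \<or>
    matrix_pow A k *v axis (jx i) 1 = - axis (jx ((i + k) mod N)) 1"
proof (induction k)
  case (Suc k)
  have e: "matrix_pow A (Suc k) *v axis (jx i) 1 = A *v (matrix_pow A k *v axis (jx i) 1)"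
    by (simp add: matrix_pow_Suc matrix_vector_mul_assoc)
  have neg: "A *v (- x) = - (A *v x)" for x by (simp add: vec.neg)
  have s: "Suc ((i + k) mod N) mod N = (i + Suc k) mod N" by (simp add: mod_Suc_eq)
  show ?case using Suc.IH A_axis[of "(i + k) mod N"] N_pos unfolding e s by (auto simp: neg)
qed (use assms in simp)

lemma num_cycles_matrix_pow: "num_cycles (matrix_pow A k) = gcd k N"
  by (rule num_cycles_shift[OF N_pos jx_bij]) (rule matrix_pow_axis_mod)

lemma orthogonal_A: "orthogonal_matrix A"
  unfolding orthogonal_matrix_orthonormal_columns
proof (intro conjI allI impI)
  fix a
  obtain i where i: "i < N" "a = jx i" by (rule jx_surj)
  show "norm (column a A) = 1"
    using A_axis[OF i(1)] by (auto simp: i(2) matrix_vector_mult_basis)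
next
  fix a c :: 'k assume "a \<noteq> c"
  obtain i where i: "i < N" "a = jx i" by (rule jx_surj)
  obtain j where j: "j < N" "c = jx j" by (rule jx_surj)
  have "Suc i mod N \<noteq> Suc j mod N"
    using i j \<open>a \<noteq> c\<close> by (auto simp: mod_Suc split: if_splits)
  then have "jx (Suc i mod N) \<noteq> jx (Suc j mod N)" using N_pos by (simp add: jx_inj)
  then show "orthogonal (column a A) (column c A)"
    using A_axis[OF i(1)] A_axis[OF j(1)]
    by (auto simp: i(2) j(2) matrix_vector_mult_basis orthogonal_def inner_axis_axis)
qed

lemma matrix_pow_N: "matrix_pow A N = - mat 1"
proof (rule matrix_eq_axis)
  fix a
  obtain i where i: "i < N" "a = jx i" by (rule jx_surj)
  show "matrix_pow A N *v axis a 1 = (- mat 1) *v axis a 1"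
    using matrix_pow_axis[OF i(1), of N] i by (simp add: neg_mat_1_mult)
qed

lemma A_integer: "integer_vec v \<Longrightarrow> integer_vec (A *v v)"
proof -
  assume v: "integer_vec v"
  have "(A *v v) $ c = (\<Sum>a\<in>UNIV. v $ a * column a A $ c)" for c
    by (simp add: matrix_mult_sum)
  moreover have "column a A $ c \<in> \<int>" for a c
  proof -
    obtain i where i: "i < N" "a = jx i" by (rule jx_surj)
    have "column a A = axis (jx (Suc i mod N)) 1 \<or> column a A = - axis (jx (Suc i mod N)) 1"
      using A_axis[OF i(1)] by (simp add: i(2) matrix_vector_mult_basis)
    then show ?thesis by (auto simp: axis_def)
  qed
  ultimately show ?thesis using v by (auto simp: integer_vec_def)
qed

abbreviation "A' \<equiv> block_one A"
definition rot :: "nat \<Rightarrow> real^('k option)^('k option)" where "rot k = matrix_pow A' k"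

lemma orthogonal_A': "orthogonal_matrix A'"
  using orthogonal_A by (simp add: orthogonal_matrix_def transpose_block_one block_one_mult block_one_mat_1)

lemma rot_N_Some: "(rot N *v x) $ Some a = - x $ Some a"
  unfolding rot_def matrix_pow_block_one matrix_pow_N block_one_mult_Some neg_mat_1_mult by simp

text \<open>By orthogonality \<open>A' + 1 = A' ** transpose (A' + 1)\<close>, so the determinant is
  \<open>1\<close> once \<open>A' + 1\<close> is invertible. A vector with \<open>A' x = -x\<close>
  would be fixed by the even power \<open>rot N\<close>, which negates the first coordinates, and
  its last coordinate equals its own negative.\<close>

lemma det_A': "det A' = 1"
proof -
  let ?I = "mat 1 :: real^('k option)^('k option)"
  have "A' + ?I = A' ** transpose (A' + ?I)"
  proof -
    have "transpose (A' + ?I) = transpose A' + ?I" by (simp add: vec_eq_iff transpose_def mat_def)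
    then show ?thesis using orthogonal_A'
      by (simp add: matrix_add_ldistrib orthogonal_matrix_def add.commute)
  qed
  then have "det (A' + ?I) = det A' * det (A' + ?I)" by (metis det_mul det_transpose)
  moreover have "det (A' + ?I) \<noteq> 0"
  proof -
    have "x = 0" if "(A' + ?I) *v x = 0" for x
    proof -
      have x: "A' *v x = - x" using that by (simp add: matrix_vector_mult_add_rdistrib eq_neg_iff_add_eq_0)
      have "rot m *v x = (if even m then x else - x)" for m
      proof (induction m)
        case (Suc m)
        have "rot (Suc m) *v x = A' *v (rot m *v x)" by (simp add: rot_def matrix_pow_Suc matrix_vector_mul_assoc)
        then show ?case using Suc x by (auto simp: vec.neg)
      qed (simp add: rot_def)
      then have "rot N *v x = x" using even_N by simp
      then have "x $ Some a = 0" for a using rot_N_Some[of x a] by simp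
      moreover have "x $ None = 0" using block_one_mult_None[of A x] x by simp
      ultimately show ?thesis by (metis (no_types) option.exhaust vec_eq_iff zero_index)
    qed
    then have "\<exists>B. B ** (A' + ?I) = mat 1" unfolding matrix_left_invertible_ker by blast
    then show ?thesis by (metis invertible_det_nz invertible_left_inverse)
  qed
  ultimately show ?thesis by simp
qed

lemma orthogonal_rot: "orthogonal_matrix (rot k)" and det_rot: "det (rot k) = 1"
  unfolding rot_def using orthogonal_matrix_pow[OF orthogonal_A'] det_matrix_pow[OF det_A'] by auto

lemma rot_add: "rot (k + l) = rot k ** rot l" and rot_0: "rot 0 = mat 1"
  by (simp_all add: rot_def matrix_pow_add)

lemma rot_2N: "rot (2 * N) = mat 1"
proof -
  have "matrix_pow A (N + N) = mat 1" unfolding matrix_pow_add matrix_pow_N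
    by (simp add: vec_eq_iff matrix_matrix_mult_def mat_def if_distrib[of "\<lambda>x. x * _"] cong: if_cong)
  then show ?thesis by (simp add: rot_def matrix_pow_block_one block_one_mat_1 mult_2)
qed

lemma rot_mod: "rot (k mod (2 * N)) = rot k"
proof -
  have m: "rot (2 * N * q) = mat 1" for q
    by (induction q) (simp_all add: rot_0 rot_add rot_2N matrix_mul_lid)
  have "rot k = rot (2 * N * (k div (2 * N)) + k mod (2 * N))" by simp
  then show ?thesis by (simp only: rot_add m matrix_mul_lid)
qed

lemma rot_axis_None: "rot k *v axis None r = axis None r"
  by (simp add: rot_def matrix_pow_block_one block_one_axis_None)

lemma rot_None: "(rot k *v x) $ None = x $ None"
  by (simp add: rot_def matrix_pow_block_one block_one_mult_None)

lemma rot_integer: "integer_vec v \<Longrightarrow> integer_vec (rot k *v v)"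
proof (induction k)
  case (Suc k)
  then have i: "integer_vec (rot k *v v)" by simp
  have "integer_vec (A' *v w)" if w: "integer_vec w" for w
  proof -
    have "integer_vec (\<chi> c. w $ Some c)" using w by (simp add: integer_vec_def)
    then have "integer_vec (A *v (\<chi> c. w $ Some c))" by (rule A_integer)
    then show ?thesis unfolding integer_vec_def
      using w by (metis (full_types) block_one_mult_None block_one_mult_Some integer_vec_def option.exhaust)
  qed
  from this[OF i] show ?case by (simp add: rot_def matrix_pow_Suc matrix_vector_mul_assoc)
qed (simp add: rot_0)

text \<open>The vector \<open>axis (jx 0) 1\<close> detects the order: for
  \<open>0 < m < 2 N\<close> its image under \<open>A^m\<close> is another basis vector or the
  negative of a basis vector.\<close>

lemma rot_eq_1: "rot k = mat 1 \<longleftrightarrow> 2 * N dvd k"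
proof
  assume "rot k = mat 1"
  define m where "m = k mod (2 * N)"
  have m: "m < 2 * N" "rot m = mat 1" using N_pos \<open>rot k = mat 1\<close> by (auto simp: m_def rot_mod)
  have p: "matrix_pow A m = mat 1"
  proof -
    have "block_one (matrix_pow A m) $ Some a $ Some c = mat 1 $ Some a $ Some c" for a c
      using m(2) by (simp add: rot_def matrix_pow_block_one)
    then show ?thesis by (simp add: vec_eq_iff block_one_def mat_def)
  qed
  have naxis: "- axis a (1::real) \<noteq> axis c 1" for a c :: 'k
  proof
    assume "- axis a (1::real) = axis c 1"
    then have "(- axis a (1::real)) $ c = axis c 1 $ c" by simp
    then show False by (simp add: axis_def split: if_splits)
  qed
  have "m = 0"
  proof (rule ccontr)
    assume "m \<noteq> 0"
    show False
    proof (cases "m \<le> N")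
      case True
      have "matrix_pow A m *v axis (jx 0) 1 = axis (jx 0) 1" by (simp add: p)
      then show False using matrix_pow_axis[OF N_pos True] naxis \<open>m \<noteq> 0\<close> N_pos
        by (auto simp: axis_eq_axis jx_inj split: if_splits)
    next
      case False
      then have "m - N < N" "m = N + (m - N)" using m by auto
      then have "matrix_pow A m *v axis (jx 0) 1 = - (matrix_pow A (m - N) *v axis (jx 0) 1)"
        by (metis matrix_pow_add matrix_pow_N neg_mat_1_mult matrix_vector_mul_assoc)
      then have "matrix_pow A (m - N) *v axis (jx 0) 1 = - axis (jx 0) 1"
        by (metis p matrix_vector_mul_lid minus_minus)
      then show False using matrix_pow_axis[OF N_pos, of "m - N"] naxis naxis[symmetric] \<open>m - N < N\<close> N_pos False by auto
    qed
  qed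
  then show "2 * N dvd k" by (simp add: m_def dvd_eq_mod_eq_0)
next
  assume "2 * N dvd k"
  then show "rot k = mat 1" using rot_mod[of k] by (simp add: dvd_eq_mod_eq_0 rot_0)
qed

end

section \<open>Fourier coefficients of periodic functions\<close>

definition periodic :: "(real^'m \<Rightarrow> complex) \<Rightarrow> bool" where
  "periodic f \<longleftrightarrow> (\<forall>x v. integer_vec v \<longrightarrow> f (x + v) = f x)"

definition wave :: "real^'m \<Rightarrow> real^'m \<Rightarrow> complex" where
  "wave \<xi> x = exp (2 * of_real pi * \<i> * of_real (\<xi> \<bullet> x))"

abbreviation unit_cube :: "(real^'m::finite) set" where
  "unit_cube \<equiv> cbox 0 (\<chi> i. 1)"

definition fourier :: "real^'m \<Rightarrow> (real^'m::finite \<Rightarrow> complex) \<Rightarrow> complex" where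
  "fourier \<xi> f = integral unit_cube (\<lambda>x. f x * wave (- \<xi>) x)"

lemma wave_add_left: "wave (\<xi> + \<eta>) x = wave \<xi> x * wave \<eta> x"
  by (simp add: wave_def inner_add_left algebra_simps exp_add)

lemma wave_add_right: "wave \<xi> (x + y) = wave \<xi> x * wave \<xi> y"
  by (simp add: wave_def inner_add_right algebra_simps exp_add)

lemma wave_zero [simp]: "wave 0 x = 1" "wave \<xi> 0 = 1"
  by (simp_all add: wave_def)

lemma norm_wave [simp]: "norm (wave \<xi> x) = 1"
  by (simp add: wave_def norm_exp_eq_Re)

lemma wave_nonzero [simp]: "wave \<xi> x \<noteq> 0"
  by (simp add: wave_def)

lemma wave_integer:
  assumes "integer_vec \<xi>" "integer_vec v" shows "wave \<xi> v = 1"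
proof -
  have "\<xi> \<bullet> v \<in> \<int>"
    using assms by (auto simp: inner_vec_def integer_vec_def intro!: Ints_sum)
  then obtain k where k: "\<xi> \<bullet> v = of_int k" by (elim Ints_cases)
  have "wave \<xi> v = exp (2 * of_real pi * \<i> * of_int k)" by (simp add: wave_def k)
  also have "\<dots> = 1" using exp_integer_2pi[of "of_int k"] by (simp add: mult_ac)
  finally show ?thesis .
qed

lemma periodic_wave: "integer_vec \<xi> \<Longrightarrow> periodic (wave \<xi>)"
  by (simp add: periodic_def wave_add_right wave_integer)

lemma periodic_mult: "periodic f \<Longrightarrow> periodic g \<Longrightarrow> periodic (\<lambda>x. f x * g x)"
  by (simp add: periodic_def)

lemma wave_has_derivative:
  "(wave \<xi> has_derivative (\<lambda>v. 2 * of_real pi * \<i> * of_real (\<xi> \<bullet> v) * wave \<xi> x)) (at x)"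
proof -
  have "((\<lambda>x. 2 * of_real pi * \<i> * complex_of_real (\<xi> \<bullet> x)) has_derivative
      (\<lambda>v. 2 * of_real pi * \<i> * of_real (\<xi> \<bullet> v))) (at x)"
    by (auto intro!: derivative_eq_intros)
  moreover have "(exp has_derivative (\<lambda>h. exp z * h)) (at z)" for z :: complex
    using DERIV_exp[of z] by (simp add: has_field_derivative_def)
  ultimately have "((\<lambda>x. exp (2 * of_real pi * \<i> * complex_of_real (\<xi> \<bullet> x))) has_derivative
      (\<lambda>v. exp (2 * of_real pi * \<i> * of_real (\<xi> \<bullet> x)) * (2 * of_real pi * \<i> * of_real (\<xi> \<bullet> v)))) (at x)"
    by (rule has_derivative_compose)
  then show ?thesis unfolding wave_def[abs_def] by (simp add: mult_ac)
qed

lemma continuous_on_wave [continuous_intros]: "continuous_on S (wave \<xi>)"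
  unfolding wave_def[abs_def] by (intro continuous_intros)

section \<open>Directional derivatives of smooth functions\<close>

lemma dir_derivI: "(f has_derivative f') (at x) \<Longrightarrow> dir_deriv v f x = f' v"
  unfolding dir_deriv_def using frechet_derivative_at by metis

lemma dir_deriv_wave: "dir_deriv v (wave \<xi>) = (\<lambda>x. (2 * of_real pi * \<i> * of_real (\<xi> \<bullet> v)) * wave \<xi> x)"
  by (rule ext) (rule dir_derivI[OF wave_has_derivative])

lemma dir_deriv_lin2:
  assumes "f differentiable at x" "g differentiable at x"
  shows "dir_deriv v (\<lambda>x. c * f x + d * g x) x = c * dir_deriv v f x + d * dir_deriv v g x"
proof -
  have "(f has_derivative frechet_derivative f (at x)) (at x)" "(g has_derivative frechet_derivative g (at x)) (at x)"
    using assms frechet_derivative_works by auto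
  then have "((\<lambda>x. c * f x + d * g x) has_derivative
    (\<lambda>v. c * frechet_derivative f (at x) v + d * frechet_derivative g (at x) v)) (at x)"
    by (auto intro!: derivative_eq_intros)
  from dir_derivI[OF this] show ?thesis by (simp add: dir_deriv_def)
qed

lemma smooth_foldr: "smooth f \<Longrightarrow> foldr dir_deriv vs f differentiable at x"
  by (simp add: smooth_def differentiable_on_def)

lemma smooth_differentiable: "smooth f \<Longrightarrow> f differentiable at x"
  using smooth_foldr[of f "[]"] by simp

lemma smooth_dir_deriv: "smooth f \<Longrightarrow> smooth (dir_deriv v f)"
  unfolding smooth_def
proof
  fix vs assume "\<forall>vs. foldr dir_deriv vs f differentiable_on UNIV"
  then have "foldr dir_deriv (vs @ [v]) f differentiable_on UNIV" by blast
  then show "foldr dir_deriv vs (dir_deriv v f) differentiable_on UNIV" by simp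
qed

lemma smooth_continuous: "smooth f \<Longrightarrow> continuous_on UNIV f"
  using smooth_differentiable
  by (auto intro!: continuous_at_imp_continuous_on differentiable_imp_continuous_within)

lemma smooth_lin2:
  assumes "smooth f" "smooth g" shows "smooth (\<lambda>x. c * f x + d * g x)"
proof -
  have "foldr dir_deriv vs (\<lambda>x. c * f x + d * g x) = (\<lambda>x. c * foldr dir_deriv vs f x + d * foldr dir_deriv vs g x)" for vs
    by (induction vs) (auto simp: dir_deriv_lin2 smooth_foldr assms)
  moreover have "(\<lambda>x. c * foldr dir_deriv vs f x + d * foldr dir_deriv vs g x) differentiable at x" for vs x
    using smooth_foldr[OF assms(1), of vs x] smooth_foldr[OF assms(2), of vs x]
    by (intro differentiable_add differentiable_mult differentiable_const)
  ultimately show ?thesis by (simp add: smooth_def differentiable_on_def)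
qed

lemma smooth_mult: "smooth f \<Longrightarrow> smooth (\<lambda>x. c * f x)"
  using smooth_lin2[of f f c 0] by simp

lemma smooth_wave: "smooth (wave \<xi>)"
proof -
  have "\<exists>c. foldr dir_deriv vs (wave \<xi>) = (\<lambda>x. c * wave \<xi> x)" for vs
  proof (induction vs)
    case Nil
    show ?case by (rule exI[of _ 1]) simp
  next
    case (Cons v vs)
    then obtain c where c: "foldr dir_deriv vs (wave \<xi>) = (\<lambda>x. c * wave \<xi> x)" by blast
    have "wave \<xi> differentiable at x" for x
      using wave_has_derivative differentiable_def by blast
    then have "dir_deriv v (\<lambda>x. c * wave \<xi> x) x = c * dir_deriv v (wave \<xi>) x" for x
      using dir_deriv_lin2[of "wave \<xi>" x "wave \<xi>" v c 0] by simp
    then show ?case by (auto simp: c dir_deriv_wave fun_eq_iff intro!: exI[of _ "c * (2 * of_real pi * \<i> * of_real (\<xi> \<bullet> v))"])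
  qed
  moreover have "(\<lambda>x. c * wave \<xi> x) differentiable at x" for c x
    using wave_has_derivative[of \<xi> x] differentiable_def
    by (intro differentiable_mult differentiable_const) blast
  ultimately show ?thesis unfolding smooth_def differentiable_on_def by (metis at_within_open open_UNIV UNIV_I)
qed

lemma smooth_zero: "smooth (\<lambda>_. 0)"
proof -
  have "foldr dir_deriv vs (\<lambda>_. 0) = (\<lambda>_. 0)" for vs :: "'a list"
    by (induction vs) (auto intro!: dir_derivI[OF has_derivative_const])
  then show ?thesis by (simp add: smooth_def)
qed

lemma smooth_sum: "(\<And>i. i \<in> S \<Longrightarrow> smooth (f i)) \<Longrightarrow> smooth (\<lambda>x. \<Sum>i\<in>S. f i x)"
proof (induction S rule: infinite_finite_induct)
  case (insert a S)
  then show ?case using smooth_lin2[of "f a" "\<lambda>x. \<Sum>i\<in>S. f i x" 1 1] by simp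
qed (simp_all add: smooth_zero)

text \<open>Cut the cube at height \<open>t\<close> along the axis: translating by \<open>t\<close>
  keeps the upper slab and replaces the lower one by its copy one period higher.\<close>

lemma integral_unit_cube_translate_axis:
  fixes f :: "real^'m::finite \<Rightarrow> complex"
  assumes "continuous_on UNIV f" "periodic f" "0 \<le> t" "t \<le> 1"
  shows "integral unit_cube (\<lambda>x. f (x + t *\<^sub>R axis i 1)) = integral unit_cube f"
proof -
  let ?k = "axis i 1 :: real^'m"
  let ?o = "(\<chi> j. 1) :: real^'m"
  define bt :: "real^'m" where "bt = (\<chi> j. if j = i then t else 1)"
  define ct where "ct = t *\<^sub>R ?k"
  have ct: "ct $ j = (if j = i then t else 0)" for j by (simp add: ct_def axis_def)
  have k: "?k \<in> Basis" by (auto simp: Basis_vec_def)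
  have ki: "x \<bullet> ?k = x $ i" for x :: "real^'m" by (simp add: inner_axis)
  have int: "f integrable_on cbox a b" for a b
    by (rule integrable_continuous) (rule continuous_on_subset[OF assms(1)], simp)
  have s1: "cbox 0 ?o \<inter> {x. x \<bullet> ?k \<le> t} = cbox 0 bt" "cbox 0 ?o \<inter> {x. x \<bullet> ?k \<ge> t} = cbox ct ?o"
    unfolding ki using assms(3,4) by (auto simp: mem_box_cart bt_def ct split: if_splits) (smt (verit))+
  have s2: "cbox ct (?o + ct) \<inter> {x. x \<bullet> ?k \<le> 1} = cbox ct ?o"
    "cbox ct (?o + ct) \<inter> {x. x \<bullet> ?k \<ge> 1} = cbox ?k (bt + ?k)"
    unfolding ki using assms(3,4) by (auto simp: mem_box_cart bt_def ct axis_def split: if_splits) (smt (verit))+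
  have 1: "(f has_integral (integral (cbox 0 bt) f + integral (cbox ct ?o) f)) (cbox 0 ?o)"
    by (rule has_integral_split[OF _ _ k, of _ _ _ _ t]) (simp_all add: s1 int integrable_integral)
  have "((\<lambda>x. f (x + - ?k)) has_integral integral (cbox 0 bt) f) (cbox (0 - - ?k) (bt - - ?k))"
    by (rule has_integral_shift_cbox) (simp add: int integrable_integral)
  moreover have "f (x - ?k) = f x" for x
    using assms(2) integer_vec_axis[of "-1" i] unfolding periodic_def
    by (metis (no_types, lifting) Ints_1 add_diff_cancel diff_add_cancel integer_vec_axis)
  ultimately have 2: "(f has_integral integral (cbox 0 bt) f) (cbox ?k (bt + ?k))" by simp
  have "(f has_integral (integral (cbox ct ?o) f + integral (cbox 0 bt) f)) (cbox ct (?o + ct))"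
    by (rule has_integral_split[OF _ _ k, of _ _ _ _ 1]) (simp_all add: s2 int integrable_integral 2)
  from has_integral_shift_cbox[OF this, of ct]
  have "((\<lambda>x. f (x + ct)) has_integral (integral (cbox ct ?o) f + integral (cbox 0 bt) f)) (cbox 0 ?o)" by simp
  then show ?thesis using 1 by (simp add: ct_def integral_unique add.commute)
qed

text \<open>The integral of the translated function is constant in the translation, and its
  derivative at \<open>0\<close> is the integral of the directional derivative. No boundary terms
  have to be discussed.\<close>

lemma integral_dir_deriv_axis:
  fixes h :: "real^'m::finite \<Rightarrow> complex"
  assumes "periodic h" "\<And>x. h differentiable at x" "continuous_on UNIV (dir_deriv (axis i 1) h)"
  shows "integral unit_cube (dir_deriv (axis i 1) h) = 0"
proof -
  let ?k = "axis i 1 :: real^'m"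
  have ch: "continuous_on UNIV h"
    using assms(2) by (auto intro!: continuous_at_imp_continuous_on differentiable_imp_continuous_within)
  have der: "((\<lambda>t. h (x + t *\<^sub>R ?k)) has_vector_derivative dir_deriv ?k h (x + t *\<^sub>R ?k)) (at t within {0..1})" for x t
  proof -
    have "(h has_derivative frechet_derivative h (at (x + t *\<^sub>R ?k))) (at (x + t *\<^sub>R ?k))"
      using assms(2) frechet_derivative_works by auto
    moreover have l: "linear (frechet_derivative h (at (x + t *\<^sub>R ?k)))"
      using assms(2) linear_frechet_derivative by auto
    moreover have "((\<lambda>t. x + t *\<^sub>R ?k) has_derivative (\<lambda>s. s *\<^sub>R ?k)) (at t within {0..1})"
      by (auto intro!: derivative_eq_intros)
    ultimately have "((\<lambda>t. h (x + t *\<^sub>R ?k)) has_derivative (\<lambda>s. frechet_derivative h (at (x + t *\<^sub>R ?k)) (s *\<^sub>R ?k))) (at t within {0..1})"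
      using has_derivative_compose by blast
    then show ?thesis unfolding has_vector_derivative_def dir_deriv_def linear_scale[OF l] .
  qed
  have "((\<lambda>t. integral unit_cube (\<lambda>x. h (x + t *\<^sub>R ?k))) has_vector_derivative
     integral unit_cube (\<lambda>x. dir_deriv ?k h (x + 0 *\<^sub>R ?k))) (at 0 within {0..1})"
  proof (rule leibniz_rule_vector_derivative)
    show "(\<lambda>x. h (x + t *\<^sub>R ?k)) integrable_on unit_cube" for t
      by (intro integrable_continuous continuous_intros continuous_on_compose2[OF ch]) auto
    show "continuous_on ({0..1} \<times> unit_cube) (\<lambda>(t, x). dir_deriv ?k h (x + t *\<^sub>R ?k))"
      unfolding split_beta by (intro continuous_intros continuous_on_compose2[OF assms(3)]) auto
  qed (auto intro: der)
  then have "((\<lambda>t. integral unit_cube h) has_vector_derivative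
     integral unit_cube (\<lambda>x. dir_deriv ?k h (x + 0 *\<^sub>R ?k))) (at 0 within {0..1})"
    by (rule has_vector_derivative_transform[rotated 2])
      (simp_all add: integral_unit_cube_translate_axis[OF ch assms(1)])
  moreover have "((\<lambda>t. integral unit_cube h) has_vector_derivative 0) (at 0 within {0..1::real})"
    by (rule has_vector_derivative_const)
  ultimately have "integral unit_cube (\<lambda>x. dir_deriv ?k h (x + 0 *\<^sub>R ?k)) = 0"
    by (rule vector_derivative_unique_within[rotated]) (simp add: trivial_limit_within islimpt_Icc)
  then show ?thesis by simp
qed

lemma dir_deriv_axis_sum:
  fixes h :: "real^'m::finite \<Rightarrow> complex"
  assumes "h differentiable at x"
  shows "dir_deriv v h x = (\<Sum>i\<in>UNIV. of_real (v $ i) * dir_deriv (axis i 1) h x)"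
proof -
  have l: "linear (frechet_derivative h (at x))" using assms linear_frechet_derivative by auto
  have "v = (\<Sum>i\<in>UNIV. (v $ i) *\<^sub>R axis i 1)"
    using basis_expansion[of v] by (simp add: scalar_mult_eq_scaleR)
  then have "dir_deriv v h x = frechet_derivative h (at x) (\<Sum>i\<in>UNIV. (v $ i) *\<^sub>R axis i 1)"
    by (simp add: dir_deriv_def)
  then show ?thesis
    by (simp only: linear_sum[OF l] linear_scale[OF l]) (simp add: dir_deriv_def scaleR_conv_of_real)
qed

text \<open>Integration by parts on the torus: the derivative of \<open>f\<close> times a wave
  integrates to zero.\<close>

lemma fourier_dir_deriv:
  assumes "smooth f" "periodic f" "integer_vec \<xi>"
  shows "fourier \<xi> (dir_deriv v f) = 2 * of_real pi * \<i> * of_real (\<xi> \<bullet> v) * fourier \<xi> f"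
proof -
  define h where "h x = f x * wave (- \<xi>) x" for x
  have hd: "(h has_derivative (\<lambda>v. dir_deriv v f x * wave (- \<xi>) x +
     f x * (2 * of_real pi * \<i> * of_real (- \<xi> \<bullet> v) * wave (- \<xi>) x))) (at x)" for x
  proof -
    have "(f has_derivative (\<lambda>v. dir_deriv v f x)) (at x)"
      using smooth_differentiable[OF assms(1)] frechet_derivative_works unfolding dir_deriv_def by blast
    from has_derivative_mult[OF this wave_has_derivative[of "- \<xi>" x]] show ?thesis
      unfolding h_def[abs_def] by (simp add: algebra_simps)
  qed
  have dh: "dir_deriv v h = (\<lambda>x. dir_deriv v f x * wave (- \<xi>) x +
     f x * (2 * of_real pi * \<i> * of_real (- \<xi> \<bullet> v) * wave (- \<xi>) x))" for v
    by (rule ext) (rule dir_derivI[OF hd])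
  have ph: "periodic h" unfolding h_def[abs_def]
    by (intro periodic_mult periodic_wave assms integer_vec_simps)
  have diff: "h differentiable at x" for x using hd differentiable_def by blast
  have cont: "continuous_on UNIV (dir_deriv v h)" for v
    unfolding dh by (intro continuous_intros smooth_continuous smooth_dir_deriv assms)
  have intg: "g integrable_on unit_cube" if "continuous_on UNIV g" for g :: "real^'a \<Rightarrow> complex"
    by (rule integrable_continuous) (rule continuous_on_subset[OF that], simp)
  have "integral unit_cube (dir_deriv v h) = (\<Sum>i\<in>UNIV. of_real (v $ i) * integral unit_cube (dir_deriv (axis i 1) h))"
    unfolding dir_deriv_axis_sum[OF diff, of v]
    by (simp add: integral_sum integrable_on_mult_right intg cont)
  also have "\<dots> = 0"
    by (simp add: integral_dir_deriv_axis[OF ph diff cont])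
  finally have "integral unit_cube (dir_deriv v h) = 0" .
  moreover have "integral unit_cube (dir_deriv v h) = fourier \<xi> (dir_deriv v f) +
      integral unit_cube (\<lambda>x. - (2 * of_real pi * \<i> * of_real (\<xi> \<bullet> v)) * (f x * wave (- \<xi>) x))"
  proof -
    have cf: "continuous_on UNIV f" "continuous_on UNIV (dir_deriv v f)"
      by (intro smooth_continuous smooth_dir_deriv assms)+
    show ?thesis unfolding dh fourier_def
      by (subst integral_add[symmetric])
        (auto intro!: intg continuous_intros cf integral_cong simp: algebra_simps)
  qed
  ultimately show ?thesis by (simp only: integral_mult_right fourier_def) (simp add: eq_neg_iff_add_eq_0)
qed

lemma fourier_lin2:
  assumes "continuous_on UNIV f" "continuous_on UNIV g"
  shows "fourier \<xi> (\<lambda>x. c * f x + d * g x) = c * fourier \<xi> f + d * fourier \<xi> g"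
proof -
  have intg: "g integrable_on unit_cube" if "continuous_on UNIV g" for g :: "real^'a \<Rightarrow> complex"
    by (rule integrable_continuous) (rule continuous_on_subset[OF that], simp)
  have "(\<lambda>x. (c * f x + d * g x) * wave (- \<xi>) x) = (\<lambda>x. c * (f x * wave (- \<xi>) x) + d * (g x * wave (- \<xi>) x))"
    by (simp add: algebra_simps)
  then show ?thesis unfolding fourier_def
    by (simp add: integral_add intg assms continuous_intros integrable_on_mult_right)
qed

lemma fourier_mult: "continuous_on UNIV f \<Longrightarrow> fourier \<xi> (\<lambda>x. c * f x) = c * fourier \<xi> f"
  using fourier_lin2[of f f \<xi> c 0] by simp

lemma fourier_zero: "fourier \<xi> (\<lambda>_. 0) = 0"
  by (simp add: fourier_def)

lemma fourier_sum:
  "(\<And>i. i \<in> S \<Longrightarrow> continuous_on UNIV (f i)) \<Longrightarrow> fourier \<xi> (\<lambda>x. \<Sum>i\<in>S. f i x) = (\<Sum>i\<in>S. fourier \<xi> (f i))"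
proof (induction S rule: infinite_finite_induct)
  case (insert a S)
  then show ?case using fourier_lin2[of "f a" "\<lambda>x. \<Sum>i\<in>S. f i x" \<xi> 1 1]
    by (simp add: continuous_on_sum)
qed (simp_all add: fourier_zero)

lemma content_unit_cube: "measure lborel (unit_cube :: (real^'m::finite) set) = 1"
proof -
  have "measure lborel (unit_cube :: (real^'m) set) = (\<Prod>i\<in>UNIV. ((\<chi> i. 1) :: real^'m) $ i - (0 :: real^'m) $ i)"
  proof (rule content_cbox_cart)
    have "(0 :: real^'m) \<in> unit_cube" by (simp add: mem_box_cart)
    then show "unit_cube \<noteq> ({} :: (real^'m) set)" by blast
  qed
  then show ?thesis by simp
qed

text \<open>Orthogonality without evaluating an integral: differentiating the wave along
  \<open>\<eta> - \<xi>\<close> multiplies its coefficient by two constants, one from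
  \<open>\<xi>\<close> and one from \<open>\<eta>\<close>, that differ.\<close>

lemma fourier_wave:
  assumes "integer_vec \<xi>" "integer_vec \<eta>"
  shows "fourier \<xi> (wave \<eta>) = (if \<xi> = \<eta> then 1 else 0)"
proof (cases "\<xi> = \<eta>")
  case True
  have "wave \<eta> x * wave (- \<eta>) x = 1" for x using wave_add_left[of \<eta> "- \<eta>" x] by simp
  then show ?thesis using True by (simp add: fourier_def content_unit_cube)
next
  case False
  define v where "v = \<eta> - \<xi>"
  have "fourier \<xi> (dir_deriv v (wave \<eta>)) = 2 * of_real pi * \<i> * of_real (\<xi> \<bullet> v) * fourier \<xi> (wave \<eta>)"
    by (rule fourier_dir_deriv[OF smooth_wave periodic_wave[OF assms(2)] assms(1)])
  moreover have "fourier \<xi> (dir_deriv v (wave \<eta>)) = 2 * of_real pi * \<i> * of_real (\<eta> \<bullet> v) * fourier \<xi> (wave \<eta>)"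
    unfolding dir_deriv_wave by (rule fourier_mult) (rule continuous_on_wave)
  ultimately have "of_real (\<eta> \<bullet> v - \<xi> \<bullet> v) * fourier \<xi> (wave \<eta>) = 0"
    by (simp add: algebra_simps)
  moreover have "\<eta> \<bullet> v - \<xi> \<bullet> v = v \<bullet> v" by (simp add: v_def inner_diff_left)
  moreover have "v \<bullet> v \<noteq> 0" using False by (simp add: v_def)
  ultimately show ?thesis using False by (simp only: mult_eq_0_iff of_real_eq_0_iff) simp
qed

section \<open>Uniqueness of Fourier coefficients\<close>

lemma fourier_wave_times:
  "fourier \<xi> (\<lambda>x. wave \<eta> x * f x) = fourier (\<xi> - \<eta>) f"
  unfolding fourier_def
  by (rule integral_cong) (simp add: mult_ac wave_add_left[symmetric] minus_diff_eq mult.left_commute[of "wave \<eta> _"])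

text \<open>This class is closed under multiplication by integer waves, hence by polynomials in the
  coordinates of \<open>torus_point\<close>, which reduces uniqueness to polynomial
  approximation.\<close>

definition fourier_null :: "(real^'m::finite \<Rightarrow> complex) \<Rightarrow> bool" where
  "fourier_null \<phi> \<longleftrightarrow> continuous_on UNIV \<phi> \<and> (\<forall>\<xi>. integer_vec \<xi> \<longrightarrow> fourier \<xi> \<phi> = 0)"

lemma fourier_null_lin2:
  "fourier_null f \<Longrightarrow> fourier_null g \<Longrightarrow> fourier_null (\<lambda>x. c * f x + d * g x)"
  unfolding fourier_null_def by (auto intro!: continuous_intros simp: fourier_lin2)

lemma fourier_null_sum:
  "(\<And>i. i \<in> S \<Longrightarrow> fourier_null (f i)) \<Longrightarrow> fourier_null (\<lambda>x. \<Sum>i\<in>S. f i x)"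
  unfolding fourier_null_def by (auto intro!: continuous_intros simp: fourier_sum)

lemma fourier_null_wave: "integer_vec \<eta> \<Longrightarrow> fourier_null f \<Longrightarrow> fourier_null (\<lambda>x. wave \<eta> x * f x)"
  unfolding fourier_null_def by (auto intro!: continuous_intros simp: fourier_wave_times)

text \<open>Embeds the torus in a complex coordinate space, where periodic functions become
  functions on a compact set and Stone-Weierstrass applies.\<close>

definition torus_point :: "real^'m \<Rightarrow> complex^'m" where
  "torus_point x = (\<chi> i. wave (axis i 1) x)"

lemma wave_axis: "wave (axis i 1) x = exp (2 * of_real pi * \<i> * of_real (x $ i))"
  by (simp add: wave_def inner_axis')

lemma continuous_on_torus_point: "continuous_on S torus_point"
  unfolding torus_point_def[abs_def] by (intro continuous_intros)

lemma torus_point_periodic: "integer_vec v \<Longrightarrow> torus_point (x + v) = torus_point x"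
  by (simp add: torus_point_def wave_add_right wave_integer integer_vec_axis)

lemma torus_point_eq:
  assumes "torus_point x = torus_point y" shows "integer_vec (x - y)"
  unfolding integer_vec_def
proof
  fix i
  have "wave (axis i 1) x = wave (axis i 1) y"
    using arg_cong[OF assms, of "\<lambda>z. z $ i"] by (simp add: torus_point_def)
  then have "exp (2 * of_real pi * \<i> * of_real (x $ i)) = exp (2 * of_real pi * \<i> * of_real (y $ i))"
    by (simp add: wave_axis)
  then obtain n where "2 * of_real pi * \<i> * of_real (x $ i) = 2 * of_real pi * \<i> * of_real (y $ i) + of_int (2 * n) * pi * \<i>"
    unfolding exp_eq by blast
  then have "2 * pi * (x $ i) = 2 * pi * (y $ i) + 2 * n * pi"
    by (simp add: complex_eq_iff)
  then have "pi * (x $ i - y $ i - n) = 0" by (simp add: algebra_simps)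
  then have "(x - y) $ i = of_int n" by simp
  then show "(x - y) $ i \<in> \<int>" by simp
qed

text \<open>Real linear functionals of \<open>torus_point\<close> are combinations of the waves of
  \<open>axis i 1\<close> and of its negative. The induction keeps \<open>\<phi>\<close> arbitrary,
  so products are absorbed one factor at a time.\<close>

lemma fourier_null_polynomial:
  fixes \<phi> :: "real^'m::finite \<Rightarrow> complex"
  assumes "real_polynomial_function p" "fourier_null \<phi>"
  shows "fourier_null (\<lambda>x. of_real (p (torus_point x)) * \<phi> x)"
  using assms
proof (induction arbitrary: \<phi> rule: real_polynomial_function.induct)
  case (linear f)
  then have l: "linear f" by (simp add: bounded_linear.linear)
  define a where "a i = (of_real (f (axis i 1)) - \<i> * of_real (f (axis i \<i>))) / (2 :: complex)" for i
  define c where "c i = (of_real (f (axis i 1)) + \<i> * of_real (f (axis i \<i>))) / (2 :: complex)" for i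
  have ax: "axis i w = Re w *\<^sub>R axis i 1 + Im w *\<^sub>R axis i \<i>" for i :: 'm and w
    by (auto simp: vec_eq_iff axis_def complex_eq_iff)
  have inv: "wave (- \<xi>) x = cnj (wave \<xi> x)" for \<xi> x :: "real^'m"
    by (simp add: wave_def exp_cnj)
  have "of_real (f (torus_point x)) * \<phi> x =
     (\<Sum>i\<in>UNIV. a i * (wave (axis i 1) x * \<phi> x) + c i * (wave (- axis i 1) x * \<phi> x))" for x
  proof -
    have "torus_point x = (\<Sum>i\<in>UNIV. axis i (torus_point x $ i))"
      by (simp add: vec_eq_iff axis_def)
    then have "f (torus_point x) = (\<Sum>i\<in>UNIV. f (axis i (torus_point x $ i)))"
      by (metis linear_sum[OF l])
    also have "\<dots> = (\<Sum>i\<in>UNIV. Re (wave (axis i 1) x) * f (axis i 1) + Im (wave (axis i 1) x) * f (axis i \<i>))"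
      by (subst ax) (simp add: linear_add[OF l] linear_scale[OF l] torus_point_def)
    finally have "of_real (f (torus_point x)) = (\<Sum>i\<in>UNIV. a i * wave (axis i 1) x + c i * wave (- axis i 1) x)"
    proof -
      assume e: "f (torus_point x) = (\<Sum>i\<in>UNIV. Re (wave (axis i 1) x) * f (axis i 1) + Im (wave (axis i 1) x) * f (axis i \<i>))"
      have "complex_of_real (Re w * p + Im w * q) = (of_real p - \<i> * of_real q) / 2 * w + (of_real p + \<i> * of_real q) / 2 * cnj w" for w p q
        by (simp add: complex_eq_iff field_simps)
      then show ?thesis unfolding e of_real_sum by (simp add: a_def c_def inv)
    qed
    then show ?thesis by (simp add: sum_distrib_left sum_distrib_right algebra_simps)
  qed
  then show ?case
    by (simp only:) (intro fourier_null_sum fourier_null_lin2 fourier_null_wave linear integer_vec_simps integer_vec_axis Ints_1)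
next
  case (const c)
  then show ?case using fourier_null_lin2[of \<phi> \<phi> "of_real c" 0] by simp
next
  case (add f g)
  then show ?case
    using fourier_null_lin2[of "\<lambda>x. of_real (f (torus_point x)) * \<phi> x" "\<lambda>x. of_real (g (torus_point x)) * \<phi> x" 1 1]
    by (simp add: algebra_simps)
next
  case (mult f g)
  show ?case using mult.IH(1)[OF mult.IH(2)[OF mult.prems]] by (simp add: mult.assoc)
qed

lemma unit_cube_translate:
  fixes x :: "real^'m::finite"
  obtains v where "integer_vec v" "x + v \<in> unit_cube"
proof
  show "integer_vec ((\<chi> i. real_of_int (- \<lfloor>x $ i\<rfloor>)) :: real^'m)" by (simp add: integer_vec_def)
  have "0 \<le> x $ i - of_int \<lfloor>x $ i\<rfloor>" "x $ i - of_int \<lfloor>x $ i\<rfloor> \<le> 1" for i by linarith+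
  then show "x + (\<chi> i. real_of_int (- \<lfloor>x $ i\<rfloor>)) \<in> unit_cube"
    by (simp add: mem_box_cart)
qed

text \<open>If a polynomial \<open>g\<close> on the torus is uniformly close to the conjugate of
  \<open>\<phi>\<close>, then \<open>g\<close> times \<open>\<phi>\<close> has integral zero, so the
  integral of the squared norm is as small as the error of approximation.\<close>

theorem fourier_unique:
  fixes \<phi> :: "real^'m::finite \<Rightarrow> complex"
  assumes "continuous_on UNIV \<phi>" "periodic \<phi>" "\<And>\<xi>. integer_vec \<xi> \<Longrightarrow> fourier \<xi> \<phi> = 0"
  shows "\<phi> = (\<lambda>_. 0)"
proof -
  let ?T = "range torus_point :: (complex^'m) set"
  have null: "fourier_null \<phi>" using assms by (simp add: fourier_null_def)
  have T: "?T = torus_point ` unit_cube"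
  proof (intro equalityI subsetI)
    fix w assume "w \<in> ?T"
    then obtain x where "w = torus_point x" by blast
    moreover obtain v where "integer_vec v" "x + v \<in> unit_cube" by (rule unit_cube_translate)
    ultimately show "w \<in> torus_point ` unit_cube" using torus_point_periodic by (metis image_eqI)
  qed auto
  have comp: "compact ?T" unfolding T by (rule compact_continuous_image[OF continuous_on_torus_point compact_cbox])
  \<comment> \<open>The conjugate of \<open>\<phi>\<close> as a function on the embedded torus; by
    periodicity its value does not depend on the chosen preimage.\<close>
  define \<Phi> where "\<Phi> w = cnj (\<phi> (SOME x. torus_point x = w))" for w
  have \<Phi>: "\<Phi> (torus_point x) = cnj (\<phi> x)" for x
  proof -
    define y where "y = (SOME y. torus_point y = torus_point x)"
    have "torus_point y = torus_point x" unfolding y_def by (rule someI) (rule refl)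
    then have "integer_vec (y - x)" by (rule torus_point_eq)
    then have "\<phi> (x + (y - x)) = \<phi> x" using assms(2) unfolding periodic_def by blast
    then show ?thesis by (simp add: \<Phi>_def y_def)
  qed
  have "continuous_on ?T \<Phi>"
    unfolding continuous_on_closed_vimage[OF compact_imp_closed[OF comp]]
  proof (intro allI impI)
    fix B :: "complex set" assume B: "closed B"
    have "\<Phi> -` B \<inter> ?T = torus_point ` (unit_cube \<inter> (\<lambda>x. cnj (\<phi> x)) -` B)"
      unfolding T using \<Phi> by auto
    moreover have "compact (unit_cube \<inter> (\<lambda>x. cnj (\<phi> x)) -` B)"
    proof (rule compact_Int_closed[OF compact_cbox])
      have "continuous_on UNIV (\<lambda>x. cnj (\<phi> x))" by (intro continuous_intros assms)
      then show "closed ((\<lambda>x. cnj (\<phi> x)) -` B)" using B by (intro closed_vimage)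
    qed
    ultimately show "closed (\<Phi> -` B \<inter> ?T)"
      by (simp add: compact_imp_closed compact_continuous_image[OF continuous_on_torus_point])
  qed
  then have approx: "\<exists>g. polynomial_function g \<and> (\<forall>w\<in>?T. norm (\<Phi> w - g w) < e)" if "e > 0" for e
    by (rule Stone_Weierstrass_polynomial_function[OF comp]) (rule that)
  have cube: "continuous_on unit_cube \<phi>" by (rule continuous_on_subset[OF assms(1)]) simp
  then have "bounded (\<phi> ` unit_cube)" by (intro compact_imp_bounded compact_continuous_image) auto
  then obtain C where C: "C > 0" "\<And>x. x \<in> unit_cube \<Longrightarrow> norm (\<phi> x) \<le> C"
    unfolding bounded_pos by auto
  define J where "J = integral unit_cube (\<lambda>x. cnj (\<phi> x) * \<phi> x)"
  have intg: "g integrable_on unit_cube" if "continuous_on UNIV g" for g :: "real^'m \<Rightarrow> complex"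
    by (rule integrable_continuous) (rule continuous_on_subset[OF that], simp)
  have nJ: "norm J \<le> e * C" if e: "e > 0" for e
  proof -
    obtain g where g: "polynomial_function g" "\<And>x. norm (cnj (\<phi> x) - g (torus_point x)) < e"
      using approx[OF e] \<Phi> by (metis rangeI)
    have "real_polynomial_function (Re \<circ> g)" "real_polynomial_function (Im \<circ> g)"
      using g(1) bounded_linear_Re bounded_linear_Im unfolding polynomial_function_def by auto
    then have n: "fourier_null (\<lambda>x. of_real (Re (g (torus_point x))) * \<phi> x)" "fourier_null (\<lambda>x. of_real (Im (g (torus_point x))) * \<phi> x)"
      using fourier_null_polynomial[OF _ null] by (auto simp: o_def)
    have "fourier_null (\<lambda>x. 1 * (of_real (Re (g (torus_point x))) * \<phi> x) + \<i> * (of_real (Im (g (torus_point x))) * \<phi> x))"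
      by (rule fourier_null_lin2[OF n])
    moreover have "1 * (of_real (Re w) * z) + \<i> * (of_real (Im w) * z) = w * z" for w z :: complex
      using complex_eq[of w] by (metis distrib_right mult.assoc mult_1)
    ultimately have ng: "fourier_null (\<lambda>x. g (torus_point x) * \<phi> x)" by (simp only:)
    then have z: "integral unit_cube (\<lambda>x. g (torus_point x) * \<phi> x) = 0" and cg: "continuous_on UNIV (\<lambda>x. g (torus_point x) * \<phi> x)"
      unfolding fourier_null_def fourier_def by (auto dest!: spec[of _ 0])
    have "((\<lambda>x. cnj (\<phi> x) * \<phi> x - g (torus_point x) * \<phi> x) has_integral (J - 0)) unit_cube"
      unfolding J_def z[symmetric]
      by (intro has_integral_diff integrable_integral intg continuous_intros assms(1) cg)
    moreover have "norm (cnj (\<phi> x) * \<phi> x - g (torus_point x) * \<phi> x) \<le> e * C" if "x \<in> unit_cube" for x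
      unfolding left_diff_distrib[symmetric] norm_mult
      using g(2)[of x] C(2)[OF that] e by (intro mult_mono) auto
    ultimately have "norm (J - 0) \<le> (e * C) * measure lborel (unit_cube :: (real^'m) set)"
      using e C(1) by (intro has_integral_bound) auto
    then show ?thesis by (simp add: content_unit_cube)
  qed
  have "norm J \<le> 0"
  proof (rule field_le_epsilon)
    fix e :: real assume "e > 0"
    then show "norm J \<le> 0 + e" using nJ[of "e / C"] C(1) by simp
  qed
  then have "((\<lambda>x. cnj (\<phi> x) * \<phi> x) has_integral 0) unit_cube"
    unfolding J_def using integrable_integral[OF intg, of "\<lambda>x. cnj (\<phi> x) * \<phi> x"] assms(1)
    by (simp add: continuous_intros)
  from has_integral_linear[OF this bounded_linear_Re]
  have "((\<lambda>x. (norm (\<phi> x))\<^sup>2) has_integral 0) unit_cube"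
    by (simp add: o_def cmod_power2 flip: power2_eq_square)
  then have cube0: "(norm (\<phi> x))\<^sup>2 = 0" if "x \<in> unit_cube" for x
    by (rule has_integral_0_cbox_imp_0[rotated 2])
      (use that cube in \<open>auto intro!: continuous_intros simp: interval_eq_empty_cart\<close>)
  show ?thesis
  proof
    fix x :: "real^'m"
    obtain v where "integer_vec v" "x + v \<in> unit_cube" by (rule unit_cube_translate)
    then show "\<phi> x = 0" using cube0[of "x + v"] assms(2) by (simp add: periodic_def)
  qed
qed

lemma norm_axis_real: "norm (axis i r :: real^'n::finite) = \<bar>r\<bar>"
  by (simp add: norm_eq_sqrt_inner inner_axis_axis)

section \<open>Normal form and geometry of the crystallographic group\<close>

locale cyclic_flat = shift_matrix A jx N
  for A :: "real^'k^('k::finite)" and jx :: "nat \<Rightarrow> 'k" and N :: nat +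
  fixes \<Gamma> :: "'k option motion set"
  assumes \<Gamma>_def: "\<Gamma> = generate motions (integer_translations \<union> {(block_one A, axis None (1 / (2 * real N)))})"
begin

definition screw :: "nat \<Rightarrow> 'k option motion" where
  "screw k = (rot k, axis None (real k / (2 * real N)))"

definition translation :: "real^('k option) \<Rightarrow> 'k option motion" where
  "translation v = (mat 1, v)"

lemma rot_1: "rot 1 = A'"
  by (simp add: rot_def matrix_pow_def matrix_mul_rid)

lemma motions_carrier:
  "screw k \<in> carrier motions" "translation v \<in> carrier motions"
  by (simp_all add: screw_def translation_def motions_def orthogonal_rot det_rot orthogonal_matrix_id)

lemma axis_None_add: "axis None (a + c) = axis None a + (axis None c :: real^('k option))"
  by (simp add: vec_eq_iff axis_def)

lemma motion_mult: "(C, c) \<otimes>\<^bsub>motions\<^esub> (D, d) = (C ** D, C *v d + c)"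
  by (simp add: motions_def)

lemma screw_mult: "screw k \<otimes>\<^bsub>motions\<^esub> screw l = screw (k + l)"
  by (simp add: screw_def motion_mult rot_add rot_axis_None axis_None_add[symmetric] add_divide_distrib add.commute)

lemma generators: "integer_translations \<union> {(A', axis None (1 / (2 * real N)))} =
   {translation v |v. integer_vec v} \<union> {screw 1}"
  using rot_1 by (auto simp: integer_translations_def translation_def integer_vec_def screw_def)

lemma general_element:
  "(rot k, axis None (real k / (2 * real N)) + v) = translation v \<otimes>\<^bsub>motions\<^esub> screw k"
  by (simp add: translation_def screw_def motion_mult matrix_mul_lid)

text \<open>Every element is a translation after a power of the screw motion with a nonnegative
  exponent: the inverse of the screw is its power \<open>2 N - 1\<close> followed by the translation
  by \<open>-1\<close> along the axis.\<close>

lemma \<Gamma>_eq: "\<Gamma> = {(rot k, axis None (real k / (2 * real N)) + v) |k v. integer_vec v}" (is "_ = ?S")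
proof (intro equalityI subsetI)
  fix g assume "g \<in> \<Gamma>"
  then have "g \<in> generate motions ({translation v |v. integer_vec v} \<union> {screw 1})"
    using \<Gamma>_def generators by simp
  then show "g \<in> ?S"
  proof (induction rule: generate.induct)
    case one
    have "\<one>\<^bsub>motions\<^esub> = (rot 0, axis None (real 0 / (2 * real N)) + (0 :: real^('k option)))"
      by (simp add: motions_def rot_0 axis_eq_0_iff)
    then show ?case using integer_vec_simps(1) by blast
  next
    case (incl h)
    then consider v where "h = translation v" "integer_vec v" | "h = screw 1" by auto
    then show ?case
    proof cases
      case 1
      then have "h = (rot 0, axis None (real 0 / (2 * real N)) + v)" by (simp add: translation_def rot_0 axis_eq_0_iff)
      then show ?thesis using 1 by blast
    next
      case 2
      then have "h = (rot 1, axis None (real 1 / (2 * real N)) + 0)" by (simp add: screw_def)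
      then show ?thesis using integer_vec_simps(1) by blast
    qed
  next
    case (inv h)
    then consider v where "h = translation v" "integer_vec v" | "h = screw 1" by auto
    then show ?case
    proof cases
      case 1
      have "inv\<^bsub>motions\<^esub> h = translation (- v)" unfolding 1(1)
        by (rule group.inv_equality[OF group_motions]) (simp_all add: motions_carrier, simp add: translation_def motions_def)
      then have "inv\<^bsub>motions\<^esub> h = (rot 0, axis None (real 0 / (2 * real N)) + - v)"
        by (simp add: translation_def rot_0 axis_eq_0_iff)
      then show ?thesis using 1(2) integer_vec_simps(4) by blast
    next
      case 2
      let ?k = "2 * N - 1"
      have k: "?k + 1 = 2 * N" using N_pos by simp
      have ax: "axis None (1::real) + axis None (-1) = (0 :: real^('k option))"
        by (simp add: axis_None_add[symmetric] axis_eq_0_iff)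
      have "(rot ?k, axis None (real ?k / (2 * real N)) + axis None (-1)) \<otimes>\<^bsub>motions\<^esub> screw 1 =
        translation (axis None (-1)) \<otimes>\<^bsub>motions\<^esub> (screw ?k \<otimes>\<^bsub>motions\<^esub> screw 1)"
        unfolding general_element
        by (rule monoid.m_assoc[OF group.is_monoid[OF group_motions]]) (simp_all add: motions_carrier)
      also have "\<dots> = \<one>\<^bsub>motions\<^esub>"
        unfolding screw_mult k using N_pos
        by (simp add: translation_def screw_def motion_mult matrix_mul_lid rot_2N ax) (simp add: motions_def)
      finally have "inv\<^bsub>motions\<^esub> h = (rot ?k, axis None (real ?k / (2 * real N)) + axis None (-1))" unfolding 2
        by (rule group.inv_equality[OF group_motions])
          (simp_all add: motions_carrier, simp add: motions_def orthogonal_rot det_rot)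
      moreover have "integer_vec (axis None (-1) :: real^('k option))" by (intro integer_vec_axis) simp
      ultimately show ?thesis by blast
    qed
  next
    case (eng g h)
    then obtain k v l w where g: "g = (rot k, axis None (real k / (2 * real N)) + v)" "integer_vec v"
      and h: "h = (rot l, axis None (real l / (2 * real N)) + w)" "integer_vec w" by blast
    have "g \<otimes>\<^bsub>motions\<^esub> h = (rot (k + l), axis None (real (k + l) / (2 * real N)) + (rot k *v w + v))"
      unfolding g(1) h(1) motion_mult
      by (simp add: rot_add matrix_vector_right_distrib rot_axis_None add_divide_distrib axis_None_add)
    moreover have "integer_vec (rot k *v w + v)" using g(2) h(2) by (simp add: rot_integer)
    ultimately show ?case by blast
  qed
next
  fix g assume "g \<in> ?S"
  then obtain k v where g: "g = translation v \<otimes>\<^bsub>motions\<^esub> screw k" and v: "integer_vec v"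
    using general_element by auto
  let ?G = "generate motions ({translation v |v. integer_vec v} \<union> {screw 1})"
  have t: "translation v \<in> ?G" if "integer_vec v" for v using that by (intro generate.incl) auto
  have "screw k \<in> ?G"
  proof (induction k)
    case 0
    have "screw 0 = translation 0" by (simp add: screw_def translation_def rot_0 axis_eq_0_iff)
    then show ?case using t[of 0] by simp
  next
    case (Suc k)
    have "screw 1 \<otimes>\<^bsub>motions\<^esub> screw k \<in> ?G" by (intro generate.eng Suc generate.incl) auto
    then show ?case by (simp add: screw_mult)
  qed
  then show "g \<in> \<Gamma>" unfolding g \<Gamma>_def generators by (intro generate.eng t v)
qed

lemma act_element: "act (rot k, axis None (real k / (2 * real N)) + v) x = rot k *v x + axis None (real k / (2 * real N)) + v"
  by (simp add: act_def)

lemma subgroup_\<Gamma>: "subgroup \<Gamma> motions"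
  unfolding \<Gamma>_def generators
  by (rule group.generate_is_subgroup[OF group_motions]) (auto simp: motions_carrier)

text \<open>The last coordinate is only translated, so a fixed point makes \<open>k / (2 N)\<close>
  an integer. Then the rotation part is trivial, and with it the translation.\<close>

lemma \<Gamma>_free:
  assumes "g \<in> \<Gamma>" "act g x = x" shows "g = \<one>\<^bsub>motions\<^esub>"
proof -
  obtain k v where g: "g = (rot k, axis None (real k / (2 * real N)) + v)" "integer_vec v"
    using assms(1) unfolding \<Gamma>_eq by blast
  have e: "rot k *v x + axis None (real k / (2 * real N)) + v = x" using assms(2) by (simp add: g(1) act_element)
  have "real k / (2 * real N) + v $ None = 0"
    using arg_cong[OF e, of "\<lambda>w. w $ None"] by (simp add: rot_None axis_def)
  moreover obtain i where i: "v $ None = of_int i" using g(2) by (auto simp: integer_vec_def elim!: Ints_cases)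
  ultimately have "real k = real_of_int (- i) * (2 * real N)" using N_pos by (simp add: field_simps)
  then have "of_int (int k) = (of_int (- i * int (2 * N)) :: real)" by simp
  then have "int k = - i * int (2 * N)" by (simp only: of_int_eq_iff)
  then have "int (2 * N) dvd int k" by simp
  then have "rot k = mat 1" by (simp add: rot_eq_1 flip: int_dvd_int_iff)
  then show ?thesis using e by (simp add: g(1) motions_def)
qed

text \<open>Full turns of the screw are integer translations along the axis and can be moved into
  \<open>v\<close>, which bounds the exponent.\<close>

lemma rot_reduce:
  assumes "g \<in> \<Gamma>"
  obtains k v where "k < 2 * N" "integer_vec v" "g = (rot k, axis None (real k / (2 * real N)) + v)"
proof -
  obtain k v where g: "g = (rot k, axis None (real k / (2 * real N)) + v)" "integer_vec v"
    using assms unfolding \<Gamma>_eq by blast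
  define r q where "r = k mod (2 * N)" and "q = k div (2 * N)"
  have "k = r + 2 * N * q" by (simp add: r_def q_def)
  then have "real k / (2 * real N) = real r / (2 * real N) + real q"
    using N_pos by (simp add: field_simps)
  then have "g = (rot r, axis None (real r / (2 * real N)) + (axis None (real q) + v))"
    unfolding g(1) by (simp add: axis_None_add r_def rot_mod)
  moreover have "integer_vec (axis None (real q) + v)" using g(2) by (simp add: integer_vec_axis)
  moreover have "r < 2 * N" using N_pos by (simp add: r_def)
  ultimately show ?thesis using that by blast
qed

lemma \<Gamma>_properly_discontinuous:
  assumes "compact K" shows "finite {g \<in> \<Gamma>. act g ` K \<inter> K \<noteq> {}}"
proof -
  obtain R where R: "R > 0" "\<And>x. x \<in> K \<Longrightarrow> norm x \<le> R"
    using compact_imp_bounded[OF assms] by (auto simp: bounded_pos)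
  obtain B :: nat where B: "2 * R + 1 \<le> B" using real_arch_simple by blast
  let ?V = "{v :: real^('k option). integer_vec v \<and> (\<forall>i. \<bar>v $ i\<bar> \<le> B)}"
  have "{g \<in> \<Gamma>. act g ` K \<inter> K \<noteq> {}} \<subseteq> (\<lambda>(k, v). (rot k, axis None (real k / (2 * real N)) + v)) ` ({..<2 * N} \<times> ?V)"
  proof
    fix g assume "g \<in> {g \<in> \<Gamma>. act g ` K \<inter> K \<noteq> {}}"
    then obtain x where g: "g \<in> \<Gamma>" and x: "x \<in> K" "act g x \<in> K" by auto
    obtain k v where k: "k < 2 * N" "integer_vec v" and gk: "g = (rot k, axis None (real k / (2 * real N)) + v)"
      using rot_reduce[OF g] by blast
    have "norm (rot k *v x) = norm x" using orthogonal_matrix_inner[OF orthogonal_rot, of k x x] by (simp add: norm_eq_sqrt_inner)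
    moreover have "norm (axis None (real k / (2 * real N)) :: real^('k option)) \<le> 1"
      using k(1) by (simp add: norm_axis_real)
    moreover have "v = act g x - rot k *v x - axis None (real k / (2 * real N))" by (simp add: gk act_element)
    ultimately have "norm v \<le> 2 * R + 1"
      using norm_triangle_ineq4[of "act g x - rot k *v x" "axis None (real k / (2 * real N))"]
        norm_triangle_ineq4[of "act g x" "rot k *v x"] R(2)[OF x(1)] R(2)[OF x(2)] by simp
    then have "\<bar>v $ i\<bar> \<le> B" for i using component_le_norm_cart[of v i] B by linarith
    then show "g \<in> (\<lambda>(k, v). (rot k, axis None (real k / (2 * real N)) + v)) ` ({..<2 * N} \<times> ?V)"
      using k gk by (intro image_eqI[of _ _ "(k, v)"]) auto
  qed
  moreover have "finite ({..<2 * N} \<times> ?V)" using card_integer_vec_box(1) by auto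
  ultimately show ?thesis using finite_subset finite_imageI by blast
qed

lemma flat_manifold_group_\<Gamma>: "flat_manifold_group \<Gamma>"
  unfolding flat_manifold_group_def
proof (intro conjI allI ballI impI)
  show "\<exists>K. compact K \<and> (\<Union>g\<in>\<Gamma>. act g ` K) = UNIV"
  proof (intro exI conjI)
    show "compact (unit_cube :: (real^('k option)) set)" by (rule compact_cbox)
    show "(\<Union>g\<in>\<Gamma>. act g ` unit_cube) = UNIV"
    proof (intro equalityI subset_UNIV subsetI)
      fix x :: "real^('k option)"
      obtain v where v: "integer_vec v" "x + v \<in> unit_cube" by (rule unit_cube_translate)
      have "(rot 0, axis None (real 0 / (2 * real N)) + - v) \<in> \<Gamma>"
        unfolding \<Gamma>_eq using integer_vec_simps(4)[OF v(1)] by blast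
      moreover have "x = act (rot 0, axis None (real 0 / (2 * real N)) + - v) (x + v)"
        by (simp add: act_def rot_0 axis_eq_0_iff)
      ultimately show "x \<in> (\<Union>g\<in>\<Gamma>. act g ` unit_cube)" using v(2) by blast
    qed
  qed
qed (use subgroup_\<Gamma> \<Gamma>_free \<Gamma>_properly_discontinuous in auto)

lemma holonomy_group_\<Gamma>: "holonomy_group \<Gamma> \<cong> integer_mod_group (2 * N)"
proof -
  let ?Z = "integer_mod_group (2 * N)"
  have N: "2 * N \<noteq> 0" using N_pos by simp
  have cz: "carrier ?Z = {0..<int (2 * N)}" using N by (simp add: integer_mod_group_def)
  have mz: "x \<otimes>\<^bsub>?Z\<^esub> y = (x + y) mod int (2 * N)" for x y by simp
  have ch: "fst ` \<Gamma> = range rot"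
  proof -
    have "rot k \<in> fst ` \<Gamma>" for k
      using integer_vec_simps(1) unfolding \<Gamma>_eq by (intro image_eqI[of _ _ "(rot k, axis None (real k / (2 * real N)) + 0)"]) auto
    then show ?thesis unfolding \<Gamma>_eq by auto
  qed
  define h where "h x = rot (nat x)" for x :: int
  have inj: "inj_on h (carrier ?Z)"
  proof (rule inj_onI)
    have *: "x = y" if xy: "x \<le> y" "0 \<le> x" "y < int (2 * N)" "h x = h y" for x y
    proof -
      have e: "nat (y - x) + nat x = nat y" using xy by linarith
      have "rot (nat (y - x)) ** rot (nat x) = mat 1 ** rot (nat x)"
      proof -
        have "rot (nat (y - x)) ** rot (nat x) = rot (nat y)" by (simp only: rot_add[symmetric] e)
        then show ?thesis using xy(4) by (simp only: h_def matrix_mul_lid)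
      qed
      then have "rot (nat (y - x)) ** (rot (nat x) ** transpose (rot (nat x))) =
        mat 1 ** (rot (nat x) ** transpose (rot (nat x)))" by (simp only: matrix_mul_assoc)
      then have "rot (nat (y - x)) = mat 1" using orthogonal_rot[of "nat x"] by (simp add: orthogonal_matrix_def matrix_mul_rid)
      then have "2 * N dvd nat (y - x)" by (simp add: rot_eq_1)
      moreover have "nat (y - x) < 2 * N" using xy by linarith
      ultimately have "nat (y - x) = 0" by (metis nat_dvd_not_less neq0_conv)
      then show "x = y" using xy(1) by simp
    qed
    fix x y assume "x \<in> carrier ?Z" "y \<in> carrier ?Z" "h x = h y"
    then show "x = y" unfolding cz using *[of x y] *[of y x] by (cases "x \<le> y") auto
  qed
  have img: "h ` carrier ?Z = range rot"
  proof (intro equalityI subsetI)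
    fix C assume "C \<in> range rot"
    then obtain k where "C = rot k" by blast
    then have "C = h (int (k mod (2 * N)))" by (simp add: h_def rot_mod)
    moreover have "int (k mod (2 * N)) \<in> carrier ?Z" unfolding cz using N_pos by (simp add: zmod_int)
    ultimately show "C \<in> h ` carrier ?Z" by blast
  qed (auto simp: h_def)
  have "h \<in> iso ?Z (holonomy_group \<Gamma>)"
    unfolding iso_def hom_def
  proof (intro CollectI conjI ballI)
    show "bij_betw h (carrier ?Z) (carrier (holonomy_group \<Gamma>))"
      using inj img by (simp add: bij_betw_def holonomy_group_def ch)
    show "h \<in> carrier ?Z \<rightarrow> carrier (holonomy_group \<Gamma>)"
      using img by (auto simp: holonomy_group_def ch)
    fix x y assume xy: "x \<in> carrier ?Z" "y \<in> carrier ?Z"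
    then have "nat ((x + y) mod int (2 * N)) = (nat x + nat y) mod (2 * N)"
      unfolding cz by (simp add: nat_mod_distrib nat_add_distrib nat_mult_distrib)
    then show "h (x \<otimes>\<^bsub>?Z\<^esub> y) = h x \<otimes>\<^bsub>holonomy_group \<Gamma>\<^esub> h y"
      unfolding mz by (simp only: h_def rot_mod rot_add) (simp add: holonomy_group_def)
  qed
  then show ?thesis using group.iso_set_sym[OF group_integer_mod_group] unfolding is_iso_def by blast
qed

text \<open>Pullback reverses products, so invariance under the integer translations and one screw
  motion gives invariance under the whole normal form.\<close>

lemma forms_on_quotient_\<Gamma>:
  "\<phi> \<in> forms_on_quotient \<Gamma> \<longleftrightarrow> diff_form \<phi> \<and>
     (\<forall>x v vs. integer_vec v \<longrightarrow> \<phi> (x + v) vs = \<phi> x vs) \<and>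
     (\<forall>x vs. \<phi> (A' *v x + axis None (1 / (2 * real N))) (map ((*v) A') vs) = \<phi> x vs)"
proof -
  have pt: "pullback (translation v) \<phi> = \<phi> \<longleftrightarrow> (\<forall>x vs. \<phi> (x + v) vs = \<phi> x vs)" for v
  proof -
    have "map ((*v) (mat 1)) us = us" for us :: "(real^('k option)) list" by (induction us) auto
    then show ?thesis by (simp add: pullback_def act_def translation_def fun_eq_iff)
  qed
  have ps: "pullback (screw 1) \<phi> = \<phi> \<longleftrightarrow>
    (\<forall>x vs. \<phi> (A' *v x + axis None (1 / (2 * real N))) (map ((*v) A') vs) = \<phi> x vs)"
    using rot_1 by (simp add: pullback_def act_def screw_def fun_eq_iff)
  have pm: "pullback (g \<otimes>\<^bsub>motions\<^esub> h) \<phi> = pullback h (pullback g \<phi>)" for g h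
  proof -
    have "fst (g \<otimes>\<^bsub>motions\<^esub> h) = fst g ** fst h" by (simp add: motions_def split_beta)
    then show ?thesis
      by (simp add: pullback_def act_mult fun_eq_iff o_def matrix_vector_mul_assoc)
  qed
  have "(\<forall>g\<in>\<Gamma>. pullback g \<phi> = \<phi>) \<longleftrightarrow>
    (\<forall>v. integer_vec v \<longrightarrow> pullback (translation v) \<phi> = \<phi>) \<and> pullback (screw 1) \<phi> = \<phi>"
  proof (intro iffI conjI allI impI ballI)
    assume all: "\<forall>g\<in>\<Gamma>. pullback g \<phi> = \<phi>"
    have "screw 1 \<in> \<Gamma>" unfolding \<Gamma>_def generators by (intro generate.incl) simp
    then show "pullback (screw 1) \<phi> = \<phi>" using all by blast
    fix v :: "real^('k option)" assume "integer_vec v"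
    then have "translation v \<in> \<Gamma>" unfolding \<Gamma>_def generators by (intro generate.incl) blast
    then show "pullback (translation v) \<phi> = \<phi>" using all by blast
  next
    fix g assume a: "(\<forall>v. integer_vec v \<longrightarrow> pullback (translation v) \<phi> = \<phi>) \<and> pullback (screw 1) \<phi> = \<phi>" and "g \<in> \<Gamma>"
    then obtain k v where g: "g = translation v \<otimes>\<^bsub>motions\<^esub> screw k" "integer_vec v"
      unfolding \<Gamma>_eq using general_element by auto
    have "pullback (screw k) \<phi> = \<phi>"
    proof (induction k)
      case 0
      have "screw 0 = translation 0" by (simp add: screw_def translation_def rot_0 axis_eq_0_iff)
      then show ?case using a by simp
    next
      case (Suc k)
      have "screw (Suc k) = screw k \<otimes>\<^bsub>motions\<^esub> screw 1" by (simp add: screw_mult)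
      then show ?case using pm[of "screw k" "screw 1"] Suc a by simp
    qed
    then show "pullback g \<phi> = \<phi>" unfolding g(1) pm using a g(2) by simp
  qed
  then show ?thesis unfolding forms_on_quotient_def pt ps by blast
qed

end

section \<open>Eigenforms and Fourier coefficients\<close>

text \<open>Unfolding the recursion gives the alternating sum that occurs in
  \<open>ext_deriv\<close>; so on Fourier coefficients the exterior derivative becomes exterior
  multiplication by \<open>2 \<pi> \<i> \<xi>\<close>.\<close>

lemma wedge_eq_sum:
  "wedge \<xi> \<alpha> vs = (\<Sum>i<length vs. (-1) ^ i * (of_real (\<xi> \<bullet> (vs ! i)) * \<alpha> (take i vs @ drop (Suc i) vs)))"
proof (induction vs arbitrary: \<alpha>)
  case (Cons u us)
  show ?case by (simp add: Cons sum.lessThan_Suc_shift sum_negf del: sum.lessThan_Suc)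
qed simp

lemma smooth_star: "(\<And>vs. smooth (\<lambda>x. \<psi> x vs)) \<Longrightarrow> smooth (\<lambda>x. star b (\<psi> x) ws)"
  unfolding star_def mult.commute[of _ "complex_of_real _"] by (intro smooth_sum smooth_mult)

lemma smooth_ext_deriv: "(\<And>vs. smooth (\<lambda>x. \<psi> x vs)) \<Longrightarrow> smooth (\<lambda>x. ext_deriv \<psi> x ws)"
  unfolding ext_deriv_def by (intro smooth_sum smooth_mult smooth_dir_deriv)

lemma periodic_dir_deriv:
  fixes f :: "real^'m::finite \<Rightarrow> complex"
  assumes "periodic f" "smooth f" shows "periodic (dir_deriv v f)"
  unfolding periodic_def
proof (intro allI impI)
  fix x w :: "real^'m" assume w: "integer_vec w"
  have "(f has_derivative (\<lambda>v. dir_deriv v f (x + w))) (at (x + w))"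
    using smooth_differentiable[OF assms(2)] frechet_derivative_works unfolding dir_deriv_def by blast
  moreover have "((\<lambda>x. x + w) has_derivative (\<lambda>v. v)) (at x)" by (auto intro!: derivative_eq_intros)
  ultimately have "((\<lambda>x. f (x + w)) has_derivative (\<lambda>v. dir_deriv v f (x + w))) (at x)"
    using has_derivative_compose by blast
  moreover have "(\<lambda>x. f (x + w)) = f" using assms(1) w by (auto simp: periodic_def)
  ultimately show "dir_deriv v f (x + w) = dir_deriv v f x" using dir_derivI[of f _ x v] by simp
qed

lemma periodic_sum: "(\<And>i. i \<in> S \<Longrightarrow> periodic (f i)) \<Longrightarrow> periodic (\<lambda>x. \<Sum>i\<in>S. f i x)"
  by (simp add: periodic_def)

lemma periodic_const_mult: "periodic f \<Longrightarrow> periodic (\<lambda>x. c * f x)"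
  by (simp add: periodic_def)

lemma periodic_star: "(\<And>vs. periodic (\<lambda>x. \<psi> x vs)) \<Longrightarrow> periodic (\<lambda>x. star b (\<psi> x) ws)"
  by (simp add: periodic_def star_def)

lemma periodic_ext_deriv:
  "(\<And>vs. periodic (\<lambda>x. \<psi> x vs)) \<Longrightarrow> (\<And>vs. smooth (\<lambda>x. \<psi> x vs)) \<Longrightarrow> periodic (\<lambda>x. ext_deriv \<psi> x ws)"
  unfolding ext_deriv_def by (intro periodic_sum periodic_const_mult periodic_dir_deriv)

lemma fourier_star:
  assumes "\<And>vs. continuous_on UNIV (\<lambda>x. \<psi> x vs)"
  shows "fourier \<xi> (\<lambda>x. star b (\<psi> x) ws) = star b (\<lambda>vs. fourier \<xi> (\<lambda>x. \<psi> x vs)) ws"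
proof -
  have c: "continuous_on UNIV (\<lambda>x. c * \<psi> x vs)" for c vs by (intro continuous_intros assms)
  show ?thesis unfolding star_def mult.commute[of _ "of_real _"]
    by (simp only: fourier_sum[OF c] fourier_mult[OF assms])
qed

lemma fourier_ext_deriv:
  assumes "\<And>vs. smooth (\<lambda>x. \<psi> x vs)" "\<And>vs. periodic (\<lambda>x. \<psi> x vs)" "integer_vec \<xi>"
  shows "fourier \<xi> (\<lambda>x. ext_deriv \<psi> x ws) = 2 * of_real pi * \<i> * wedge \<xi> (\<lambda>vs. fourier \<xi> (\<lambda>x. \<psi> x vs)) ws"
proof -
  have s: "continuous_on UNIV (dir_deriv v (\<lambda>y. \<psi> y vs))" for v vs
    by (intro smooth_continuous smooth_dir_deriv assms)
  have c: "continuous_on UNIV (\<lambda>x. c * dir_deriv v (\<lambda>y. \<psi> y vs) x)" for c v vs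
    by (intro continuous_on_mult continuous_on_const s)
  have "fourier \<xi> (\<lambda>x. ext_deriv \<psi> x ws) = (\<Sum>i<length ws. (-1) ^ i *
     (2 * of_real pi * \<i> * of_real (\<xi> \<bullet> (ws ! i)) * fourier \<xi> (\<lambda>y. \<psi> y (take i ws @ drop (Suc i) ws))))"
    unfolding ext_deriv_def
    by (simp only: fourier_sum[OF c] fourier_mult[OF s] fourier_dir_deriv[OF assms(1,2,3)])
  then show ?thesis unfolding wedge_eq_sum sum_distrib_left by (simp add: mult_ac)
qed

lemma neg_one_power_eq: "even (i + j) \<Longrightarrow> (-1 :: complex) ^ i = (-1) ^ j"
  by (auto simp: uminus_power_if)

lemma neg_one_power_neg: "odd (i + j) \<Longrightarrow> (-1 :: complex) ^ i = - ((-1) ^ j)"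
  by (auto simp: uminus_power_if)

section \<open>The signs of B in terms of the degree of the result\<close>

context odd_frame
begin

lemma star_degree:
  "star b (\<lambda>vs. if length vs = q then \<alpha> vs else 0) ws =
    (if q + length ws = DIM('a) then star b \<alpha> ws else 0)"
proof (cases "q + length ws = DIM('a)")
  case True
  then have "star b (\<lambda>vs. if length vs = q then \<alpha> vs else 0) ws = star b \<alpha> ws"
    by (intro star_cong_degree) auto
  then show ?thesis using True by simp
next
  case False
  then have "star b (\<lambda>vs. if length vs = q then \<alpha> vs else 0) ws = star b (\<lambda>_. 0) ws"
    by (intro star_cong_degree) auto
  then show ?thesis using False by (simp add: star_zero)
qed

lemma star_high_degree: "length ws > DIM('a) \<Longrightarrow> star b \<alpha> ws = 0"
  using star_cong_degree[of ws \<alpha> "\<lambda>_. 0" b] by (simp add: star_zero)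

text \<open>At an argument list of even length at most two degrees \<open>q\<close> contribute, one
  for each order of the star and the derivative. Expressed through the length of the list, the sign
  of \<open>B\<close> is opposite in the two degrees, and the minus sign inside \<open>B\<close>
  makes both terms enter with the same sign. On lists of odd length everything vanishes because
  \<open>\<alpha>\<close> is even.\<close>

lemma symbol_degree_sum:
  assumes dim: "DIM('a) = 4 * n - 1" "n \<ge> 1" and a: "even_cochain \<alpha>"
  shows "(\<Sum>q\<le>DIM('a). let \<beta> = (\<lambda>vs. if length vs = q then \<alpha> vs else 0); p = (q + 1) div 2;
        \<epsilon> = (if even q then 1 else -1)
      in (-1) ^ (n + p + 1) * (\<epsilon> * star b (wedge \<xi> \<beta>) vs - wedge \<xi> (star b \<beta>) vs)) = symbol n b \<xi> \<alpha> vs"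
proof -
  define X where "X = star b \<alpha> (\<xi> # vs)"
  define Y where "Y = wedge \<xi> (star b \<alpha>) vs"
  define r where "r = length vs div 2"
  have w: "wedge \<xi> (star b (\<lambda>vs. if length vs = q then \<alpha> vs else 0)) vs =
    (if q + length vs = Suc DIM('a) then Y else 0)" for q
  proof (cases "q + length vs = Suc DIM('a)")
    case True
    have "wedge \<xi> (star b (\<lambda>vs. if length vs = q then \<alpha> vs else 0)) vs = wedge \<xi> (star b \<alpha>) vs"
      by (rule wedge_cong_length) (use True in \<open>auto simp: star_degree\<close>)
    then show ?thesis using True by (simp add: Y_def)
  next
    case False
    have "wedge \<xi> (star b (\<lambda>vs. if length vs = q then \<alpha> vs else 0)) vs = wedge \<xi> (\<lambda>_. 0) vs"
      by (rule wedge_cong_length) (use False in \<open>auto simp: star_degree\<close>)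
    then show ?thesis using False by (simp add: wedge_zero)
  qed
  have t: "(let \<beta> = (\<lambda>vs. if length vs = q then \<alpha> vs else 0); p = (q + 1) div 2; \<epsilon> = (if even q then 1 else -1)
      in (-1) ^ (n + p + 1) * (\<epsilon> * star b (wedge \<xi> \<beta>) vs - wedge \<xi> (star b \<beta>) vs)) =
    (-1) ^ (n + r) * ((if q + length vs + 1 = DIM('a) then X else 0) + (if q + length vs = Suc DIM('a) then Y else 0))"
    (is "?L = ?R") for q
  proof -
    have L: "?L = (-1) ^ (n + (q + 1) div 2 + 1) * ((if even q then 1 else -1) *
      ((-1) ^ length vs * (if q + length vs + 1 = DIM('a) then X else 0)) - (if q + length vs = Suc DIM('a) then Y else 0))"
      by (simp add: Let_def star_wedge w star_degree X_def)
    consider "odd (length vs)" | "even (length vs)" "q + length vs + 1 = DIM('a)"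
      | "even (length vs)" "q + length vs = Suc DIM('a)" | "q + length vs + 1 \<noteq> DIM('a)" "q + length vs \<noteq> Suc DIM('a)"
      by blast
    then show ?thesis
    proof cases
      case 1
      have "X = 0" unfolding X_def by (rule star_even_odd[OF a]) (use 1 in simp)
      moreover have "Y = 0"
      proof -
        have "Y = wedge \<xi> (\<lambda>_. 0) vs" unfolding Y_def
        proof (rule wedge_cong_length)
          fix ws :: "'a list" assume "Suc (length ws) = length vs"
          then show "star b \<alpha> ws = 0" using 1 by (intro star_even_odd[OF a]) (metis even_Suc)
        qed
        then show ?thesis by (simp add: wedge_zero)
      qed
      ultimately show ?thesis unfolding L by simp
    next
      case 2
      then have len: "length vs = 2 * r" by (simp add: r_def)
      have q: "q = 2 * (2 * n - 1 - r)" "r \<le> 2 * n - 1" using 2(2) len dim by linarith+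
      have "(q + 1) div 2 = 2 * n - 1 - r" unfolding q(1) by simp
      then have "n + (q + 1) div 2 + 1 + (n + r) = 4 * n" using q(2) dim(2) by linarith
      then have "even (n + (q + 1) div 2 + 1 + (n + r))" by (rule ssubst) simp
      then have "(-1::complex) ^ (n + (q + 1) div 2 + 1) = (-1) ^ (n + r)" by (rule neg_one_power_eq)
      moreover have "even q" unfolding q(1) by simp
      ultimately show ?thesis unfolding L using 2 by simp
    next
      case 3
      then have len: "length vs = 2 * r" by (simp add: r_def)
      have q: "q = 2 * (2 * n - r)" "r \<le> 2 * n" using 3(2) len dim by linarith+
      have "(q + 1) div 2 = 2 * n - r" unfolding q(1) by simp
      then have "n + (q + 1) div 2 + 1 + (n + r) = 4 * n + 1" using q(2) dim(2) by linarith
      then have "odd (n + (q + 1) div 2 + 1 + (n + r))" by (rule ssubst) simp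
      then have "(-1::complex) ^ (n + (q + 1) div 2 + 1) = - ((-1) ^ (n + r))" by (rule neg_one_power_neg)
      then show ?thesis unfolding L using 3 by simp
    next
      case 4
      then show ?thesis unfolding L by simp
    qed
  qed
  have X0: "X = 0" if "length vs + 1 > DIM('a)" unfolding X_def by (rule star_high_degree) (use that in simp)
  have Y0: "Y = 0" if "length vs = 0 \<or> length vs > Suc DIM('a)"
  proof (cases "length vs = 0")
    case False
    have "Y = wedge \<xi> (\<lambda>_. 0) vs" unfolding Y_def
      by (rule wedge_cong_length, rule star_high_degree) (use that False in auto)
    then show ?thesis by (simp add: wedge_zero)
  qed (simp add: Y_def)
  have "(\<Sum>q\<le>DIM('a). if q + length vs + 1 = DIM('a) then X else 0) = X"
  proof (cases "length vs + 1 > DIM('a)")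
    case False
    then have "(\<Sum>q\<le>DIM('a). if q + length vs + 1 = DIM('a) then X else 0) = (\<Sum>q\<le>DIM('a). if q = DIM('a) - 1 - length vs then X else 0)"
      by (intro sum.cong) auto
    then show ?thesis by simp
  qed (simp add: X0)
  moreover have "(\<Sum>q\<le>DIM('a). if q + length vs = Suc DIM('a) then Y else 0) = Y"
  proof (cases "length vs = 0 \<or> length vs > Suc DIM('a)")
    case False
    then have "(\<Sum>q\<le>DIM('a). if q + length vs = Suc DIM('a) then Y else 0) = (\<Sum>q\<le>DIM('a). if q = Suc DIM('a) - length vs then Y else 0)"
      by (intro sum.cong) auto
    moreover have "Suc DIM('a) - length vs \<le> DIM('a)" using False by linarith
    ultimately show ?thesis by simp
  next
    case True
    then have "Y = 0" by (rule Y0)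
    then show ?thesis by (simp cong: if_cong)
  qed
  ultimately show ?thesis
    unfolding t sum_distrib_left[symmetric] sum.distrib by (simp add: symbol_def X_def Y_def r_def)
qed

end

section \<open>B on Fourier coefficients\<close>

definition smooth_periodic_form :: "(real^'m::finite) form \<Rightarrow> bool" where
  "smooth_periodic_form \<phi> \<longleftrightarrow> (\<forall>vs. smooth (\<lambda>x. \<phi> x vs) \<and> periodic (\<lambda>x. \<phi> x vs))"

lemma smooth_periodic_form_simps:
  assumes "smooth_periodic_form \<phi>"
  shows "smooth (\<lambda>x. \<phi> x vs)" "periodic (\<lambda>x. \<phi> x vs)" "continuous_on UNIV (\<lambda>x. \<phi> x vs)"
  using assms by (auto simp: smooth_periodic_form_def intro: smooth_continuous)

lemma smooth_periodic_degree_part: "smooth_periodic_form \<phi> \<Longrightarrow> smooth_periodic_form (degree_part q \<phi>)"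
  unfolding smooth_periodic_form_def degree_part_def
  by (intro allI, case_tac "length vs = q") (simp_all add: smooth_zero periodic_def)

lemma smooth_periodic_B_op:
  assumes "smooth_periodic_form \<phi>" shows "smooth_periodic_form (B_op n b \<phi>)"
proof -
  have 1: "smooth (\<lambda>x. c * (e * star b (ext_deriv \<psi> x) vs - ext_deriv (\<lambda>x. star b (\<psi> x)) x vs))"
    if p: "smooth_periodic_form \<psi>" for c e vs \<psi>
  proof -
    have "smooth (\<lambda>x. e * star b (ext_deriv \<psi> x) vs + (-1) * ext_deriv (\<lambda>x. star b (\<psi> x)) x vs)"
      by (intro smooth_lin2 smooth_star smooth_ext_deriv smooth_periodic_form_simps(1)[OF p])
    then show ?thesis using smooth_mult by fastforce
  qed
  have 2: "periodic (\<lambda>x. c * (e * star b (ext_deriv \<psi> x) vs - ext_deriv (\<lambda>x. star b (\<psi> x)) x vs))"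
    if p: "smooth_periodic_form \<psi>" for c e vs \<psi>
  proof -
    have "periodic (\<lambda>x. star b (ext_deriv \<psi> x) vs)" "periodic (\<lambda>x. ext_deriv (\<lambda>x. star b (\<psi> x)) x vs)"
      by (intro periodic_star periodic_ext_deriv smooth_star smooth_periodic_form_simps[OF p])+
    then show ?thesis by (simp add: periodic_def)
  qed
  show ?thesis unfolding smooth_periodic_form_def B_op_def Let_def hodge_star_eq
    by (intro allI conjI smooth_sum periodic_sum 1 2 smooth_periodic_degree_part assms)
qed

lemma fourier_B_op:
  fixes b :: "nat \<Rightarrow> real^'m::finite"
  assumes "orthonormal_frame b" "DIM(real^'m) = 4 * n - 1" "n \<ge> 1"
    and \<phi>: "smooth_periodic_form \<phi>" "even_form \<phi>" and "integer_vec \<xi>"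
  shows "fourier \<xi> (\<lambda>x. B_op n b \<phi> x vs) =
    2 * of_real pi * \<i> * symbol n b \<xi> (\<lambda>vs. fourier \<xi> (\<lambda>x. \<phi> x vs)) vs"
proof -
  interpret odd_frame b by unfold_locales (use assms(1,2,3) in auto)
  define \<alpha> where "\<alpha> vs = fourier \<xi> (\<lambda>x. \<phi> x vs)" for vs
  let ?c = "2 * of_real pi * \<i> :: complex"
  have ev: "even_cochain \<alpha>" using \<phi>(2) by (auto simp: even_cochain_def even_form_def \<alpha>_def fourier_zero)
  have dp: "(\<lambda>vs. fourier \<xi> (\<lambda>x. degree_part q \<phi> x vs)) = (\<lambda>vs. if length vs = q then \<alpha> vs else 0)" for q
    by (auto simp: degree_part_def \<alpha>_def fourier_zero)
  have trm: "fourier \<xi> (\<lambda>x. c * (e * star b (ext_deriv \<psi> x) vs - ext_deriv (\<lambda>x. star b (\<psi> x)) x vs)) =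
     c * (e * (?c * star b (wedge \<xi> \<beta>) vs) - ?c * wedge \<xi> (star b \<beta>) vs)"
    and cont: "continuous_on UNIV (\<lambda>x. c * (e * star b (ext_deriv \<psi> x) vs - ext_deriv (\<lambda>x. star b (\<psi> x)) x vs))"
    if p: "smooth_periodic_form \<psi>" and \<beta>: "(\<lambda>vs. fourier \<xi> (\<lambda>x. \<psi> x vs)) = \<beta>" for \<psi> \<beta> c e
  proof -
    note sp = smooth_periodic_form_simps[OF p]
    have c1: "continuous_on UNIV (\<lambda>x. star b (ext_deriv \<psi> x) vs)" "continuous_on UNIV (\<lambda>x. ext_deriv (\<lambda>x. star b (\<psi> x)) x vs)"
      by (intro smooth_continuous smooth_star smooth_ext_deriv sp)+
    show "continuous_on UNIV (\<lambda>x. c * (e * star b (ext_deriv \<psi> x) vs - ext_deriv (\<lambda>x. star b (\<psi> x)) x vs))"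
      by (intro continuous_intros c1)
    have f1: "fourier \<xi> (\<lambda>x. star b (ext_deriv \<psi> x) vs) = ?c * star b (wedge \<xi> \<beta>) vs"
    proof -
      have "fourier \<xi> (\<lambda>x. star b (ext_deriv \<psi> x) vs) = star b (\<lambda>ws. ?c * wedge \<xi> \<beta> ws) vs"
        by (subst fourier_star) (auto intro: smooth_continuous smooth_ext_deriv sp
          simp: fourier_ext_deriv[OF sp(1,2) assms(6)] \<beta>)
      then show ?thesis by (simp only: star_mult)
    qed
    have f2: "fourier \<xi> (\<lambda>x. ext_deriv (\<lambda>x. star b (\<psi> x)) x vs) = ?c * wedge \<xi> (star b \<beta>) vs"
    proof -
      have "(\<lambda>ws. fourier \<xi> (\<lambda>x. star b (\<psi> x) ws)) = star b \<beta>"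
        by (rule ext) (simp add: fourier_star[OF sp(3)] \<beta>)
      then show ?thesis
        by (subst fourier_ext_deriv) (auto intro: smooth_star periodic_star sp assms(6))
    qed
    have "(\<lambda>x. c * (e * star b (ext_deriv \<psi> x) vs - ext_deriv (\<lambda>x. star b (\<psi> x)) x vs)) =
      (\<lambda>x. (c * e) * star b (ext_deriv \<psi> x) vs + (- c) * ext_deriv (\<lambda>x. star b (\<psi> x)) x vs)" (is "?f = ?g")
      by (simp add: algebra_simps)
    then have "fourier \<xi> ?f = (c * e) * (?c * star b (wedge \<xi> \<beta>) vs) + (- c) * (?c * wedge \<xi> (star b \<beta>) vs)"
      by (simp only: fourier_lin2[OF c1] f1 f2)
    then show "fourier \<xi> (\<lambda>x. c * (e * star b (ext_deriv \<psi> x) vs - ext_deriv (\<lambda>x. star b (\<psi> x)) x vs)) =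
     c * (e * (?c * star b (wedge \<xi> \<beta>) vs) - ?c * wedge \<xi> (star b \<beta>) vs)"
      by (simp only:) (simp add: algebra_simps)
  qed
  have "fourier \<xi> (\<lambda>x. B_op n b \<phi> x vs) = (\<Sum>q\<le>DIM(real^'m). ?c *
      (let \<beta> = (\<lambda>vs. if length vs = q then \<alpha> vs else 0); p = (q + 1) div 2; \<epsilon> = (if even q then 1 else -1)
      in (-1) ^ (n + p + 1) * (\<epsilon> * star b (wedge \<xi> \<beta>) vs - wedge \<xi> (star b \<beta>) vs)))"
    unfolding B_op_def Let_def hodge_star_eq
    by (subst fourier_sum[OF cont[OF smooth_periodic_degree_part[OF \<phi>(1)] dp]])
      (simp only: trm[OF smooth_periodic_degree_part[OF \<phi>(1)] dp], intro sum.cong refl, simp only: right_diff_distrib mult_ac)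
  also have "\<dots> = ?c * symbol n b \<xi> \<alpha> vs"
    unfolding sum_distrib_left[symmetric] symbol_degree_sum[OF assms(2,3) ev] ..
  also have "\<alpha> = (\<lambda>vs. fourier \<xi> (\<lambda>x. \<phi> x vs))" by (rule ext) (rule \<alpha>_def)
  finally show ?thesis .
qed

section \<open>Eigenspaces of B as spaces of coefficient families\<close>

locale eta_manifold = cyclic_flat A jx N \<Gamma> + plane_frame b K
  for A :: "real^'k^('k::finite)" and jx :: "nat \<Rightarrow> 'k" and N :: nat and \<Gamma> :: "'k option motion set"
    and b :: "nat \<Rightarrow> real^('k option)" and K :: nat +
  fixes n :: nat and \<gamma> :: "nat \<Rightarrow> real"
  assumes n_pos: "n \<ge> 1" and K_def: "K = 2 * n - 1" and N_def: "N = 2 * K"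
    and b0: "b 0 = axis None 1" and rotates: "rotates ((*v) (block_one A)) \<gamma>"
    and \<gamma>_def: "\<And>l. l \<in> {1..K} \<Longrightarrow> \<gamma> l = (2 * real l - 1) * pi / (2 * real K)"
begin

lemma odd_K: "odd K" and dim_n: "DIM(real^('k option)) = 4 * n - 1"
  using n_pos dim_planes unfolding K_def by auto

lemma inner_A': "(A' *v x) \<bullet> (A' *v y) = x \<bullet> y"
  by (rule orthogonal_matrix_inner[OF orthogonal_A'])

definition shift_vec :: "real^('k option)" where
  "shift_vec = axis None (1 / (2 * real N))"

lemma A'_shift_vec: "A' *v shift_vec = shift_vec"
  by (simp add: shift_vec_def block_one_axis_None)

lemma wave_A': "wave (A' *v \<xi>) (A' *v x) = wave \<xi> x"
  by (simp add: wave_def inner_A')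

lemma wave_A'_shift: "wave (A' *v \<xi>) shift_vec = wave \<xi> shift_vec"
  using wave_A'[of \<xi> shift_vec] by (simp add: A'_shift_vec)

lemma A'_inverse: "transpose A' *v (A' *v x) = x" "A' *v (transpose A' *v x) = x"
  using orthogonal_A' by (simp_all only: matrix_vector_mul_assoc orthogonal_matrix_def matrix_vector_mul_lid)

lemma A'_eq_rot: "A' = rot 1" "transpose A' = rot (2 * N - 1)"
proof -
  show 1: "A' = rot 1" by (rule rot_1[symmetric])
  have "2 * N - 1 + 1 = 2 * N" using N_pos by simp
  then have "rot (2 * N - 1) ** A' = mat 1" unfolding 1 rot_add[symmetric] by (simp only: rot_2N)
  then have "rot (2 * N - 1) ** (A' ** transpose A') = transpose A'" by (simp add: matrix_mul_assoc matrix_mul_lid)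
  then show "transpose A' = rot (2 * N - 1)" using orthogonal_A' by (simp add: orthogonal_matrix_def matrix_mul_rid)
qed

lemma integer_A': "integer_vec (A' *v \<xi>) \<longleftrightarrow> integer_vec \<xi>"
proof
  assume "integer_vec (A' *v \<xi>)"
  then have "integer_vec (rot (2 * N - 1) *v (A' *v \<xi>))" by (rule rot_integer)
  then have "integer_vec (transpose A' *v (A' *v \<xi>))" by (simp only: A'_eq_rot(2))
  then show "integer_vec \<xi>" by (simp only: A'_inverse)
next
  assume "integer_vec \<xi>"
  then have "integer_vec (rot 1 *v \<xi>)" by (rule rot_integer)
  then show "integer_vec (A' *v \<xi>)" by (simp only: rot_1)
qed

text \<open>\<open>frequencies \<mu>\<close> carries the Fourier series of an eigenform for \<open>\<mu>\<close>, as \<open>B\<close> squares to the Laplacian.\<close>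

definition frequencies :: "real \<Rightarrow> (real^('k option)) set" where
  "frequencies \<mu> = {\<xi>. integer_vec \<xi> \<and> 4 * pi\<^sup>2 * (\<xi> \<bullet> \<xi>) = \<mu>\<^sup>2}"

lemma frequencies_A': "A' *v \<xi> \<in> frequencies \<mu> \<longleftrightarrow> \<xi> \<in> frequencies \<mu>"
  by (simp add: frequencies_def inner_A' integer_A')

lemma frequencies_uminus: "frequencies (- \<mu>) = frequencies \<mu>"
  by (simp add: frequencies_def)

lemma frequencies_box:
  assumes "\<mu>\<^sup>2 = 4 * pi\<^sup>2 * real k"
  shows "frequencies \<mu> \<subseteq> {v. integer_vec v \<and> (\<forall>i. \<bar>v $ i\<bar> \<le> real k)}"
proof
  fix \<xi> assume x: "\<xi> \<in> frequencies \<mu>"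
  then have k: "\<xi> \<bullet> \<xi> = real k" using assms by (simp add: frequencies_def)
  have "\<bar>\<xi> $ i\<bar> \<le> real k" for i
  proof -
    obtain m where m: "\<xi> $ i = of_int m" using x by (auto simp: frequencies_def integer_vec_def elim!: Ints_cases)
    have "(\<xi> $ i)\<^sup>2 \<le> \<xi> \<bullet> \<xi>"
      using component_le_norm_cart[of \<xi> i] by (metis abs_le_square_iff abs_norm_cancel power2_norm_eq_inner)
    moreover have "\<bar>\<xi> $ i\<bar> \<le> (\<xi> $ i)\<^sup>2"
    proof -
      have "\<bar>m\<bar> \<le> m\<^sup>2"
      proof (cases "m = 0")
        case False
        then have "\<bar>m\<bar> * 1 \<le> \<bar>m\<bar> * \<bar>m\<bar>" by (intro mult_left_mono) auto
        then show ?thesis by (simp only: abs_mult_self_eq power2_eq_square mult_1_right)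
      qed simp
      then have "real_of_int \<bar>m\<bar> \<le> real_of_int (m\<^sup>2)" by (simp only: of_int_le_iff)
      then show ?thesis by (simp add: m)
    qed
    ultimately show ?thesis using k by simp
  qed
  then show "\<xi> \<in> {v. integer_vec v \<and> (\<forall>i. \<bar>v $ i\<bar> \<le> real k)}" using x by (simp add: frequencies_def)
qed

lemma frequencies_level:
  assumes "\<xi> \<in> frequencies \<mu>" obtains k :: nat where "\<mu>\<^sup>2 = 4 * pi\<^sup>2 * real k" "\<xi> \<bullet> \<xi> = real k"
proof -
  have "\<xi> \<bullet> \<xi> \<in> \<int>" using assms by (auto simp: frequencies_def inner_vec_def integer_vec_def intro!: Ints_sum)
  then obtain m where m: "\<xi> \<bullet> \<xi> = of_int m" by (elim Ints_cases)
  then have "m \<ge> 0" using inner_ge_zero[of \<xi>] by simp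
  then show ?thesis using that[of "nat m"] m assms by (simp add: frequencies_def)
qed

lemma bij_frequencies: "bij_betw ((*v) A') (frequencies \<mu>) (frequencies \<mu>)"
proof (rule bij_betw_byWitness[where f' = "(*v) (transpose A')"])
  show "\<forall>\<xi>\<in>frequencies \<mu>. transpose A' *v (A' *v \<xi>) = \<xi>" using A'_inverse(1) by blast
  show "\<forall>\<xi>\<in>frequencies \<mu>. A' *v (transpose A' *v \<xi>) = \<xi>" using A'_inverse(2) by blast
  show "(*v) A' ` frequencies \<mu> \<subseteq> frequencies \<mu>" using frequencies_A' by blast
  show "(*v) (transpose A') ` frequencies \<mu> \<subseteq> frequencies \<mu>"
  proof
    fix \<eta> assume "\<eta> \<in> (*v) (transpose A') ` frequencies \<mu>"
    then obtain \<xi> where x: "\<xi> \<in> frequencies \<mu>" "\<eta> = transpose A' *v \<xi>" by blast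
    then have "A' *v \<eta> \<in> frequencies \<mu>" using A'_inverse(2)[of \<xi>] by (simp only:)
    then show "\<eta> \<in> frequencies \<mu>" by (simp only: frequencies_A')
  qed
qed

lemma finite_frequencies: "finite (frequencies \<mu>)"
proof (cases "frequencies \<mu> = {}")
  case False
  then obtain \<xi> where "\<xi> \<in> frequencies \<mu>" by blast
  then obtain k where k: "\<mu>\<^sup>2 = 4 * pi\<^sup>2 * real k" by (rule frequencies_level)
  show ?thesis by (rule finite_subset[OF frequencies_box[OF k] card_integer_vec_box(1)])
qed simp

text \<open>The last condition is invariance under the screw motion seen on coefficients:
  \<open>A'\<close> permutes the frequencies, and the translation along the axis contributes a value
  of the wave. Families have the type \<open>form\<close>, with the frequency in place of the point,
  so that the vector space of forms can be reused.\<close>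

definition families :: "real \<Rightarrow> (real^('k option)) form set" where
  "families \<mu> = {a. (\<forall>\<xi>. \<xi> \<notin> frequencies \<mu> \<longrightarrow> a \<xi> = (\<lambda>_. 0)) \<and>
     (\<forall>\<xi>. alternating (a \<xi>) \<and> even_cochain (a \<xi>)) \<and>
     (\<forall>\<xi> vs. 2 * of_real pi * \<i> * symbol n b \<xi> (a \<xi>) vs = of_real \<mu> * a \<xi> vs) \<and>
     (\<forall>\<xi> vs. a \<xi> vs = wave \<xi> shift_vec * a (A' *v \<xi>) (map ((*v) A') vs))}"

lemma familiesD:
  assumes "a \<in> families \<mu>"
  shows "alternating (a \<xi>)" "even_cochain (a \<xi>)"
    "2 * of_real pi * \<i> * symbol n b \<xi> (a \<xi>) vs = of_real \<mu> * a \<xi> vs"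
    "a \<xi> vs = wave \<xi> shift_vec * a (A' *v \<xi>) (map ((*v) A') vs)"
    "\<xi> \<notin> frequencies \<mu> \<Longrightarrow> a \<xi> = (\<lambda>_. 0)"
  using assms unfolding families_def mem_Collect_eq by blast+

definition synthesis :: "real \<Rightarrow> (real^('k option)) form \<Rightarrow> (real^('k option)) form" where
  "synthesis \<mu> a = (\<lambda>x vs. \<Sum>\<xi>\<in>frequencies \<mu>. a \<xi> vs * wave \<xi> x)"

lemma synthesis_smooth_periodic: "smooth_periodic_form (synthesis \<mu> a)"
  unfolding smooth_periodic_form_def synthesis_def
proof (intro allI conjI)
  fix vs
  show "smooth (\<lambda>x. \<Sum>\<xi>\<in>frequencies \<mu>. a \<xi> vs * wave \<xi> x)"
    by (rule smooth_sum, rule smooth_mult[OF smooth_wave])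
  show "periodic (\<lambda>x. \<Sum>\<xi>\<in>frequencies \<mu>. a \<xi> vs * wave \<xi> x)"
    by (rule periodic_sum, rule periodic_const_mult, rule periodic_wave) (simp add: frequencies_def)
qed

lemma fourier_synthesis:
  assumes "integer_vec \<xi>"
  shows "fourier \<xi> (\<lambda>x. synthesis \<mu> a x vs) = (if \<xi> \<in> frequencies \<mu> then a \<xi> vs else 0)"
proof -
  have c: "continuous_on UNIV (\<lambda>x. a \<eta> vs * wave \<eta> x)" for \<eta> by (intro continuous_intros)
  have "fourier \<xi> (\<lambda>x. synthesis \<mu> a x vs) = (\<Sum>\<eta>\<in>frequencies \<mu>. a \<eta> vs * fourier \<xi> (wave \<eta>))"
    unfolding synthesis_def by (simp only: fourier_sum[OF c] fourier_mult[OF continuous_on_wave])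
  also have "\<dots> = (\<Sum>\<eta>\<in>frequencies \<mu>. if \<xi> = \<eta> then a \<xi> vs else 0)"
    by (rule sum.cong) (auto simp: fourier_wave assms frequencies_def)
  finally show ?thesis by (simp add: finite_frequencies)
qed

lemma form_eqI:
  assumes "smooth_periodic_form \<phi>" "smooth_periodic_form \<psi>"
    and "\<And>\<xi> vs. integer_vec \<xi> \<Longrightarrow> fourier \<xi> (\<lambda>x. \<phi> x vs) = fourier \<xi> (\<lambda>x. \<psi> x vs)"
  shows "\<phi> = \<psi>"
proof (intro ext)
  fix x vs
  note s = smooth_periodic_form_simps[OF assms(1)] smooth_periodic_form_simps[OF assms(2)]
  have "(\<lambda>x. 1 * \<phi> x vs + (-1) * \<psi> x vs) = (\<lambda>_. 0)"
  proof (rule fourier_unique)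
    show "continuous_on UNIV (\<lambda>x. 1 * \<phi> x vs + (-1) * \<psi> x vs)" by (intro continuous_intros s)
    show "periodic (\<lambda>x. 1 * \<phi> x vs + (-1) * \<psi> x vs)" using s(2)[of vs] s(5)[of vs] by (simp add: periodic_def)
    show "fourier \<xi> (\<lambda>x. 1 * \<phi> x vs + (-1) * \<psi> x vs) = 0" if "integer_vec \<xi>" for \<xi>
      unfolding fourier_lin2[OF s(3,6)] assms(3)[OF that] by simp
  qed
  then show "\<phi> x vs = \<psi> x vs" by (simp add: fun_eq_iff)
qed

lemma synthesis_in_eigenspace:
  assumes a: "a \<in> families \<mu>" shows "synthesis \<mu> a \<in> B_eigenspace n \<Gamma> b \<mu>"
proof -
  have alt: "alternating (a \<xi>)" and ev: "even_cochain (a \<xi>)"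
    and sy: "2 * of_real pi * \<i> * symbol n b \<xi> (a \<xi>) vs = of_real \<mu> * a \<xi> vs"
    and inv: "a \<xi> vs = wave \<xi> shift_vec * a (A' *v \<xi>) (map ((*v) A') vs)" for \<xi> vs
    by (rule familiesD[OF a])+
  have sp: "smooth_periodic_form (synthesis \<mu> a)" by (rule synthesis_smooth_periodic)
  have af: "alternating (synthesis \<mu> a x)" for x
  proof -
    have "alternating (\<lambda>vs. \<Sum>\<xi>\<in>frequencies \<mu>. wave \<xi> x * a \<xi> vs)" by (intro alternating_sum alternating_mult alt)
    then show ?thesis by (simp add: synthesis_def mult.commute)
  qed
  have df: "diff_form (synthesis \<mu> a)"
    unfolding diff_form_def using af sp by (auto simp: alternating_def smooth_periodic_form_def)
  have evf: "even_form (synthesis \<mu> a)"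
    using ev by (auto simp: even_form_def even_cochain_def synthesis_def)
  note bij = bij_frequencies[of \<mu>]
  have "synthesis \<mu> a (A' *v x + shift_vec) (map ((*v) A') vs) = synthesis \<mu> a x vs" for x vs
  proof -
    have "synthesis \<mu> a (A' *v x + shift_vec) (map ((*v) A') vs) =
      (\<Sum>\<xi>\<in>frequencies \<mu>. a (A' *v \<xi>) (map ((*v) A') vs) * wave (A' *v \<xi>) (A' *v x + shift_vec))"
      unfolding synthesis_def by (rule sum.reindex_bij_betw[OF bij, symmetric])
    also have "\<dots> = synthesis \<mu> a x vs" unfolding synthesis_def
      by (rule sum.cong[OF refl]) (subst inv[of _ vs], simp add: wave_add_right wave_A' wave_A'_shift mult_ac)
    finally show ?thesis .
  qed
  then have fq: "synthesis \<mu> a \<in> forms_on_quotient \<Gamma>"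
    unfolding forms_on_quotient_\<Gamma> using df smooth_periodic_form_simps(2)[OF sp]
    by (simp add: periodic_def shift_vec_def)
  have "B_op n b (synthesis \<mu> a) = form_scale (of_real \<mu>) (synthesis \<mu> a)"
  proof (rule form_eqI[OF smooth_periodic_B_op[OF sp]])
    have "smooth_periodic_form (\<lambda>x vs. of_real \<mu> * synthesis \<mu> a x vs)"
      unfolding smooth_periodic_form_def
      by (intro allI conjI smooth_mult[OF smooth_periodic_form_simps(1)[OF sp]]
        periodic_const_mult[OF smooth_periodic_form_simps(2)[OF sp]])
    then show "smooth_periodic_form (form_scale (of_real \<mu>) (synthesis \<mu> a))" by (simp add: form_scale_def)
    fix \<xi> :: "real^('k option)" and vs assume i: "integer_vec \<xi>"
    have "(\<lambda>vs. fourier \<xi> (\<lambda>x. synthesis \<mu> a x vs)) = a \<xi>"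
      using familiesD(5)[OF a, of \<xi>] by (auto simp: fourier_synthesis[OF i])
    then show "fourier \<xi> (\<lambda>x. B_op n b (synthesis \<mu> a) x vs) = fourier \<xi> (\<lambda>x. form_scale (of_real \<mu>) (synthesis \<mu> a) x vs)"
      using fourier_B_op[OF frame dim_n n_pos sp evf i, of vs] sy[of \<xi> vs]
      by (simp add: form_scale_def fourier_mult smooth_periodic_form_simps[OF sp] fun_eq_iff)
  qed
  then show ?thesis using fq evf by (simp add: B_eigenspace_def)
qed

text \<open>Applying \<open>2 \<pi> \<i>\<close> times the symbol twice multiplies a coefficient
  both by \<open>\<mu>\<^sup>2\<close> and by
  \<open>4 \<pi>\<^sup>2 (\<xi> \<bullet> \<xi>)\<close>, so coefficients vanish off
  \<open>frequencies \<mu>\<close>. The Fourier series is finite and no convergence question arises;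
  uniqueness then transfers the invariance.\<close>

lemma eigenspace_synthesis:
  assumes \<phi>: "\<phi> \<in> B_eigenspace n \<Gamma> b \<mu>"
  obtains a where "a \<in> families \<mu>" "\<phi> = synthesis \<mu> a"
proof -
  have df: "diff_form \<phi>" and per: "\<And>x v vs. integer_vec v \<Longrightarrow> \<phi> (x + v) vs = \<phi> x vs"
    and inv: "\<And>x vs. \<phi> (A' *v x + shift_vec) (map ((*v) A') vs) = \<phi> x vs"
    and ev: "even_form \<phi>" and eig: "B_op n b \<phi> = form_scale (of_real \<mu>) \<phi>"
    using \<phi> unfolding B_eigenspace_def forms_on_quotient_\<Gamma> shift_vec_def by auto
  have sp: "smooth_periodic_form \<phi>" using df per by (auto simp: smooth_periodic_form_def diff_form_def periodic_def)
  note s = smooth_periodic_form_simps[OF sp]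
  define a where "a \<xi> vs = (if integer_vec \<xi> then fourier \<xi> (\<lambda>x. \<phi> x vs) else 0)" for \<xi> vs
  have alt: "alternating (a \<xi>)" for \<xi>
  proof (cases "integer_vec \<xi>")
    case True
    show ?thesis unfolding alternating_def
    proof (intro conjI allI impI)
      fix us ws
      have l: "linear (\<lambda>v. \<phi> x (us @ v # ws))" for x using df by (simp add: diff_form_def)
      show "linear (\<lambda>v. a \<xi> (us @ v # ws))"
      proof (rule linearI)
        fix v w
        have "fourier \<xi> (\<lambda>x. 1 * \<phi> x (us @ v # ws) + 1 * \<phi> x (us @ w # ws)) =
          1 * fourier \<xi> (\<lambda>x. \<phi> x (us @ v # ws)) + 1 * fourier \<xi> (\<lambda>x. \<phi> x (us @ w # ws))"
          by (rule fourier_lin2[OF s(3) s(3)])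
        then show "a \<xi> (us @ (v + w) # ws) = a \<xi> (us @ v # ws) + a \<xi> (us @ w # ws)"
          using True by (simp add: a_def linear_add[OF l])
      next
        fix r :: real and v
        have "\<phi> x (us @ (r *\<^sub>R v) # ws) = of_real r * \<phi> x (us @ v # ws)" for x
          using linear_scale[OF l, of x r v] by (simp only: scaleR_conv_of_real[where 'a = complex])
        then show "a \<xi> (us @ (r *\<^sub>R v) # ws) = r *\<^sub>R a \<xi> (us @ v # ws)"
          using True fourier_mult[OF s(3), of \<xi> "of_real r"] by (simp add: a_def scaleR_conv_of_real[where 'a = complex])
      qed
    next
      fix vs :: "(real^('k option)) list" assume "\<not> distinct vs"
      then have "(\<lambda>x. \<phi> x vs) = (\<lambda>_. 0)" using df by (auto simp: diff_form_def)
      then show "a \<xi> vs = 0" by (simp add: a_def fourier_zero)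
    qed
  next
    case False
    then have "a \<xi> = (\<lambda>_. 0)" by (auto simp: a_def)
    then show ?thesis by (simp add: alternating_zero)
  qed
  have eva: "even_cochain (a \<xi>)" for \<xi>
    using ev by (auto simp: even_cochain_def a_def even_form_def fourier_zero)
  have sy: "2 * of_real pi * \<i> * symbol n b \<xi> (a \<xi>) vs = of_real \<mu> * a \<xi> vs" for \<xi> vs
  proof (cases "integer_vec \<xi>")
    case True
    then have "a \<xi> = (\<lambda>vs. fourier \<xi> (\<lambda>x. \<phi> x vs))" by (auto simp: a_def)
    then show ?thesis
      using fourier_B_op[OF frame dim_n n_pos sp ev True, of vs] fourier_mult[OF s(3), of \<xi> "of_real \<mu>" vs]
      by (simp add: eig form_scale_def)
  next
    case False
    then have "a \<xi> = (\<lambda>_. 0)" by (auto simp: a_def)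
    then show ?thesis by (simp add: symbol_zero)
  qed
  have supp: "a \<xi> = (\<lambda>_. 0)" if nf: "\<xi> \<notin> frequencies \<mu>" for \<xi>
  proof
    fix vs
    show "a \<xi> vs = 0"
    proof (cases "integer_vec \<xi> \<and> even (length vs)")
      case True
      let ?c = "2 * of_real pi * \<i> :: complex"
      have f: "(\<lambda>vs. ?c * symbol n b \<xi> (a \<xi>) vs) = (\<lambda>vs. of_real \<mu> * a \<xi> vs)" by (rule ext) (rule sy)
      have "?c * (?c * symbol n b \<xi> (symbol n b \<xi> (a \<xi>)) vs) = ?c * symbol n b \<xi> (\<lambda>vs. ?c * symbol n b \<xi> (a \<xi>) vs) vs"
        by (simp only: symbol_mult)
      also have "\<dots> = of_real \<mu> * (of_real \<mu> * a \<xi> vs)"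
        unfolding f symbol_mult using sy[of \<xi> vs] by (simp add: mult.left_commute)
      finally have "of_real (4 * pi\<^sup>2 * (\<xi> \<bullet> \<xi>) - \<mu>\<^sup>2) * a \<xi> vs = 0"
        using symbol_symbol[OF dim_n n_pos alt, of vs \<xi> \<xi>] True
        by (simp add: power2_eq_square algebra_simps)
      moreover have "4 * pi\<^sup>2 * (\<xi> \<bullet> \<xi>) - \<mu>\<^sup>2 \<noteq> 0" using nf True by (simp add: frequencies_def)
      ultimately show ?thesis unfolding mult_eq_0_iff of_real_eq_0_iff by blast
    next
      case False
      then show ?thesis using eva[of \<xi>] by (auto simp: even_cochain_def a_def)
    qed
  qed
  have \<phi>a: "\<phi> = synthesis \<mu> a"
  proof (rule form_eqI[OF sp synthesis_smooth_periodic])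
    fix \<xi> :: "real^('k option)" and vs assume i: "integer_vec \<xi>"
    then show "fourier \<xi> (\<lambda>x. \<phi> x vs) = fourier \<xi> (\<lambda>x. synthesis \<mu> a x vs)"
      using fun_cong[OF supp, of \<xi> vs] by (auto simp: fourier_synthesis a_def)
  qed
  note bij = bij_frequencies[of \<mu>]
  have "a \<xi> vs = wave \<xi> shift_vec * a (A' *v \<xi>) (map ((*v) A') vs)" for \<xi> vs
  proof (cases "\<xi> \<in> frequencies \<mu>")
    case True
    then have i: "integer_vec \<xi>" by (simp add: frequencies_def)
    \<comment> \<open>The coefficients of the form pulled back by the screw motion.\<close>
    define c where "c \<eta> vs = wave \<eta> shift_vec * a (A' *v \<eta>) (map ((*v) A') vs)" for \<eta> vs
    have "synthesis \<mu> a x vs = synthesis \<mu> c x vs" for x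
    proof -
      have "synthesis \<mu> a x vs = synthesis \<mu> a (A' *v x + shift_vec) (map ((*v) A') vs)"
        using inv[of x vs] unfolding \<phi>a by simp
      also have "\<dots> = (\<Sum>\<xi>\<in>frequencies \<mu>. a (A' *v \<xi>) (map ((*v) A') vs) * wave (A' *v \<xi>) (A' *v x + shift_vec))"
        unfolding synthesis_def by (rule sum.reindex_bij_betw[OF bij, symmetric])
      also have "\<dots> = synthesis \<mu> c x vs" unfolding synthesis_def c_def
        by (rule sum.cong[OF refl]) (simp add: wave_add_right wave_A' wave_A'_shift mult_ac)
      finally show ?thesis .
    qed
    then have "a \<xi> vs = c \<xi> vs" using fourier_synthesis[OF i, of \<mu> a vs] fourier_synthesis[OF i, of \<mu> c vs] True by simp
    then show ?thesis by (simp add: c_def)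
  next
    case False
    then show ?thesis using supp[of \<xi>] supp[of "A' *v \<xi>"] by (simp add: frequencies_A')
  qed
  then have "a \<in> families \<mu>" unfolding families_def using supp alt eva sy by blast
  then show ?thesis using \<phi>a that by blast
qed

lemma B_eigenspace_eq: "B_eigenspace n \<Gamma> b \<mu> = synthesis \<mu> ` families \<mu>"
  using synthesis_in_eigenspace eigenspace_synthesis by blast

lemma synthesis_eq_0:
  assumes "a \<in> families \<mu>" "synthesis \<mu> a = 0" shows "a = 0"
proof (intro ext)
  fix \<xi> vs
  show "a \<xi> vs = 0 \<xi> vs"
  proof (cases "\<xi> \<in> frequencies \<mu>")
    case True
    then have i: "integer_vec \<xi>" by (simp add: frequencies_def)
    show ?thesis using fourier_synthesis[OF i, of \<mu> a vs] assms(2) True by (simp add: fourier_zero)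
  next
    case False
    then show ?thesis using familiesD(5)[OF assms(1), of \<xi>] by simp
  qed
qed

end

section \<open>Comparing the eigenspaces for \<open>\<mu>\<close> and \<open>-\<mu>\<close>\<close>

context vector_space
begin

lemma dim_singleton_zero: "dim {0} = 0"
  using dim_le_card[of "{0}" "{}"] by simp

lemma dim_mono_finite:
  assumes "X \<subseteq> Y" "Y \<subseteq> span W" "finite W" shows "dim X \<le> dim Y"
proof -
  obtain B where B: "B \<subseteq> Y" "independent B" "Y \<subseteq> span B" "card B = dim Y" by (rule basis_exists)
  have "finite B" using independent_span_bound[OF assms(3) B(2)] B(1) assms(2) by blast
  then show ?thesis using dim_le_card[of X B] assms(1) B by auto
qed

text \<open>Finiteness is localised, as the ambient space of forms is infinite-dimensional:
  \<open>V\<close> lies in the span of a finite \<open>W\<close>. A basis of the kernel is extended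
  to one of \<open>V\<close>, and the added vectors map to a basis of the image.\<close>

lemma rank_nullity:
  assumes lin: "Vector_Spaces.linear scale scale T" and V: "subspace V" "V \<subseteq> span W" "finite W"
  shows "dim V = dim (T ` V) + dim {x \<in> V. T x = 0}"
proof -
  interpret T: Vector_Spaces.linear scale scale T by (rule lin)
  let ?Z = "{x \<in> V. T x = 0}"
  obtain B0 where B0: "B0 \<subseteq> ?Z" "independent B0" "?Z \<subseteq> span B0" "card B0 = dim ?Z" by (rule basis_exists)
  obtain B where B: "B0 \<subseteq> B" "B \<subseteq> V" "independent B" "V \<subseteq> span B"
    using maximal_independent_subset_extend[of B0 V] B0 by auto
  have fB: "finite B" using independent_span_bound[OF V(3) B(3)] B(2) V(2) by blast
  define C where "C = B - B0"
  have fin: "finite C" "finite B0" using fB B(1) by (auto simp: C_def intro: finite_subset)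
  have key: "u v = 0" if z: "(\<Sum>v\<in>C. u v *s T v) = 0" and v: "v \<in> C" for u v
  proof -
    define x where "x = (\<Sum>v\<in>C. u v *s v)"
    have "x \<in> V" unfolding x_def
      by (intro subspace_sum V(1) subspace_scale) (use B(2) in \<open>auto simp: C_def\<close>)
    moreover have "T x = 0" unfolding x_def by (simp add: T.sum T.scale z)
    ultimately have "x \<in> span B0" using B0(3) by blast
    then obtain w where w: "x = (\<Sum>v\<in>B0. w v *s v)" using span_finite[OF fin(2)] by auto
    define g where "g v = (if v \<in> B0 then w v else - u v)" for v
    have "(\<Sum>v\<in>B. g v *s v) = (\<Sum>v\<in>B0. g v *s v) + (\<Sum>v\<in>C. g v *s v)"
      unfolding C_def using sum.subset_diff[OF B(1) fB, of "\<lambda>v. g v *s v"] by (simp only: add.commute)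
    also have "(\<Sum>v\<in>B0. g v *s v) = x" unfolding w by (rule sum.cong) (auto simp: g_def)
    also have "(\<Sum>v\<in>C. g v *s v) = (\<Sum>v\<in>C. - (u v *s v))" by (rule sum.cong) (auto simp: g_def C_def)
    finally have "(\<Sum>v\<in>B. g v *s v) = 0" by (simp add: x_def sum_negf)
    then have "g v = 0" using independentD[OF B(3) fB order_refl] v by (auto simp: C_def)
    then show ?thesis using v by (auto simp: g_def C_def)
  qed
  have inj: "inj_on T C"
  proof (rule inj_onI, rule ccontr)
    fix v w assume vw: "v \<in> C" "w \<in> C" "T v = T w" "v \<noteq> w"
    define u :: "'b \<Rightarrow> 'a" where "u x = (if x = v then 1 else if x = w then -1 else 0)" for x
    have "(\<Sum>x\<in>C. u x *s T x) = (\<Sum>x\<in>{v, w}. u x *s T x)"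
      by (rule sum.mono_neutral_right) (use fin vw in \<open>auto simp: u_def\<close>)
    also have "\<dots> = 0" using vw by (simp add: u_def)
    finally have "u v = 0" using key vw(1) by blast
    then show False by (simp add: u_def)
  qed
  have ind: "independent (T ` C)"
  proof
    assume "dependent (T ` C)"
    then obtain u y where u: "y \<in> T ` C" "u y \<noteq> 0" "(\<Sum>y\<in>T ` C. u y *s y) = 0"
      using dependent_finite[OF finite_imageI[OF fin(1)]] by blast
    then have "(\<Sum>v\<in>C. (u \<circ> T) v *s T v) = 0" by (simp add: sum.reindex[OF inj] o_def)
    then show False using key[of "u \<circ> T"] u(1,2) by auto
  qed
  have "T ` V \<subseteq> span (T ` C)"
  proof -
    have "T ` V \<subseteq> T ` span B" using B(4) by blast
    also have "\<dots> = span (T ` B)" by (rule T.span_image[symmetric])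
    also have "\<dots> \<subseteq> span (T ` C)"
    proof (rule span_minimal[OF _ subspace_span])
      show "T ` B \<subseteq> span (T ` C)"
      proof
        fix y assume "y \<in> T ` B"
        then obtain x where x: "x \<in> B" "y = T x" by blast
        show "y \<in> span (T ` C)"
        proof (cases "x \<in> B0")
          case True
          then show ?thesis using B0(1) x(2) by (auto simp: span_zero)
        next
          case False
          then show ?thesis using x by (auto simp: C_def intro: span_base)
        qed
      qed
    qed
    finally show ?thesis .
  qed
  moreover have "T ` C \<subseteq> T ` V" using B(2) by (auto simp: C_def)
  ultimately have "dim (T ` V) = card C"
    using basis_card_eq_dim[OF _ _ ind] card_image[OF inj] by simp
  moreover have "dim V = card B" using basis_card_eq_dim[OF B(2,4,3)] by simp
  moreover have "card B = card B0 + card C"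
    unfolding C_def using card_Diff_subset[OF fin(2) B(1)] card_mono[OF fB B(1)] by simp
  ultimately show ?thesis using B0(4) by simp
qed

text \<open>By the kernel condition \<open>T\<close> is injective on the image of \<open>V\<close>,
  and it sends this image into the image of \<open>U\<close>; by symmetry the two ranks bound each
  other. Rank-nullity on both sides turns equal ranks into the claim.\<close>

lemma dim_swap:
  assumes lin: "Vector_Spaces.linear scale scale T"
    and V: "subspace V" "V \<subseteq> span W" "finite W" and U: "subspace U" "U \<subseteq> span W'" "finite W'"
    and VU: "T ` V \<subseteq> U" "T ` U \<subseteq> V"
    and ker: "\<And>x. x \<in> V \<union> U \<Longrightarrow> T (T x) = 0 \<Longrightarrow> T x = 0"
  shows "dim V + dim {x \<in> U. T x = 0} = dim U + dim {x \<in> V. T x = 0}"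
proof -
  interpret T: Vector_Spaces.linear scale scale T by (rule lin)
  have le: "dim (T ` X) \<le> dim (T ` Y)"
    if X: "subspace X" "X \<subseteq> span S" "finite S" and Y: "subspace Y" "Y \<subseteq> span S'" "finite S'"
      and XY: "T ` X \<subseteq> Y" "T ` Y \<subseteq> X" and k: "\<And>x. x \<in> X \<Longrightarrow> T (T x) = 0 \<Longrightarrow> T x = 0" for X Y S S'
  proof -
    have "{x \<in> T ` X. T x = 0} = {0}" using k subspace_0[OF X(1)] T.zero by (auto intro: image_eqI[of _ _ 0])
    then have "dim (T ` X) = dim (T ` T ` X)"
      using rank_nullity[OF lin T.subspace_image[OF X(1)] subset_trans[OF XY(1) Y(2)] Y(3)]
      by (simp add: dim_singleton_zero)
    also have "\<dots> \<le> dim (T ` Y)"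
      by (rule dim_mono_finite[OF image_mono[OF XY(1)] subset_trans[OF XY(2) X(2)] X(3)])
    finally show ?thesis .
  qed
  have "dim (T ` V) = dim (T ` U)"
    by (rule antisym) (rule le[OF V U VU] le[OF U V VU(2) VU(1)], rule ker, simp_all)+
  then show ?thesis using rank_nullity[OF lin V] rank_nullity[OF lin U] by simp
qed

end

interpretation forms: vector_space "form_scale :: complex \<Rightarrow> 'a form \<Rightarrow> 'a form"
  by (rule vector_space_form)

lemma form_linearI:
  assumes "\<And>a c d e \<xi> vs. T (\<lambda>\<xi> vs. c * a \<xi> vs + d * e \<xi> vs) \<xi> vs = c * T a \<xi> vs + d * T e \<xi> vs"
  shows "Vector_Spaces.linear form_scale form_scale (T :: 'a form \<Rightarrow> 'b form)"
  unfolding Vector_Spaces.linear_iff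
proof (intro conjI allI vector_space_form)
  fix a e :: "'a form" and c
  show "T (a + e) = T a + T e" using assms[of 1 a 1 e] by (simp add: fun_eq_iff plus_fun_def)
  show "T (form_scale c a) = form_scale c (T a)" using assms[of c a 0 a] by (simp add: fun_eq_iff form_scale_def)
qed

section \<open>Finite dimension of the eigenspaces and the map exchanging them\<close>

context eta_manifold
begin

lemma subspace_families: "forms.subspace (families \<mu>)"
proof (rule forms.subspaceI)
  show "0 \<in> families \<mu>" by (auto simp: families_def zero_fun_def alternating_zero even_cochain_def symbol_zero)
  have lin: "(\<lambda>\<xi> vs. c * a \<xi> vs + d * e \<xi> vs) \<in> families \<mu>" if "a \<in> families \<mu>" "e \<in> families \<mu>" for a e c d
    unfolding families_def
  proof (intro CollectI conjI allI impI)
    fix \<xi> assume x: "\<xi> \<notin> frequencies \<mu>"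
    show "(\<lambda>vs. c * a \<xi> vs + d * e \<xi> vs) = (\<lambda>_. 0)"
      using familiesD(5)[OF that(1) x] familiesD(5)[OF that(2) x] by simp
  next
    fix \<xi> show "alternating (\<lambda>vs. c * a \<xi> vs + d * e \<xi> vs)" by (intro alternating_lin2 familiesD(1)[OF that(1)] familiesD(1)[OF that(2)])
    show "even_cochain (\<lambda>vs. c * a \<xi> vs + d * e \<xi> vs)" 
      using familiesD(2)[OF that(1), of \<xi>] familiesD(2)[OF that(2), of \<xi>] by (simp add: even_cochain_def)
    fix vs
    have "2 * of_real pi * \<i> * symbol n b \<xi> (a \<xi>) vs = of_real \<mu> * a \<xi> vs"
      "2 * of_real pi * \<i> * symbol n b \<xi> (e \<xi>) vs = of_real \<mu> * e \<xi> vs"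
      by (rule familiesD[OF that(1)], rule familiesD[OF that(2)])
    moreover have "2 * of_real pi * \<i> * symbol n b \<xi> (\<lambda>vs. c * a \<xi> vs + d * e \<xi> vs) vs =
      c * (2 * of_real pi * \<i> * symbol n b \<xi> (a \<xi>) vs) + d * (2 * of_real pi * \<i> * symbol n b \<xi> (e \<xi>) vs)"
      by (simp add: symbol_lin2 algebra_simps)
    ultimately show "2 * of_real pi * \<i> * symbol n b \<xi> (\<lambda>vs. c * a \<xi> vs + d * e \<xi> vs) vs = of_real \<mu> * (c * a \<xi> vs + d * e \<xi> vs)"
      by (simp add: algebra_simps)
    have "a \<xi> vs = wave \<xi> shift_vec * a (A' *v \<xi>) (map ((*v) A') vs)"
      "e \<xi> vs = wave \<xi> shift_vec * e (A' *v \<xi>) (map ((*v) A') vs)"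
      by (rule familiesD[OF that(1)], rule familiesD[OF that(2)])
    then show "c * a \<xi> vs + d * e \<xi> vs = wave \<xi> shift_vec *
       (c * a (A' *v \<xi>) (map ((*v) A') vs) + d * e (A' *v \<xi>) (map ((*v) A') vs))"
      by (simp only: distrib_left mult.left_commute[of "wave \<xi> shift_vec"])
  qed
  show "a + e \<in> families \<mu>" if "a \<in> families \<mu>" "e \<in> families \<mu>" for a e
    using lin[OF that, of 1 1] by (simp add: plus_fun_def)
  show "form_scale c a \<in> families \<mu>" if "a \<in> families \<mu>" for c a
    using lin[OF that that, of c 0] by (simp add: form_scale_def)
qed

text \<open>As a function of \<open>vs\<close>, the number \<open>monomial vs (basis_list I)\<close>
  is the basis cochain dual to \<open>I\<close>; the reproducing formula is then the expansion in
  this basis.\<close>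

definition coordinate_family :: "real^('k option) \<Rightarrow> nat set \<Rightarrow> (real^('k option)) form" where
  "coordinate_family \<xi> I = (\<lambda>\<eta> vs. if \<eta> = \<xi> then monomial vs (basis_list I) else 0)"

lemma families_span:
  "families \<mu> \<subseteq> forms.span ((\<lambda>(\<xi>, I). coordinate_family \<xi> I) ` (frequencies \<mu> \<times> Pow {..<DIM(real^('k option))}))"
proof
  fix a assume a: "a \<in> families \<mu>"
  let ?P = "frequencies \<mu> \<times> Pow {..<DIM(real^('k option))}"
  have e: "a = (\<Sum>p\<in>?P. form_scale (a (fst p) (basis_list (snd p))) (case p of (\<xi>, I) \<Rightarrow> coordinate_family \<xi> I))"
  proof (intro ext)
    fix \<eta> vs
    have ap: "(\<Sum>p\<in>P. F p) \<eta> vs = (\<Sum>p\<in>P. F p \<eta> vs)" for P :: "'z set" and F :: "'z \<Rightarrow> (real^('k option)) form"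
      by (induction P rule: infinite_finite_induct) auto
    have "(\<Sum>p\<in>?P. form_scale (a (fst p) (basis_list (snd p))) (case p of (\<xi>, I) \<Rightarrow> coordinate_family \<xi> I)) \<eta> vs =
      (\<Sum>\<xi>\<in>frequencies \<mu>. \<Sum>I\<in>Pow {..<DIM(real^('k option))}. a \<xi> (basis_list I) * (if \<eta> = \<xi> then monomial vs (basis_list I) else 0))"
      unfolding ap form_scale_def sum.cartesian_product by (rule sum.cong) (auto simp: coordinate_family_def)
    also have "\<dots> = (\<Sum>\<xi>\<in>frequencies \<mu>. if \<eta> = \<xi> then a \<eta> vs else 0)"
    proof (rule sum.cong[OF refl])
      fix \<xi>
      have "(\<Sum>I\<in>Pow {..<DIM(real^('k option))}. monomial vs (basis_list I) * a \<eta> (basis_list I)) = a \<eta> vs"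
        using alternating_reproducing[OF frame familiesD(1)[OF a], of vs \<eta>]
        unfolding frame_list_def sublist_sum_subsets atLeast0LessThan .
      then show "(\<Sum>I\<in>Pow {..<DIM(real^('k option))}. a \<xi> (basis_list I) * (if \<eta> = \<xi> then monomial vs (basis_list I) else 0)) =
        (if \<eta> = \<xi> then a \<eta> vs else 0)"
        by (cases "\<eta> = \<xi>") (simp_all add: mult.commute)
    qed
    also have "\<dots> = a \<eta> vs" using familiesD(5)[OF a, of \<eta>] by (auto simp: finite_frequencies)
    finally show "a \<eta> vs = (\<Sum>p\<in>?P. form_scale (a (fst p) (basis_list (snd p))) (case p of (\<xi>, I) \<Rightarrow> coordinate_family \<xi> I)) \<eta> vs" ..
  qed
  have m: "(\<Sum>p\<in>?P. form_scale (a (fst p) (basis_list (snd p))) (case p of (\<xi>, I) \<Rightarrow> coordinate_family \<xi> I)) \<in>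
    forms.span ((\<lambda>(\<xi>, I). coordinate_family \<xi> I) ` ?P)"
    by (intro forms.span_sum forms.span_scale forms.span_base imageI)
  show "a \<in> forms.span ((\<lambda>(\<xi>, I). coordinate_family \<xi> I) ` ?P)" by (subst e) (rule m)
qed

lemma finite_coordinate_families:
  "finite ((\<lambda>(\<xi>, I). coordinate_family \<xi> I) ` (frequencies \<mu> \<times> Pow {..<DIM(real^('k option))}))"
  by (intro finite_imageI finite_cartesian_product finite_frequencies) simp

lemma multiplicity_eq_dim_families: "multiplicity_of n \<Gamma> b \<mu> = forms.dim (families \<mu>)"
proof -
  have lin: "Vector_Spaces.linear form_scale form_scale (synthesis \<mu>)"
    by (rule form_linearI) (simp add: synthesis_def sum_distrib_left sum.distrib[symmetric] algebra_simps)
  have "{a \<in> families \<mu>. synthesis \<mu> a = 0} = {0}"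
    using synthesis_eq_0 forms.subspace_0[OF subspace_families] by (auto simp: synthesis_def zero_fun_def)
  then show ?thesis
    using forms.rank_nullity[OF lin subspace_families families_span finite_coordinate_families, of \<mu>]
    by (simp add: multiplicity_of_def B_eigenspace_eq forms.dim_singleton_zero)
qed

text \<open>The frequencies lie in a box with \<open>2 k + 1\<close> integers per coordinate, and
  each carries at most as many coefficients as there are subsets of the frame. Polynomial growth in
  \<open>k\<close> is all that absolute convergence requires.\<close>

lemma multiplicity_bound:
  assumes "\<mu>\<^sup>2 = 4 * pi\<^sup>2 * real k"
  shows "multiplicity_of n \<Gamma> b \<mu> \<le> (2 * k + 1) ^ CARD('k option) * 2 ^ DIM(real^('k option))"
proof -
  have "multiplicity_of n \<Gamma> b \<mu> \<le> card ((\<lambda>(\<xi>, I). coordinate_family \<xi> I) ` (frequencies \<mu> \<times> Pow {..<DIM(real^('k option))}))"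
    unfolding multiplicity_eq_dim_families by (rule forms.dim_le_card[OF families_span finite_coordinate_families])
  also have "\<dots> \<le> card (frequencies \<mu> \<times> Pow {..<DIM(real^('k option))})"
    by (rule card_image_le) (simp add: finite_frequencies)
  also have "\<dots> = card (frequencies \<mu>) * 2 ^ DIM(real^('k option))" by (simp add: card_cartesian_product card_Pow)
  also have "\<dots> \<le> (2 * k + 1) ^ CARD('k option) * 2 ^ DIM(real^('k option))"
    using card_mono[OF card_integer_vec_box(1) frequencies_box[OF assms]] card_integer_vec_box(2)[where B = k and 'n = "'k option"]
    by (intro mult_le_mono1) linarith
  finally show ?thesis .
qed

text \<open>\<open>\<xi> \<bullet> \<xi>\<close> times the projection of the axis vector to the
  orthogonal complement of \<open>\<xi>\<close>; \<open>\<zeta>\<close> is the part of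
  \<open>\<xi>\<close> across the axis. It is equivariant since \<open>A'\<close> fixes the axis
  vector, and vanishes exactly on the axis.\<close>

definition twist_vec :: "real^('k option) \<Rightarrow> real^('k option)" where
  "twist_vec \<xi> = (let \<zeta> = \<xi> - axis None (\<xi> $ None) in (\<zeta> \<bullet> \<zeta>) *\<^sub>R axis None 1 - (\<xi> $ None) *\<^sub>R \<zeta>)"

text \<open>Off the axis, reflecting in a vector orthogonal to \<open>\<xi>\<close> that depends equivariantly on \<open>\<xi>\<close> anticommutes
  with the symbol of \<open>B\<close>.\<close>

definition twist :: "(real^('k option)) form \<Rightarrow> (real^('k option)) form" where
  "twist a = (\<lambda>\<xi> vs. if \<xi> = axis None (\<xi> $ None) then axis_op (a \<xi>) vs else a \<xi> (map (reflect (twist_vec \<xi>)) vs))"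

lemma twist_on_axis: "\<xi> = axis None (\<xi> $ None) \<Longrightarrow> twist a \<xi> = axis_op (a \<xi>)"
  unfolding twist_def by (rule ext) (rule if_P)

lemma twist_off_axis:
  "\<xi> \<noteq> axis None (\<xi> $ None) \<Longrightarrow> twist a \<xi> = (\<lambda>vs. a \<xi> (map (reflect (twist_vec \<xi>)) vs))"
  unfolding twist_def by (rule ext) (rule if_not_P)

lemma twist_vec_orthogonal: "twist_vec \<xi> \<bullet> \<xi> = 0"
proof -
  define \<zeta> where "\<zeta> = \<xi> - axis None (\<xi> $ None)"
  have z: "\<zeta> \<bullet> axis None r = 0" for r by (simp add: \<zeta>_def inner_diff_left inner_axis)
  have x: "\<xi> = \<zeta> + axis None (\<xi> $ None)" by (simp add: \<zeta>_def)
  have "\<zeta> \<bullet> \<xi> = \<zeta> \<bullet> \<zeta>" by (subst x) (simp add: inner_add_right z)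
  then show ?thesis
    by (simp add: twist_vec_def \<zeta>_def[symmetric] inner_diff_left inner_axis')
qed

lemma twist_vec_nonzero:
  assumes "\<xi> \<noteq> axis None (\<xi> $ None)" shows "twist_vec \<xi> \<noteq> 0"
proof -
  define \<zeta> where "\<zeta> = \<xi> - axis None (\<xi> $ None)"
  have "twist_vec \<xi> $ None = \<zeta> \<bullet> \<zeta>" by (simp add: twist_vec_def \<zeta>_def[symmetric]) (simp add: \<zeta>_def axis_def)
  moreover have "\<zeta> \<noteq> 0" using assms by (simp add: \<zeta>_def)
  ultimately show ?thesis by (metis inner_eq_zero_iff zero_index)
qed

lemma twist_vec_A': "twist_vec (A' *v \<xi>) = A' *v twist_vec \<xi>"
proof -
  define \<zeta> where "\<zeta> = \<xi> - axis None (\<xi> $ None)"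
  have e: "A' *v \<xi> - axis None ((A' *v \<xi>) $ None) = A' *v \<zeta>"
    unfolding \<zeta>_def by (simp add: matrix_vector_mult_diff_distrib block_one_axis_None block_one_mult_None)
  have "twist_vec (A' *v \<xi>) = (\<zeta> \<bullet> \<zeta>) *\<^sub>R axis None 1 - ((A' *v \<xi>) $ None) *\<^sub>R (A' *v \<zeta>)"
    unfolding twist_vec_def Let_def e inner_A' ..
  moreover have "A' *v twist_vec \<xi> = (\<zeta> \<bullet> \<zeta>) *\<^sub>R (A' *v axis None 1) - (\<xi> $ None) *\<^sub>R (A' *v \<zeta>)"
    unfolding twist_vec_def Let_def \<zeta>_def[symmetric] matrix_vector_mult_diff_distrib matrix_vector_mult_scaleR ..
  ultimately show ?thesis by (simp only: block_one_mult_None block_one_axis_None)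
qed

lemma reflect_A': "reflect (A' *v v) (A' *v x) = A' *v reflect v x"
  by (simp add: reflect_def inner_A' matrix_vector_mult_diff_distrib matrix_vector_mult_scaleR)

lemma on_axis_A': "A' *v \<xi> = axis None ((A' *v \<xi>) $ None) \<longleftrightarrow> \<xi> = axis None (\<xi> $ None)"
proof
  assume "A' *v \<xi> = axis None ((A' *v \<xi>) $ None)"
  then have "A' *v \<xi> = A' *v axis None (\<xi> $ None)" by (simp only: block_one_mult_None block_one_axis_None)
  then have "transpose A' *v (A' *v \<xi>) = transpose A' *v (A' *v axis None (\<xi> $ None))" by (rule arg_cong)
  then show "\<xi> = axis None (\<xi> $ None)" by (simp only: A'_inverse(1))
next
  assume "\<xi> = axis None (\<xi> $ None)"
  then have "A' *v \<xi> = A' *v axis None (\<xi> $ None)" by (rule arg_cong)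
  then show "A' *v \<xi> = axis None ((A' *v \<xi>) $ None)" unfolding block_one_axis_None block_one_mult_None .
qed

lemma axis_None_eq: "axis None r = r *\<^sub>R b 0"
  by (simp add: b0 vec_eq_iff axis_def)

lemma twist_lin2:
  "twist (\<lambda>\<xi> vs. c * a \<xi> vs + d * e \<xi> vs) \<xi> vs = c * twist a \<xi> vs + d * twist e \<xi> vs"
  by (simp add: twist_def axis_op_lin2)

lemma twist_families:
  assumes a: "a \<in> families \<mu>" shows "twist a \<in> families (- \<mu>)"
proof -
  have alt: "alternating (a \<xi>)" and ev: "even_cochain (a \<xi>)"
    and sy: "2 * of_real pi * \<i> * symbol n b \<xi> (a \<xi>) vs = of_real \<mu> * a \<xi> vs"
    and inv: "a \<xi> vs = wave \<xi> shift_vec * a (A' *v \<xi>) (map ((*v) A') vs)" for \<xi> vs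
    by (rule familiesD[OF a])+
  note t1 = twist_on_axis[of _ a] and t2 = twist_off_axis[of _ a]
  show ?thesis unfolding families_def frequencies_uminus
  proof (intro CollectI conjI allI impI)
    fix \<xi> assume "\<xi> \<notin> frequencies \<mu>"
    then have "a \<xi> = (\<lambda>_. 0)" by (rule familiesD(5)[OF a])
    then show "twist a \<xi> = (\<lambda>_. 0)" using axis_op_lin2[of 0 "\<lambda>_. 0" 0 "\<lambda>_. 0"]
      by (auto simp: twist_def)
  next
    fix \<xi>
    show "alternating (twist a \<xi>)"
    proof (cases "\<xi> = axis None (\<xi> $ None)")
      case True
      show ?thesis unfolding t1[OF True] by (rule alternating_axis_op[OF alt])
    next
      case False
      show ?thesis unfolding t2[OF False] by (rule alternating_compose_map[OF alt linear_reflect])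
    qed
    show "even_cochain (twist a \<xi>)"
    proof (cases "\<xi> = axis None (\<xi> $ None)")
      case True
      show ?thesis unfolding t1[OF True] by (rule even_cochain_axis_op[OF ev alt])
    next
      case False
      show ?thesis unfolding t2[OF False] using ev[of \<xi>] by (simp add: even_cochain_def)
    qed
    fix vs
    have f: "symbol n b \<xi> (a \<xi>) = (\<lambda>vs. (of_real \<mu> / (2 * of_real pi * \<i>)) * a \<xi> vs + 0 * a \<xi> vs)"
    proof
      fix vs
      show "symbol n b \<xi> (a \<xi>) vs = (of_real \<mu> / (2 * of_real pi * \<i>)) * a \<xi> vs + 0 * a \<xi> vs"
        using sy[of \<xi> vs] by (simp add: field_simps)
    qed
    show "2 * of_real pi * \<i> * symbol n b \<xi> (twist a \<xi>) vs = of_real (- \<mu>) * twist a \<xi> vs"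
    proof (cases "\<xi> = axis None (\<xi> $ None)")
      case True
      have xi: "\<xi> = (\<xi> $ None) *\<^sub>R b 0" unfolding axis_None_eq[symmetric] by (rule True)
      have "symbol n b ((\<xi> $ None) *\<^sub>R b 0) (axis_op (a \<xi>)) vs = - axis_op (symbol n b ((\<xi> $ None) *\<^sub>R b 0) (a \<xi>)) vs"
        by (rule symbol_axis_op[OF alt])
      then have "symbol n b \<xi> (axis_op (a \<xi>)) vs = - axis_op (symbol n b \<xi> (a \<xi>)) vs"
        unfolding xi[symmetric] .
      also have "axis_op (symbol n b \<xi> (a \<xi>)) vs = (of_real \<mu> / (2 * of_real pi * \<i>)) * axis_op (a \<xi>) vs"
        unfolding f axis_op_lin2 by simp
      finally show ?thesis by (simp add: t1[OF True])
    next
      case False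
      have "symbol n b \<xi> (twist a \<xi>) vs = - symbol n b \<xi> (a \<xi>) (map (reflect (twist_vec \<xi>)) vs)"
        unfolding t2[OF False] by (rule symbol_reflect[OF alt twist_vec_nonzero[OF False] twist_vec_orthogonal])
      then show ?thesis using sy[of \<xi> "map (reflect (twist_vec \<xi>)) vs"] by (simp add: t2[OF False])
    qed
    show "twist a \<xi> vs = wave \<xi> shift_vec * twist a (A' *v \<xi>) (map ((*v) A') vs)"
    proof (cases "\<xi> = axis None (\<xi> $ None)")
      case True
      \<comment> \<open>On the axis \<open>A'\<close> fixes the frequency, so invariance is a
        condition on the single cochain \<open>g\<close>, which \<open>axis_op\<close> preserves
        because it commutes with the rotation.\<close>
      have Ax: "A' *v \<xi> = \<xi>" by (subst (1 2) True) (rule block_one_axis_None)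
      define g where "g = a \<xi>"
      have "g vs = wave \<xi> shift_vec * g (map ((*v) A') vs) + 0 * g vs" for vs
        using inv[of \<xi> vs] unfolding Ax g_def[symmetric] by (simp only: mult_zero_left add_0_right)
      then have "axis_op g = axis_op (\<lambda>vs. wave \<xi> shift_vec * g (map ((*v) A') vs) + 0 * g vs)"
        by (intro arg_cong[of _ _ axis_op] ext)
      then have "axis_op g vs = wave \<xi> shift_vec * axis_op (\<lambda>vs. g (map ((*v) A') vs)) vs"
        unfolding axis_op_lin2 by (simp only: mult_zero_left add_0_right)
      also have "axis_op (\<lambda>vs. g (map ((*v) A') vs)) vs = axis_op g (map ((*v) A') vs)"
        unfolding g_def using axis_op_rotate[OF rotates alt, of \<xi> vs] by (simp only:)
      finally show ?thesis unfolding Ax t1[OF True] g_def .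
    next
      case False
      then have F: "A' *v \<xi> \<noteq> axis None ((A' *v \<xi>) $ None)" by (simp add: on_axis_A')
      show ?thesis unfolding t2[OF False] t2[OF F]
        using inv[of \<xi> "map (reflect (twist_vec \<xi>)) vs"] by (simp only: twist_vec_A' map_map o_def reflect_A')
    qed
  qed
qed

text \<open>Off the axis the twist is an involution at each frequency; on the axis the claim is the
  semisimplicity of \<open>axis_op\<close>.\<close>

lemma twist_twist_eq_0:
  assumes a: "a \<in> families \<mu>" and z: "twist (twist a) = 0" shows "twist a = 0"
proof (intro ext)
  fix \<xi> vs
  have alt: "alternating (a \<xi>)" by (rule familiesD(1)[OF a])
  show "twist a \<xi> vs = 0 \<xi> vs"
  proof (cases "\<xi> = axis None (\<xi> $ None)")
    case True
    have e: "twist a \<xi> = axis_op (a \<xi>)" "twist (twist a) \<xi> = axis_op (twist a \<xi>)" by (rule twist_on_axis[OF True])+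
    have "axis_op (axis_op (a \<xi>)) = (\<lambda>_. 0)" using fun_cong[OF z, of \<xi>] unfolding e by (simp add: zero_fun_def)
    from axis_op_twice[OF alt this] show ?thesis unfolding e by simp
  next
    case False
    then have "twist (twist a) \<xi> (map (reflect (twist_vec \<xi>)) vs) = twist a \<xi> vs"
      using reflect_reflect[OF twist_vec_nonzero[OF False]] by (simp add: twist_def o_def)
    then show ?thesis using z by simp
  qed
qed

definition twist_kernel :: "real \<Rightarrow> (real^('k option)) form set" where
  "twist_kernel \<mu> = {a \<in> families \<mu>. twist a = 0}"

lemma multiplicity_difference:
  "multiplicity_of n \<Gamma> b \<mu> + forms.dim (twist_kernel (- \<mu>)) = multiplicity_of n \<Gamma> b (- \<mu>) + forms.dim (twist_kernel \<mu>)"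
  unfolding multiplicity_eq_dim_families twist_kernel_def
proof (rule forms.dim_swap[OF form_linearI[OF twist_lin2] subspace_families families_span finite_coordinate_families
      subspace_families families_span finite_coordinate_families])
  show "twist ` families \<mu> \<subseteq> families (- \<mu>)" "twist ` families (- \<mu>) \<subseteq> families \<mu>"
    using twist_families[of _ \<mu>] twist_families[of _ "- \<mu>"] by auto
  show "twist a = 0" if "a \<in> families \<mu> \<union> families (- \<mu>)" "twist (twist a) = 0" for a
    using that twist_twist_eq_0 by blast
qed

end

text \<open>Expanding the product chooses one summand in each factor; \<open>D\<close> records where
  \<open>g\<close> is taken.\<close>

lemma sum_Pow_prod:
  "(\<Sum>D\<in>Pow {1..K}. \<Prod>l\<in>{1..K}. if l \<in> D then g l else f l) = (\<Prod>l\<in>{1..K::nat}. f l + g l :: complex)"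
proof (induction K)
  case (Suc K)
  have iv: "{1..Suc K} = insert (Suc K) {1..K}" by auto
  have inj: "inj_on (insert (Suc K)) (Pow {1..K})"
    by (rule inj_onI) (metis PowD Suc_n_not_le_n atLeastAtMost_iff insert_ident subsetD)
  let ?h = "\<lambda>D. \<Prod>l\<in>{1..Suc K}. if l \<in> D then g l else f l"
  let ?h' = "\<lambda>D. \<Prod>l\<in>{1..K}. if l \<in> D then g l else f l"
  have "(\<Sum>D\<in>Pow {1..Suc K}. ?h D) = (\<Sum>D\<in>Pow {1..K}. ?h D) + (\<Sum>D\<in>insert (Suc K) ` Pow {1..K}. ?h D)"
    unfolding iv Pow_insert by (rule sum.union_disjoint) auto
  also have "(\<Sum>D\<in>Pow {1..K}. ?h D) = (\<Sum>D\<in>Pow {1..K}. ?h' D * f (Suc K))"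
    by (rule sum.cong) auto
  also have "(\<Sum>D\<in>insert (Suc K) ` Pow {1..K}. ?h D) = (\<Sum>D\<in>Pow {1..K}. ?h' D * g (Suc K))"
    unfolding sum.reindex[OF inj] o_def
  proof (rule sum.cong[OF refl])
    fix D assume "D \<in> Pow {1..K}"
    have "(\<Prod>l\<in>{1..K}. if l \<in> insert (Suc K) D then g l else f l) = ?h' D" by (rule prod.cong) auto
    then show "?h (insert (Suc K) D) = ?h' D * g (Suc K)" by simp
  qed
  finally have e: "(\<Sum>D\<in>Pow {1..Suc K}. ?h D) =
    (\<Sum>D\<in>Pow {1..K}. ?h' D * f (Suc K)) + (\<Sum>D\<in>Pow {1..K}. ?h' D * g (Suc K))" .
  show ?case unfolding e sum_distrib_right[symmetric] Suc.IH by (simp add: algebra_simps)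
qed simp

lemma (in vector_space) independent_dual_family:
  assumes "finite I" and lin: "\<And>p x y c. p \<in> I \<Longrightarrow> \<Phi> p (x + scale c y) = \<Phi> p x + c * \<Phi> p y"
    and zero: "\<And>p. p \<in> I \<Longrightarrow> \<Phi> p 0 = 0"
    and dual: "\<And>p q. p \<in> I \<Longrightarrow> q \<in> I \<Longrightarrow> \<Phi> p (F q) = (if p = q then 1 else 0)"
  shows "inj_on F I" "independent (F ` I)"
proof -
  show inj: "inj_on F I"
  proof (rule inj_onI)
    fix p q assume "p \<in> I" "q \<in> I" "F p = F q"
    then have "(1 :: 'a) = (if p = q then 1 else 0)" using dual[of p p] dual[of p q] by simp
    then show "p = q" by (auto split: if_splits)
  qed
  show "independent (F ` I)"
  proof
    assume "dependent (F ` I)"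
    then obtain u q where u: "q \<in> I" "u (F q) \<noteq> 0" "(\<Sum>y\<in>F ` I. u y *s y) = 0"
      using dependent_finite[OF finite_imageI[OF assms(1)]] by blast
    have e: "\<Phi> q (\<Sum>p\<in>J. u (F p) *s F p) = (\<Sum>p\<in>J. u (F p) * \<Phi> q (F p))" if "J \<subseteq> I" for J
    proof -
      have "finite J" using that assms(1) finite_subset by blast
      then show ?thesis using that
      proof (induction J rule: finite_induct)
        case (insert p J)
        then show ?case using lin[OF u(1), of "\<Sum>p\<in>J. u (F p) *s F p" "u (F p)" "F p"] by (simp add: add.commute)
      qed (simp add: zero u(1))
    qed
    have "0 = \<Phi> q (\<Sum>p\<in>I. u (F p) *s F p)" using u(3) zero[OF u(1)] by (simp add: sum.reindex[OF inj])
    also have "\<dots> = (\<Sum>p\<in>I. if q = p then u (F q) else 0)"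
      unfolding e[OF order_refl] by (rule sum.cong) (auto simp: dual u(1))
    finally show False using u(1,2) assms(1) by simp
  qed
qed

section \<open>The kernel of the twist\<close>

context eta_manifold
begin

text \<open>The scalar by which pullback along the screw motion acts on
  \<open>single (sign_of D)\<close> at the axial frequency \<open>j\<close>: a wave factor from the
  translation by \<open>1 / (2 N)\<close> and the eigenvalue of the rotation.\<close>

definition phase :: "int \<Rightarrow> nat set \<Rightarrow> complex" where
  "phase j D = exp (2 * of_real pi * \<i> * of_int j / of_nat (2 * N)) * exp (\<i> * (\<Sum>l\<in>{1..K}. sign_of D l * of_real (\<gamma> l)))"

definition parity :: "nat set \<Rightarrow> complex" where
  "parity D = (\<Prod>l\<in>{1..K}. sign_of D l)"

text \<open>The axial frequencies and sign patterns that give eigenforms for \<open>\<mu>\<close> on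
  the quotient: the first equation is the eigenvalue, the second the invariance.\<close>

definition single_indices :: "real \<Rightarrow> (int \<times> nat set) set" where
  "single_indices \<mu> = {(j, D). D \<subseteq> {1..K} \<and> 2 * of_real pi * of_int j * parity D = of_real \<mu> \<and> phase j D = 1}"

definition single_family :: "int \<times> nat set \<Rightarrow> (real^('k option)) form" where
  "single_family p = (\<lambda>\<xi> vs. if \<xi> = axis None (of_int (fst p)) then single (sign_of (snd p)) vs else 0)"

lemma wave_shift_vec: "wave (axis None (of_int j)) shift_vec = exp (2 * of_real pi * \<i> * of_int j / of_nat (2 * N))"
  by (simp add: wave_def shift_vec_def inner_axis_axis)

lemma parity_square: "parity D * parity D = 1"
  unfolding parity_def prod.distrib[symmetric] sign_of_square by simp

lemma parity_cases: "parity D = 1 \<or> parity D = -1"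
  using parity_square[of D] by (simp add: square_eq_1_iff)

lemma sign_of_cases: "sign_of D j = 1 \<or> sign_of D j = -1"
  by (simp add: sign_of_def)

lemma symbol_single_axis:
  "2 * of_real pi * \<i> * symbol n b (axis None r) (single (sign_of D)) vs =
    2 * of_real pi * of_real r * parity D * single (sign_of D) vs"
  unfolding axis_None_eq symbol_single[OF n_pos K_def sign_of_square] parity_def by simp

lemma single_family_twist_kernel:
  assumes "(j, D) \<in> single_indices \<mu>" shows "single_family (j, D) \<in> twist_kernel \<mu>"
proof -
  let ?x = "axis None (of_int j) :: real^('k option)"
  have D: "D \<subseteq> {1..K}" and mu: "2 * of_real pi * of_int j * parity D = of_real \<mu>" and ph: "phase j D = 1"
    using assms by (auto simp: single_indices_def)
  have F: "single_family (j, D) ?x = single (sign_of D)" and F0: "\<xi> \<noteq> ?x \<Longrightarrow> single_family (j, D) \<xi> = (\<lambda>_. 0)" for \<xi>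
    by (auto simp: single_family_def)
  have "4 * pi\<^sup>2 * (?x \<bullet> ?x) = \<mu>\<^sup>2"
  proof -
    have "complex_of_real (\<mu>\<^sup>2) = 4 * (of_real pi)\<^sup>2 * (of_int j)\<^sup>2 * (parity D * parity D)"
      unfolding of_real_power mu[symmetric] by (simp add: power2_eq_square)
    also have "\<dots> = of_real (4 * pi\<^sup>2 * (real_of_int j)\<^sup>2)" by (simp add: parity_square)
    finally have "\<mu>\<^sup>2 = 4 * pi\<^sup>2 * (real_of_int j)\<^sup>2" by (simp only: of_real_eq_iff)
    then show ?thesis by (simp add: inner_axis_axis power2_eq_square)
  qed
  then have fr: "?x \<in> frequencies \<mu>" by (simp add: frequencies_def integer_vec_axis)
  have Ax: "A' *v \<xi> = ?x \<longleftrightarrow> \<xi> = ?x" for \<xi>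
    by (metis A'_inverse(1) block_one_axis_None)
  have "single_family (j, D) \<in> families \<mu>" unfolding families_def
  proof (intro CollectI conjI allI impI)
    fix \<xi>
    show "single_family (j, D) \<xi> = (\<lambda>_. 0)" if "\<xi> \<notin> frequencies \<mu>"
      by (rule F0) (use that fr in auto)
    show "alternating (single_family (j, D) \<xi>)"
      by (cases "\<xi> = ?x") (simp_all only: F F0 alternating_single alternating_zero not_False_eq_True)
    show "even_cochain (single_family (j, D) \<xi>)"
      by (cases "\<xi> = ?x") (simp_all only: F F0 even_cochain_single[OF odd_K] not_False_eq_True, simp add: even_cochain_def)
    fix vs
    show "2 * of_real pi * \<i> * symbol n b \<xi> (single_family (j, D) \<xi>) vs = of_real \<mu> * single_family (j, D) \<xi> vs"
    proof (cases "\<xi> = ?x")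
      case True
      show ?thesis unfolding True F symbol_single_axis using mu by simp
    qed (simp add: F0 symbol_zero)
    show "single_family (j, D) \<xi> vs = wave \<xi> shift_vec * single_family (j, D) (A' *v \<xi>) (map ((*v) A') vs)"
    proof (cases "\<xi> = ?x")
      case True
      have "single (sign_of D) (map ((*v) A') vs) = exp (\<i> * (\<Sum>l\<in>{1..K}. sign_of D l * of_real (\<gamma> l))) * single (sign_of D) vs"
        by (rule single_rotate[OF rotates sign_of_cases])
      then have "wave ?x shift_vec * single (sign_of D) (map ((*v) A') vs) = phase j D * single (sign_of D) vs"
        by (simp add: wave_shift_vec phase_def)
      then show ?thesis unfolding True using ph by (simp add: F block_one_axis_None)
    qed (simp add: F0 Ax)
  qed
  moreover have "twist (single_family (j, D)) = 0"
  proof (intro ext)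
    fix \<xi> vs
    have z: "axis_op (\<lambda>_. 0) vs = 0" using axis_op_lin2[of 0 "\<lambda>_. 0" 0 "\<lambda>_. 0" vs] by simp
    show "twist (single_family (j, D)) \<xi> vs = 0 \<xi> vs"
    proof (cases "\<xi> = ?x")
      case True
      have "twist (single_family (j, D)) ?x = axis_op (single_family (j, D) ?x)"
        by (rule twist_on_axis) (simp add: axis_def)
      then show ?thesis unfolding True F axis_op_single by simp
    next
      case False
      show ?thesis unfolding twist_def F0[OF False] by (simp add: z)
    qed
  qed
  ultimately show ?thesis by (simp add: twist_kernel_def)
qed

lemma finite_single_indices: "finite (single_indices \<mu>)"
proof -
  have "single_indices \<mu> \<subseteq> {- \<lceil>\<bar>\<mu>\<bar>\<rceil>..\<lceil>\<bar>\<mu>\<bar>\<rceil>} \<times> Pow {1..K}"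
  proof
    fix p assume "p \<in> single_indices \<mu>"
    then obtain j D where p: "p = (j, D)" "D \<subseteq> {1..K}" and mu: "2 * of_real pi * of_int j * parity D = (of_real \<mu> :: complex)"
      by (auto simp: single_indices_def)
    have "norm (2 * of_real pi * of_int j * parity D) = 2 * pi * \<bar>of_int j\<bar>"
      using parity_cases[of D] by (auto simp: norm_mult)
    then have "\<bar>\<mu>\<bar> = 2 * pi * \<bar>of_int j\<bar>" unfolding mu by simp
    moreover have "1 * \<bar>real_of_int j\<bar> \<le> (2 * pi) * \<bar>real_of_int j\<bar>" using pi_ge_two by (intro mult_right_mono) auto
    ultimately have "\<bar>real_of_int j\<bar> \<le> \<bar>\<mu>\<bar>" by simp
    then have "\<bar>j\<bar> \<le> \<lceil>\<bar>\<mu>\<bar>\<rceil>" by linarith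
    then show "p \<in> {- \<lceil>\<bar>\<mu>\<bar>\<rceil>..\<lceil>\<bar>\<mu>\<bar>\<rceil>} \<times> Pow {1..K}" using p by auto
  qed
  then show ?thesis by (rule finite_subset) simp
qed

definition single_functional :: "int \<times> nat set \<Rightarrow> (real^('k option)) form \<Rightarrow> complex" where
  "single_functional p a = single_coefficient (snd p) (a (axis None (of_int (fst p))))"

text \<open>Off the axis the twist is injective, so only axial frequencies survive, and there the
  kernel of \<open>axis_op\<close> is spanned by the products. Comparing coefficients in the
  eigenvalue equation and in the invariance removes every pair outside
  \<open>single_indices \<mu>\<close>.\<close>

lemma twist_kernel_expansion:
  assumes a: "a \<in> twist_kernel \<mu>"
  shows "a = (\<Sum>p\<in>single_indices \<mu>. form_scale (single_functional p a) (single_family p))"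
proof (intro ext)
  fix \<xi> vs
  have fam: "a \<in> families \<mu>" and tw: "twist a = 0" using a by (auto simp: twist_kernel_def)
  have alt: "alternating (a \<xi>)" and ev: "even_cochain (a \<xi>)"
    and sy: "2 * of_real pi * \<i> * symbol n b \<xi> (a \<xi>) vs = of_real \<mu> * a \<xi> vs"
    and inv: "a \<xi> vs = wave \<xi> shift_vec * a (A' *v \<xi>) (map ((*v) A') vs)" for \<xi> vs
    by (rule familiesD[OF fam])+
  have ap: "(\<Sum>p\<in>P. F p) \<xi> vs = (\<Sum>p\<in>P. F p \<xi> vs)" for P :: "'z set" and F :: "'z \<Rightarrow> (real^('k option)) form"
    by (induction P rule: infinite_finite_induct) auto
  have rhs: "(\<Sum>p\<in>single_indices \<mu>. form_scale (single_functional p a) (single_family p)) \<xi> vs =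
    (\<Sum>p\<in>single_indices \<mu>. single_functional p a * single_family p \<xi> vs)" unfolding ap form_scale_def ..
  show "a \<xi> vs = (\<Sum>p\<in>single_indices \<mu>. form_scale (single_functional p a) (single_family p)) \<xi> vs"
  proof (cases "\<exists>j. \<xi> = axis None (of_int j)")
    case False
    then have "(\<Sum>p\<in>single_indices \<mu>. single_functional p a * single_family p \<xi> vs) = 0"
      by (intro sum.neutral) (auto simp: single_family_def)
    moreover have "a \<xi> vs = 0"
    proof (cases "\<xi> = axis None (\<xi> $ None)")
      case True
      have "\<xi> \<notin> frequencies \<mu>"
      proof
        assume "\<xi> \<in> frequencies \<mu>"
        then have "\<xi> $ None \<in> \<int>" by (simp add: frequencies_def integer_vec_def)
        then show False using True False by (metis Ints_cases)
      qed
      then show ?thesis using familiesD(5)[OF fam, of \<xi>] by simp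
    next
      case off: False
      have "twist a \<xi> (map (reflect (twist_vec \<xi>)) vs) = a \<xi> vs"
        using reflect_reflect[OF twist_vec_nonzero[OF off]] off by (simp add: twist_def o_def)
      then show ?thesis using tw by simp
    qed
    ultimately show ?thesis unfolding rhs by simp
  next
    case True
    then obtain j where j: "\<xi> = axis None (of_int j)" by blast
    have ax: "axis_op (a \<xi>) = (\<lambda>_. 0)"
    proof
      fix vs
      have "twist a \<xi> = axis_op (a \<xi>)" by (rule twist_on_axis) (simp add: j axis_def)
      then show "axis_op (a \<xi>) vs = 0" using fun_cong[OF fun_cong[OF tw, of \<xi>], of vs] by simp
    qed
    have ex: "a \<xi> vs = (\<Sum>D\<in>Pow {1..K}. single_functional (j, D) a * single (sign_of D) vs)" for vs
      unfolding single_functional_def using axis_kernel_expansion[OF odd_K alt ev ax, of vs] by (simp add: j)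
    define c where "c D = single_functional (j, D) a" for D
    have exf: "a \<xi> = (\<lambda>vs. \<Sum>D\<in>Pow {1..K}. c D * single (sign_of D) vs)" by (rule ext) (simp add: ex c_def)
    have co: "single_coefficient D (\<lambda>vs. \<Sum>E\<in>Pow {1..K}. g E * single (sign_of E) vs) = g D" if D: "D \<subseteq> {1..K}" for g D
    proof -
      have "single_coefficient D (\<lambda>vs. \<Sum>E\<in>Pow {1..K}. g E * single (sign_of E) vs) = (\<Sum>E\<in>Pow {1..K}. if D = E then g D else 0)"
        unfolding single_coefficient_sum single_coefficient_mult
        by (rule sum.cong) (use D in \<open>auto simp: single_coefficient_single\<close>)
      then show ?thesis using D by simp
    qed
    have zero: "c D = 0" if D: "D \<subseteq> {1..K}" "(j, D) \<notin> single_indices \<mu>" for D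
    proof (rule ccontr)
      assume nz: "c D \<noteq> 0"
      have "(\<Sum>E\<in>Pow {1..K}. (of_real \<mu> * c E) * single (sign_of E) vs) =
         (\<Sum>E\<in>Pow {1..K}. (2 * of_real pi * of_int j * parity E * c E) * single (sign_of E) vs)" for vs
      proof -
        have "(\<Sum>E\<in>Pow {1..K}. (of_real \<mu> * c E) * single (sign_of E) vs) = of_real \<mu> * a \<xi> vs"
          by (simp add: exf sum_distrib_left mult.assoc)
        also have "\<dots> = 2 * of_real pi * \<i> * symbol n b \<xi> (\<lambda>vs. \<Sum>D\<in>Pow {1..K}. c D * single (sign_of D) vs) vs"
          using sy[of \<xi> vs] unfolding exf by simp
        also have "\<dots> = (\<Sum>E\<in>Pow {1..K}. c E * (2 * of_real pi * \<i> * symbol n b \<xi> (single (sign_of E)) vs))"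
          unfolding symbol_sum symbol_mult by (simp add: sum_distrib_left mult_ac)
        finally show ?thesis unfolding j symbol_single_axis by (simp add: mult_ac)
      qed
      then have "(\<lambda>vs. \<Sum>E\<in>Pow {1..K}. (of_real \<mu> * c E) * single (sign_of E) vs) =
         (\<lambda>vs. \<Sum>E\<in>Pow {1..K}. (2 * of_real pi * of_int j * parity E * c E) * single (sign_of E) vs)" by blast
      from arg_cong[OF this, of "single_coefficient D"] have m: "of_real \<mu> * c D = 2 * of_real pi * of_int j * parity D * c D"
        unfolding co[OF D(1)] .
      have "(\<Sum>E\<in>Pow {1..K}. c E * single (sign_of E) vs) = (\<Sum>E\<in>Pow {1..K}. (phase j E * c E) * single (sign_of E) vs)" for vs
      proof -
        have "(\<Sum>E\<in>Pow {1..K}. c E * single (sign_of E) vs) = wave \<xi> shift_vec * a \<xi> (map ((*v) A') vs)"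
        proof -
          have Ax: "A' *v \<xi> = \<xi>" unfolding j block_one_axis_None ..
          have "a \<xi> vs = wave \<xi> shift_vec * a \<xi> (map ((*v) A') vs)" using inv[of \<xi> vs] unfolding Ax .
          then show ?thesis unfolding exf .
        qed
        then show ?thesis unfolding exf unfolding single_rotate[OF rotates sign_of_cases] phase_def j wave_shift_vec
          by (simp add: sum_distrib_left mult_ac)
      qed
      then have "(\<lambda>vs. \<Sum>E\<in>Pow {1..K}. c E * single (sign_of E) vs) = (\<lambda>vs. \<Sum>E\<in>Pow {1..K}. (phase j E * c E) * single (sign_of E) vs)" by blast
      from arg_cong[OF this, of "single_coefficient D"] have "c D = phase j D * c D" unfolding co[OF D(1)] .
      then have "phase j D = 1" using nz by simp
      moreover have "2 * of_real pi * of_int j * parity D = of_real \<mu>" using m nz by simp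
      ultimately show False using D by (simp add: single_indices_def)
    qed
    have "(\<Sum>p\<in>single_indices \<mu>. single_functional p a * single_family p \<xi> vs) =
      (\<Sum>p\<in>{j} \<times> Pow {1..K}. single_functional p a * single (sign_of (snd p)) vs)"
    proof (rule sum.mono_neutral_cong[OF _ finite_single_indices])
      show "finite ({j} \<times> Pow {1..K})" by simp
      show "single_functional p a * single_family p \<xi> vs = 0" if "p \<in> single_indices \<mu> - {j} \<times> Pow {1..K}" for p
      proof -
        have "fst p \<noteq> j" using that by (auto simp: single_indices_def)
        then have "\<xi> \<noteq> axis None (of_int (fst p))" by (auto simp: j axis_eq_axis)
        then show ?thesis by (simp add: single_family_def)
      qed
      show "single_functional p a * single (sign_of (snd p)) vs = 0" if "p \<in> {j} \<times> Pow {1..K} - single_indices \<mu>" for p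
        using that zero by (auto simp: c_def)
      show "single_functional p a * single_family p \<xi> vs = single_functional p a * single (sign_of (snd p)) vs"
        if "p \<in> single_indices \<mu> \<inter> {j} \<times> Pow {1..K}" for p
        using that by (auto simp: single_family_def j)
    qed
    also have "\<dots> = (\<Sum>D\<in>Pow {1..K}. single_functional (j, D) a * single (sign_of D) vs)"
    proof -
      have e: "{j} \<times> Pow {1..K} = Pair j ` Pow {1..K}" by auto
      show ?thesis unfolding e by (subst sum.reindex) (auto simp: inj_on_def o_def)
    qed
    finally show ?thesis unfolding rhs ex by simp
  qed
qed

lemma dim_twist_kernel: "forms.dim (twist_kernel \<mu>) = card (single_indices \<mu>)"
proof -
  have lin: "single_functional p (x + form_scale c y) = single_functional p x + c * single_functional p y" for p x y c
    using coefficient_lin2[of K "sign_of (snd p)" 1 "x (axis None (of_int (fst p)))" c "y (axis None (of_int (fst p)))"]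
    by (simp add: single_functional_def single_coefficient_def form_scale_def plus_fun_def add_divide_distrib)
  have zero: "single_functional p 0 = 0" for p
    by (simp add: single_functional_def single_coefficient_def zero_fun_def coefficient_zero)
  have dual: "single_functional p (single_family q) = (if p = q then 1 else 0)"
    if "p \<in> single_indices \<mu>" "q \<in> single_indices \<mu>" for p q
  proof (cases "fst p = fst q")
    case True
    then have e: "single_family q (axis None (of_int (fst p))) = single (sign_of (snd q))" by (simp add: single_family_def)
    have sub: "snd p \<subseteq> {1..K}" "snd q \<subseteq> {1..K}" using that by (auto simp: single_indices_def)
    have "single_functional p (single_family q) = (if snd p = snd q then 1 else 0)"
      unfolding single_functional_def e by (rule single_coefficient_single[OF sub])
    then show ?thesis using True by (simp add: prod_eq_iff)
  next
    case False
    then have "axis None (of_int (fst p)) \<noteq> (axis None (of_int (fst q)) :: real^('k option))" by (auto simp: axis_eq_axis)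
    then have "single_family q (axis None (of_int (fst p))) = (\<lambda>_. 0)" by (simp add: single_family_def)
    then show ?thesis using False by (auto simp: single_functional_def single_coefficient_def coefficient_zero)
  qed
  note ind = forms.independent_dual_family[OF finite_single_indices lin zero dual]
  have "single_family ` single_indices \<mu> \<subseteq> twist_kernel \<mu>" using single_family_twist_kernel by auto
  moreover have "twist_kernel \<mu> \<subseteq> forms.span (single_family ` single_indices \<mu>)"
  proof
    fix a assume a: "a \<in> twist_kernel \<mu>"
    have "(\<Sum>p\<in>single_indices \<mu>. form_scale (single_functional p a) (single_family p)) \<in> forms.span (single_family ` single_indices \<mu>)"
      by (intro forms.span_sum forms.span_scale forms.span_base imageI)
    then show "a \<in> forms.span (single_family ` single_indices \<mu>)"
      by (subst twist_kernel_expansion[OF a])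
  qed
  ultimately show ?thesis
    using forms.basis_card_eq_dim[of "single_family ` single_indices \<mu>" "twist_kernel \<mu>"] ind card_image by fastforce
qed

lemma multiplicity_difference_card:
  "multiplicity_of n \<Gamma> b \<mu> + card (single_indices (- \<mu>)) = multiplicity_of n \<Gamma> b (- \<mu>) + card (single_indices \<mu>)"
  using multiplicity_difference[of \<mu>] by (simp add: dim_twist_kernel)

end

lemma sum_powers_root_of_unity:
  assumes "u ^ M = (1 :: complex)"
  shows "(\<Sum>k<M. u ^ k) = (if u = 1 then of_nat M else 0)"
  using assms by (simp add: sum_gp_strict)

section \<open>Counting invariant sign patterns with roots of unity\<close>

context eta_manifold
begin

definition unit_root :: "nat \<Rightarrow> complex" where
  "unit_root k = cis (pi * real k / real N)"

definition sine_prod :: "nat \<Rightarrow> complex" where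
  "sine_prod k = (\<Prod>l\<in>{1..K}. 2 * \<i> * of_real (sin (real k * \<gamma> l)))"

lemma phase_eq: "phase j D = cis (pi * of_int j / real N) * (\<Prod>l\<in>{1..K}. exp (\<i> * (sign_of D l * of_real (\<gamma> l))))"
proof -
  have "2 * of_real pi * \<i> * of_int j / of_nat (2 * N) = \<i> * of_real (pi * of_int j / real N)"
    using N_pos by (simp add: field_simps)
  then have "exp (2 * of_real pi * \<i> * of_int j / of_nat (2 * N)) = cis (pi * of_int j / real N)"
    unfolding cis_conv_exp by (rule arg_cong)
  moreover have "exp (\<i> * (\<Sum>l\<in>{1..K}. sign_of D l * of_real (\<gamma> l))) = (\<Prod>l\<in>{1..K}. exp (\<i> * (sign_of D l * of_real (\<gamma> l))))"
    unfolding sum_distrib_left by (rule exp_sum) simp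
  ultimately show ?thesis unfolding phase_def by (simp only:)
qed

lemma phase_power:
  "phase j D ^ k = cis (real k * (pi * of_int j / real N)) * (\<Prod>l\<in>{1..K}. exp (of_nat k * (\<i> * (sign_of D l * of_real (\<gamma> l)))))"
  unfolding phase_eq power_mult_distrib Complex.DeMoivre prod_power_distrib[symmetric] exp_of_nat_mult ..

text \<open>\<open>2 N \<gamma>\<^sub>l\<close> is \<open>2 \<pi>\<close> times the integer
  \<open>2 l - 1\<close>, and \<open>2 N\<close> axial steps make a whole period, on which the wave
  of frequency \<open>j\<close> returns to \<open>1\<close>.\<close>

lemma phase_root_of_unity: "phase j D ^ (2 * N) = 1"
proof -
  have K0: "K > 0" using odd_K by (auto intro!: Nat.gr0I)
  have "cis (real (2 * N) * (pi * of_int j / real N)) = 1"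
  proof -
    have "real (2 * N) * (pi * of_int j / real N) = 2 * pi * of_int j" using N_pos by simp
    then show ?thesis by (simp add: cis_multiple_2pi)
  qed
  moreover have "exp (of_nat (2 * N) * (\<i> * (sign_of D l * of_real (\<gamma> l)))) = 1" if l: "l \<in> {1..K}" for l
  proof -
    have g: "real (2 * N) * \<gamma> l = 2 * pi * (2 * real l - 1)"
      using K0 by (simp add: \<gamma>_def[OF l] N_def field_simps)
    have "of_nat (2 * N) * (\<i> * (sign_of D l * of_real (\<gamma> l))) = sign_of D l * (\<i> * of_real (real (2 * N) * \<gamma> l))"
      by simp
    also have "\<dots> = 2 * of_real pi * of_int (if l \<in> D then - (2 * int l - 1) else 2 * int l - 1) * \<i>"
      unfolding g sign_of_def by (simp add: algebra_simps)
    finally have e: "of_nat (2 * N) * (\<i> * (sign_of D l * of_real (\<gamma> l))) =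
       2 * of_real pi * of_int (if l \<in> D then - (2 * int l - 1) else 2 * int l - 1) * \<i>" .
    show ?thesis unfolding e exp_eq_1 by (intro conjI exI[of _ "if l \<in> D then - (2 * int l - 1) else 2 * int l - 1"]) simp_all
  qed
  ultimately show ?thesis unfolding phase_power by simp
qed

text \<open>The weight \<open>parity D\<close> turns the sum over sign patterns into a product of
  differences of conjugate exponentials, hence of sines; without it the factors would be
  cosines.\<close>

lemma sum_parity_phase_power:
  "(\<Sum>D\<in>Pow {1..K}. parity D * phase j D ^ k) = cis (real k * (pi * of_int j / real N)) * sine_prod k"
proof -
  define f where "f l = exp (of_nat k * (\<i> * of_real (\<gamma> l)))" for l
  define g where "g l = - exp (- (of_nat k * (\<i> * of_real (\<gamma> l))))" for l
  have "(\<Sum>D\<in>Pow {1..K}. parity D * phase j D ^ k) =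
      (\<Sum>D\<in>Pow {1..K}. cis (real k * (pi * of_int j / real N)) * (\<Prod>l\<in>{1..K}. if l \<in> D then g l else f l))"
  proof (rule sum.cong[OF refl])
    fix D
    have "parity D * (\<Prod>l\<in>{1..K}. exp (of_nat k * (\<i> * (sign_of D l * of_real (\<gamma> l))))) =
        (\<Prod>l\<in>{1..K}. if l \<in> D then g l else f l)"
      unfolding parity_def prod.distrib[symmetric] by (rule prod.cong) (simp_all add: sign_of_def f_def g_def)
    then show "parity D * phase j D ^ k = cis (real k * (pi * of_int j / real N)) * (\<Prod>l\<in>{1..K}. if l \<in> D then g l else f l)"
      unfolding phase_power mult.left_commute[of "parity D"] by (rule arg_cong)
  qed
  also have "\<dots> = cis (real k * (pi * of_int j / real N)) * (\<Prod>l\<in>{1..K}. f l + g l)"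
    unfolding sum_distrib_left[symmetric] sum_Pow_prod ..
  also have "(\<Prod>l\<in>{1..K}. f l + g l) = sine_prod k" unfolding sine_prod_def
  proof (rule prod.cong[OF refl])
    fix l
    have e: "of_nat k * (\<i> * of_real (\<gamma> l)) = \<i> * of_real (real k * \<gamma> l)" by simp
    show "f l + g l = 2 * \<i> * of_real (sin (real k * \<gamma> l))"
      unfolding f_def g_def e mult_minus_right[symmetric] of_real_minus[symmetric] cis_conv_exp[symmetric]
      by (simp add: complex_eq_iff)
  qed
  finally show ?thesis .
qed

text \<open>For given \<open>m\<close> the parity of a pattern determines its frequency,
  \<open>j = m\<close> or \<open>j = - m\<close>, so it is enough to count patterns.\<close>

lemma card_single_indices:
  "of_nat (card (single_indices (2 * pi * of_int m))) =
    (\<Sum>D\<in>Pow {1..K}. if phase (if parity D = 1 then m else - m) D = 1 then 1 else 0 :: complex)"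
proof -
  let ?f = "\<lambda>D. (if parity D = 1 then m else - m, D)"
  let ?S = "{D \<in> Pow {1..K}. phase (if parity D = 1 then m else - m) D = 1}"
  have "single_indices (2 * pi * of_int m) = ?f ` ?S"
  proof -
    have e: "2 * of_real pi * of_int j * parity D = complex_of_real (2 * pi * of_int m) \<longleftrightarrow> j = (if parity D = 1 then m else - m)"
      for j D
    proof -
      have "2 * of_real pi * of_int j * parity D = complex_of_real (2 * pi * of_int m) \<longleftrightarrow> of_int j * parity D = (of_int m :: complex)"
        by simp
      moreover have "(- of_int j = (of_int m :: complex)) \<longleftrightarrow> j = - m"
        unfolding of_int_minus[symmetric] of_int_eq_iff by auto
      ultimately show ?thesis using parity_cases[of D] by auto
    qed
    show ?thesis unfolding single_indices_def e by auto
  qed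
  moreover have "inj_on ?f ?S" by (rule inj_onI) simp
  ultimately have "card (single_indices (2 * pi * of_int m)) = card ?S" by (simp add: card_image)
  moreover have "of_nat (card ?S) = (\<Sum>D\<in>?S. 1 :: complex)" by simp
  moreover have "\<dots> = (\<Sum>D\<in>Pow {1..K}. if phase (if parity D = 1 then m else - m) D = 1 then 1 else 0)"
    by (rule sum.inter_filter) simp
  ultimately show ?thesis by (simp only:)
qed

text \<open>Patterns of the two parities exchange their roles between \<open>m\<close> and
  \<open>-m\<close>, whence the weight \<open>parity D\<close>. The filter replaces the condition
  that the phase is \<open>1\<close> by an average over its powers, and for each power the sum over
  patterns factorises.\<close>

lemma multiplicity_difference_multiple:
  "of_nat (multiplicity_of n \<Gamma> b (2 * pi * real m)) - of_nat (multiplicity_of n \<Gamma> b (- (2 * pi * real m))) =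
    (\<Sum>k<2 * N. sine_prod k / of_nat (2 * N) * (unit_root k ^ m - cnj (unit_root k) ^ m))"
proof -
  define \<delta> where "\<delta> j D = (if phase j D = 1 then 1 else 0 :: complex)" for j D
  have \<delta>: "\<delta> j D = (\<Sum>k<2 * N. phase j D ^ k) / of_nat (2 * N)" for j D
    using N_pos by (simp add: \<delta>_def sum_powers_root_of_unity[OF phase_root_of_unity] del: of_nat_mult)
  have \<delta>sum: "(\<Sum>D\<in>Pow {1..K}. parity D * \<delta> j D) =
      (\<Sum>k<2 * N. sine_prod k / of_nat (2 * N) * cis (real k * (pi * of_int j / real N)))" for j
  proof -
    have "(\<Sum>D\<in>Pow {1..K}. parity D * \<delta> j D) = (\<Sum>D\<in>Pow {1..K}. \<Sum>k<2 * N. parity D * phase j D ^ k / of_nat (2 * N))"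
      unfolding \<delta> by (simp only: times_divide_eq_right sum_distrib_left sum_divide_distrib)
    also have "\<dots> = (\<Sum>k<2 * N. (\<Sum>D\<in>Pow {1..K}. parity D * phase j D ^ k) / of_nat (2 * N))"
      by (subst sum.swap) (simp only: sum_divide_distrib)
    finally show ?thesis unfolding sum_parity_phase_power by (simp add: mult.commute)
  qed
  have "of_nat (multiplicity_of n \<Gamma> b (2 * pi * real m)) - of_nat (multiplicity_of n \<Gamma> b (- (2 * pi * real m))) =
      of_nat (card (single_indices (2 * pi * of_int (int m)))) - (of_nat (card (single_indices (2 * pi * of_int (- int m)))) :: complex)"
    using arg_cong[OF multiplicity_difference_card[of "2 * pi * real m"], of "of_nat :: nat \<Rightarrow> complex"]
    by (simp add: algebra_simps)
  also have "\<dots> = (\<Sum>D\<in>Pow {1..K}. parity D * \<delta> (int m) D - parity D * \<delta> (- int m) D)"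
    unfolding card_single_indices sum_subtractf[symmetric]
  proof (rule sum.cong[OF refl])
    fix D
    show "(if phase (if parity D = 1 then int m else - int m) D = 1 then 1 else 0) -
        (if phase (if parity D = 1 then - int m else - (- int m)) D = 1 then 1 else 0) =
        parity D * \<delta> (int m) D - parity D * \<delta> (- int m) D"
      using parity_cases[of D] by (auto simp: \<delta>_def)
  qed
  also have "\<dots> = (\<Sum>k<2 * N. sine_prod k / of_nat (2 * N) * (unit_root k ^ m - cnj (unit_root k) ^ m))"
    unfolding sum_subtractf \<delta>sum unfolding sum_subtractf[symmetric] right_diff_distrib[symmetric]
    by (rule sum.cong) (simp_all add: unit_root_def Complex.DeMoivre cis_cnj field_simps)
  finally show ?thesis .
qed

text \<open>Kernel elements of the twist have integer axial frequencies, so their eigenvalues are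
  integer multiples of \<open>2 \<pi>\<close>; for all other \<open>\<mu>\<close> both kernels are
  zero.\<close>

lemma multiplicity_symmetric:
  assumes "\<And>m. \<mu> \<noteq> 2 * pi * of_int m"
  shows "multiplicity_of n \<Gamma> b (- \<mu>) = multiplicity_of n \<Gamma> b \<mu>"
proof -
  have "single_indices \<nu> = {}" if \<nu>: "\<nu> = \<mu> \<or> \<nu> = - \<mu>" for \<nu>
  proof (rule ccontr)
    assume "single_indices \<nu> \<noteq> {}"
    then obtain j D where "2 * of_real pi * of_int j * parity D = complex_of_real \<nu>"
      by (auto simp: single_indices_def)
    then have "complex_of_real (2 * pi * of_int j) = of_real \<nu> \<or> complex_of_real (2 * pi * of_int (- j)) = of_real \<nu>"
      using parity_cases[of D] by auto
    then have "2 * pi * of_int j = \<nu> \<or> 2 * pi * of_int (- j) = \<nu>" by (simp only: of_real_eq_iff)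
    then show False using \<nu> assms[of j] assms[of "- j"] by auto
  qed
  then show ?thesis using multiplicity_difference_card[of \<mu>] by simp
qed

lemma multiplicity_eq_0:
  assumes "\<And>k :: nat. \<mu>\<^sup>2 \<noteq> 4 * pi\<^sup>2 * real k"
  shows "multiplicity_of n \<Gamma> b \<mu> = 0"
proof -
  have "\<xi> \<notin> frequencies \<mu>" for \<xi> using assms by (auto elim: frequencies_level)
  then have "a = 0" if "a \<in> families \<mu>" for a using familiesD(5)[OF that] by (intro ext) simp
  then have "families \<mu> \<subseteq> forms.span {}" by auto
  from forms.dim_le_card[OF this finite.emptyI] show ?thesis unfolding multiplicity_eq_dim_families by simp
qed

lemma multiplicity_eq_0_spectrum:
  assumes "\<mu> \<notin> B_spectrum n \<Gamma> b" shows "multiplicity_of n \<Gamma> b \<mu> = 0"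
proof -
  have "B_eigenspace n \<Gamma> b \<mu> \<subseteq> forms.span {}"
    using assms by (auto simp: B_spectrum_def)
  from forms.dim_le_card[OF this finite.emptyI] show ?thesis unfolding multiplicity_of_def by simp
qed

end

section \<open>The eta function\<close>

text \<open>The singularities of a meromorphic function form a sparse set with open connected
  complement, so the identity theorem carries the vanishing of \<open>F - G\<close> from a common
  half-plane of convergence to \<open>0\<close>. This gives meaning to the definite description in
  \<open>eta_invariant\<close>.\<close>

lemma eta_continuation_unique:
  assumes F: "eta_continuation n \<Gamma> b F" and G: "eta_continuation n \<Gamma> b G"
  shows "F 0 = G 0"
proof -
  define h where "h z = F z - G z" for z
  from F obtain \<sigma> where \<sigma>: "\<And>s. Re s > \<sigma> \<Longrightarrow>
      ((\<lambda>\<mu>. of_real (sgn \<mu>) * of_nat (multiplicity_of n \<Gamma> b \<mu>) * of_real \<bar>\<mu>\<bar> powr (- s)) has_sum F s) (B_spectrum n \<Gamma> b - {0})"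
    unfolding eta_continuation_def by blast
  from G obtain \<tau> where \<tau>: "\<And>s. Re s > \<tau> \<Longrightarrow>
      ((\<lambda>\<mu>. of_real (sgn \<mu>) * of_nat (multiplicity_of n \<Gamma> b \<mu>) * of_real \<bar>\<mu>\<bar> powr (- s)) has_sum G s) (B_spectrum n \<Gamma> b - {0})"
    unfolding eta_continuation_def by blast
  define H where "H = {s. Re s > max \<sigma> \<tau>}"
  have H0: "h s = 0" if "s \<in> H" for s
    using has_sum_unique[OF \<sigma>[of s] \<tau>[of s]] that by (simp add: h_def H_def)
  have openH: "open H" unfolding H_def by (rule open_halfspace_Re_gt)
  have mero: "h meromorphic_on UNIV" unfolding h_def
    using F G by (intro meromorphic_intros) (auto simp: eta_continuation_def)
  define S where "S = UNIV - {w. \<not> h analytic_on {w}}"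
  have sp: "{w. \<not> h analytic_on {w}} sparse_in UNIV"
    by (rule meromorphic_on_imp_sparse_singularities[OF mero])
  have S: "open S" "connected S" unfolding S_def
    by (rule open_diff_sparse_pts[OF open_UNIV sp]) (rule sparse_imp_connected[OF _ connected_UNIV open_UNIV sp], simp)
  have hol: "h holomorphic_on S"
    by (rule analytic_imp_holomorphic, subst analytic_on_analytic_at) (simp add: S_def)
  have "H \<subseteq> S"
  proof
    fix s assume s: "s \<in> H"
    have "h holomorphic_on H" by (rule holomorphic_transform[where f = "\<lambda>_. 0"]) (auto simp: H0)
    then have "h analytic_on H" by (simp add: analytic_on_open openH)
    then have "h analytic_on {s}" by (rule analytic_on_subset) (use s in simp)
    then show "s \<in> S" by (simp add: S_def)
  qed
  moreover have "0 \<in> S"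
    using F G analytic_on_diff[of F "{0}" G] by (simp add: S_def h_def[abs_def] eta_continuation_def)
  moreover have "of_real (max \<sigma> \<tau> + 1) \<in> H" unfolding H_def mem_Collect_eq Re_complex_of_real by linarith
  ultimately have "h 0 = 0"
    using analytic_continuation_open[OF openH S(1) _ S(2) _ hol holomorphic_on_const[of 0], of 0] H0 by blast
  then show ?thesis by (simp add: h_def)
qed

text \<open>Passes from a sum over a set of reals to the sum over pairs of opposite points; absolute
  convergence permits the regrouping, and positivity of \<open>p\<close> keeps the two halves
  disjoint.\<close>

lemma has_sum_symmetric_points:
  fixes g :: "real \<Rightarrow> complex" and p :: "nat \<Rightarrow> real"
  assumes inj: "inj p" and pos: "\<And>k. p k > 0"
    and s1: "summable (\<lambda>k. norm (g (p k)))" and s2: "summable (\<lambda>k. norm (g (- p k)))"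
    and supp: "\<And>x. x \<in> T \<Longrightarrow> x \<notin> range p \<Longrightarrow> - x \<notin> range p \<Longrightarrow> g x = 0"
    and out: "\<And>x. x \<notin> T \<Longrightarrow> g x = 0"
  obtains X where "(g has_sum X) T" "((\<lambda>k. g (p k) + g (- p k)) has_sum X) UNIV"
proof -
  obtain X Y where X: "((\<lambda>k. g (p k)) has_sum X) UNIV" and Y: "((\<lambda>k. g (- p k)) has_sum Y) UNIV"
    using norm_summable_imp_summable_on[OF s1] norm_summable_imp_summable_on[OF s2] unfolding summable_on_def by blast
  have i2: "inj (\<lambda>k. - p k)" using inj by (simp add: inj_def)
  have "(g has_sum X) (range p)" using X by (subst has_sum_reindex[OF inj]) (simp add: o_def)
  moreover have "(g has_sum Y) (range (\<lambda>k. - p k))" using Y by (subst has_sum_reindex[OF i2]) (simp add: o_def)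
  moreover have "range p \<inter> range (\<lambda>k. - p k) = {}"
  proof -
    have "p k \<noteq> - p l" for k l using pos[of k] pos[of l] by linarith
    then show ?thesis by auto
  qed
  ultimately have "(g has_sum (X + Y)) (range p \<union> range (\<lambda>k. - p k))" by (rule has_sum_Un_disjoint)
  then have "(g has_sum (X + Y)) T"
  proof (rule has_sum_cong_neutral[THEN iffD1, rotated -1])
    fix x assume x: "x \<in> T - (range p \<union> range (\<lambda>k. - p k))"
    have "- x \<notin> range p"
    proof
      assume "- x \<in> range p"
      then obtain k where "- x = p k" by blast
      then have "x = - p k" by linarith
      then show False using x by blast
    qed
    then show "g x = 0" using supp[of x] x by blast
  qed (use out in auto)
  with has_sum_add[OF X Y] that show thesis by blast
qed

section \<open>Convergence and pairing of the eta series\<close>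

context eta_manifold
begin

definition eta_term :: "complex \<Rightarrow> real \<Rightarrow> complex" where
  "eta_term s \<mu> = of_real (sgn \<mu>) * of_nat (multiplicity_of n \<Gamma> b \<mu>) * of_real \<bar>\<mu>\<bar> powr (- s)"

text \<open>The candidates for absolute values of nonzero eigenvalues: the squared length of an
  integer frequency is a natural number, and \<open>Suc\<close> excludes zero.\<close>

definition level :: "nat \<Rightarrow> real" where
  "level k = 2 * pi * sqrt (real (Suc k))"

lemma level_pos: "level k > 0" by (simp add: level_def)

lemma level_square: "(level k)\<^sup>2 = 4 * pi\<^sup>2 * real (Suc k)"
  by (simp add: level_def power_mult_distrib)

lemma inj_level: "inj level"
  by (rule injI) (simp add: level_def)

text \<open>With \<open>m\<close> the dimension, the multiplicity is at most a constant times
  \<open>(k + 1)^m\<close>, while the eigenvalue grows like the square root of \<open>k + 1\<close>;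
  the bound on \<open>Re s\<close> pushes the exponent \<open>m - Re s / 2\<close> below
  \<open>-2\<close>.\<close>

lemma summable_eta_term:
  assumes s: "Re s > 2 * real CARD('k option) + 4" and \<epsilon>: "\<epsilon> = 1 \<or> \<epsilon> = (-1 :: real)"
  shows "summable (\<lambda>k. norm (eta_term s (\<epsilon> * level k)))"
proof (rule summable_comparison_test')
  let ?m = "CARD('k option)"
  let ?C = "3 ^ ?m * 2 ^ DIM(real^('k option)) :: real"
  have "summable (\<lambda>k. real (Suc k) powr (real ?m - Re s / 2))"
    using s by (subst summable_Suc_iff, subst summable_real_powr_iff) simp
  then show "summable (\<lambda>k. ?C * real (Suc k) powr (real ?m - Re s / 2))" by (rule summable_mult)
  fix k :: nat
  have sq: "(\<epsilon> * level k)\<^sup>2 = 4 * pi\<^sup>2 * real (Suc k)" using \<epsilon> by (auto simp: level_square power_mult_distrib)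
  have "real (multiplicity_of n \<Gamma> b (\<epsilon> * level k)) \<le> real ((2 * Suc k + 1) ^ ?m * 2 ^ DIM(real^('k option)))"
    by (rule of_nat_mono) (rule multiplicity_bound[OF sq])
  also have "\<dots> = (2 * real (Suc k) + 1) ^ ?m * 2 ^ DIM(real^('k option))"
    by (simp only: of_nat_mult of_nat_power of_nat_add of_nat_numeral of_nat_1)
  also have "\<dots> \<le> (3 * real (Suc k)) ^ ?m * 2 ^ DIM(real^('k option))"
    by (intro mult_right_mono power_mono) auto
  also have "\<dots> = ?C * real (Suc k) powr real ?m" by (simp only: power_mult_distrib powr_realpow of_nat_0_less_iff zero_less_Suc mult_ac)
  finally have m: "real (multiplicity_of n \<Gamma> b (\<epsilon> * level k)) \<le> ?C * real (Suc k) powr real ?m" .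
  have l: "level k powr (- Re s) \<le> real (Suc k) powr (- (Re s / 2))"
  proof -
    have "1 * sqrt (real (Suc k)) \<le> 2 * pi * sqrt (real (Suc k))"
      using pi_ge_two by (intro mult_right_mono) auto
    then have "level k powr (- Re s) \<le> sqrt (real (Suc k)) powr (- Re s)"
      using s unfolding level_def by (intro powr_mono2') auto
    also have "\<dots> = real (Suc k) powr (- (Re s / 2))"
      by (simp add: powr_half_sqrt[symmetric] powr_powr)
    finally show ?thesis .
  qed
  have "norm (eta_term s (\<epsilon> * level k)) = real (multiplicity_of n \<Gamma> b (\<epsilon> * level k)) * level k powr (- Re s)"
    using \<epsilon> level_pos[of k] by (auto simp: eta_term_def norm_mult abs_mult norm_powr_real_powr sgn_mult sgn_if)
  also have "\<dots> \<le> (?C * real (Suc k) powr real ?m) * real (Suc k) powr (- (Re s / 2))"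
    by (intro mult_mono m l) auto
  also have "\<dots> = ?C * real (Suc k) powr (real ?m - Re s / 2)"
    by (simp only: mult.assoc powr_add[symmetric] add_uminus_conv_diff)
  finally show "norm (norm (eta_term s (\<epsilon> * level k))) \<le> ?C * real (Suc k) powr (real ?m - Re s / 2)" by simp
qed

definition coefficient_at :: "nat \<Rightarrow> complex" where
  "coefficient_at m = (\<Sum>k<2 * N. sine_prod k / of_nat (2 * N) * (unit_root k ^ m - cnj (unit_root k) ^ m))"

text \<open>After pairing \<open>level k\<close> with its negative only the levels that are integer
  multiples of \<open>2 \<pi>\<close> survive, and these are the ones for which \<open>Suc k\<close>
  is a perfect square.\<close>

lemma eta_term_sum:
  assumes s: "Re s > 2 * real CARD('k option) + 4"
  obtains X where "(eta_term s has_sum X) (B_spectrum n \<Gamma> b - {0})"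
    "(\<lambda>j. coefficient_at (Suc j) * of_real (2 * pi * real (Suc j)) powr (- s)) sums X"
proof -
  have su: "summable (\<lambda>k. norm (eta_term s (level k)))" "summable (\<lambda>k. norm (eta_term s (- level k)))"
    using summable_eta_term[OF s, of 1] summable_eta_term[OF s, of "-1"] by simp_all
  have supp: "eta_term s x = 0" if x: "x \<in> B_spectrum n \<Gamma> b - {0}" "x \<notin> range level" "- x \<notin> range level" for x
  proof -
    have "x\<^sup>2 \<noteq> 4 * pi\<^sup>2 * real k" for k
    proof
      assume e: "x\<^sup>2 = 4 * pi\<^sup>2 * real k"
      have "k \<noteq> 0"
      proof
        assume "k = 0"
        then have "x\<^sup>2 = 0" using e by simp
        then show False using x(1) by simp
      qed
      then obtain l where "k = Suc l" using not0_implies_Suc by blast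
      then have "x\<^sup>2 = (level l)\<^sup>2" using e by (simp only: level_square)
      then have "x = level l \<or> - x = level l" by (auto simp: power2_eq_iff)
      then show False using x(2,3) by (metis rangeI)
    qed
    then show ?thesis by (simp add: eta_term_def multiplicity_eq_0)
  qed
  have out: "eta_term s x = 0" if "x \<notin> B_spectrum n \<Gamma> b - {0}" for x
    using that multiplicity_eq_0_spectrum[of x] by (auto simp: eta_term_def)
  obtain X where X: "(eta_term s has_sum X) (B_spectrum n \<Gamma> b - {0})"
      "((\<lambda>k. eta_term s (level k) + eta_term s (- level k)) has_sum X) UNIV"
    by (rule has_sum_symmetric_points[OF inj_level level_pos su supp out])
  define h where "h k = eta_term s (level k) + eta_term s (- level k)" for k
  have h: "h k = (of_nat (multiplicity_of n \<Gamma> b (level k)) - of_nat (multiplicity_of n \<Gamma> b (- level k))) * of_real (level k) powr (- s)" for k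
    using level_pos[of k] by (simp add: h_def eta_term_def sgn_if left_diff_distrib)
  \<comment> \<open>\<open>Suc (q j)\<close> is the square of \<open>Suc j\<close>; the predecessor
    is taken because levels are numbered from zero.\<close>
  define q where "q j = Suc j * Suc j - 1" for j
  have level_q: "level (q j) = 2 * pi * real (Suc j)" for j
  proof -
    have "real (Suc (q j)) = (real (Suc j))\<^sup>2" unfolding power2_eq_square of_nat_mult[symmetric] by (simp add: q_def)
    then show ?thesis unfolding level_def by simp
  qed
  have inj_q: "inj q"
  proof (rule injI)
    fix i j assume "q i = q j"
    then have "level (q i) = level (q j)" by simp
    then show "i = j" unfolding level_q by simp
  qed
  have "(h has_sum X) (range q)"
  proof (rule has_sum_cong_neutral[THEN iffD1, rotated -1])
    show "(h has_sum X) UNIV" using X(2) by (simp add: h_def[abs_def])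
    fix k assume k: "k \<in> UNIV - range q"
    have "level k \<noteq> 2 * pi * of_int m" for m
    proof
      assume e: "level k = 2 * pi * of_int m"
      then have "of_int m > (0 :: real)" using level_pos[of k] by (simp add: zero_less_mult_iff)
      then have m: "m > 0" by simp
      then have "real_of_int m = real (Suc (nat m - 1))" by simp
      then have "level k = level (q (nat m - 1))" unfolding e level_q by (rule arg_cong)
      then have "k = q (nat m - 1)" using inj_level by (simp add: inj_eq)
      then show False using k by blast
    qed
    then show "h k = 0" unfolding h using multiplicity_symmetric[of "level k"] by simp
  qed simp_all
  then have "((\<lambda>j. h (q j)) has_sum X) UNIV" by (simp add: has_sum_reindex[OF inj_q] o_def)
  then have "(\<lambda>j. h (q j)) sums X" by (rule has_sum_imp_sums)
  moreover have "h (q j) = coefficient_at (Suc j) * of_real (2 * pi * real (Suc j)) powr (- s)" for j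
    unfolding h level_q multiplicity_difference_multiple coefficient_at_def ..
  ultimately have "(\<lambda>j. coefficient_at (Suc j) * of_real (2 * pi * real (Suc j)) powr (- s)) sums X"
    by (simp only:)
  with X(1) show thesis by (rule that)
qed

end

lemma cis_double_quotient:
  assumes "sin t \<noteq> 0"
  shows "cis (2 * t) \<noteq> 1" "cis (2 * t) / (1 - cis (2 * t)) = \<i> * cis t / (2 * of_real (sin t))"
proof -
  have a: "1 - cis (2 * t) = - 2 * \<i> * of_real (sin t) * cis t"
    by (simp add: complex_eq_iff cos_double_sin sin_double power2_eq_square)
  have nz: "- 2 * \<i> * of_real (sin t) * cis t \<noteq> 0" using assms by simp
  then show "cis (2 * t) \<noteq> 1" using a by auto
  have b: "cis (2 * t) = cis t * cis t" by (simp add: cis_mult)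
  have "cis t * cis t * (2 * of_real (sin t)) = \<i> * cis t * (- 2 * \<i> * of_real (sin t) * cis t)"
    by (simp add: algebra_simps)
  then show "cis (2 * t) / (1 - cis (2 * t)) = \<i> * cis t / (2 * of_real (sin t))"
    unfolding a unfolding b using nz assms by (subst frac_eq_eq) simp_all
qed

text \<open>The origin of the cotangents: for \<open>w = exp (2 \<i> t)\<close> the values of
  \<open>w / (1 - w)\<close> at \<open>w\<close> and at its conjugate differ by
  \<open>\<i> cot t\<close>.\<close>

lemma oscillating_difference:
  assumes "sin t \<noteq> 0"
  obtains F where "F holomorphic_on UNIV" "F 0 = \<i> * of_real (cot t)"
    "\<And>s. Re s > 1 \<Longrightarrow> (\<lambda>j. (cis (2 * t) ^ Suc j - cnj (cis (2 * t)) ^ Suc j) * of_nat (Suc j) powr (- s)) sums F s"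
proof -
  have t': "sin (- t) \<noteq> 0" using assms by simp
  have c: "cnj (cis (2 * t)) = cis (2 * (- t))" by (simp add: cis_cnj)
  obtain F where F: "F holomorphic_on UNIV" "F 0 = cis (2 * t) / (1 - cis (2 * t))"
      "\<And>s. Re s > 1 \<Longrightarrow> (\<lambda>j. cis (2 * t) ^ Suc j * of_nat (Suc j) powr (- s)) sums F s"
    by (rule oscillating_dirichlet_series[of "cis (2 * t)"]) (use cis_double_quotient(1)[OF assms] in auto)
  obtain G where G: "G holomorphic_on UNIV" "G 0 = cis (2 * (- t)) / (1 - cis (2 * (- t)))"
      "\<And>s. Re s > 1 \<Longrightarrow> (\<lambda>j. cis (2 * (- t)) ^ Suc j * of_nat (Suc j) powr (- s)) sums G s"
    by (rule oscillating_dirichlet_series[of "cis (2 * (- t))"]) (use cis_double_quotient(1)[OF t'] in auto)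
  have "F 0 - G 0 = \<i> * of_real (cot t)"
  proof -
    have "F 0 - G 0 = \<i> * (cis t + cis (- t)) / (2 * of_real (sin t))"
      unfolding F(2) G(2) cis_double_quotient(2)[OF assms] cis_double_quotient(2)[OF t']
      by (simp add: add_divide_distrib distrib_left)
    also have "cis t + cis (- t) = 2 * of_real (cos t)" by (simp add: complex_eq_iff)
    finally show ?thesis by (simp add: cot_def)
  qed
  moreover have "(\<lambda>s. F s - G s) holomorphic_on UNIV" by (intro holomorphic_on_diff F G)
  moreover have "(\<lambda>j. (cis (2 * t) ^ Suc j - cnj (cis (2 * t)) ^ Suc j) * of_nat (Suc j) powr (- s)) sums (F s - G s)" if "Re s > 1" for s
    unfolding c left_diff_distrib by (intro sums_diff F(3) G(3) that)
  ultimately show thesis using that[of "\<lambda>s. F s - G s"] by blast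
qed

section \<open>Evaluation at s = 0\<close>

context eta_manifold
begin

text \<open>Even \<open>k\<close> drop out with their sine product. For odd \<open>k\<close> the
  \<open>-\<i>\<close> of the sine product meets the \<open>\<i>\<close> of the cotangent, the power
  of \<open>2 \<pi>\<close> is \<open>1\<close> at \<open>s = 0\<close>, and
  \<open>gcd k N = gcd k K\<close> identifies the exponent of two with the number of cycles.\<close>

lemma eta_invariant_value:
  "eta_invariant n \<Gamma> b = of_real ((-1) ^ n / (2 * real N) *
     (\<Sum>r<N. 2 ^ num_cycles (matrix_pow A (2 * r + 1)) * (-1) ^ r * cot ((2 * real r + 1) * pi / (2 * real N))))"
proof -
  define odds where "odds = {k \<in> {..<2 * N}. odd k}"
  define t where "t k = pi * real k / (2 * real N)" for k
  have sine: "sine_prod k = (\<Prod>l\<in>{1..K}. 2 * \<i> * of_real (sin (real k * ((2 * real l - 1) * pi / (2 * real K)))))" for k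
    unfolding sine_prod_def by (rule prod.cong) (simp_all only: \<gamma>_def)
  have ur: "unit_root k = cis (2 * t k)" for k by (simp add: unit_root_def t_def)
  have st: "sin (t k) \<noteq> 0" if "k \<in> odds" for k
  proof -
    have "0 < k" "k < 2 * N" using that by (auto simp: odds_def intro!: Nat.gr0I)
    then have "0 < t k" "t k < pi" using N_pos by (simp_all add: t_def field_simps)
    then show ?thesis using sin_gt_zero[of "t k"] by simp
  qed
  have ex: "\<exists>F. F holomorphic_on UNIV \<and> F 0 = \<i> * of_real (cot (t k)) \<and>
      (\<forall>s. Re s > 1 \<longrightarrow> (\<lambda>j. (unit_root k ^ Suc j - cnj (unit_root k) ^ Suc j) * of_nat (Suc j) powr (- s)) sums F s)"
    if "k \<in> odds" for k
    unfolding ur by (rule oscillating_difference[OF st[OF that]]) blast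
  define G where "G k = (SOME F. F holomorphic_on UNIV \<and> F 0 = \<i> * of_real (cot (t k)) \<and>
      (\<forall>s. Re s > 1 \<longrightarrow> (\<lambda>j. (unit_root k ^ Suc j - cnj (unit_root k) ^ Suc j) * of_nat (Suc j) powr (- s)) sums F s))" for k
  have G: "G k holomorphic_on UNIV" "G k 0 = \<i> * of_real (cot (t k))"
      "Re s > 1 \<Longrightarrow> (\<lambda>j. (unit_root k ^ Suc j - cnj (unit_root k) ^ Suc j) * of_nat (Suc j) powr (- s)) sums G k s"
    if "k \<in> odds" for k s
    using someI_ex[OF ex[OF that]] unfolding G_def[symmetric] by blast+
  define F where "F s = of_real (2 * pi) powr (- s) * (\<Sum>k\<in>odds. sine_prod k / of_nat (2 * N) * G k s)" for s
  have co: "coefficient_at m = (\<Sum>k\<in>odds. sine_prod k / of_nat (2 * N) * (unit_root k ^ m - cnj (unit_root k) ^ m))" for m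
    unfolding coefficient_at_def
  proof (rule sum.mono_neutral_right)
    show "\<forall>k\<in>{..<2 * N} - odds. sine_prod k / of_nat (2 * N) * (unit_root k ^ m - cnj (unit_root k) ^ m) = 0"
    proof
      fix k assume "k \<in> {..<2 * N} - odds"
      then have "even k" by (simp add: odds_def)
      then have "sine_prod k = 0" unfolding sine by (rule prod_sines_even[OF n_pos K_def])
      then show "sine_prod k / of_nat (2 * N) * (unit_root k ^ m - cnj (unit_root k) ^ m) = 0" by simp
    qed
  qed (auto simp: odds_def)
  have F: "(\<lambda>j. coefficient_at (Suc j) * of_real (2 * pi * real (Suc j)) powr (- s)) sums F s" if s: "Re s > 1" for s
  proof -
    have "(\<lambda>j. \<Sum>k\<in>odds. sine_prod k / of_nat (2 * N) * ((unit_root k ^ Suc j - cnj (unit_root k) ^ Suc j) * of_nat (Suc j) powr (- s)))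
        sums (\<Sum>k\<in>odds. sine_prod k / of_nat (2 * N) * G k s)"
      by (intro sums_sum sums_mult G(3) s)
    then have "(\<lambda>j. of_real (2 * pi) powr (- s) * (coefficient_at (Suc j) * of_nat (Suc j) powr (- s))) sums F s"
      unfolding F_def co sum_distrib_right mult.assoc by (rule sums_mult)
    moreover have "of_real (2 * pi) powr (- s) * (coefficient_at (Suc j) * of_nat (Suc j) powr (- s)) =
        coefficient_at (Suc j) * of_real (2 * pi * real (Suc j)) powr (- s)" for j
    proof -
      have "complex_of_real (2 * pi * real (Suc j)) powr (- s) = of_real (2 * pi) powr (- s) * of_real (real (Suc j)) powr (- s)"
        unfolding of_real_mult[of "2 * pi"] by (rule powr_times_real) (simp_all del: of_nat_Suc)
      then show ?thesis by (simp only: of_real_of_nat_eq mult.left_commute)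
    qed
    ultimately show ?thesis by (simp only:)
  qed
  have hol: "F holomorphic_on UNIV"
    unfolding F_def by (intro holomorphic_intros G(1)) auto
  have "eta_continuation n \<Gamma> b F" unfolding eta_continuation_def
  proof (intro conjI exI allI impI)
    have an: "F analytic_on UNIV" using hol by (simp add: analytic_on_open)
    then show "F meromorphic_on UNIV" by (rule analytic_on_imp_meromorphic_on)
    show "F analytic_on {0}" by (rule analytic_on_subset[OF an]) simp
    fix s :: complex assume s: "Re s > 2 * real CARD('k option) + 4"
    obtain X where X: "(eta_term s has_sum X) (B_spectrum n \<Gamma> b - {0})"
        "(\<lambda>j. coefficient_at (Suc j) * of_real (2 * pi * real (Suc j)) powr (- s)) sums X"
      by (rule eta_term_sum[OF s])
    have "X = F s" by (rule sums_unique2[OF X(2) F]) (use s in linarith)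
    then show "((\<lambda>\<mu>. of_real (sgn \<mu>) * of_nat (multiplicity_of n \<Gamma> b \<mu>) * of_real \<bar>\<mu>\<bar> powr (- s)) has_sum F s)
        (B_spectrum n \<Gamma> b - {0})"
      using X(1) by (simp only: eta_term_def[abs_def])
  qed
  then have "eta_invariant n \<Gamma> b = F 0"
    unfolding eta_invariant_def by (intro the_equality) (auto intro: eta_continuation_unique)
  also have "F 0 = (\<Sum>k\<in>odds. sine_prod k / of_nat (2 * N) * (\<i> * of_real (cot (t k))))"
    by (simp add: F_def G(2))
  also have "odds = (\<lambda>r. 2 * r + 1) ` {..<N}"
    unfolding odds_def by (auto elim!: oddE)
  also have "(\<Sum>k\<in>(\<lambda>r. 2 * r + 1) ` {..<N}. sine_prod k / of_nat (2 * N) * (\<i> * of_real (cot (t k)))) =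
      (\<Sum>r<N. sine_prod (2 * r + 1) / of_nat (2 * N) * (\<i> * of_real (cot (t (2 * r + 1)))))"
    by (subst sum.reindex) (auto simp: inj_on_def)
  also have "\<dots> = (\<Sum>r<N. of_real ((-1) ^ n / (2 * real N) *
      (2 ^ num_cycles (matrix_pow A (2 * r + 1)) * (-1) ^ r * cot ((2 * real r + 1) * pi / (2 * real N)))))"
  proof (rule sum.cong[OF refl])
    fix r
    have sp: "sine_prod (2 * r + 1) = - \<i> * (-1) ^ (n + r) * 2 ^ gcd (2 * r + 1) K"
      unfolding sine by (rule prod_sines_odd[OF n_pos K_def refl])
    have "gcd (2 * r + 1) (2 * K) = gcd (2 * r + 1) K" by (rule gcd_mult_right_left_cancel) simp
    then have g: "num_cycles (matrix_pow A (2 * r + 1)) = gcd (2 * r + 1) K"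
      unfolding num_cycles_matrix_pow N_def .
    have t: "t (2 * r + 1) = (2 * real r + 1) * pi / (2 * real N)" by (simp add: t_def mult.commute)
    have "- \<i> * x * y / z * (\<i> * w) = x * y * w / z" for x y z w :: complex
      by (simp add: complex_eq_iff divide_inverse algebra_simps)
    then show "sine_prod (2 * r + 1) / of_nat (2 * N) * (\<i> * of_real (cot (t (2 * r + 1)))) =
      of_real ((-1) ^ n / (2 * real N) *
      (2 ^ num_cycles (matrix_pow A (2 * r + 1)) * (-1) ^ r * cot ((2 * real r + 1) * pi / (2 * real N))))"
      unfolding sp g t by (simp only:) (simp add: power_add mult_ac)
  qed
  also have "\<dots> = of_real ((-1) ^ n / (2 * real N) *
     (\<Sum>r<N. 2 ^ num_cycles (matrix_pow A (2 * r + 1)) * (-1) ^ r * cot ((2 * real r + 1) * pi / (2 * real N))))"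
    unfolding of_real_sum[symmetric] sum_distrib_left ..
  finally show ?thesis .
qed

end

theorem mainTheorem3:
  fixes n :: nat
    and ix :: "nat \<Rightarrow> 'k::finite"
    and A :: "real^'k^'k"
    and f :: "nat \<Rightarrow> real^'k"
    and b :: "nat \<Rightarrow> real^('k option)"
    and \<Gamma> :: "'k option motion set"
  assumes "n \<ge> 1"
    and "CARD('k) = 4 * n - 2"
    and "bij_betw ix {1..4 * n - 2} UNIV"
    and "\<And>i. 1 \<le> i \<Longrightarrow> i \<le> 4 * n - 3 \<Longrightarrow> A *v axis (ix i) 1 = axis (ix (i + 1)) 1"
    and "A *v axis (ix (4 * n - 2)) 1 = - axis (ix 1) 1"
    and "\<Gamma> = generate motions
               (integer_translations \<union>
                {(block_one A, axis None (1 / (2 * (4 * real n - 2))))})"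
    \<comment> \<open>the orientation: the last coordinate direction first, followed by a basis of the
        span of the others in which \<open>A\<close> is block diagonal with the prescribed rotation angles\<close>
    and "orthonormal_frame b"
    and "b 0 = axis None 1"
    and "\<And>i. 1 \<le> i \<Longrightarrow> i \<le> 4 * n - 2 \<Longrightarrow> b i = embed_first (f i)"
    and "\<And>l. 1 \<le> l \<Longrightarrow> l \<le> 2 * n - 1 \<Longrightarrow>
           (let \<gamma> = (2 * real l - 1) * pi / (4 * real n - 2) in
              A *v f (2 * l - 1) = cos \<gamma> *\<^sub>R f (2 * l - 1) + sin \<gamma> *\<^sub>R f (2 * l) \<and>
              A *v f (2 * l) = - sin \<gamma> *\<^sub>R f (2 * l - 1) + cos \<gamma> *\<^sub>R f (2 * l))"
  shows "flat_manifold_group \<Gamma> \<and>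
         holonomy_group \<Gamma> \<cong> integer_mod_group (2 * (4 * n - 2)) \<and>
         eta_invariant n \<Gamma> b =
           of_real ((-1) ^ n / (8 * real n - 4) *
             (\<Sum>r = 0..4 * n - 3. 2 ^ num_cycles (matrix_pow A (2 * r + 1)) * (-1) ^ r *
                cot ((2 * real r + 1) * pi / (2 * (4 * real n - 2)))))"
proof -
  note n = assms(1) and card = assms(2) and ix = assms(3) and step = assms(4) and wrap = assms(5)
    and \<Gamma> = assms(6) and frame = assms(7) and b0 = assms(8) and bf = assms(9) and rot = assms(10)
  define N where N_eq: "N = 4 * n - 2"
  define K where K_eq: "K = 2 * n - 1"
  \<comment> \<open>Positions are renumbered from zero, as arithmetic modulo \<open>N\<close>
    requires.\<close>
  define jx where "jx i = ix (Suc i)" for i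
  define \<gamma> where \<gamma>_eq: "\<gamma> l = (2 * real l - 1) * pi / (4 * real n - 2)" for l
  have rN: "real N = 4 * real n - 2" and rK: "2 * real K = 4 * real n - 2"
    using n by (simp_all add: N_eq K_eq of_nat_diff)
  have shift: "shift_matrix A jx N"
  proof
    show "N > 0" "even N" using n by (simp_all add: N_eq)
    have "bij_betw (ix \<circ> Suc) {..<N} UNIV"
    proof (rule bij_betw_trans)
      show "bij_betw Suc {..<N} {1..4 * n - 2}"
        unfolding bij_betw_def N_eq by (simp add: image_Suc_lessThan)
    qed (rule ix)
    then show "bij_betw jx {..<N} UNIV" by (simp add: jx_def[abs_def] o_def)
    show "A *v axis (jx i) 1 = axis (jx (Suc i)) 1" if "Suc i < N" for i
      using step[of "Suc i"] that by (simp add: jx_def N_eq)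
    show "A *v axis (jx (N - 1)) 1 = - axis (jx 0) 1"
    proof -
      have "Suc (N - 1) = 4 * n - 2" "Suc 0 = 1" using n by (simp_all add: N_eq)
      then show ?thesis unfolding jx_def using wrap by (simp only:)
    qed
  qed
  interpret shift: shift_matrix A jx N by (rule shift)
  have dim: "DIM(real^('k option)) = 2 * K + 1" using n card by (simp add: K_eq)
  interpret P: plane_frame b K
    by unfold_locales (use frame dim in auto)
  \<comment> \<open>The prescribed blocks of \<open>A\<close> on the vectors \<open>f i\<close> are
    carried to the planes of \<open>b\<close> by \<open>embed_first\<close>, which intertwines
    \<open>A\<close> with \<open>block_one A\<close>.\<close>
  have rotates: "P.rotates ((*v) (block_one A)) \<gamma>" unfolding P.rotates_def
  proof (intro conjI allI ballI)
    show "linear ((*v) (block_one A))" by (rule matrix_vector_mul_linear)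
    show "(block_one A *v x) \<bullet> (block_one A *v y) = x \<bullet> y" for x y
      by (rule orthogonal_matrix_inner[OF shift.orthogonal_A'])
    show "block_one A *v b 0 = b 0" unfolding b0 by (rule block_one_axis_None)
    have emb: "embed_first (x *\<^sub>R u + y *\<^sub>R v) = x *\<^sub>R embed_first u + y *\<^sub>R embed_first v" for x y :: real and u v :: "real^'k"
      by (simp add: vec_eq_iff embed_first_def split: option.split)
    fix l assume "l \<in> {1..K}"
    then have l: "1 \<le> l" "l \<le> 2 * n - 1" by (auto simp: K_eq)
    have p: "P.pv l = embed_first (f (2 * l - 1))" and q: "P.qv l = embed_first (f (2 * l))"
      unfolding P.pv_def P.qv_def using l by (intro bf; arith)+
    have r: "A *v f (2 * l - 1) = cos (\<gamma> l) *\<^sub>R f (2 * l - 1) + sin (\<gamma> l) *\<^sub>R f (2 * l)"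
        "A *v f (2 * l) = - sin (\<gamma> l) *\<^sub>R f (2 * l - 1) + cos (\<gamma> l) *\<^sub>R f (2 * l)"
      using rot[OF l] unfolding Let_def \<gamma>_eq by blast+
    show "block_one A *v P.pv l = cos (\<gamma> l) *\<^sub>R P.pv l + sin (\<gamma> l) *\<^sub>R P.qv l"
      unfolding p q block_one_embed_first r emb ..
    show "block_one A *v P.qv l = - sin (\<gamma> l) *\<^sub>R P.pv l + cos (\<gamma> l) *\<^sub>R P.qv l"
      unfolding p q block_one_embed_first r emb ..
  qed
  interpret eta_manifold A jx N \<Gamma> b K n \<gamma>
  proof unfold_locales
    show "\<Gamma> = generate motions (integer_translations \<union> {(block_one A, axis None (1 / (2 * real N)))})"
      unfolding \<Gamma> rN ..
    show "n \<ge> 1" by (rule n)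
    show "K = 2 * n - 1" by (rule K_eq)
    show "N = 2 * K" using n by (simp add: N_eq K_eq)
    show "b 0 = axis None 1" by (rule b0)
    show "P.rotates ((*v) (block_one A)) \<gamma>" by (rule rotates)
    show "\<gamma> l = (2 * real l - 1) * pi / (2 * real K)" for l unfolding \<gamma>_eq rK ..
  qed
  have "{..<N} = {0..4 * n - 3}" using n by (auto simp: N_eq)
  moreover have "2 * real N = 8 * real n - 4" unfolding rN by simp
  ultimately have "eta_invariant n \<Gamma> b = of_real ((-1) ^ n / (8 * real n - 4) *
      (\<Sum>r = 0..4 * n - 3. 2 ^ num_cycles (matrix_pow A (2 * r + 1)) * (-1) ^ r *
        cot ((2 * real r + 1) * pi / (2 * (4 * real n - 2)))))"
    using eta_invariant_value unfolding rN[symmetric] by (simp only:)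
  then show ?thesis using flat_manifold_group_\<Gamma> holonomy_group_\<Gamma> unfolding N_eq by blast
qed

end
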